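(* Let $\delta>0$, $p=2+\delta$, and let $f_0$ be a probability density on $\mathbb{R}_+$ with $f_0\in\mathcal{M}_p$. Let $Y$ be a symmetric real random variable with zero mean and unit variance, having a probability density on $\mathbb{R}$ with finite absolute moment of order $2+\alpha$ for some $\alpha>\delta$. Fix $\lambda>0$. For each $\gamma\in(0,1)$ let $\sigma=\sigma(\gamma)>0$ be given by $\sigma^2=\lambda\gamma$, let $\mu_\sigma$ be the density of $\sigma Y$, let $f_\gamma(w,t)$ be a weak solution of the kinetic (Boltzmann-type) equation with parameters $(\gamma,\mu_\sigma)$ and initial datum $f_0$ (as defined in the context), and define the scaled density $$g_\gamma(w,\tau)=f_\gamma(w,t),\qquad \tau=\gamma t .$$ Then, as $\gamma\to0$ (hence $\sigma\to0$ with $\sigma^2=\lambda\gamma$), $g_\gamma(\cdot,\tau)$ converges, up to extraction of a subsequence, to a probability density $g(\cdot,\tau)$ on $\mathbb{R}_+$, in the sense of weak convergence of probability measures for each $\tau\ge 0$. The limit $g$ is a weak solution, with initial datum $f_0$, of the Fokker-Planck equation $$\frac{\partial g}{\partial\tau}=\frac{\lambda}{2}\frac{\partial^2}{\partial w^2}\left(w^2 g\right)+\frac{\partial}{\partial w}\left((w-m)g\right),\qquad m=\int_{\mathbb{R}_+}w f_0(w)\,dw,$$ and the mean wealth is conserved: $\int_{\mathbb{R}_+} w\,g(w,\tau)\,dw=m$ for all $\tau\ge0$.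
   Context: **Spaces.** $\mathbb{R}_+=[0,\infty)$. $\mathcal{M}_p$ is the set of Borel probability measures on $\mathbb{R}_+$ with finite moment of order $p$, equipped with the topology of weak convergence of measures; a probability density is identified with the measure it defines. For $s>0$ write $s=k+\kappa$ with $k$ a nonnegative integer and $0<\kappa\le1$. Then $\mathcal{F}_s(\mathbb{R}_+)$ is the class of real functions $\phi$ on $\mathbb{R}_+$ with $\phi(0)=\phi'(0)=0$ whose $k$-th derivative $\phi^{(k)}$ is Hölder continuous of order $\kappa$, i.e. $\sup_{v\neq w}|\phi^{(k)}(v)-\phi^{(k)}(w)|/|v-w|^{\kappa}<\infty$. **Trade rule.** Given $\gamma\in(0,1)$, wealths $w,w_*\ge0$ and $\eta,\eta_*\in\mathbb{R}$, the post-trade wealths are $$w'=(1-\gamma)w+\gamma w_*+\eta w,\qquad w_*'=(1-\gamma)w_*+\gamma w+\eta_* w_* .$$ Trades leading to debts are not allowed. Given a symmetric probability density $\mu$ on $\mathbb{R}$ with zero mean and variance $\sigma^2$, the interaction kernel is $$\beta_{(w,w_* )\to(w',w_*')}=\mu(\eta)\,\mu(\eta_* )\,\Psi(w'\ge0)\,\Psi(w_*'\ge0),$$ where $\Psi(A)$ is the indicator function of $A$. The support of $\mu$ is not assumed to be bounded, so $\beta$ may depend on $(w,w_* )$. **Weak solution of the kinetic equation.** For an initial probability density $f_0\in\mathcal{M}_p$, a weak solution with parameters $(\gamma,\mu)$ is a probability density $f\in C^1(\mathbb{R}_+,\mathcal{M}_p)$ (as a function of time $t$) such that for all $\phi\in\mathcal{F}_p(\mathbb{R}_+)$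 and all $t>0$ $$\frac{d}{dt}\int_{\mathbb{R}_+}\phi(w)f(w,t)\,dw=\int_{\mathbb{R}^2}\int_{\mathbb{R}_+^2}\beta_{(w,w_* )\to(w',w_*')}\,f(w,t)f(w_*,t)\,\big(\phi(w')-\phi(w)\big)\,dw_*\,dw\,d\eta\,d\eta_*,$$ and $\lim_{t\to0}\int_{\mathbb{R}_+}\phi(w)f(w,t)\,dw=\int_{\mathbb{R}_+}\phi(w)f_0(w)\,dw$ for all $\phi\in\mathcal{F}_p(\mathbb{R}_+)$. **Weak solution of the Fokker-Planck equation.** A weak solution with initial datum $f_0$ is a family of probability densities $g(\cdot,\tau)$ such that for all $\phi\in\mathcal{F}_p(\mathbb{R}_+)$ and all $\tau>0$ $$\frac{d}{d\tau}\int_{\mathbb{R}_+}\phi(w)g(w,\tau)\,dw=\int_{\mathbb{R}_+}\Big[(m-w)\phi'(w)+\frac{\lambda}{2}w^2\phi''(w)\Big]g(w,\tau)\,dw,$$ and $\lim_{\tau\to0}\int_{\mathbb{R}_+}\phi(w)g(w,\tau)\,dw=\int_{\mathbb{R}_+}\phi(w)f_0(w)\,dw$. *)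

theory Defs
  imports "HOL-Probability.Probability"
begin

text \<open>
  Densities and test functions on \<open>[0, \<infinity>)\<close> are represented by total functions on \<^typ>\<open>real\<close>
  of which only the values on \<open>{0..}\<close> matter.  A time-dependent density takes the time first:
  \<open>f t w\<close>.
\<close>

definition prob_density_on :: "real set \<Rightarrow> (real \<Rightarrow> real) \<Rightarrow> bool" where
  "prob_density_on S f \<longleftrightarrow>
     set_borel_measurable borel S f \<and> (\<forall>x\<in>S. 0 \<le> f x) \<and> (LINT x:S|lborel. f x) = 1"

text \<open>
  Measures on \<open>[0, \<infinity>)\<close> are Borel measures on the line that vanish on the negative half-line.
\<close>

definition density_measure :: "(real \<Rightarrow> real) \<Rightarrow> real measure" where
  "density_measure f = density lborel (\<lambda>w. ennreal (indicator {0..} w * f w))"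

definition moment_measures :: "real \<Rightarrow> real measure set" where
  "moment_measures p =
     {M. real_distribution M \<and> emeasure M {..<0} = 0 \<and> integrable M (\<lambda>w. \<bar>w\<bar> powr p)}"

text \<open>
  Curves of measures that are continuously differentiable for the topology of weak convergence,
  i.e. the coarsest topology making all the maps \<open>M \<mapsto> \<integral> \<phi> dM\<close> with \<open>\<phi>\<close> bounded and
  continuous on \<open>[0, \<infinity>)\<close> continuous; at time \<open>0\<close> the derivative is the right one.
\<close>

definition weakly_C1 :: "(real \<Rightarrow> real measure) \<Rightarrow> bool" where
  "weakly_C1 F \<longleftrightarrow>
     (\<forall>\<phi> :: real \<Rightarrow> real. continuous_on {0..} \<phi> \<and> bounded (\<phi> ` {0..}) \<longrightarrow>
        (\<exists>D. continuous_on {0..} D \<and>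
             (\<forall>t\<ge>0. ((\<lambda>t. LINT w:{0..}|F t. \<phi> w) has_real_derivative D t)
                        (at t within {0..}))))"

text \<open>Derivatives of functions on \<open>[0, \<infinity>)\<close>; one-sided at the end point \<open>0\<close>.\<close>

definition deriv_Rplus :: "(real \<Rightarrow> real) \<Rightarrow> real \<Rightarrow> real" where
  "deriv_Rplus \<phi> w = vector_derivative \<phi> (at w within {0..})"

definition holder_Rplus :: "real \<Rightarrow> (real \<Rightarrow> real) \<Rightarrow> bool" where
  "holder_Rplus \<kappa> \<psi> \<longleftrightarrow>
     bdd_above {\<bar>\<psi> v - \<psi> w\<bar> / \<bar>v - w\<bar> powr \<kappa> | v w. 0 \<le> v \<and> 0 \<le> w \<and> v \<noteq> w}"

text \<open>The pair \<open>(k, \<kappa>)\<close> below is uniquely determined by \<open>s > 0\<close>.\<close>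

definition test_functions :: "real \<Rightarrow> (real \<Rightarrow> real) set" where
  "test_functions s =
     {\<phi>. \<phi> 0 = 0 \<and> (\<phi> has_real_derivative 0) (at 0 within {0..}) \<and>
         (\<exists>(k::nat) \<kappa>. s = real k + \<kappa> \<and> 0 < \<kappa> \<and> \<kappa> \<le> 1 \<and>
            (\<forall>i<k. \<forall>w\<ge>0. (deriv_Rplus ^^ i) \<phi> differentiable (at w within {0..})) \<and>
            holder_Rplus \<kappa> ((deriv_Rplus ^^ k) \<phi>))}"

text \<open>
  Both post-trade wealths arise from the same map: \<open>w' = post_trade \<gamma> w w\<^sub>* \<eta>\<close> and
  \<open>w\<^sub>*' = post_trade \<gamma> w\<^sub>* w \<eta>\<^sub>*\<close>.
\<close>

definition post_trade :: "real \<Rightarrow> real \<Rightarrow> real \<Rightarrow> real \<Rightarrow> real" where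
  "post_trade \<gamma> w ws \<eta> = (1 - \<gamma>) * w + \<gamma> * ws + \<eta> * w"

definition trade_kernel ::
  "real \<Rightarrow> (real \<Rightarrow> real) \<Rightarrow> real \<Rightarrow> real \<Rightarrow> real \<Rightarrow> real \<Rightarrow> real" where
  "trade_kernel \<gamma> \<mu> w ws \<eta> \<eta>s =
     \<mu> \<eta> * \<mu> \<eta>s * indicator {0..} (post_trade \<gamma> w ws \<eta>) * indicator {0..} (post_trade \<gamma> ws w \<eta>s)"

definition kinetic_weak_solution ::
  "real \<Rightarrow> real \<Rightarrow> (real \<Rightarrow> real) \<Rightarrow> (real \<Rightarrow> real) \<Rightarrow> (real \<Rightarrow> real \<Rightarrow> real) \<Rightarrow> bool" where
  "kinetic_weak_solution p \<gamma> \<mu> f0 f \<longleftrightarrow>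
     (\<forall>t\<ge>0. prob_density_on {0..} (f t) \<and> density_measure (f t) \<in> moment_measures p) \<and>
     weakly_C1 (\<lambda>t. density_measure (f t)) \<and>
     (\<forall>\<phi> \<in> test_functions p.
        (\<forall>t>0. ((\<lambda>t. LINT w:{0..}|lborel. \<phi> w * f t w) has_real_derivative
           (LINT (\<eta>, \<eta>s)|lborel. set_lebesgue_integral lborel ({0..} \<times> {0..}) (\<lambda>(w, ws).
              trade_kernel \<gamma> \<mu> w ws \<eta> \<eta>s * f t w * f t ws *
              (\<phi> (post_trade \<gamma> w ws \<eta>) - \<phi> w)))) (at t)) \<and>
        ((\<lambda>t. LINT w:{0..}|lborel. \<phi> w * f t w) \<longlongrightarrow> (LINT w:{0..}|lborel. \<phi> w * f0 w))
           (at_right 0))"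

definition scaled_density :: "real \<Rightarrow> (real \<Rightarrow> real \<Rightarrow> real) \<Rightarrow> real \<Rightarrow> real \<Rightarrow> real" where
  "scaled_density \<gamma> f \<tau> w = f (\<tau> / \<gamma>) w"

text \<open>
  No moments of \<open>g \<tau>\<close> are prescribed, so the existence of the integrals is required explicitly
  (the Bochner integral of a non-integrable function is \<open>0\<close> by convention).
\<close>

definition fokker_planck_weak_solution ::
  "real \<Rightarrow> real \<Rightarrow> real \<Rightarrow> (real \<Rightarrow> real) \<Rightarrow> (real \<Rightarrow> real \<Rightarrow> real) \<Rightarrow> bool" where
  "fokker_planck_weak_solution p lam m f0 g \<longleftrightarrow>
     (\<forall>\<tau>\<ge>0. prob_density_on {0..} (g \<tau>)) \<and>
     (\<forall>\<phi> \<in> test_functions p.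
        (\<forall>\<tau>>0. set_integrable lborel {0..} (\<lambda>w. \<phi> w * g \<tau> w) \<and>
           set_integrable lborel {0..}
             (\<lambda>w. ((m - w) * deriv_Rplus \<phi> w
                   + lam / 2 * w\<^sup>2 * (deriv_Rplus ^^ 2) \<phi> w) * g \<tau> w) \<and>
           ((\<lambda>\<tau>. LINT w:{0..}|lborel. \<phi> w * g \<tau> w) has_real_derivative
             (LINT w:{0..}|lborel.
                ((m - w) * deriv_Rplus \<phi> w
                 + lam / 2 * w\<^sup>2 * (deriv_Rplus ^^ 2) \<phi> w) * g \<tau> w)) (at \<tau>)) \<and>
        ((\<lambda>\<tau>. LINT w:{0..}|lborel. \<phi> w * g \<tau> w) \<longlongrightarrow> (LINT w:{0..}|lborel. \<phi> w * f0 w))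
           (at_right 0))"

end

theory Submission
  imports Defs "HOL-Library.Diagonal_Subsequence"
begin

text \<open>
  A Taylor expansion of \<open>\<phi>(w') - \<phi>(w)\<close> shows that \<open>1/\<gamma>\<close> times the collision operator equals the
  Fokker-Planck operator up to \<open>O(\<gamma>\<^sup>q\<^sup>/\<^sup>2\<^sup>-\<^sup>1)\<close> with \<open>q = min p 3\<close>, uniformly on \<open>\<tau> \<le> T\<close>, because moments of order
  \<open>p\<close> stay bounded by a Gronwall argument; trades cut off by the no-debt condition have \<open>\<bar>\<eta>\<bar> \<ge> 1/2\<close> and
  contribute only \<open>O(\<gamma>\<^sup>q\<^sup>/\<^sup>2)\<close>.  Hence integrals of smooth functions are equi-Lipschitz in \<open>\<tau>\<close>, and
  tightness with a diagonal argument gives a limit curve of measures for all \<open>\<tau>\<close>.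

  The limit is absolutely continuous because equi-integrability is propagated: a trade with small \<open>\<eta>\<close>
  acts on \<open>w\<close> by an affine map whose mean inverse Jacobian is \<open>1 + O(\<gamma>)\<close>, so
  \<open>\<integral> (f - N e\<^sup>c\<^sup>\<tau>)\<^sup>+ dw\<close> does not increase up to \<open>o(1)\<close>.

  The limit equation is first proved for functions with bounded smooth second derivative and then extended
  to all test functions by approximating \<open>\<phi>''\<close> with polynomials in \<open>tanh w\<close>.  Taking \<open>\<phi> = w\<^sup>p\<close> makes the
  \<open>p\<close>-th moment continuous in \<open>\<tau>\<close>, which turns the integrated equation into a pointwise one although the
  integrand grows like \<open>w\<^sup>p\<close>.
\<close>

section \<open>Smooth bounded functions and test functions\<close>

text \<open>Two restrictions shape the argument. Test functions vanish to first order at 0, so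
  neither \<open>w\<close> nor \<open>cos\<close> is one: affine parts have to be subtracted, and
  the evolution of \<open>w\<close> itself is recovered by approximation. And along the sequence
  moments of order \<open>p\<close> are bounded but not known to be uniformly integrable, so weak
  convergence passes only to integrands of growth below \<open>w powr p\<close>. A bounded second
  derivative makes the Fokker-Planck integrand quadratic, and \<open>2 < p\<close> then suffices.

  The working class is that of functions on the line with all derivatives bounded. It contains
  \<open>sin\<close> and \<open>cos\<close>, which determine measures and weak limits, and
  \<open>tanh\<close>, which supplies approximants and bumps; products and affine substitutions stay
  inside. All orders are needed because the smoothness required of a test function grows with
  \<open>p\<close>.\<close>

primrec bdd_deriv :: "nat \<Rightarrow> (real \<Rightarrow> real) \<Rightarrow> bool" where
  "bdd_deriv 0 \<phi> \<longleftrightarrow> bounded (range \<phi>) \<and> continuous_on UNIV \<phi>"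
| "bdd_deriv (Suc n) \<phi> \<longleftrightarrow> bounded (range \<phi>) \<and>
     (\<exists>\<phi>'. (\<forall>x. (\<phi> has_real_derivative \<phi>' x) (at x)) \<and> bdd_deriv n \<phi>')"

text \<open>Derivatives are existential witnesses, order by order, so that closure properties follow
  by induction from explicit derivatives. Continuity is asked only at the last order, since
  differentiability gives it at the others.\<close>

definition bdd_smooth :: "(real \<Rightarrow> real) \<Rightarrow> bool" where
  "bdd_smooth \<phi> \<longleftrightarrow> (\<forall>n. bdd_deriv n \<phi>)"

lemma DERIV_imp_continuous_on_UNIV:
  "(\<And>x. (\<phi> has_real_derivative \<phi>' x) (at x)) \<Longrightarrow> continuous_on UNIV \<phi>"
  by (metis DERIV_continuous_on)

lemma bdd_deriv_imp_bounded: "bdd_deriv n \<phi> \<Longrightarrow> bounded (range \<phi>)"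
  by (cases n) auto

lemma bdd_deriv_imp_continuous: "bdd_deriv n \<phi> \<Longrightarrow> continuous_on UNIV \<phi>"
  by (cases n) (auto intro: DERIV_imp_continuous_on_UNIV)

lemma bdd_deriv_Suc_imp: "bdd_deriv (Suc n) \<phi> \<Longrightarrow> bdd_deriv n \<phi>"
proof (induction n arbitrary: \<phi>)
  case 0
  then show ?case using bdd_deriv_imp_continuous[of "Suc 0" \<phi>] by auto
next
  case (Suc n)
  then obtain \<phi>' where "bounded (range \<phi>)" "\<And>x. (\<phi> has_real_derivative \<phi>' x) (at x)"
    "bdd_deriv (Suc n) \<phi>'" by auto
  with Suc.IH[of \<phi>'] show ?case by auto
qed

lemma bdd_deriv_SucI:
  assumes "bounded (range \<phi>)" "\<And>x. (\<phi> has_real_derivative \<phi>' x) (at x)" "bdd_deriv n \<phi>'"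
  shows "bdd_deriv (Suc n) \<phi>"
  unfolding bdd_deriv.simps using assms by blast

lemma bounded_range_real_iff:
  fixes \<phi> :: "'a \<Rightarrow> real"
  shows "bounded (range \<phi>) \<longleftrightarrow> (\<exists>B. \<forall>x. \<bar>\<phi> x\<bar> \<le> B)"
  by (auto simp: bounded_iff)

lemma bounded_range_add:
  fixes \<phi> \<psi> :: "real \<Rightarrow> real"
  shows "bounded (range \<phi>) \<Longrightarrow> bounded (range \<psi>) \<Longrightarrow> bounded (range (\<lambda>x. \<phi> x + \<psi> x))"
  unfolding bounded_range_real_iff by (metis abs_triangle_ineq add_mono order_trans)

lemma bounded_range_mult:
  fixes \<phi> \<psi> :: "real \<Rightarrow> real"
  assumes "bounded (range \<phi>)" "bounded (range \<psi>)"
  shows "bounded (range (\<lambda>x. \<phi> x * \<psi> x))"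
proof -
  from assms obtain A B where "\<And>x. \<bar>\<phi> x\<bar> \<le> A" "\<And>x. \<bar>\<psi> x\<bar> \<le> B"
    unfolding bounded_range_real_iff by auto
  then have "\<bar>\<phi> x * \<psi> x\<bar> \<le> A * B" for x
    unfolding abs_mult by (intro mult_mono) (auto intro: order_trans[OF abs_ge_zero])
  then show ?thesis unfolding bounded_range_real_iff by blast
qed

lemma bdd_deriv_const: "bdd_deriv n (\<lambda>x. c)"
proof (induction n arbitrary: c)
  case 0 show ?case by (auto simp: bounded_range_real_iff)
next
  case (Suc n)
  then show ?case by (auto simp: bounded_range_real_iff intro!: exI[of _ "\<lambda>x. 0"])
qed

lemma bdd_deriv_add:
  "bdd_deriv n \<phi> \<Longrightarrow> bdd_deriv n \<psi> \<Longrightarrow> bdd_deriv n (\<lambda>x. \<phi> x + \<psi> x)"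
proof (induction n arbitrary: \<phi> \<psi>)
  case 0 then show ?case by (auto intro!: bounded_range_add continuous_intros)
next
  case (Suc n)
  then obtain \<phi>' \<psi>' where "\<And>x. (\<phi> has_real_derivative \<phi>' x) (at x)" "bdd_deriv n \<phi>'"
    "\<And>x. (\<psi> has_real_derivative \<psi>' x) (at x)" "bdd_deriv n \<psi>'" by auto
  with Suc show ?case
    by (auto intro!: bounded_range_add exI[of _ "\<lambda>x. \<phi>' x + \<psi>' x"] derivative_eq_intros)
qed

lemma bdd_deriv_mult:
  "bdd_deriv n \<phi> \<Longrightarrow> bdd_deriv n \<psi> \<Longrightarrow> bdd_deriv n (\<lambda>x. \<phi> x * \<psi> x)"
proof (induction n arbitrary: \<phi> \<psi>)
  case 0 then show ?case by (auto intro!: bounded_range_mult continuous_intros)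
next
  case (Suc n)
  then obtain \<phi>' \<psi>' where d: "\<And>x. (\<phi> has_real_derivative \<phi>' x) (at x)" "bdd_deriv n \<phi>'"
    "\<And>x. (\<psi> has_real_derivative \<psi>' x) (at x)" "bdd_deriv n \<psi>'" by auto
  have "bdd_deriv n (\<lambda>x. \<phi>' x * \<psi> x + \<phi> x * \<psi>' x)"
    using d Suc by (intro bdd_deriv_add Suc.IH) (auto intro: bdd_deriv_Suc_imp simp del: bdd_deriv.simps)
  with d Suc.prems show ?case
    by (auto intro!: bounded_range_mult exI[of _ "\<lambda>x. \<phi>' x * \<psi> x + \<phi> x * \<psi>' x"] derivative_eq_intros)
qed

lemma bdd_deriv_affine: "bdd_deriv n \<phi> \<Longrightarrow> bdd_deriv n (\<lambda>x. \<phi> (a * x + b))"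
proof (induction n arbitrary: \<phi>)
  case 0 then show ?case
    by (auto simp: bounded_range_real_iff intro!: continuous_on_compose2[of UNIV \<phi>] continuous_intros)
next
  case (Suc n)
  then obtain \<phi>' where d: "\<And>x. (\<phi> has_real_derivative \<phi>' x) (at x)" "bdd_deriv n \<phi>'" by auto
  have "bdd_deriv n (\<lambda>x. \<phi>' (a * x + b) * a)"
    using d Suc by (intro bdd_deriv_mult bdd_deriv_const Suc.IH)
  moreover have "\<And>x. ((\<lambda>x. \<phi> (a * x + b)) has_real_derivative \<phi>' (a * x + b) * a) (at x)"
    by (rule DERIV_chain2[OF d(1)]) (auto intro!: derivative_eq_intros)
  moreover have "bounded (range (\<lambda>x. \<phi> (a * x + b)))"
    using Suc.prems by (auto simp: bounded_range_real_iff)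
  ultimately show ?case using bdd_deriv_SucI[of "\<lambda>x. \<phi> (a * x + b)" "\<lambda>x. \<phi>' (a * x + b) * a"] by blast
qed

text \<open>The derivative of \<open>tanh\<close> is a polynomial in \<open>tanh\<close>, so the
  closure properties give one more bounded derivative at each step of the induction.\<close>

lemma bdd_deriv_tanh: "bdd_deriv n tanh"
proof (induction n)
  case 0
  have "continuous_on UNIV (tanh :: real \<Rightarrow> real)" by (intro continuous_intros) auto
  moreover have "\<bar>tanh x\<bar> \<le> 1" for x :: real using tanh_real_lt_1[of x] tanh_real_gt_neg1[of x] by linarith
  ultimately show ?case by (auto simp: bounded_range_real_iff)
next
  case (Suc n)
  have "bdd_deriv n (\<lambda>x. 1 + (-1) * (tanh x * tanh x))"
    by (intro bdd_deriv_add bdd_deriv_mult bdd_deriv_const Suc)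
  moreover have "\<And>x :: real. (tanh has_real_derivative 1 + (-1) * (tanh x * tanh x)) (at x)"
    by (auto intro!: derivative_eq_intros simp: power2_eq_square)
  ultimately show ?case by (intro bdd_deriv_SucI[OF bdd_deriv_imp_bounded[OF Suc]])
qed

text \<open>Each function is the derivative of the other up to sign, hence the simultaneous
  induction.\<close>

lemma bdd_deriv_sin_cos: "bdd_deriv n sin \<and> bdd_deriv n cos"
proof (induction n)
  case 0 show ?case by (auto simp: bounded_range_real_iff intro!: continuous_intros exI[of _ 1])
next
  case (Suc n)
  have "bdd_deriv n (\<lambda>x. (-1) * sin x)" using Suc by (intro bdd_deriv_mult bdd_deriv_const) auto
  then have "bdd_deriv (Suc n) cos"
    by (rule bdd_deriv_SucI[OF bdd_deriv_imp_bounded[OF conjunct2[OF Suc]], rotated])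
       (auto intro!: derivative_eq_intros)
  moreover have "bdd_deriv (Suc n) sin"
    by (rule bdd_deriv_SucI[OF bdd_deriv_imp_bounded[OF conjunct1[OF Suc]] _ conjunct2[OF Suc]])
       (auto intro!: derivative_eq_intros)
  ultimately show ?case by blast
qed

named_theorems bdd_smooth_intros

lemma bdd_smooth_const[bdd_smooth_intros]: "bdd_smooth (\<lambda>x. c)"
  and bdd_smooth_tanh: "bdd_smooth tanh"
  and bdd_smooth_sin: "bdd_smooth sin"
  and bdd_smooth_cos: "bdd_smooth cos"
  and bdd_smooth_add[bdd_smooth_intros]: "bdd_smooth \<phi> \<Longrightarrow> bdd_smooth \<psi> \<Longrightarrow> bdd_smooth (\<lambda>x. \<phi> x + \<psi> x)"
  and bdd_smooth_mult[bdd_smooth_intros]: "bdd_smooth \<phi> \<Longrightarrow> bdd_smooth \<psi> \<Longrightarrow> bdd_smooth (\<lambda>x. \<phi> x * \<psi> x)"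
  and bdd_smooth_affine: "bdd_smooth \<phi> \<Longrightarrow> bdd_smooth (\<lambda>x. \<phi> (a * x + b))"
  by (simp_all add: bdd_smooth_def bdd_deriv_const bdd_deriv_tanh bdd_deriv_sin_cos bdd_deriv_add
      bdd_deriv_mult bdd_deriv_affine)

lemma bdd_smooth_minus[bdd_smooth_intros]: "bdd_smooth \<phi> \<Longrightarrow> bdd_smooth (\<lambda>x. - \<phi> x)"
  using bdd_smooth_mult[OF bdd_smooth_const[of "-1"], of \<phi>] by simp

lemma bdd_smooth_diff[bdd_smooth_intros]:
  "bdd_smooth \<phi> \<Longrightarrow> bdd_smooth \<psi> \<Longrightarrow> bdd_smooth (\<lambda>x. \<phi> x - \<psi> x)"
  using bdd_smooth_add[of \<phi> "\<lambda>x. - \<psi> x"] bdd_smooth_minus[of \<psi>] by simp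

lemma bdd_smooth_power[bdd_smooth_intros]: "bdd_smooth \<phi> \<Longrightarrow> bdd_smooth (\<lambda>x. \<phi> x ^ n)"
  by (induction n) (auto intro!: bdd_smooth_intros)

lemma bdd_smooth_sum[bdd_smooth_intros]:
  "(\<And>i. i \<in> A \<Longrightarrow> bdd_smooth (\<phi> i)) \<Longrightarrow> bdd_smooth (\<lambda>x. \<Sum>i\<in>A. \<phi> i x)"
  by (induction A rule: infinite_finite_induct) (auto intro!: bdd_smooth_intros)

lemma bdd_smooth_prod[bdd_smooth_intros]:
  "(\<And>i. i \<in> A \<Longrightarrow> bdd_smooth (\<phi> i)) \<Longrightarrow> bdd_smooth (\<lambda>x. \<Prod>i\<in>A. \<phi> i x)"
  by (induction A rule: infinite_finite_induct) (auto intro!: bdd_smooth_intros)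

lemma bdd_smooth_bounded: assumes "bdd_smooth \<phi>" obtains B where "B \<ge> 0" "\<And>x. \<bar>\<phi> x\<bar> \<le> B"
proof -
  have "bdd_deriv 0 \<phi>" using assms by (simp add: bdd_smooth_def)
  then obtain B where B: "\<And>x. \<bar>\<phi> x\<bar> \<le> B" by (auto simp: bounded_range_real_iff)
  moreover from B[of 0] have "B \<ge> 0" by linarith
  ultimately show ?thesis using that by blast
qed

lemma bdd_smooth_continuous: "bdd_smooth \<phi> \<Longrightarrow> continuous_on UNIV \<phi>"
  using bdd_deriv_imp_continuous[of 0 \<phi>] by (simp add: bdd_smooth_def)

lemma bdd_smooth_measurable: "bdd_smooth \<phi> \<Longrightarrow> \<phi> \<in> borel_measurable borel"
  by (intro borel_measurable_continuous_onI bdd_smooth_continuous)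

text \<open>The definition gives, for each order separately, some derivative bounded up to that
  order; uniqueness of derivatives identifies them all with one function.\<close>

lemma bdd_smooth_obtain_deriv:
  assumes "bdd_smooth \<phi>"
  obtains \<phi>' where "\<And>x. (\<phi> has_real_derivative \<phi>' x) (at x)" "bdd_smooth \<phi>'"
proof -
  have "bdd_deriv (Suc n) \<phi>" for n using assms by (simp only: bdd_smooth_def)
  then have *: "\<exists>\<phi>'. (\<forall>x. (\<phi> has_real_derivative \<phi>' x) (at x)) \<and> bdd_deriv n \<phi>'" for n by auto
  from *[of 0] obtain \<phi>' where d: "\<And>x. (\<phi> has_real_derivative \<phi>' x) (at x)" by auto
  have "bdd_deriv n \<phi>'" for n
  proof -
    from *[of n] obtain \<psi> where \<psi>: "\<And>x. (\<phi> has_real_derivative \<psi> x) (at x)" "bdd_deriv n \<psi>" by auto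
    then have "\<psi> = \<phi>'" using d by (auto intro: DERIV_unique)
    with \<psi> show ?thesis by simp
  qed
  with d that show ?thesis by (auto simp: bdd_smooth_def)
qed

text \<open>\<open>\<phi>\<^sub>1\<close> and \<open>\<phi>\<^sub>2\<close> are the first two derivatives of \<open>\<phi>\<close>; only \<open>\<phi>\<^sub>2\<close> is bounded, so that \<open>\<phi> w = w\<close> is allowed.\<close>

definition C2_smooth :: "(real \<Rightarrow> real) \<Rightarrow> (real \<Rightarrow> real) \<Rightarrow> (real \<Rightarrow> real) \<Rightarrow> bool" where
  "C2_smooth \<phi> \<phi>1 \<phi>2 \<longleftrightarrow> (\<forall>x. (\<phi> has_real_derivative \<phi>1 x) (at x)) \<and>
     (\<forall>x. (\<phi>1 has_real_derivative \<phi>2 x) (at x)) \<and> bdd_smooth \<phi>2"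

lemma bdd_smooth_imp_C2: assumes "bdd_smooth \<phi>" obtains \<phi>1 \<phi>2 where "C2_smooth \<phi> \<phi>1 \<phi>2"
  by (metis C2_smooth_def assms bdd_smooth_obtain_deriv)

lemma C2_smooth_add: "C2_smooth \<phi> \<phi>1 \<phi>2 \<Longrightarrow> C2_smooth \<psi> \<psi>1 \<psi>2 \<Longrightarrow>
    C2_smooth (\<lambda>x. \<phi> x + \<psi> x) (\<lambda>x. \<phi>1 x + \<psi>1 x) (\<lambda>x. \<phi>2 x + \<psi>2 x)"
  by (auto simp: C2_smooth_def intro!: derivative_eq_intros bdd_smooth_intros)

lemma C2_smooth_cmult: "C2_smooth \<phi> \<phi>1 \<phi>2 \<Longrightarrow> C2_smooth (\<lambda>x. c * \<phi> x) (\<lambda>x. c * \<phi>1 x) (\<lambda>x. c * \<phi>2 x)"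
  by (auto simp: C2_smooth_def intro!: derivative_eq_intros bdd_smooth_intros)

lemma C2_smooth_id: "C2_smooth (\<lambda>x. x) (\<lambda>x. 1) (\<lambda>x. 0)"
  by (auto simp: C2_smooth_def intro!: derivative_eq_intros bdd_smooth_intros)

lemma C2_smooth_const: "C2_smooth (\<lambda>x. c) (\<lambda>x. 0) (\<lambda>x. 0)"
  by (auto simp: C2_smooth_def intro!: derivative_eq_intros bdd_smooth_intros)

lemma C2_smooth_continuous:
  assumes "C2_smooth \<phi> \<phi>1 \<phi>2"
  shows "continuous_on UNIV \<phi>" "continuous_on UNIV \<phi>1" "continuous_on UNIV \<phi>2"
  using assms by (auto simp: C2_smooth_def intro: DERIV_imp_continuous_on_UNIV bdd_smooth_continuous)

section \<open>Growth and Taylor bounds when the second derivative is bounded\<close>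

lemma abs_diff_le_of_deriv_le:
  assumes "\<And>x. (\<phi> has_real_derivative \<phi>' x) (at x)" "\<And>x. \<bar>\<phi>' x\<bar> \<le> B"
  shows "\<bar>\<phi> y - \<phi> x\<bar> \<le> B * \<bar>y - x\<bar>"
proof -
  have "norm (\<phi> y - \<phi> x) \<le> B * norm (y - x)"
    by (rule field_differentiable_bound[of UNIV \<phi> \<phi>']) (use assms in auto)
  then show ?thesis by simp
qed

text \<open>Integrating the bound on \<open>\<phi>2\<close> gives linear growth of
  \<open>\<phi>1\<close>, and the bound on the next derivative makes \<open>\<phi>2\<close>
  Lipschitz. One constant serves all three bounds, so later error terms are linear in a single
  \<open>C\<close>.\<close>

lemma C2_smooth_deriv_growth:
  assumes "C2_smooth \<phi> \<phi>1 \<phi>2"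
  obtains C where "C \<ge> 0" "\<And>x. \<bar>\<phi>1 x\<bar> \<le> C * (1 + \<bar>x\<bar>)" "\<And>x. \<bar>\<phi>2 x\<bar> \<le> C"
    "\<And>x y. \<bar>\<phi>2 x - \<phi>2 y\<bar> \<le> C * \<bar>x - y\<bar>"
proof -
  from assms have d: "\<And>x. (\<phi>1 has_real_derivative \<phi>2 x) (at x)" and s: "bdd_smooth \<phi>2"
    by (auto simp: C2_smooth_def)
  obtain B where B: "B \<ge> 0" "\<And>x. \<bar>\<phi>2 x\<bar> \<le> B" using bdd_smooth_bounded[OF s] by blast
  obtain \<phi>3 where d3: "\<And>x. (\<phi>2 has_real_derivative \<phi>3 x) (at x)" "bdd_smooth \<phi>3"
    using bdd_smooth_obtain_deriv[OF s] by blast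
  obtain L where L: "L \<ge> 0" "\<And>x. \<bar>\<phi>3 x\<bar> \<le> L" using bdd_smooth_bounded[OF d3(2)] by blast
  define C where "C = B + L + \<bar>\<phi>1 0\<bar>"
  have "\<bar>\<phi>1 x\<bar> \<le> C * (1 + \<bar>x\<bar>)" for x
  proof -
    have "\<bar>\<phi>1 x - \<phi>1 0\<bar> \<le> B * \<bar>x\<bar>" using abs_diff_le_of_deriv_le[OF d B(2), of x 0] by simp
    also have "\<dots> \<le> C * \<bar>x\<bar>" using L(1) by (intro mult_right_mono) (auto simp: C_def)
    finally have "\<bar>\<phi>1 x\<bar> \<le> \<bar>\<phi>1 0\<bar> + C * \<bar>x\<bar>" by linarith
    also have "\<dots> \<le> C * (1 + \<bar>x\<bar>)" using B(1) L(1) by (simp add: C_def algebra_simps)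
    finally show ?thesis .
  qed
  moreover have "\<bar>\<phi>2 x - \<phi>2 y\<bar> \<le> C * \<bar>x - y\<bar>" for x y
  proof -
    have "\<bar>\<phi>2 x - \<phi>2 y\<bar> \<le> L * \<bar>x - y\<bar>" by (rule abs_diff_le_of_deriv_le[OF d3(1) L(2)])
    also have "\<dots> \<le> C * \<bar>x - y\<bar>" using B(1) by (intro mult_right_mono) (auto simp: C_def)
    finally show ?thesis .
  qed
  moreover have "C \<ge> 0" using B(1) L(1) by (simp add: C_def)
  moreover have "\<bar>\<phi>2 x\<bar> \<le> C" for x using B(2)[of x] L(1) by (simp add: C_def)
  ultimately show ?thesis using that by blast
qed

lemma C2_taylor:
  assumes "\<And>x. (\<phi> has_real_derivative \<phi>1 x) (at x)" "\<And>x. (\<phi>1 has_real_derivative \<phi>2 x) (at x)"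
  obtains z where "\<bar>z - x\<bar> \<le> \<bar>y - x\<bar>" "\<phi> y = \<phi> x + \<phi>1 x * (y - x) + \<phi>2 z * (y - x)\<^sup>2 / 2"
proof (cases "y = x")
  case True then show ?thesis using that[of x] by simp
next
  case False
  define D where "D n = (if n = 0 then \<phi> else if n = 1 then \<phi>1 else \<phi>2)" for n :: nat
  have "\<exists>t. (if y < x then y < t \<and> t < x else x < t \<and> t < y) \<and>
      \<phi> y = (\<Sum>m<2. (D m x / fact m) * (y - x)^m) + (D 2 t / fact 2) * (y - x)^2"
    by (rule Taylor[of 2 D \<phi> "min x y" "max x y"])
       (use assms False in \<open>auto simp: D_def less_2_cases_iff\<close>)
  then obtain t where t: "if y < x then y < t \<and> t < x else x < t \<and> t < y"
    "\<phi> y = (\<Sum>m<2. (D m x / fact m) * (y - x)^m) + (D 2 t / fact 2) * (y - x)^2" by blast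
  show ?thesis
    by (rule that[of t]) (use t in \<open>auto simp: D_def numeral_2_eq_2 split: if_splits\<close>)
qed

text \<open>The remainder is controlled by the oscillation of \<open>\<phi>2\<close>: it is
  Lipschitz for increments of size at most 1, giving a cube, and bounded for larger ones, giving a
  square. Every power between 2 and 3 dominates both, which matters because the noise may lack a
  third moment.\<close>

lemma C2_smooth_taylor_le:
  assumes "C2_smooth \<phi> \<phi>1 \<phi>2" "2 \<le> q" "q \<le> 3" "\<And>x. \<bar>\<phi>2 x\<bar> \<le> C"
    and "\<And>x y. \<bar>\<phi>2 x - \<phi>2 y\<bar> \<le> C * \<bar>x - y\<bar>"
  shows "\<bar>\<phi> y - (\<phi> x + \<phi>1 x * (y - x) + \<phi>2 x * (y - x)\<^sup>2 / 2)\<bar> \<le> C * \<bar>y - x\<bar> powr q"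
proof -
  from assms(1) obtain z where z: "\<bar>z - x\<bar> \<le> \<bar>y - x\<bar>"
    "\<phi> y = \<phi> x + \<phi>1 x * (y - x) + \<phi>2 z * (y - x)\<^sup>2 / 2"
    using C2_taylor[of \<phi> \<phi>1 \<phi>2 x y] by (auto simp: C2_smooth_def)
  have C: "C \<ge> 0" using assms(4)[of 0] by linarith
  define h where "h = \<bar>y - x\<bar>"
  have h: "h \<ge> 0" "(y - x)\<^sup>2 = h\<^sup>2" by (auto simp: h_def)
  have e: "\<bar>\<phi> y - (\<phi> x + \<phi>1 x * (y - x) + \<phi>2 x * (y - x)\<^sup>2 / 2)\<bar> = \<bar>\<phi>2 z - \<phi>2 x\<bar> * h\<^sup>2 / 2"
  proof -
    have "\<phi> y - (\<phi> x + \<phi>1 x * (y - x) + \<phi>2 x * (y - x)\<^sup>2 / 2) = (\<phi>2 z - \<phi>2 x) * h\<^sup>2 / 2"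
      unfolding z(2) h(2) by (simp add: field_simps)
    then show ?thesis by (simp only: abs_mult abs_divide) simp
  qed
  show ?thesis
  proof (cases "h \<le> 1")
    case True
    have "\<bar>\<phi>2 z - \<phi>2 x\<bar> \<le> C * h"
      using assms(5)[of z x] z(1) C by (auto simp: h_def intro: order_trans mult_left_mono)
    then have "\<bar>\<phi>2 z - \<phi>2 x\<bar> * h\<^sup>2 / 2 \<le> (C * h) * h\<^sup>2 / 2"
      using h by (intro divide_right_mono mult_right_mono) auto
    also have "\<dots> \<le> C * h ^ 3" using C h by (simp add: power2_eq_square power3_eq_cube)
    also have "\<dots> \<le> C * h powr q"
    proof (cases "h = 0")
      case False
      then have "h ^ 3 = h powr 3" using h powr_realpow[of h 3] by simp
      also have "\<dots> \<le> h powr q" using True h assms(3) False by (intro powr_mono') auto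
      finally show ?thesis using C by (intro mult_left_mono)
    qed auto
    finally show ?thesis using e by (simp add: h_def)
  next
    case False
    have "\<bar>\<phi>2 z - \<phi>2 x\<bar> \<le> 2 * C" using assms(4)[of z] assms(4)[of x] by linarith
    then have "\<bar>\<phi>2 z - \<phi>2 x\<bar> * h\<^sup>2 / 2 \<le> (2 * C) * h\<^sup>2 / 2"
      using h by (intro divide_right_mono mult_right_mono) auto
    also have "\<dots> = C * h powr 2" using False powr_realpow[of h 2] by simp
    also have "\<dots> \<le> C * h powr q" using C False assms(2) by (intro mult_left_mono powr_mono) auto
    finally show ?thesis using e by (simp add: h_def)
  qed
qed

lemma C2_smooth_growth:
  assumes "C2_smooth \<phi> \<phi>1 \<phi>2"
  obtains C where "C \<ge> 0" "\<And>x. \<bar>\<phi> x\<bar> \<le> C * (1 + x\<^sup>2)"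
proof -
  from assms obtain C where C: "C \<ge> 0" "\<And>x. \<bar>\<phi>2 x\<bar> \<le> C" by (metis C2_smooth_deriv_growth)
  define D where "D = \<bar>\<phi> 0\<bar> + \<bar>\<phi>1 0\<bar> + C"
  have "\<bar>\<phi> x\<bar> \<le> D * (1 + x\<^sup>2)" for x
  proof -
    from assms obtain z where z: "\<phi> x = \<phi> 0 + \<phi>1 0 * (x - 0) + \<phi>2 z * (x - 0)\<^sup>2 / 2"
      using C2_taylor[of \<phi> \<phi>1 \<phi>2 0 x] unfolding C2_smooth_def by metis
    have x: "\<bar>x\<bar> \<le> 1 + x\<^sup>2"
      using zero_le_power2[of "\<bar>x\<bar> - 1"] unfolding power2_diff by simp
    have 1: "\<bar>\<phi>1 0 * x\<bar> \<le> \<bar>\<phi>1 0\<bar> * (1 + x\<^sup>2)" unfolding abs_mult by (intro mult_left_mono x) auto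
    have 2: "\<bar>\<phi>2 z * x\<^sup>2 / 2\<bar> \<le> C * (1 + x\<^sup>2)"
    proof -
      have "\<bar>\<phi>2 z * x\<^sup>2 / 2\<bar> \<le> \<bar>\<phi>2 z\<bar> * x\<^sup>2" by (simp add: abs_mult)
      also have "\<dots> \<le> C * (1 + x\<^sup>2)" using C by (intro mult_mono) auto
      finally show ?thesis .
    qed
    have 3: "\<bar>\<phi> 0\<bar> \<le> \<bar>\<phi> 0\<bar> * (1 + x\<^sup>2)" by (simp add: algebra_simps)
    have "\<phi> x = \<phi> 0 + \<phi>1 0 * x + \<phi>2 z * x\<^sup>2 / 2" using z by simp
    then have "\<bar>\<phi> x\<bar> \<le> \<bar>\<phi> 0\<bar> + \<bar>\<phi>1 0 * x\<bar> + \<bar>\<phi>2 z * x\<^sup>2 / 2\<bar>" by linarith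
    also have "\<dots> \<le> D * (1 + x\<^sup>2)" using 1 2 3 unfolding D_def distrib_right by linarith
    finally show ?thesis .
  qed
  moreover have "D \<ge> 0" using C by (simp add: D_def)
  ultimately show ?thesis using that by blast
qed

section \<open>One-sided derivatives and membership in the class of test functions\<close>

lemma deriv_Rplus_eq:
  assumes "w \<ge> 0" "(\<phi> has_real_derivative d) (at w within {0..})"
  shows "deriv_Rplus \<phi> w = d"
proof -
  have "at w within {0..} \<noteq> bot"
  proof -
    have "w islimpt {w..w + 1}" by (simp add: islimpt_closure_open islimpt_Icc)
    then have "w islimpt {0..}" by (rule islimpt_subset) (use assms(1) in auto)
    then show ?thesis by (simp add: trivial_limit_within)
  qed
  with assms(2) show ?thesis unfolding deriv_Rplus_def
    by (intro vector_derivative_within) (auto simp: has_real_derivative_iff_has_vector_derivative)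
qed

text \<open>Nothing is known at negative arguments, so the iterates are identified with the family
  \<open>D\<close> on \<open>{0..}\<close> only; differentiating within that set needs no
  more.\<close>

lemma deriv_Rplus_iterate:
  assumes "\<And>i w. i < k \<Longrightarrow> w \<ge> 0 \<Longrightarrow> (D i has_real_derivative D (Suc i) w) (at w within {0..})"
    and "i \<le> k" "w \<ge> 0"
  shows "(deriv_Rplus ^^ i) (D 0) w = D i w"
  using assms(2,3)
proof (induction i arbitrary: w)
  case (Suc i)
  have "((deriv_Rplus ^^ i) (D 0) has_real_derivative D (Suc i) w) (at w within {0..})"
    by (rule has_field_derivative_transform_within[OF assms(1)[of i w], of 1])
       (use Suc in auto)
  with Suc show ?case by (simp add: deriv_Rplus_eq)
qed simp

lemma deriv_Rplus_iterate_deriv: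
  assumes "\<And>i w. i < k \<Longrightarrow> w \<ge> 0 \<Longrightarrow> (D i has_real_derivative D (Suc i) w) (at w within {0..})"
    and "i < k" "w \<ge> 0"
  shows "((deriv_Rplus ^^ i) (D 0) has_real_derivative D (Suc i) w) (at w within {0..})"
  by (rule has_field_derivative_transform_within[OF assms(1)[of i w], of 1])
     (use assms deriv_Rplus_iterate[of k D i] in auto)

text \<open>A criterion in terms of an explicit list of derivatives \<open>D 0\<close>, ...,
  \<open>D k\<close>, so that \<open>deriv_Rplus\<close> need not be iterated in
  applications.\<close>

lemma test_functionsI:
  assumes "p = real k + \<kappa>" "0 < \<kappa>" "\<kappa> \<le> 1" "k \<ge> 1"
    and D: "\<And>i w. i < k \<Longrightarrow> w \<ge> 0 \<Longrightarrow> (D i has_real_derivative D (Suc i) w) (at w within {0..})"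
    and "D 0 0 = 0" "D 1 0 = 0"
    and h: "\<And>v w. v \<ge> 0 \<Longrightarrow> w \<ge> 0 \<Longrightarrow> \<bar>D k v - D k w\<bar> \<le> C * \<bar>v - w\<bar> powr \<kappa>"
  shows "D 0 \<in> test_functions p"
proof -
  have "(D 0 has_real_derivative 0) (at 0 within {0..})" using D[of 0 0] assms(4,7) by auto
  moreover have "(deriv_Rplus ^^ i) (D 0) differentiable (at w within {0..})" if "i < k" "w \<ge> 0" for i w
    using deriv_Rplus_iterate_deriv[of k D i w] D that
    by (auto simp: real_differentiable_def)
  moreover have "holder_Rplus \<kappa> ((deriv_Rplus ^^ k) (D 0))"
  proof -
    have "x \<le> C" if "x \<in> {\<bar>D k v - D k w\<bar> / \<bar>v - w\<bar> powr \<kappa> | v w. 0 \<le> v \<and> 0 \<le> w \<and> v \<noteq> w}" for x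
      using that h by (auto simp: divide_le_eq)
    then have "bdd_above {\<bar>D k v - D k w\<bar> / \<bar>v - w\<bar> powr \<kappa> | v w. 0 \<le> v \<and> 0 \<le> w \<and> v \<noteq> w}"
      by (rule bdd_aboveI)
    moreover have "{\<bar>D k v - D k w\<bar> / \<bar>v - w\<bar> powr \<kappa> | v w. 0 \<le> v \<and> 0 \<le> w \<and> v \<noteq> w} =
      {\<bar>(deriv_Rplus ^^ k) (D 0) v - (deriv_Rplus ^^ k) (D 0) w\<bar> / \<bar>v - w\<bar> powr \<kappa> | v w. 0 \<le> v \<and> 0 \<le> w \<and> v \<noteq> w}"
      using deriv_Rplus_iterate[of k D k] D by (intro Collect_cong) (metis (no_types, lifting) order_refl)
    ultimately show ?thesis by (simp add: holder_Rplus_def)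
  qed
  ultimately show ?thesis using assms by (auto simp: test_functions_def)
qed

lemma ex_order_decomp:
  assumes "(2::real) < p" obtains k \<kappa> where "p = real k + \<kappa>" "0 < \<kappa>" "\<kappa> \<le> 1" "k \<ge> 2"
proof -
  \<comment> \<open>Since \<kappa> ranges over \<open>(0, 1]\<close>, an integer \<open>p\<close>
    must give \<kappa> = 1; hence the ceiling minus one instead of the floor.\<close>
  define k where "k = nat (\<lceil>p\<rceil> - 1)"
  have c: "\<lceil>p\<rceil> \<ge> 3" using assms by linarith
  have k: "real k = of_int \<lceil>p\<rceil> - 1" unfolding k_def using c by simp
  show ?thesis
    by (rule that[of k "p - real k"]) (use c k in \<open>auto simp: k_def; linarith\<close>)+
qed

text \<open>A bounded Lipschitz function is Hoelder continuous of every exponent at most 1: the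
  Lipschitz bound serves small distances, the bound itself large ones. This is applied to the
  derivative of order \<open>k\<close>, whose own derivative is bounded.\<close>

lemma C2_smooth_test_function:
  assumes "C2_smooth \<phi> \<phi>1 \<phi>2" "\<phi> 0 = 0" "\<phi>1 0 = 0" "2 < p"
  shows "\<phi> \<in> test_functions p"
proof -
  from ex_order_decomp[OF \<open>2 < p\<close>] obtain k \<kappa> where k: "p = real k + \<kappa>" "0 < \<kappa>" "\<kappa> \<le> 1" "k \<ge> 2" .
  have s: "bdd_smooth \<phi>2" using assms by (simp add: C2_smooth_def)
  obtain E where E: "E 0 = \<phi>2" "\<And>n. bdd_smooth (E n)" "\<And>n x. (E n has_real_derivative E (Suc n) x) (at x)"
  proof -
    define R where "R \<psi> = (SOME \<psi>'. (\<forall>x. (\<psi> has_real_derivative \<psi>' x) (at x)) \<and> bdd_smooth \<psi>')" for \<psi>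
    have R: "(\<forall>x. (\<psi> has_real_derivative R \<psi> x) (at x)) \<and> bdd_smooth (R \<psi>)" if \<psi>: "bdd_smooth \<psi>" for \<psi>
    proof -
      obtain \<psi>' where "\<And>x. (\<psi> has_real_derivative \<psi>' x) (at x)" "bdd_smooth \<psi>'"
        using bdd_smooth_obtain_deriv[OF \<psi>] by blast
      then have "\<exists>\<psi>'. (\<forall>x. (\<psi> has_real_derivative \<psi>' x) (at x)) \<and> bdd_smooth \<psi>'" by (intro exI[of _ \<psi>']) simp
      then show ?thesis unfolding R_def by (rule someI_ex)
    qed
    have i: "bdd_smooth ((R ^^ n) \<phi>2)" for n by (induction n) (use s R in auto)
    show ?thesis by (rule that[of "\<lambda>n. (R ^^ n) \<phi>2"]) (use i R[OF i] in auto)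
  qed
  define D where "D i = (if i = 0 then \<phi> else if i = 1 then \<phi>1 else E (i - 2))" for i
  have D: "(D i has_real_derivative D (Suc i) w) (at w)" for i w
  proof -
    consider "i = 0" | "i = 1" | j where "i = Suc (Suc j)" by (metis One_nat_def old.nat.exhaust)
    then show ?thesis using assms(1) E by cases (auto simp: D_def C2_smooth_def)
  qed
  have sD: "bdd_smooth (D k)" "bdd_smooth (D (Suc k))" using k E by (auto simp: D_def)
  obtain B where B: "B \<ge> 0" "\<And>x. \<bar>D k x\<bar> \<le> B" using bdd_smooth_bounded[OF sD(1)] by blast
  obtain L where L: "L \<ge> 0" "\<And>x. \<bar>D (Suc k) x\<bar> \<le> L" using bdd_smooth_bounded[OF sD(2)] by blast
  have h: "\<bar>D k v - D k w\<bar> \<le> (2 * B + L) * \<bar>v - w\<bar> powr \<kappa>" for v w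
  proof (cases "\<bar>v - w\<bar> \<le> 1")
    case True
    show ?thesis
    proof (cases "v = w")
      case False
      have "\<bar>D k v - D k w\<bar> \<le> L * \<bar>v - w\<bar>" by (rule abs_diff_le_of_deriv_le[OF D L(2)])
      also have "\<bar>v - w\<bar> = \<bar>v - w\<bar> powr 1" using False by simp
      also have "\<dots> \<le> \<bar>v - w\<bar> powr \<kappa>" using False True k by (intro powr_mono') auto
      finally have "\<bar>D k v - D k w\<bar> \<le> L * \<bar>v - w\<bar> powr \<kappa>" using L(1) by (meson mult_left_mono order_trans)
      also have "\<dots> \<le> (2 * B + L) * \<bar>v - w\<bar> powr \<kappa>" using B(1) by (intro mult_right_mono) auto
      finally show ?thesis .
    qed auto
  next
    case False
    have "\<bar>D k v - D k w\<bar> \<le> (2 * B + L) * 1" using B(2)[of v] B(2)[of w] L(1) unfolding mult_1_right by (simp add: abs_le_iff)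
    also have "\<dots> \<le> (2 * B + L) * \<bar>v - w\<bar> powr \<kappa>"
      using False k B(1) L(1) by (intro mult_left_mono ge_one_powr_ge_zero) auto
    finally show ?thesis .
  qed
  have "D 0 0 = 0" "D 1 0 = 0" using assms by (auto simp: D_def)
  then have "D 0 \<in> test_functions p"
    using k h by (intro test_functionsI[of p k \<kappa> D "2 * B + L"]) (auto intro: has_field_derivative_at_within[OF D])
  then show ?thesis by (simp add: D_def)
qed

text \<open>Subadditivity of \<open>t powr \<kappa>\<close>, obtained by adding
  \<open>x \<le> x powr \<kappa>\<close> at the two fractions \<open>x = a / (a + b)\<close> and
  \<open>x = b / (a + b)\<close>.\<close>

lemma powr_holder:
  fixes v w :: real assumes "0 \<le> w" "0 \<le> v" "0 < \<kappa>" "\<kappa> \<le> 1"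
  shows "\<bar>v powr \<kappa> - w powr \<kappa>\<bar> \<le> \<bar>v - w\<bar> powr \<kappa>"
proof -
  have *: "(a + b) powr \<kappa> \<le> a powr \<kappa> + b powr \<kappa>" if "a \<ge> 0" "b \<ge> 0" for a b :: real
  proof (cases "a + b = 0")
    case False
    then have s: "a + b > 0" using that by linarith
    have le: "x \<le> x powr \<kappa>" if "0 \<le> x" "x \<le> 1" for x :: real
    proof (cases "x = 0")
      case False
      then show ?thesis using powr_mono'[of \<kappa> 1 x] assms that by auto
    qed auto
    have "1 = a / (a + b) + b / (a + b)" using s by (simp flip: add_divide_distrib)
    also have "\<dots> \<le> (a / (a + b)) powr \<kappa> + (b / (a + b)) powr \<kappa>"
      using that s by (intro add_mono le) auto
    also have "\<dots> = (a powr \<kappa> + b powr \<kappa>) / (a + b) powr \<kappa>"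
      using that s by (simp add: powr_divide add_divide_distrib)
    finally show ?thesis using s by (simp add: field_simps)
  qed (use that in auto)
  show ?thesis
  proof (cases "v \<ge> w")
    case True
    have "v powr \<kappa> \<le> w powr \<kappa> + (v - w) powr \<kappa>" using *[of w "v - w"] True assms by simp
    moreover have "w powr \<kappa> \<le> v powr \<kappa>" using True assms by (intro powr_mono2) auto
    ultimately show ?thesis using True by simp
  next
    case False
    have "w powr \<kappa> \<le> v powr \<kappa> + (w - v) powr \<kappa>" using *[of v "w - v"] False assms by simp
    moreover have "v powr \<kappa> \<le> w powr \<kappa>" using False assms by (intro powr_mono2) auto
    ultimately show ?thesis using False by simp
  qed
qed

text \<open>At 0 the difference quotient is \<open>y powr (s - 1)\<close>, which tends to 0 because
  \<open>s > 1\<close>.\<close>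

lemma powr_has_deriv_Rplus:
  fixes s w :: real assumes "s > 1" "w \<ge> 0"
  shows "((\<lambda>w. w powr s) has_real_derivative s * w powr (s - 1)) (at w within {0..})"
proof (cases "w = 0")
  case False
  then show ?thesis using assms
    by (intro has_field_derivative_at_within[OF has_real_derivative_powr]) auto
next
  case True
  have "((\<lambda>y::real. y powr (s - 1)) \<longlongrightarrow> 0 powr (s - 1)) (at 0 within {0..})"
    using assms by (intro tendsto_powr' tendsto_ident_at tendsto_const) (auto simp: eventually_at_filter)
  then have "((\<lambda>y. y powr (s - 1)) \<longlongrightarrow> 0) (at 0 within {0::real..})" using assms by simp
  then have "((\<lambda>y. (y powr s - 0 powr s) / (y - 0)) \<longlongrightarrow> 0) (at 0 within {0::real..})"
    by (rule Lim_transform_eventually)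
       (auto simp: eventually_at_filter powr_diff)
  with True show ?thesis using assms by (simp add: has_field_derivative_iff)
qed

text \<open>A test function of the largest growth the class allows: its derivative of order
  \<open>k\<close> is a multiple of \<open>w powr \<kappa>\<close>, just Hoelder enough. It gives
  access to the moment of order \<open>p\<close>.\<close>

lemma powr_test_function:
  assumes "2 < p" shows "(\<lambda>w. w powr p) \<in> test_functions p"
proof -
  from ex_order_decomp[OF assms] obtain k \<kappa> where k: "p = real k + \<kappa>" "0 < \<kappa>" "\<kappa> \<le> 1" "k \<ge> 2" .
  \<comment> \<open>Falling factorial, the coefficient of the i-th derivative.\<close>
  define c where "c i = (\<Prod>j<i. (p - real j))" for i
  define D where "D i w = c i * w powr (p - real i)" for i w
  have "D 0 \<in> test_functions p"
  proof (rule test_functionsI[OF k(1-3)])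
    fix i and w :: real assume i: "i < k" "w \<ge> 0"
    have "p - real i > 1" using i k by simp
    from DERIV_cmult[OF powr_has_deriv_Rplus[OF this i(2)], of "c i"]
    show "(D i has_real_derivative D (Suc i) w) (at w within {0..})"
      by (simp add: D_def[abs_def] c_def algebra_simps)
  next
    fix v w :: real assume "v \<ge> 0" "w \<ge> 0"
    with k powr_holder[of w v \<kappa>] show "\<bar>D k v - D k w\<bar> \<le> \<bar>c k\<bar> * \<bar>v - w\<bar> powr \<kappa>"
      by (simp add: D_def right_diff_distrib[symmetric] abs_mult mult_left_mono)
  qed (use k assms in \<open>auto simp: D_def\<close>)
  then show ?thesis by (simp add: D_def[abs_def] c_def)
qed

section \<open>Expected effect of a single trade\<close>

lemma integrable_pair_mult:
  fixes f g :: "_ \<Rightarrow> real"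
  assumes "prob_space A" "prob_space B" and f: "integrable A f" and g: "integrable B g"
  shows "integrable (A \<Otimes>\<^sub>M B) (\<lambda>z. f (fst z) * g (snd z))"
    and "(\<integral>z. f (fst z) * g (snd z) \<partial>(A \<Otimes>\<^sub>M B)) = (\<integral>x. f x \<partial>A) * (\<integral>y. g y \<partial>B)"
proof -
  interpret A: prob_space A by fact
  interpret B: prob_space B by fact
  interpret P: pair_sigma_finite A B ..
  have [measurable]: "f \<in> borel_measurable A" "g \<in> borel_measurable B" using f g by auto
  show 1: "integrable (A \<Otimes>\<^sub>M B) (\<lambda>z. f (fst z) * g (snd z))"
  proof (rule P.Fubini_integrable)
    have "(\<lambda>x. \<integral>y. norm (f (fst (x, y)) * g (snd (x, y))) \<partial>B) = (\<lambda>x. \<bar>f x\<bar> * (\<integral>y. \<bar>g y\<bar> \<partial>B))"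
      by (simp add: abs_mult)
    then show "integrable A (\<lambda>x. \<integral>y. norm (f (fst (x, y)) * g (snd (x, y))) \<partial>B)" using f by simp
  qed (use g in auto)
  show "(\<integral>z. f (fst z) * g (snd z) \<partial>(A \<Otimes>\<^sub>M B)) = (\<integral>x. f x \<partial>A) * (\<integral>y. g y \<partial>B)"
    using P.integral_fst'[OF 1] by simp
qed

lemma integrable_pair_fst:
  fixes f :: "_ \<Rightarrow> real"
  assumes "prob_space A" "prob_space B" "integrable A f"
  shows "integrable (A \<Otimes>\<^sub>M B) (\<lambda>z. f (fst z))" "(\<integral>z. f (fst z) \<partial>(A \<Otimes>\<^sub>M B)) = (\<integral>x. f x \<partial>A)"
  using integrable_pair_mult[OF assms(1,2,3), of "\<lambda>_. 1"] assms(1,2)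
  by (simp_all add: prob_space.prob_space prob_space.finite_measure finite_measure.integrable_const)

lemma integrable_pair_snd:
  fixes f :: "_ \<Rightarrow> real"
  assumes "prob_space A" "prob_space B" "integrable B f"
  shows "integrable (A \<Otimes>\<^sub>M B) (\<lambda>z. f (snd z))" "(\<integral>z. f (snd z) \<partial>(A \<Otimes>\<^sub>M B)) = (\<integral>x. f x \<partial>B)"
  using integrable_pair_mult[OF assms(1,2) _ assms(3), of "\<lambda>_. 1"] assms(1,2)
  by (simp_all add: prob_space.prob_space prob_space.finite_measure finite_measure.integrable_const)

text \<open>In the applications \<open>T\<close> is a Taylor polynomial with known integral and
  \<open>B\<close> an integrable error bound; integrability of \<open>X\<close> is part of the
  conclusion.\<close>

lemma integral_near:
  fixes X T B :: "_ \<Rightarrow> real"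
  assumes "integrable N T" "integrable N B" "X \<in> borel_measurable N" "AE z in N. \<bar>X z - T z\<bar> \<le> B z"
  shows "integrable N X" "\<bar>(\<integral>z. X z \<partial>N) - (\<integral>z. T z \<partial>N)\<bar> \<le> (\<integral>z. B z \<partial>N)"
proof -
  have [measurable]: "T \<in> borel_measurable N" "X \<in> borel_measurable N" using assms by auto
  have d: "integrable N (\<lambda>z. X z - T z)"
    by (rule Bochner_Integration.integrable_bound[OF assms(2)]) (use assms(4) in auto)
  from Bochner_Integration.integrable_add[OF d assms(1)] show X: "integrable N X" by simp
  have "\<bar>(\<integral>z. X z \<partial>N) - (\<integral>z. T z \<partial>N)\<bar> = \<bar>\<integral>z. X z - T z \<partial>N\<bar>" using X assms by simp
  also have "\<dots> \<le> (\<integral>z. \<bar>X z - T z\<bar> \<partial>N)" by (rule integral_abs_bound)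
  also have "\<dots> \<le> (\<integral>z. B z \<partial>N)" using d assms by (intro integral_mono_AE) auto
  finally show "\<bar>(\<integral>z. X z \<partial>N) - (\<integral>z. T z \<partial>N)\<bar> \<le> (\<integral>z. B z \<partial>N)" .
qed

section \<open>Admissible trades and large noise\<close>

definition admissible :: "real \<Rightarrow> real \<Rightarrow> real \<Rightarrow> real \<times> real \<Rightarrow> real" where
  "admissible \<gamma> w ws z = indicator {0..} (post_trade \<gamma> w ws (fst z)) * indicator {0..} (post_trade \<gamma> ws w (snd z))"

definition mean_jump :: "real \<Rightarrow> real measure \<Rightarrow> (real \<Rightarrow> real) \<Rightarrow> real \<Rightarrow> real \<Rightarrow> real" where
  "mean_jump \<gamma> \<nu> \<phi> w ws =
     (\<integral>z. admissible \<gamma> w ws z * (\<phi> (post_trade \<gamma> w ws (fst z)) - \<phi> w) \<partial>(\<nu> \<Otimes>\<^sub>M \<nu>))"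

lemma admissible_01: "admissible \<gamma> w ws z = 0 \<or> admissible \<gamma> w ws z = 1"
  by (auto simp: admissible_def indicator_def)

lemma admissible_bounds: "0 \<le> admissible \<gamma> w ws z" "admissible \<gamma> w ws z \<le> 1" "\<bar>admissible \<gamma> w ws z\<bar> \<le> 1"
  using admissible_01[of \<gamma> w ws z] by auto

text \<open>Threshold 1/2: when \<gamma> is at most 1/2, a debt requires
  \<open>1 - \<gamma> + \<eta> < 0\<close>, hence \<eta> < -1/2.\<close>

definition large :: "real \<Rightarrow> real" where "large \<eta> = indicator {\<eta>. 1 / 2 \<le> \<bar>\<eta>\<bar>} \<eta>"

lemma large_bounds: "0 \<le> large x" "large x \<le> 1" by (auto simp: large_def indicator_def)

lemma post_trade_neg_imp_large:
  assumes "0 \<le> \<gamma>" "\<gamma> \<le> 1 / 2" "0 \<le> w" "0 \<le> ws" "post_trade \<gamma> w ws \<eta> < 0"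
  shows "large \<eta> = 1"
proof -
  have "(1 - \<gamma> + \<eta>) * w < 0" using assms by (simp add: post_trade_def algebra_simps add_nonneg_pos) (smt (verit) mult_nonneg_nonneg)
  then have "1 - \<gamma> + \<eta> < 0" using assms by (simp add: mult_less_0_iff)
  then show ?thesis using assms by (auto simp: large_def)
qed

lemma not_admissible_le:
  assumes "0 \<le> \<gamma>" "\<gamma> \<le> 1 / 2" "0 \<le> w" "0 \<le> ws"
  shows "1 - admissible \<gamma> w ws z \<le> large (fst z) + large (snd z)"
  using post_trade_neg_imp_large[of \<gamma> w ws "fst z"] post_trade_neg_imp_large[of \<gamma> ws w "snd z"] assms
    large_bounds[of "fst z"] large_bounds[of "snd z"]
  by (auto simp: admissible_def indicator_def)

lemma measurable_admissible[measurable]: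
  "(\<lambda>z. admissible \<gamma> w ws z) \<in> borel_measurable (borel \<Otimes>\<^sub>M borel)"
  unfolding admissible_def post_trade_def by measurable

lemma powr_add_le: "(a + b) powr r \<le> 2 powr r * (a powr r + b powr r)" if "0 \<le> a" "0 \<le> b" "0 \<le> r" for a b r :: real
proof -
  have "(a + b) powr r \<le> (2 * max a b) powr r" using that by (intro powr_mono2) auto
  also have "\<dots> = 2 powr r * (max a b) powr r" using that by (simp add: powr_mult)
  also have "\<dots> \<le> 2 powr r * (a powr r + b powr r)" by (intro mult_left_mono) (auto simp: max_def)
  finally show ?thesis .
qed

text \<open>The mean value inequality is used twice on the segment between \<open>w\<close> and
  \<open>y\<close>, with derivatives taken within it so that 0 may be an end point. No point of the
  segment exceeds \<open>w + \<bar>y - w\<bar>\<close>, where the increasing power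
  \<open>p - 2\<close> is evaluated.\<close>

lemma powr_taylor_le:
  fixes p w y :: real
  assumes p: "2 < p" and "0 \<le> w" "0 \<le> y"
  shows "\<bar>y powr p - w powr p - p * w powr (p - 1) * (y - w)\<bar> \<le> p * (p - 1) * (w + \<bar>y - w\<bar>) powr (p - 2) * (y - w)\<^sup>2"
proof -
  define S where "S = {min w y..max w y}"
  define R where "R = (p - 1) * (w + \<bar>y - w\<bar>) powr (p - 2)"
  have R: "R \<ge> 0" using p by (simp add: R_def)
  have S: "convex S" "S \<subseteq> {0..}" "w \<in> S" "y \<in> S" using assms by (auto simp: S_def)
  have 1: "\<bar>u powr (p - 1) - w powr (p - 1)\<bar> \<le> R * \<bar>u - w\<bar>" if "u \<in> S" for u
  proof -
    have "norm (u powr (p - 1) - w powr (p - 1)) \<le> R * norm (u - w)"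
    proof (rule field_differentiable_bound[OF S(1) _ _ that S(3)])
      fix z assume z: "z \<in> S"
      then have z0: "z \<ge> 0" using S by auto
      show "((\<lambda>u. u powr (p - 1)) has_real_derivative (p - 1) * z powr (p - 1 - 1)) (at z within S)"
        by (rule DERIV_subset[OF powr_has_deriv_Rplus]) (use z0 p S in auto)
      have "z powr (p - 2) \<le> (w + \<bar>y - w\<bar>) powr (p - 2)"
        using z z0 p by (intro powr_mono2) (auto simp: S_def)
      then show "norm ((p - 1) * z powr (p - 1 - 1)) \<le> R" using p by (simp add: R_def abs_mult)
    qed
    then show ?thesis by simp
  qed
  define h where "h u = u powr p - p * w powr (p - 1) * u" for u
  have "norm (h y - h w) \<le> (p * R * \<bar>y - w\<bar>) * norm (y - w)"
  proof (rule field_differentiable_bound[OF S(1) _ _ S(4,3)])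
    fix z assume z: "z \<in> S"
    then have z0: "z \<ge> 0" using S by auto
    have "((\<lambda>u. u powr p) has_real_derivative p * z powr (p - 1)) (at z within S)"
      by (rule DERIV_subset[OF powr_has_deriv_Rplus]) (use z0 p S in auto)
    then show "(h has_real_derivative p * z powr (p - 1) - p * w powr (p - 1)) (at z within S)"
      unfolding h_def by (rule DERIV_diff[OF _ DERIV_cmult_Id])
    have "\<bar>p * z powr (p - 1) - p * w powr (p - 1)\<bar> = p * \<bar>z powr (p - 1) - w powr (p - 1)\<bar>"
      using p by (simp add: right_diff_distrib[symmetric] abs_mult)
    also have "\<dots> \<le> p * (R * \<bar>z - w\<bar>)" using 1[OF z] p by (intro mult_left_mono) auto
    also have "\<dots> \<le> p * (R * \<bar>y - w\<bar>)" using z p R by (intro mult_left_mono) (auto simp: S_def)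
    finally show "norm (p * z powr (p - 1) - p * w powr (p - 1)) \<le> p * R * \<bar>y - w\<bar>" by (simp add: mult.assoc)
  qed
  moreover have "h y - h w = y powr p - w powr p - p * w powr (p - 1) * (y - w)"
    by (simp add: h_def algebra_simps)
  moreover have "(p * R * \<bar>y - w\<bar>) * norm (y - w) = p * (p - 1) * (w + \<bar>y - w\<bar>) powr (p - 2) * (y - w)\<^sup>2"
    unfolding R_def real_norm_def by (simp add: power2_eq_square mult.assoc)
  ultimately show ?thesis by (metis real_norm_def)
qed

section \<open>Expansion of the mean jump for a centred noise\<close>

locale noise = real_distribution \<nu> for \<nu> :: "real measure" +
  assumes square_integrable: "integrable \<nu> (\<lambda>x. x\<^sup>2)"
    and mean_zero: "(\<integral>x. x \<partial>\<nu>) = 0"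
begin

definition var :: real where "var = (\<integral>x. x\<^sup>2 \<partial>\<nu>)"
definition abs_moment :: "real \<Rightarrow> real" where "abs_moment r = (\<integral>x. \<bar>x\<bar> powr r \<partial>\<nu>)"

lemma prob_UNIV[simp]: "prob UNIV = 1" using prob_space by simp

lemma var_nonneg: "0 \<le> var" by (simp add: var_def)
lemma abs_moment_nonneg: "0 \<le> abs_moment r" by (simp add: abs_moment_def)

lemma abs_le_1_square: "\<bar>x\<bar> \<le> 1 + x\<^sup>2" for x :: real
  using zero_le_power2[of "\<bar>x\<bar> - 1"] unfolding power2_diff by simp

lemma abs_integrable: "integrable \<nu> (\<lambda>x. \<bar>x\<bar>)" "integrable \<nu> (\<lambda>x. x)"
proof -
  have 1: "integrable \<nu> (\<lambda>x. 1 + x\<^sup>2)" using square_integrable by simp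
  show "integrable \<nu> (\<lambda>x. \<bar>x\<bar>)"
    by (rule Bochner_Integration.integrable_bound[OF 1]) (use abs_le_1_square in auto)
  show "integrable \<nu> (\<lambda>x. x)"
    by (rule Bochner_Integration.integrable_bound[OF 1]) (use abs_le_1_square in auto)
qed

lemma abs_mean_le: "(\<integral>x. \<bar>x\<bar> \<partial>\<nu>) \<le> 1 + var"
proof -
  have "(\<integral>x. \<bar>x\<bar> \<partial>\<nu>) \<le> (\<integral>x. 1 + x\<^sup>2 \<partial>\<nu>)"
    using square_integrable abs_integrable abs_le_1_square by (intro integral_mono) auto
  also have "\<dots> = 1 + var" using square_integrable by (simp add: var_def prob_space)
  finally show ?thesis .
qed

text \<open>Chebyshev: where \<open>large\<close> is nonzero, \<open>2 * \<bar>x\<bar>\<close> is at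
  least 1, and its power of order \<open>r\<close> dominates 1 and the lower powers.\<close>

lemma large_moment_le:
  assumes "2 \<le> r"
  shows "large x * (1 + \<bar>x\<bar> + x\<^sup>2) \<le> 2 * 2 powr r * \<bar>x\<bar> powr r" "large x \<le> 2 powr r * \<bar>x\<bar> powr r"
proof -
  show b: "large x \<le> 2 powr r * \<bar>x\<bar> powr r"
  proof (cases "1 / 2 \<le> \<bar>x\<bar>")
    case True
    then have "1 \<le> (2 * \<bar>x\<bar>) powr r" using assms by (intro ge_one_powr_ge_zero) auto
    then show ?thesis using True by (simp add: large_def powr_mult)
  qed (simp add: large_def)
  show "large x * (1 + \<bar>x\<bar> + x\<^sup>2) \<le> 2 * 2 powr r * \<bar>x\<bar> powr r"
  proof (cases "1 / 2 \<le> \<bar>x\<bar>")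
    case True
    define y where "y = 2 * \<bar>x\<bar>"
    have y: "y \<ge> 1" "\<bar>x\<bar> = y / 2" "x\<^sup>2 = y\<^sup>2 / 4"
      using True by (auto simp: y_def power2_eq_square)
    have y2: "y\<^sup>2 \<le> y powr r" using y powr_mono[of 2 r y] assms powr_realpow[of y 2] by simp
    have y1: "y \<le> y\<^sup>2" using y by (simp add: power2_eq_square)
    have "1 + \<bar>x\<bar> + x\<^sup>2 \<le> 2 * y powr r" using y y1 y2 by simp
    also have "y powr r = 2 powr r * \<bar>x\<bar> powr r" by (simp add: y_def powr_mult)
    finally show ?thesis using True by (simp add: large_def)
  qed (simp add: large_def)
qed

lemma large_measurable[measurable]: "large \<in> borel_measurable borel"
  unfolding large_def by measurable

lemma large_integrable: "integrable \<nu> large"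
  by (rule integrable_const_bound[of _ 1]) (use large_bounds in auto)

lemma noise_prob: "prob_space \<nu>" by (rule prob_space_axioms)

abbreviation "\<nu>2 \<equiv> \<nu> \<Otimes>\<^sub>M \<nu>"

sublocale pair: pair_prob_space \<nu> \<nu> ..

lemma sets_pair[measurable_cong]: "sets \<nu>2 = sets (borel \<Otimes>\<^sub>M borel)"
  by (intro sets_pair_measure_cong) auto

text \<open>The price of trades cut off by the no-debt rule: there the Taylor polynomial, quadratic
  in the agent's own noise, survives uncompensated and is integrated against \<open>large\<close> of
  either noise. Independence splits the second product.\<close>

lemma large_pair_le:
  assumes r: "2 \<le> r" and i: "integrable \<nu> (\<lambda>x. \<bar>x\<bar> powr r)"
  defines "B \<equiv> \<lambda>z. (large (fst z) + large (snd z)) * (1 + \<bar>fst z\<bar> + (fst z)\<^sup>2)"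
  shows "integrable \<nu>2 B" "(\<integral>z. B z \<partial>\<nu>2) \<le> 2 * 2 powr r * (2 + var) * abs_moment r"
proof -
  have i1: "integrable \<nu> (\<lambda>x. large x * (1 + \<bar>x\<bar> + x\<^sup>2))"
    by (rule Bochner_Integration.integrable_bound[of _ "\<lambda>x. 2 * 2 powr r * \<bar>x\<bar> powr r"])
       (use i large_moment_le[OF r] large_bounds in \<open>auto simp: abs_mult\<close>)
  have i2: "integrable \<nu> (\<lambda>x. 1 + \<bar>x\<bar> + x\<^sup>2)" using abs_integrable square_integrable by simp
  note f = integrable_pair_fst[OF noise_prob noise_prob i1]
  note s = integrable_pair_mult[OF noise_prob noise_prob i2 large_integrable]
  have B: "B = (\<lambda>z. large (fst z) * (1 + \<bar>fst z\<bar> + (fst z)\<^sup>2) + (1 + \<bar>fst z\<bar> + (fst z)\<^sup>2) * large (snd z))"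
    by (auto simp: B_def algebra_simps)
  show "integrable \<nu>2 B" unfolding B using f(1) s(1) by (rule Bochner_Integration.integrable_add)
  have "(\<integral>z. B z \<partial>\<nu>2) = (\<integral>x. large x * (1 + \<bar>x\<bar> + x\<^sup>2) \<partial>\<nu>) + (\<integral>x. 1 + \<bar>x\<bar> + x\<^sup>2 \<partial>\<nu>) * (\<integral>x. large x \<partial>\<nu>)"
    unfolding B using f s by simp
  also have "\<dots> \<le> 2 * 2 powr r * abs_moment r + (2 + 2 * var) * (2 powr r * abs_moment r)"
  proof (intro add_mono mult_mono)
    have "(\<integral>x. large x * (1 + \<bar>x\<bar> + x\<^sup>2) \<partial>\<nu>) \<le> (\<integral>x. 2 * 2 powr r * \<bar>x\<bar> powr r \<partial>\<nu>)"
      using i large_moment_le[OF r] i1 by (intro integral_mono) auto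
    then show "(\<integral>x. large x * (1 + \<bar>x\<bar> + x\<^sup>2) \<partial>\<nu>) \<le> 2 * 2 powr r * abs_moment r"
      by (simp add: abs_moment_def)
    have "(\<integral>x. large x \<partial>\<nu>) \<le> (\<integral>x. 2 powr r * \<bar>x\<bar> powr r \<partial>\<nu>)"
      using i large_moment_le[OF r] large_integrable by (intro integral_mono) auto
    then show "(\<integral>x. large x \<partial>\<nu>) \<le> 2 powr r * abs_moment r" by (simp add: abs_moment_def)
    show "(\<integral>x. 1 + \<bar>x\<bar> + x\<^sup>2 \<partial>\<nu>) \<le> 2 + 2 * var"
      using abs_integrable square_integrable abs_mean_le by (simp add: var_def prob_space)
  qed (use large_bounds var_nonneg in auto)
  also have "\<dots> = 2 * 2 powr r * (2 + var) * abs_moment r" by (simp add: algebra_simps)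
  finally show "(\<integral>z. B z \<partial>\<nu>2) \<le> 2 * 2 powr r * (2 + var) * abs_moment r" .
qed

lemma increment_bounds:
  assumes "0 \<le> \<gamma>" "\<gamma> \<le> 1" "0 \<le> w" "0 \<le> ws"
  shows "\<bar>post_trade \<gamma> w ws \<eta> - w\<bar> \<le> (w + ws) * (\<gamma> + \<bar>\<eta>\<bar>)"
proof -
  have "post_trade \<gamma> w ws \<eta> - w = \<gamma> * (ws - w) + \<eta> * w" by (simp add: post_trade_def algebra_simps)
  also have "\<bar>\<dots>\<bar> \<le> \<gamma> * \<bar>ws - w\<bar> + \<bar>\<eta>\<bar> * w"
    using assms by (metis abs_mult abs_of_nonneg abs_triangle_ineq)
  also have "\<dots> \<le> \<gamma> * (w + ws) + \<bar>\<eta>\<bar> * (w + ws)"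
    using assms by (intro add_mono mult_left_mono) auto
  finally show ?thesis by (simp add: algebra_simps)
qed

lemma increment_integrable:
  "integrable \<nu>2 (\<lambda>z. post_trade \<gamma> w ws (fst z) - w)"
  "(\<integral>z. post_trade \<gamma> w ws (fst z) - w \<partial>\<nu>2) = \<gamma> * (ws - w)"
proof -
  have e: "(\<lambda>x. post_trade \<gamma> w ws x - w) = (\<lambda>x. \<gamma> * (ws - w) + x * w)"
    by (auto simp: post_trade_def algebra_simps)
  have i: "integrable \<nu> (\<lambda>x. post_trade \<gamma> w ws x - w)" unfolding e using abs_integrable by simp
  note f = integrable_pair_fst[OF noise_prob noise_prob i]
  show "integrable \<nu>2 (\<lambda>z. post_trade \<gamma> w ws (fst z) - w)" by (rule f(1))
  show "(\<integral>z. post_trade \<gamma> w ws (fst z) - w \<partial>\<nu>2) = \<gamma> * (ws - w)"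
    unfolding f(2) e using abs_integrable by (simp add: mean_zero prob_space)
qed

lemma increment_square_integrable:
  "integrable \<nu>2 (\<lambda>z. (post_trade \<gamma> w ws (fst z) - w)\<^sup>2)"
  "(\<integral>z. (post_trade \<gamma> w ws (fst z) - w)\<^sup>2 \<partial>\<nu>2) = \<gamma>\<^sup>2 * (ws - w)\<^sup>2 + var * w\<^sup>2"
proof -
  have e: "(\<lambda>x. (post_trade \<gamma> w ws x - w)\<^sup>2) = (\<lambda>x. \<gamma>\<^sup>2 * (ws - w)\<^sup>2 + (2 * \<gamma> * (ws - w) * w) * x + w\<^sup>2 * x\<^sup>2)"
    by (auto simp: post_trade_def power2_eq_square algebra_simps)
  have i: "integrable \<nu> (\<lambda>x. (post_trade \<gamma> w ws x - w)\<^sup>2)" unfolding e using abs_integrable square_integrable by simp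
  note f = integrable_pair_fst[OF noise_prob noise_prob i]
  show "integrable \<nu>2 (\<lambda>z. (post_trade \<gamma> w ws (fst z) - w)\<^sup>2)" by (rule f(1))
  show "(\<integral>z. (post_trade \<gamma> w ws (fst z) - w)\<^sup>2 \<partial>\<nu>2) = \<gamma>\<^sup>2 * (ws - w)\<^sup>2 + var * w\<^sup>2"
    unfolding f(2) e using abs_integrable square_integrable by (simp add: mean_zero prob_space var_def)
qed

lemma measurable_jump:
  assumes [measurable]: "\<phi> \<in> borel_measurable borel"
  shows "(\<lambda>z. admissible \<gamma> w ws z * (\<phi> (post_trade \<gamma> w ws (fst z)) - \<phi> w)) \<in> borel_measurable \<nu>2"
  unfolding post_trade_def by measurable

text \<open>The jump is compared with \<open>T\<close>, the second-order Taylor polynomial in the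
  wealth increment without the admissibility factor, whose mean is explicit because the noise is
  centred. On admissible trades the difference is the Taylor remainder; on the others it is
  \<open>T\<close> itself, and then one of the noises is large.\<close>

lemma mean_jump_consistent:
  assumes \<phi>: "C2_smooth \<phi> \<phi>1 \<phi>2"
    and C: "\<And>x. \<bar>\<phi>1 x\<bar> \<le> C * (1 + \<bar>x\<bar>)" "\<And>x. \<bar>\<phi>2 x\<bar> \<le> C" "\<And>x y. \<bar>\<phi>2 x - \<phi>2 y\<bar> \<le> C * \<bar>x - y\<bar>"
    and q: "2 \<le> q" "q \<le> 3" "integrable \<nu> (\<lambda>x. \<bar>x\<bar> powr q)"
    and \<gamma>: "0 \<le> \<gamma>" "\<gamma> \<le> 1 / 2" and w: "0 \<le> w" "0 \<le> ws"
  shows "\<bar>mean_jump \<gamma> \<nu> \<phi> w ws - (\<gamma> * (ws - w) * \<phi>1 w + var / 2 * w\<^sup>2 * \<phi>2 w)\<bar>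
    \<le> C * (40 * (2 + var) * (abs_moment q + \<gamma>\<^sup>2)) * (1 + w + ws) powr q"
proof -
  have C0: "C \<ge> 0" using C(2)[of 0] by linarith
  define s where "s = w + ws"
  have s: "s \<ge> 0" "w \<le> s" using w by (auto simp: s_def)
  define x where "x z = post_trade \<gamma> w ws (fst z) - w" for z :: "real \<times> real"
  define T where "T z = \<phi>1 w * x z + \<phi>2 w / 2 * (x z)\<^sup>2" for z
  define Z where "Z z = (large (fst z) + large (snd z)) * (1 + \<bar>fst z\<bar> + (fst z)\<^sup>2)" for z
  \<comment> \<open>First summand: trades that are cut off. Second summand: Taylor remainder of
    order \<open>q\<close>.\<close>
  define B where "B z = 2 * C * (1 + s)\<^sup>2 * Z z + 8 * C * s powr q * (\<gamma>\<^sup>2 + \<bar>fst z\<bar> powr q)" for z :: "real \<times> real"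
  define I where "I = admissible \<gamma> w ws"
  define X where "X z = I z * (\<phi> (post_trade \<gamma> w ws (fst z)) - \<phi> w)" for z
  have Ti: "integrable \<nu>2 T" and TE: "(\<integral>z. T z \<partial>\<nu>2) = \<phi>1 w * (\<gamma> * (ws - w)) + \<phi>2 w / 2 * (\<gamma>\<^sup>2 * (ws - w)\<^sup>2 + var * w\<^sup>2)"
    unfolding T_def x_def using increment_integrable[of \<gamma> w ws] increment_square_integrable[of \<gamma> w ws] by auto
  note Zf = large_pair_le[OF q(1,3), folded Z_def]
  have Zi: "integrable \<nu>2 Z" using Zf(1) by (simp add: Z_def[abs_def])
  have ZE: "(\<integral>z. Z z \<partial>\<nu>2) \<le> 2 * 2 powr q * (2 + var) * abs_moment q" using Zf(2) by (simp add: Z_def[abs_def])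
  note pf = integrable_pair_fst[OF noise_prob noise_prob q(3)]
  have Bi: "integrable \<nu>2 B" unfolding B_def using Zi pf(1) by simp
  have q8: "2 powr q \<le> (8::real)" using powr_mono[of q 3 "2::real"] q powr_realpow[of 2 3] by simp
  have BE: "(\<integral>z. B z \<partial>\<nu>2) \<le> C * (1 + s) powr q * (32 * (2 + var) * abs_moment q + 8 * (\<gamma>\<^sup>2 + abs_moment q))"
  proof -
    have "(\<integral>z. B z \<partial>\<nu>2) = 2 * C * (1 + s)\<^sup>2 * (\<integral>z. Z z \<partial>\<nu>2) + 8 * C * s powr q * (\<gamma>\<^sup>2 + abs_moment q)"
      unfolding B_def using Zi pf by (simp add: abs_moment_def pair.prob_space)
    also have "\<dots> \<le> 2 * C * (1 + s) powr q * (16 * (2 + var) * abs_moment q) + 8 * C * (1 + s) powr q * (\<gamma>\<^sup>2 + abs_moment q)"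
    proof (intro add_mono mult_mono)
      have "(1 + s)\<^sup>2 = (1 + s) powr 2" using s powr_realpow[of "1 + s" 2] by simp
      also have "\<dots> \<le> (1 + s) powr q" using s q by (intro powr_mono) auto
      finally show "(1 + s)\<^sup>2 \<le> (1 + s) powr q" .
      have "2 * 2 powr q * (2 + var) * abs_moment q \<le> 16 * (2 + var) * abs_moment q"
        using q8 var_nonneg abs_moment_nonneg by (intro mult_right_mono) auto
      with ZE show "(\<integral>z. Z z \<partial>\<nu>2) \<le> 16 * (2 + var) * abs_moment q" by linarith
      show "s powr q \<le> (1 + s) powr q" using s q by (intro powr_mono2) auto
      show "0 \<le> (\<integral>z. Z z \<partial>\<nu>2)" unfolding Z_def using large_bounds by (intro integral_nonneg_AE) auto
    qed (use C0 var_nonneg abs_moment_nonneg in auto)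
    also have "\<dots> = C * (1 + s) powr q * (32 * (2 + var) * abs_moment q + 8 * (\<gamma>\<^sup>2 + abs_moment q))"
      by (simp add: algebra_simps)
    finally show ?thesis .
  qed
  have XTB: "\<bar>X z - T z\<bar> \<le> B z" for z
  proof -
    define \<eta> where "\<eta> = \<bar>fst z\<bar>"
    have \<eta>: "\<eta> \<ge> 0" "(fst z)\<^sup>2 = \<eta>\<^sup>2" "\<bar>fst z\<bar> = \<eta>" by (auto simp: \<eta>_def)
    have xb: "\<bar>x z\<bar> \<le> s * (\<gamma> + \<eta>)"
      using increment_bounds[of \<gamma> w ws "fst z"] \<gamma> w by (simp add: x_def s_def \<eta>_def)
    have xb1: "\<bar>x z\<bar> \<le> (1 + s) * (1 + \<eta>)"
      by (rule order_trans[OF xb]) (use s \<eta> \<gamma> in \<open>intro mult_mono; simp\<close>)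
    have R: "\<bar>\<phi> (w + x z) - \<phi> w - T z\<bar> \<le> C * (8 * s powr q * (\<gamma>\<^sup>2 + \<eta> powr q))"
    proof -
      have R1: "\<bar>\<phi> (w + x z) - \<phi> w - T z\<bar> \<le> C * \<bar>x z\<bar> powr q"
        using C2_smooth_taylor_le[OF \<phi> q(1,2) C(2,3), of "w + x z" w] by (simp add: T_def algebra_simps)
      have "\<bar>x z\<bar> powr q \<le> (s * (\<gamma> + \<eta>)) powr q" using xb q by (intro powr_mono2) auto
      also have "\<dots> = s powr q * (\<gamma> + \<eta>) powr q" using s \<gamma> \<eta> by (simp add: powr_mult)
      also have "\<dots> \<le> s powr q * (8 * (\<gamma>\<^sup>2 + \<eta> powr q))"
      proof (intro mult_left_mono)
        have "\<gamma> powr q \<le> \<gamma>\<^sup>2"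
        proof (cases "\<gamma> = 0")
          case False
          then show ?thesis using powr_mono'[of 2 q \<gamma>] \<gamma> q powr_realpow[of \<gamma> 2] by simp
        qed simp
        then have "2 powr q * (\<gamma> powr q + \<eta> powr q) \<le> 8 * (\<gamma>\<^sup>2 + \<eta> powr q)"
          using q8 by (intro mult_mono) auto
        with powr_add_le[of \<gamma> \<eta> q] \<gamma> \<eta> q show "(\<gamma> + \<eta>) powr q \<le> 8 * (\<gamma>\<^sup>2 + \<eta> powr q)" by linarith
      qed auto
      finally have "C * \<bar>x z\<bar> powr q \<le> C * (s powr q * (8 * (\<gamma>\<^sup>2 + \<eta> powr q)))" using C0 by (rule mult_left_mono)
      with R1 show ?thesis by (simp add: mult_ac)
    qed
    have Tb: "\<bar>T z\<bar> \<le> 2 * C * (1 + s)\<^sup>2 * (1 + \<eta> + \<eta>\<^sup>2)"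
    proof -
      have "\<bar>\<phi>1 w * x z\<bar> \<le> (C * (1 + s)) * ((1 + s) * (1 + \<eta>))"
        unfolding abs_mult
      proof (intro mult_mono xb1)
        have "\<bar>\<phi>1 w\<bar> \<le> C * (1 + \<bar>w\<bar>)" by (rule C)
        also have "\<dots> \<le> C * (1 + s)" using C0 w s by (intro mult_left_mono) auto
        finally show "\<bar>\<phi>1 w\<bar> \<le> C * (1 + s)" .
      qed (use C0 s in auto)
      moreover have "\<bar>\<phi>2 w / 2 * (x z)\<^sup>2\<bar> \<le> (C / 2) * ((1 + s)\<^sup>2 * (2 * (1 + \<eta>\<^sup>2)))"
        unfolding abs_mult
      proof (intro mult_mono)
        have "(x z)\<^sup>2 = \<bar>x z\<bar>\<^sup>2" by simp
        also have "\<dots> \<le> ((1 + s) * (1 + \<eta>))\<^sup>2" by (intro power_mono xb1) auto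
        also have "\<dots> = (1 + s)\<^sup>2 * (1 + \<eta>)\<^sup>2" by (simp add: power_mult_distrib)
        also have "(1 + \<eta>)\<^sup>2 \<le> 2 * (1 + \<eta>\<^sup>2)"
          using zero_le_power2[of "1 - \<eta>"] by (simp add: power2_eq_square algebra_simps)
        finally show "\<bar>(x z)\<^sup>2\<bar> \<le> (1 + s)\<^sup>2 * (2 * (1 + \<eta>\<^sup>2))" by (simp add: mult_left_mono)
      qed (use C(2)[of w] C0 in auto)
      ultimately have "\<bar>T z\<bar> \<le> (C * (1 + s)) * ((1 + s) * (1 + \<eta>)) + (C / 2) * ((1 + s)\<^sup>2 * (2 * (1 + \<eta>\<^sup>2)))"
        unfolding T_def by linarith
      also have "\<dots> = C * (1 + s)\<^sup>2 * (2 + \<eta> + \<eta>\<^sup>2)" by (simp add: power2_eq_square algebra_simps)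
      also have "\<dots> \<le> C * (1 + s)\<^sup>2 * (2 * (1 + \<eta> + \<eta>\<^sup>2))" using C0 \<eta> by (intro mult_left_mono) auto
      also have "\<dots> = 2 * C * (1 + s)\<^sup>2 * (1 + \<eta> + \<eta>\<^sup>2)" by (simp only: mult_ac)
      finally show ?thesis .
    qed
    have pt: "post_trade \<gamma> w ws (fst z) = w + x z" by (simp add: x_def)
    show ?thesis
    proof (cases "I z = 1")
      case True
      have "0 \<le> Z z" using large_bounds by (auto simp: Z_def)
      then have "0 \<le> 2 * C * (1 + s)\<^sup>2 * Z z" using C0 by simp
      moreover have "C * (8 * s powr q * (\<gamma>\<^sup>2 + \<eta> powr q)) = 8 * C * s powr q * (\<gamma>\<^sup>2 + \<bar>fst z\<bar> powr q)" by (simp add: \<eta>)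
      ultimately have "\<bar>\<phi> (w + x z) - \<phi> w - T z\<bar> \<le> B z" using R unfolding B_def by linarith
      with True show ?thesis by (simp add: X_def pt)
    next
      case False
      then have I0: "I z = 0" using admissible_01[of \<gamma> w ws z] by (simp add: I_def)
      have "1 \<le> large (fst z) + large (snd z)" using not_admissible_le[OF \<gamma> w, of z] I0 by (simp add: I_def)
      then have "1 * (1 + \<eta> + \<eta>\<^sup>2) \<le> Z z" unfolding Z_def \<eta> using \<eta> by (intro mult_right_mono) auto
      then have "2 * C * (1 + s)\<^sup>2 * (1 + \<eta> + \<eta>\<^sup>2) \<le> 2 * C * (1 + s)\<^sup>2 * Z z" using C0 by (intro mult_left_mono) auto
      moreover have "0 \<le> 8 * C * s powr q * (\<gamma>\<^sup>2 + \<bar>fst z\<bar> powr q)" using C0 by simp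
      ultimately show ?thesis using Tb I0 by (simp add: X_def B_def)
    qed
  qed
  have Xm: "X \<in> borel_measurable \<nu>2" unfolding X_def I_def
    by (intro measurable_jump borel_measurable_continuous_onI C2_smooth_continuous(1)[OF \<phi>])
  have "\<bar>(\<integral>z. X z \<partial>\<nu>2) - (\<integral>z. T z \<partial>\<nu>2)\<bar> \<le> (\<integral>z. B z \<partial>\<nu>2)"
    by (rule integral_near[OF Ti Bi Xm]) (use XTB in auto)
  moreover have "(\<integral>z. X z \<partial>\<nu>2) = mean_jump \<gamma> \<nu> \<phi> w ws" by (simp add: X_def I_def mean_jump_def)
  moreover have "(\<integral>z. T z \<partial>\<nu>2) = (\<gamma> * (ws - w) * \<phi>1 w + var / 2 * w\<^sup>2 * \<phi>2 w) + \<phi>2 w / 2 * (\<gamma>\<^sup>2 * (ws - w)\<^sup>2)"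
    unfolding TE by (simp add: algebra_simps)
  \<comment> \<open>The deterministic exchange contributes a term of order
    \<open>\<gamma>\<^sup>2\<close> to the second moment of the increment; it counts as an
    error.\<close>
  moreover have "\<bar>\<phi>2 w / 2 * (\<gamma>\<^sup>2 * (ws - w)\<^sup>2)\<bar> \<le> C * (1 + s) powr q * \<gamma>\<^sup>2"
  proof -
    have "\<bar>ws - w\<bar>\<^sup>2 \<le> (1 + s)\<^sup>2" using w by (intro power_mono) (auto simp: s_def)
    also have "(1 + s)\<^sup>2 = (1 + s) powr 2" using s powr_realpow[of "1 + s" 2] by simp
    also have "\<dots> \<le> (1 + s) powr q" using s q by (intro powr_mono) auto
    finally have "(ws - w)\<^sup>2 \<le> (1 + s) powr q" by simp
    then have "\<bar>\<phi>2 w\<bar> / 2 * (\<gamma>\<^sup>2 * (ws - w)\<^sup>2) \<le> C * (\<gamma>\<^sup>2 * (1 + s) powr q)"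
      using C(2)[of w] C0 by (intro mult_mono) auto
    then show ?thesis by (simp add: abs_mult mult_ac)
  qed
  ultimately have "\<bar>mean_jump \<gamma> \<nu> \<phi> w ws - (\<gamma> * (ws - w) * \<phi>1 w + var / 2 * w\<^sup>2 * \<phi>2 w)\<bar>
      \<le> C * (1 + s) powr q * (32 * (2 + var) * abs_moment q + 8 * (\<gamma>\<^sup>2 + abs_moment q)) + C * (1 + s) powr q * \<gamma>\<^sup>2"
    using BE by linarith
  also have "\<dots> = C * (1 + s) powr q * (32 * (2 + var) * abs_moment q + 8 * abs_moment q + 9 * \<gamma>\<^sup>2)" by (simp add: algebra_simps)
  also have "\<dots> \<le> C * (1 + s) powr q * (40 * (2 + var) * (abs_moment q + \<gamma>\<^sup>2))"
  proof (intro mult_left_mono)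
    have "0 \<le> var * abs_moment q" "0 \<le> var * \<gamma>\<^sup>2" "0 \<le> abs_moment q" "0 \<le> \<gamma>\<^sup>2"
      using var_nonneg abs_moment_nonneg by auto
    then show "32 * (2 + var) * abs_moment q + 8 * abs_moment q + 9 * \<gamma>\<^sup>2 \<le> 40 * (2 + var) * (abs_moment q + \<gamma>\<^sup>2)"
      by (simp add: algebra_simps)
  qed (use C0 in auto)
  finally show ?thesis by (simp add: s_def add.assoc mult_ac)
qed

text \<open>Only an upper bound is needed, for a Gronwall argument. The first-order term is at most
  \<open>p * \<gamma> * (w + ws) powr p\<close>; the rest costs \<open>\<gamma>\<^sup>2\<close>, a
  multiple of the variance, or the noise moment of order \<open>p\<close>.\<close>

lemma mean_jump_powr_le:
  assumes p: "2 < p" "integrable \<nu> (\<lambda>x. \<bar>x\<bar> powr p)"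
    and \<gamma>: "0 \<le> \<gamma>" "\<gamma> \<le> 1 / 2" and w: "0 \<le> w" "0 \<le> ws"
  shows "mean_jump \<gamma> \<nu> (\<lambda>w. w powr p) w ws
    \<le> 4 * p\<^sup>2 * 6 powr p * (2 * \<gamma> + 9 * (2 + var) * var + abs_moment p) * (w powr p + ws powr p)"
proof -
  define s where "s = w + ws"
  have s: "s \<ge> 0" "w \<le> s" "ws \<le> s" using w by (auto simp: s_def)
  define c where "c = p * w powr (p - 1)"
  have c: "c \<ge> 0" "c * s \<le> p * s powr p"
  proof -
    show "c \<ge> 0" using p by (simp add: c_def)
    have "w powr (p - 1) * s \<le> s powr (p - 1) * s" using s p w by (intro mult_right_mono powr_mono2) auto
    also have "\<dots> = s powr p" using s p by (cases "s = 0") (auto simp: powr_diff)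
    finally show "c * s \<le> p * s powr p" using p by (simp add: c_def mult.assoc)
  qed
  define x where "x z = post_trade \<gamma> w ws (fst z) - w" for z :: "real \<times> real"
  define T where "T z = c * x z" for z
  define Z where "Z z = (large (fst z) + large (snd z)) * (1 + \<bar>fst z\<bar> + (fst z)\<^sup>2)" for z
  define U where "U z = \<gamma>\<^sup>2 + (fst z)\<^sup>2 + \<bar>fst z\<bar> powr p" for z :: "real \<times> real"
  define D where "D = p * (p - 1) * s powr p * (4 * 3 powr p)"
  define B where "B z = c * s * Z z + D * U z" for z :: "real \<times> real"
  define I where "I = admissible \<gamma> w ws"
  define X where "X z = I z * (post_trade \<gamma> w ws (fst z) powr p - w powr p)" for z
  define E where "E = 4 * p\<^sup>2 * 3 powr p"
  have D0: "D \<ge> 0" and E0: "E \<ge> 0" using p by (simp_all add: D_def E_def)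
  have Ti: "integrable \<nu>2 T" and TE: "(\<integral>z. T z \<partial>\<nu>2) = c * (\<gamma> * (ws - w))"
    unfolding T_def x_def using increment_integrable[of \<gamma> w ws] by auto
  \<comment> \<open>Unlike in the consistency estimate, a cost proportional to the variance is
    acceptable for cut-off trades, so the exponent 2 suffices.\<close>
  have sq: "integrable \<nu> (\<lambda>x. \<bar>x\<bar> powr 2)" "abs_moment 2 = var"
    using square_integrable by (simp_all add: abs_moment_def var_def)
  note Zf = large_pair_le[OF order_refl sq(1)]
  have Zi: "integrable \<nu>2 Z" using Zf(1) by (simp add: Z_def[abs_def])
  have ZE: "(\<integral>z. Z z \<partial>\<nu>2) \<le> 8 * (2 + var) * var" using Zf(2) by (simp add: Z_def[abs_def] sq)
  note pf = integrable_pair_fst[OF noise_prob noise_prob p(2)]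
  note sf = integrable_pair_fst[OF noise_prob noise_prob square_integrable]
  have Ui: "integrable \<nu>2 U" unfolding U_def using pf(1) sf(1) by simp
  have UE: "(\<integral>z. U z \<partial>\<nu>2) = \<gamma>\<^sup>2 + var + abs_moment p"
    unfolding U_def using pf sf by (simp add: abs_moment_def var_def pair.prob_space)
  have Bi: "integrable \<nu>2 B" unfolding B_def using Zi Ui by simp
  have BE: "(\<integral>z. B z \<partial>\<nu>2) \<le> c * s * (8 * (2 + var) * var) + D * (\<gamma>\<^sup>2 + var + abs_moment p)"
    unfolding B_def using Zi Ui ZE c s by (simp add: UE mult_left_mono)
  have XTB: "\<bar>X z - T z\<bar> \<le> B z" for z
  proof -
    define \<eta> where "\<eta> = \<bar>fst z\<bar>"
    have \<eta>: "\<eta> \<ge> 0" "(fst z)\<^sup>2 = \<eta>\<^sup>2" "\<bar>fst z\<bar> = \<eta>" by (auto simp: \<eta>_def)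
    have xb: "\<bar>x z\<bar> \<le> s * (\<gamma> + \<eta>)"
      using increment_bounds[of \<gamma> w ws "fst z"] \<gamma> w by (simp add: x_def s_def \<eta>_def)
    have xb1: "\<bar>x z\<bar> \<le> s * (1 + \<eta>)"
      by (rule order_trans[OF xb]) (use s \<eta> \<gamma> in \<open>intro mult_mono; simp\<close>)
    have Z0: "0 \<le> c * s * Z z" using large_bounds c s by (auto simp: Z_def)
    have U0: "0 \<le> D * U z" using D0 by (auto simp: U_def)
    have pt: "post_trade \<gamma> w ws (fst z) = w + x z" by (simp add: x_def)
    show ?thesis
    proof (cases "I z = 1")
      case True
      then have "indicator {0..} (post_trade \<gamma> w ws (fst z)) \<noteq> (0::real)" by (auto simp: I_def admissible_def)
      then have w': "0 \<le> w + x z" by (auto simp: pt indicator_def split: if_splits)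
      have "\<bar>(w + x z) powr p - w powr p - c * x z\<bar> \<le> p * (p - 1) * (w + \<bar>x z\<bar>) powr (p - 2) * (x z)\<^sup>2"
        using powr_taylor_le[OF p(1) w(1) w'] by (simp add: c_def)
      also have "\<dots> \<le> p * (p - 1) * (s * (2 + \<eta>)) powr (p - 2) * (s * (\<gamma> + \<eta>))\<^sup>2"
      proof (intro mult_mono mult_left_mono)
        have "w + \<bar>x z\<bar> \<le> s * (2 + \<eta>)" using xb1 s by (simp add: algebra_simps)
        then show "(w + \<bar>x z\<bar>) powr (p - 2) \<le> (s * (2 + \<eta>)) powr (p - 2)" using w p by (intro powr_mono2) auto
        have "\<bar>x z\<bar>\<^sup>2 \<le> (s * (\<gamma> + \<eta>))\<^sup>2" by (intro power_mono xb) auto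
        then show "(x z)\<^sup>2 \<le> (s * (\<gamma> + \<eta>))\<^sup>2" by simp
      qed (use p in auto)
      also have "\<dots> = p * (p - 1) * s powr p * ((2 + \<eta>) powr (p - 2) * (\<gamma> + \<eta>)\<^sup>2)"
        using s \<eta> p by (cases "s = 0") (auto simp: powr_mult powr_diff power_mult_distrib powr_numeral)
      also have "\<dots> \<le> p * (p - 1) * s powr p * (4 * 3 powr p * U z)"
      proof (intro mult_left_mono)
        have g2: "(\<gamma> + \<eta>)\<^sup>2 \<le> 2 * (\<gamma>\<^sup>2 + \<eta>\<^sup>2)"
          using zero_le_power2[of "\<gamma> - \<eta>"] by (simp add: power2_eq_square algebra_simps)
        have g1: "\<gamma>\<^sup>2 \<le> 1" using \<gamma> by (simp add: power_le_one)
        have p3: "3 powr (p - 2) \<le> (3 powr p :: real)" using p by (intro powr_mono) auto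
        \<comment> \<open>For \<eta> at most 1 the first factor is bounded and the squares remain;
          for larger \<eta> the whole product is at most a multiple of
          \<open>\<eta> powr p\<close>.\<close>
        show "(2 + \<eta>) powr (p - 2) * (\<gamma> + \<eta>)\<^sup>2 \<le> 4 * 3 powr p * U z"
        proof (cases "\<eta> \<le> 1")
          case True
          have "(2 + \<eta>) powr (p - 2) \<le> 3 powr (p - 2)" using True \<eta> p by (intro powr_mono2) auto
          then have "(2 + \<eta>) powr (p - 2) \<le> 3 powr p" using p3 by (rule order_trans)
          then have "(2 + \<eta>) powr (p - 2) * (\<gamma> + \<eta>)\<^sup>2 \<le> 3 powr p * (2 * (\<gamma>\<^sup>2 + \<eta>\<^sup>2))"
            by (intro mult_mono g2) auto
          also have "\<dots> = 2 * 3 powr p * (\<gamma>\<^sup>2 + \<eta>\<^sup>2)" by simp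
          also have "\<dots> \<le> 4 * 3 powr p * U z"
            unfolding U_def \<eta> by (intro mult_mono) auto
          finally show ?thesis .
        next
          case False
          have e1: "1 \<le> \<eta>\<^sup>2" using False by (simp add: power2_eq_square) (metis less_eq_real_def mult_le_cancel_left1 mult_mono' not_le zero_less_one_class.zero_le_one order_trans)
          have "(2 + \<eta>) powr (p - 2) \<le> (3 * \<eta>) powr (p - 2)" using False \<eta> p by (intro powr_mono2) auto
          also have "\<dots> = 3 powr (p - 2) * \<eta> powr (p - 2)" using \<eta> by (simp add: powr_mult)
          also have "\<dots> \<le> 3 powr p * \<eta> powr (p - 2)" by (intro mult_right_mono p3) auto
          finally have "(2 + \<eta>) powr (p - 2) * (\<gamma> + \<eta>)\<^sup>2 \<le> (3 powr p * \<eta> powr (p - 2)) * (4 * \<eta>\<^sup>2)"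
            using g2 g1 e1 by (intro mult_mono) auto
          also have "\<dots> = 4 * 3 powr p * \<eta> powr p" using False by (simp add: powr_diff powr_numeral)
          also have "\<dots> \<le> 4 * 3 powr p * U z"
            unfolding U_def \<eta> by (intro mult_left_mono) auto
          finally show ?thesis .
        qed
      qed (use p in auto)
      also have "\<dots> = D * U z" by (simp add: D_def)
      finally show ?thesis using True Z0 by (simp add: X_def T_def B_def pt)
    next
      case False
      then have I0: "I z = 0" using admissible_01[of \<gamma> w ws z] by (simp add: I_def)
      have "1 \<le> large (fst z) + large (snd z)" using not_admissible_le[OF \<gamma> w, of z] I0 by (simp add: I_def)
      then have Z1: "1 * (1 + \<eta> + \<eta>\<^sup>2) \<le> Z z" unfolding Z_def \<eta> using \<eta> by (intro mult_right_mono) auto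
      have "\<bar>T z\<bar> \<le> c * (s * (1 + \<eta>))" unfolding T_def abs_mult using c xb1 by (auto intro: mult_left_mono)
      also have "\<dots> \<le> c * (s * Z z)"
      proof (intro mult_left_mono)
        show "1 + \<eta> \<le> Z z" using Z1 zero_le_power2[of \<eta>] unfolding mult_1_left by linarith
      qed (use c s in auto)
      finally show ?thesis using I0 U0 by (simp add: X_def B_def mult.assoc)
    qed
  qed
  have Xm: "X \<in> borel_measurable \<nu>2" unfolding X_def I_def by (intro measurable_jump) measurable
  have "\<bar>(\<integral>z. X z \<partial>\<nu>2) - (\<integral>z. T z \<partial>\<nu>2)\<bar> \<le> (\<integral>z. B z \<partial>\<nu>2)"
    by (rule integral_near[OF Ti Bi Xm]) (use XTB in auto)
  moreover have "(\<integral>z. X z \<partial>\<nu>2) = mean_jump \<gamma> \<nu> (\<lambda>w. w powr p) w ws" by (simp add: X_def I_def mean_jump_def)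
  moreover have "c * (\<gamma> * (ws - w)) \<le> p * s powr p * \<gamma>"
  proof -
    have "c * (\<gamma> * (ws - w)) \<le> c * (\<gamma> * s)" using c \<gamma> s w by (intro mult_left_mono) auto
    also have "\<dots> = (c * s) * \<gamma>" by simp
    also have "\<dots> \<le> p * s powr p * \<gamma>" using c \<gamma> by (intro mult_right_mono) auto
    finally show ?thesis .
  qed
  moreover have "c * s * (8 * (2 + var) * var) \<le> p * s powr p * (8 * (2 + var) * var)"
    using c var_nonneg by (intro mult_right_mono) auto
  ultimately have "mean_jump \<gamma> \<nu> (\<lambda>w. w powr p) w ws \<le>
      p * s powr p * \<gamma> + p * s powr p * (8 * (2 + var) * var) + D * (\<gamma>\<^sup>2 + var + abs_moment p)"
    using BE TE by linarith
  also have "\<dots> = s powr p * (p * \<gamma> + p * (8 * (2 + var) * var) + p * (p - 1) * (4 * 3 powr p) * (\<gamma>\<^sup>2 + var + abs_moment p))"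
    by (simp add: D_def algebra_simps)
  also have "\<dots> \<le> s powr p * (E * \<gamma> + E * (8 * (2 + var) * var) + E * (\<gamma> + (2 + var) * var + abs_moment p))"
  proof (intro mult_left_mono[of _ _ "s powr p"] add_mono)
    have 3: "1 \<le> (3 powr p :: real)" using p by (intro ge_one_powr_ge_zero) auto
    have "p * 1 \<le> p\<^sup>2 * (4 * 3 powr p)" using p 3 by (intro mult_mono) (auto simp: power2_eq_square)
    then have pE: "p \<le> E" by (simp add: E_def mult_ac)
    have "p * (p - 1) * (4 * 3 powr p) \<le> p\<^sup>2 * (4 * 3 powr p)"
      using p by (intro mult_right_mono) (auto simp: power2_eq_square)
    then have QE: "p * (p - 1) * (4 * 3 powr p) \<le> E" by (simp add: E_def mult_ac)
    show "p * \<gamma> \<le> E * \<gamma>" using pE \<gamma> by (intro mult_right_mono)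
    show "p * (8 * (2 + var) * var) \<le> E * (8 * (2 + var) * var)" using pE var_nonneg by (intro mult_right_mono) auto
    have "\<gamma>\<^sup>2 \<le> \<gamma>" using \<gamma> by (simp add: power2_eq_square mult_left_le)
    moreover have "var \<le> (2 + var) * var" using var_nonneg by (simp add: algebra_simps)
    ultimately have "\<gamma>\<^sup>2 + var + abs_moment p \<le> \<gamma> + (2 + var) * var + abs_moment p" by linarith
    then show "p * (p - 1) * (4 * 3 powr p) * (\<gamma>\<^sup>2 + var + abs_moment p) \<le> E * (\<gamma> + (2 + var) * var + abs_moment p)"
      using E0 var_nonneg abs_moment_nonneg by (intro mult_mono[OF QE]) auto
  qed auto
  also have "\<dots> = 4 * p\<^sup>2 * 3 powr p * (2 * \<gamma> + 9 * (2 + var) * var + abs_moment p) * s powr p"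
    by (simp add: E_def algebra_simps)
  also have "\<dots> \<le> 4 * p\<^sup>2 * 3 powr p * (2 * \<gamma> + 9 * (2 + var) * var + abs_moment p) * (2 powr p * (w powr p + ws powr p))"
    unfolding s_def using var_nonneg abs_moment_nonneg \<gamma> p w by (intro mult_left_mono powr_add_le) auto
  also have "\<dots> = 4 * p\<^sup>2 * (3 powr p * 2 powr p) * (2 * \<gamma> + 9 * (2 + var) * var + abs_moment p) * (w powr p + ws powr p)"
    by (simp add: mult_ac)
  \<comment> \<open>Source of \<open>6 powr p\<close>: one factor comes from the increment, the
    other from splitting \<open>(w + ws) powr p\<close>.\<close>
  also have "3 powr p * 2 powr p = (6 powr p :: real)" by (simp flip: powr_mult)
  finally show ?thesis .
qed

end

section \<open>The collision operator\<close>

definition growth :: "real \<Rightarrow> (real \<Rightarrow> real) \<Rightarrow> bool" where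
  "growth p \<phi> \<longleftrightarrow> (\<exists>C. \<forall>w\<ge>0. \<bar>\<phi> w\<bar> \<le> C * (1 + w powr p))"

lemma growthI: "(\<And>w. w \<ge> 0 \<Longrightarrow> \<bar>\<phi> w\<bar> \<le> C * (1 + w powr p)) \<Longrightarrow> growth p \<phi>"
  by (auto simp: growth_def)

lemma growthE:
  assumes "growth p \<phi>" obtains C where "C \<ge> 0" "\<And>w. w \<ge> 0 \<Longrightarrow> \<bar>\<phi> w\<bar> \<le> C * (1 + w powr p)"
proof -
  from assms obtain C where C: "\<And>w. w \<ge> 0 \<Longrightarrow> \<bar>\<phi> w\<bar> \<le> C * (1 + w powr p)" by (auto simp: growth_def)
  have "\<bar>\<phi> w\<bar> \<le> \<bar>C\<bar> * (1 + w powr p)" if "w \<ge> 0" for w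
    by (rule order_trans[OF C[OF that]]) (intro mult_right_mono, auto)
  then show ?thesis using that[of "\<bar>C\<bar>"] by auto
qed

lemma powr_le_1_powr: "w powr r \<le> 1 + w powr s" if "0 \<le> r" "r \<le> s" "0 \<le> w" for w r s :: real
proof (cases "w \<le> 1")
  case True
  then have "w powr r \<le> 1" using that by (intro powr_le1) auto
  then show ?thesis by (simp add: add_increasing2)
next
  case False
  then have "w powr r \<le> w powr s" using that by (intro powr_mono) auto
  then show ?thesis by simp
qed

lemma growth_mono: assumes "growth r \<phi>" "0 \<le> r" "r \<le> s" shows "growth s \<phi>"
proof -
  from assms(1) obtain C where C: "C \<ge> 0" "\<And>w. w \<ge> 0 \<Longrightarrow> \<bar>\<phi> w\<bar> \<le> C * (1 + w powr r)" by (rule growthE) blast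
  have "\<bar>\<phi> w\<bar> \<le> (2 * C) * (1 + w powr s)" if "w \<ge> 0" for w
  proof -
    have "1 + w powr r \<le> 2 * (1 + w powr s)" using powr_le_1_powr[OF assms(2,3) that] powr_ge_zero[of w s] unfolding distrib_left by linarith
    then have "C * (1 + w powr r) \<le> C * (2 * (1 + w powr s))" using C(1) by (intro mult_left_mono)
    with C(2)[OF that] show ?thesis by (simp add: algebra_simps)
  qed
  then show ?thesis by (rule growthI)
qed

lemma C2_smooth_imp_growth: assumes "C2_smooth \<phi> \<phi>1 \<phi>2" "2 \<le> p" shows "growth p \<phi>"
proof (rule growth_mono)
  obtain C where C: "C \<ge> 0" "\<And>x. \<bar>\<phi> x\<bar> \<le> C * (1 + x\<^sup>2)" using C2_smooth_growth[OF assms(1)] by blast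
  then show "growth 2 \<phi>" by (intro growthI[of _ C]) (simp add: powr_numeral)
qed (use assms in auto)

lemma growth_powr: "0 \<le> r \<Longrightarrow> r \<le> p \<Longrightarrow> growth p (\<lambda>w. w powr r)"
  by (rule growthI[of _ 1]) (use powr_le_1_powr in auto)

definition wealth :: "real \<Rightarrow> real measure \<Rightarrow> bool" where
  "wealth p F \<longleftrightarrow> F \<in> moment_measures p"

lemma wealthD:
  assumes "wealth p F"
  shows "real_distribution F" "prob_space F" "sets F = sets borel" "space F = UNIV" "AE w in F. 0 \<le> w"
    "integrable F (\<lambda>w. \<bar>w\<bar> powr p)"
proof -
  show r: "real_distribution F" and i: "integrable F (\<lambda>w. \<bar>w\<bar> powr p)" using assms by (auto simp: wealth_def moment_measures_def)
  then interpret real_distribution F by simp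
  show "prob_space F" by (rule prob_space_axioms)
  show s: "sets F = sets borel" "space F = UNIV" by auto
  have "emeasure F {..<0} = 0" using assms by (auto simp: wealth_def moment_measures_def)
  then show "AE w in F. 0 \<le> w" by (intro AE_I[of _ _ "{..<0}"]) (auto simp: s not_le)
qed

lemma wealth_integrable:
  assumes "wealth p F" "\<phi> \<in> borel_measurable borel" "growth p \<phi>"
  shows "integrable F \<phi>"
proof -
  note F = wealthD[OF assms(1)]
  interpret real_distribution F by (rule F)
  obtain C where C: "C \<ge> 0" "\<And>w. w \<ge> 0 \<Longrightarrow> \<bar>\<phi> w\<bar> \<le> C * (1 + w powr p)" using growthE[OF assms(3)] by blast
  have i: "integrable F (\<lambda>w. C * (1 + \<bar>w\<bar> powr p))" using F(6) by simp
  show ?thesis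
  proof (rule Bochner_Integration.integrable_bound[OF i])
    show "AE w in F. norm (\<phi> w) \<le> norm (C * (1 + \<bar>w\<bar> powr p))"
      using F(5) by eventually_elim (use C in \<open>auto simp: abs_mult intro: order_trans\<close>)
  qed (use assms(2) in simp)
qed

lemma wealth_moment_eq: assumes "wealth p F" shows "(\<integral>w. \<bar>w\<bar> powr r \<partial>F) = (\<integral>w. w powr r \<partial>F)"
proof -
  interpret real_distribution F by (rule wealthD[OF assms])
  show ?thesis using wealthD(5)[OF assms] by (intro integral_cong_AE) auto
qed

lemma AE_pair_wealth:
  assumes "wealth p F" "wealth p G"
  shows "AE z in F \<Otimes>\<^sub>M G. 0 \<le> fst z \<and> 0 \<le> snd z"
proof -
  interpret F: real_distribution F by (rule wealthD[OF assms(1)])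
  interpret G: real_distribution G by (rule wealthD[OF assms(2)])
  interpret pair_sigma_finite F G ..
  show ?thesis
  proof (rule AE_pair_measure)
    have [measurable_cong]: "sets (F \<Otimes>\<^sub>M G) = sets (borel \<Otimes>\<^sub>M borel)" by (intro sets_pair_measure_cong) auto
    show "{z \<in> space (F \<Otimes>\<^sub>M G). 0 \<le> fst z \<and> 0 \<le> snd z} \<in> sets (F \<Otimes>\<^sub>M G)" by measurable
  qed (use wealthD(5)[OF assms(1)] wealthD(5)[OF assms(2)] in auto)
qed

section \<open>Integrability of jumps and exchange of integrations\<close>

definition jump :: "real \<Rightarrow> (real \<Rightarrow> real) \<Rightarrow> real \<times> real \<Rightarrow> real \<times> real \<Rightarrow> real" where
  "jump \<gamma> \<phi> z y = admissible \<gamma> (fst y) (snd y) z * (\<phi> (post_trade \<gamma> (fst y) (snd y) (fst z)) - \<phi> (fst y))"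

lemma measurable_jump_pair[measurable]:
  assumes [measurable]: "\<phi> \<in> borel_measurable borel"
  shows "(\<lambda>x. jump \<gamma> \<phi> (fst x) (snd x)) \<in> borel_measurable ((borel \<Otimes>\<^sub>M borel) \<Otimes>\<^sub>M (borel \<Otimes>\<^sub>M borel))"
  unfolding jump_def admissible_def post_trade_def by measurable

definition coll :: "real \<Rightarrow> real measure \<Rightarrow> real measure \<Rightarrow> (real \<Rightarrow> real) \<Rightarrow> real" where
  "coll \<gamma> \<nu> F \<phi> = (\<integral>y. mean_jump \<gamma> \<nu> \<phi> (fst y) (snd y) \<partial>(F \<Otimes>\<^sub>M F))"

lemma mean_jump_eq: "mean_jump \<gamma> \<nu> \<phi> (fst y) (snd y) = (\<integral>z. jump \<gamma> \<phi> z y \<partial>(\<nu> \<Otimes>\<^sub>M \<nu>))"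
  by (simp add: mean_jump_def jump_def)

text \<open>Domination by a product. The numbers 1, \<open>w\<close> and the post-trade wealth are
  all at most \<open>(1 + w + ws) * (2 + \<bar>\<eta>\<bar>)\<close>; the power of order
  \<open>p\<close> of this factorises into a noise part and a wealth part, each integrable.\<close>

lemma (in noise) jump_integrable:
  assumes F: "wealth p F" and \<phi>[measurable]: "\<phi> \<in> borel_measurable borel" and g: "growth p \<phi>" and p: "0 \<le> p"
    and i: "integrable \<nu> (\<lambda>x. \<bar>x\<bar> powr p)" and \<gamma>: "0 \<le> \<gamma>" "\<gamma> \<le> 1"
  shows "integrable (\<nu>2 \<Otimes>\<^sub>M (F \<Otimes>\<^sub>M F)) (\<lambda>x. jump \<gamma> \<phi> (fst x) (snd x))"
proof -
  interpret F: real_distribution F by (rule wealthD[OF F])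
  interpret FF: pair_prob_space F F ..
  interpret P: pair_prob_space \<nu>2 "F \<Otimes>\<^sub>M F" ..
  have [measurable_cong]: "sets (F \<Otimes>\<^sub>M F) = sets (borel \<Otimes>\<^sub>M borel)" by (intro sets_pair_measure_cong) auto
  obtain C where C: "C \<ge> 0" "\<And>w. w \<ge> 0 \<Longrightarrow> \<bar>\<phi> w\<bar> \<le> C * (1 + w powr p)" using growthE[OF g] by blast
  define a where "a z = (2 + \<bar>fst z\<bar>) powr p" for z :: "real \<times> real"
  define b where "b y = 4 * C * (1 + \<bar>fst y\<bar> + \<bar>snd y\<bar>) powr p" for y :: "real \<times> real"
  have pw: "(1 + u + v) powr p \<le> 2 powr p * (1 + 2 powr p * (u powr p + v powr p))" if "u \<ge> 0" "v \<ge> 0" for u v :: real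
  proof -
    have "(1 + (u + v)) powr p \<le> 2 powr p * (1 powr p + (u + v) powr p)" using that p by (intro powr_add_le) auto
    also have "\<dots> \<le> 2 powr p * (1 + 2 powr p * (u powr p + v powr p))"
      using powr_add_le[OF that p] by (intro mult_left_mono) auto
    finally show ?thesis by (simp add: add.assoc)
  qed
  have ai: "integrable \<nu>2 a"
  proof -
    have "integrable \<nu> (\<lambda>x. 2 powr p * (2 powr p + \<bar>x\<bar> powr p))" using i by simp
    then have 1: "integrable \<nu> (\<lambda>x. (2 + \<bar>x\<bar>) powr p)"
      by (rule Bochner_Integration.integrable_bound) (use powr_add_le[of 2 _ p] p in auto)
    show ?thesis unfolding a_def by (rule integrable_pair_fst[OF noise_prob noise_prob 1])
  qed
  have bi: "integrable (F \<Otimes>\<^sub>M F) b"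
  proof -
    note m = wealthD(6)[OF F]
    note pf = integrable_pair_fst(1)[OF wealthD(2)[OF F] wealthD(2)[OF F] m]
    note ps = integrable_pair_snd(1)[OF wealthD(2)[OF F] wealthD(2)[OF F] m]
    have "integrable (F \<Otimes>\<^sub>M F) (\<lambda>y. 4 * C * (2 powr p * (1 + 2 powr p * (\<bar>fst y\<bar> powr p + \<bar>snd y\<bar> powr p))))"
      using pf ps by simp
    then show ?thesis
      by (rule Bochner_Integration.integrable_bound)
         (use C pw in \<open>auto simp: b_def[abs_def] intro!: mult_left_mono\<close>)
  qed
  have ab: "integrable (\<nu>2 \<Otimes>\<^sub>M (F \<Otimes>\<^sub>M F)) (\<lambda>x. a (fst x) * b (snd x))"
    by (rule integrable_pair_mult[OF pair.prob_space_axioms FF.prob_space_axioms ai bi])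
  have nn: "AE x in \<nu>2 \<Otimes>\<^sub>M (F \<Otimes>\<^sub>M F). 0 \<le> fst (snd x) \<and> 0 \<le> snd (snd x)"
  proof (rule P.AE_pair_measure)
    show "{x \<in> space (\<nu>2 \<Otimes>\<^sub>M (F \<Otimes>\<^sub>M F)). 0 \<le> fst (snd x) \<and> 0 \<le> snd (snd x)} \<in> sets (\<nu>2 \<Otimes>\<^sub>M (F \<Otimes>\<^sub>M F))"
      by measurable
  qed (use AE_pair_wealth[OF F F] in auto)
  show ?thesis
  proof (rule Bochner_Integration.integrable_bound[OF ab])
    show "AE x in \<nu>2 \<Otimes>\<^sub>M (F \<Otimes>\<^sub>M F). norm (jump \<gamma> \<phi> (fst x) (snd x)) \<le> norm (a (fst x) * b (snd x))"
      using nn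
    proof eventually_elim
      case (elim x)
      obtain z w ws where x: "x = (z, (w, ws))" by (metis surj_pair)
      with elim have w: "0 \<le> w" "0 \<le> ws" by auto
      define R where "R = (1 + w + ws) powr p * (2 + \<bar>fst z\<bar>) powr p"
      have R: "u powr p \<le> R" if "0 \<le> u" "u \<le> (1 + w + ws) * (2 + \<bar>fst z\<bar>)" for u
      proof -
        have "u powr p \<le> ((1 + w + ws) * (2 + \<bar>fst z\<bar>)) powr p" using that p by (intro powr_mono2) auto
        then show ?thesis using w by (simp add: R_def powr_mult)
      qed
      have one: "1 \<le> (1 + w + ws) * (2 + \<bar>fst z\<bar>)"
      proof -
        have "1 * 1 \<le> (1 + w + ws) * (2 + \<bar>fst z\<bar>)" using w by (intro mult_mono) auto
        then show ?thesis by simp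
      qed
      have R1: "1 \<le> R" using R[of 1] one by simp
      have R2: "w powr p \<le> R"
      proof (rule R[OF w(1)])
        have "w * 1 \<le> (1 + w + ws) * (2 + \<bar>fst z\<bar>)" using w by (intro mult_mono) auto
        then show "w \<le> (1 + w + ws) * (2 + \<bar>fst z\<bar>)" by simp
      qed
      have "\<bar>jump \<gamma> \<phi> z (w, ws)\<bar> \<le> 4 * C * R"
      proof (cases "admissible \<gamma> w ws z = 0")
        case True
        then show ?thesis using C R1 by (simp add: jump_def)
      next
        case False
        then have "indicator {0..} (post_trade \<gamma> w ws (fst z)) \<noteq> (0::real)" by (auto simp: admissible_def)
        then have w': "0 \<le> post_trade \<gamma> w ws (fst z)" by (auto simp: indicator_def split: if_splits)
        have "post_trade \<gamma> w ws (fst z) \<le> w + (w + ws) * (\<gamma> + \<bar>fst z\<bar>)"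
          using increment_bounds[OF \<gamma> w, of "fst z"] by linarith
        also have "\<dots> \<le> (1 + w + ws) + (1 + w + ws) * (1 + \<bar>fst z\<bar>)"
          using w \<gamma> by (intro add_mono mult_mono) auto
        also have "\<dots> = (1 + w + ws) * (2 + \<bar>fst z\<bar>)" by (simp add: algebra_simps)
        finally have R3: "post_trade \<gamma> w ws (fst z) powr p \<le> R" using w' by (intro R)
        have "\<bar>jump \<gamma> \<phi> z (w, ws)\<bar> \<le> 1 * \<bar>\<phi> (post_trade \<gamma> w ws (fst z)) - \<phi> w\<bar>"
          unfolding jump_def abs_mult fst_conv snd_conv by (intro mult_right_mono admissible_bounds) auto
        also have "\<dots> \<le> \<bar>\<phi> (post_trade \<gamma> w ws (fst z))\<bar> + \<bar>\<phi> w\<bar>" by simp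
        also have "\<dots> \<le> C * (1 + post_trade \<gamma> w ws (fst z) powr p) + C * (1 + w powr p)"
          using C w w' by (intro add_mono) auto
        also have "\<dots> \<le> C * (R + R) + C * (R + R)"
          using C R1 R2 R3 by (intro add_mono mult_left_mono) auto
        finally show ?thesis by simp
      qed
      moreover have "0 \<le> R" using R1 by simp
      ultimately show ?case using w C by (simp add: x a_def b_def R_def mult_ac)
    qed
  qed measurable
qed

text \<open>The weak formulation integrates over wealths first and noises last, \<open>coll\<close>
  in the opposite order.\<close>

lemma (in noise) coll_fubini:
  assumes F: "wealth p F" and \<phi>[measurable]: "\<phi> \<in> borel_measurable borel" and g: "growth p \<phi>" and p: "0 \<le> p"
    and i: "integrable \<nu> (\<lambda>x. \<bar>x\<bar> powr p)" and \<gamma>: "0 \<le> \<gamma>" "\<gamma> \<le> 1"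
  shows "coll \<gamma> \<nu> F \<phi> = (\<integral>z. (\<integral>y. jump \<gamma> \<phi> z y \<partial>(F \<Otimes>\<^sub>M F)) \<partial>\<nu>2)"
    and "integrable (F \<Otimes>\<^sub>M F) (\<lambda>y. mean_jump \<gamma> \<nu> \<phi> (fst y) (snd y))"
    and "AE y in F \<Otimes>\<^sub>M F. integrable \<nu>2 (\<lambda>z. jump \<gamma> \<phi> z y)"
proof -
  interpret F: real_distribution F by (rule wealthD[OF F])
  interpret FF: pair_prob_space F F ..
  interpret P: pair_sigma_finite \<nu>2 "F \<Otimes>\<^sub>M F" ..
  have j: "integrable (\<nu>2 \<Otimes>\<^sub>M (F \<Otimes>\<^sub>M F)) (case_prod (jump \<gamma> \<phi>))"
    using jump_integrable[OF assms] by (simp add: case_prod_beta')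
  show "coll \<gamma> \<nu> F \<phi> = (\<integral>z. (\<integral>y. jump \<gamma> \<phi> z y \<partial>(F \<Otimes>\<^sub>M F)) \<partial>\<nu>2)"
    unfolding coll_def mean_jump_eq using P.Fubini_integral[OF j] .
  show "integrable (F \<Otimes>\<^sub>M F) (\<lambda>y. mean_jump \<gamma> \<nu> \<phi> (fst y) (snd y))"
    unfolding mean_jump_eq using P.integrable_snd[OF j] .
  show "AE y in F \<Otimes>\<^sub>M F. integrable \<nu>2 (\<lambda>z. jump \<gamma> \<phi> z y)"
    using P.AE_integrable_snd[OF j] .
qed

lemma (in noise) mean_jump_measurable:
  assumes F: "wealth p F" and \<phi>[measurable]: "\<phi> \<in> borel_measurable borel"
  shows "(\<lambda>y. mean_jump \<gamma> \<nu> \<phi> (fst y) (snd y)) \<in> borel_measurable (F \<Otimes>\<^sub>M F)"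
proof -
  interpret F: real_distribution F by (rule wealthD[OF F])
  have [measurable_cong]: "sets (F \<Otimes>\<^sub>M F) = sets (borel \<Otimes>\<^sub>M borel)" by (intro sets_pair_measure_cong) auto
  have "(\<lambda>x. jump \<gamma> \<phi> (snd x) (fst x)) \<in> borel_measurable ((F \<Otimes>\<^sub>M F) \<Otimes>\<^sub>M \<nu>2)"
    unfolding jump_def admissible_def post_trade_def by measurable
  then show ?thesis unfolding mean_jump_eq
    by (intro pair.borel_measurable_lebesgue_integral) (simp add: case_prod_beta')
qed

lemma integral_density_pair:
  fixes a :: "real \<Rightarrow> real" and G :: "real \<times> real \<Rightarrow> real"
  assumes [measurable]: "a \<in> borel_measurable borel" "G \<in> borel_measurable (borel \<Otimes>\<^sub>M borel)" and "\<And>x. 0 \<le> a x"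
    and "prob_space (density lborel (\<lambda>x. ennreal (a x)))"
  shows "(\<integral>z. G z \<partial>(density lborel (\<lambda>x. ennreal (a x)) \<Otimes>\<^sub>M density lborel (\<lambda>x. ennreal (a x)))) =
    (\<integral>z. (a (fst z) * a (snd z)) * G z \<partial>lborel)"
proof -
  let ?D = "density lborel (\<lambda>x. ennreal (a x))"
  interpret D: prob_space ?D by fact
  have "?D \<Otimes>\<^sub>M ?D = density (lborel \<Otimes>\<^sub>M lborel) (\<lambda>(x, y). ennreal (a x) * ennreal (a y))"
    by (rule pair_measure_density) (auto intro: lborel.sigma_finite_measure_axioms D.sigma_finite_measure_axioms)
  also have "\<dots> = density lborel (\<lambda>z. ennreal (a (fst z) * a (snd z)))"
    using assms(3) by (simp add: lborel_prod case_prod_beta' ennreal_mult)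
  finally show ?thesis using assms(3)
    by (simp add: integral_density borel_prod[symmetric])
qed

text \<open>From densities to measures: the kernel is the product of the two noise densities with
  the admissibility factor, so the right-hand side of the weak formulation is an integral against
  product measures. The evolution can then be treated at the level of measures.\<close>

lemma kinetic_integral_eq_coll:
  assumes \<mu>: "prob_density_on UNIV \<mu>" and f: "prob_density_on {0..} f"
    and F: "wealth p (density_measure f)" and n: "noise (density lborel (\<lambda>x. ennreal (\<mu> x)))"
    and i: "integrable (density lborel (\<lambda>x. ennreal (\<mu> x))) (\<lambda>x. \<bar>x\<bar> powr p)"
    and \<phi>[measurable]: "\<phi> \<in> borel_measurable borel" and g: "growth p \<phi>" and p: "0 \<le> p" and \<gamma>: "0 \<le> \<gamma>" "\<gamma> \<le> 1"
  shows "(LINT (\<eta>, \<eta>s)|lborel. set_lebesgue_integral lborel ({0..} \<times> {0..}) (\<lambda>(w, ws).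
              trade_kernel \<gamma> \<mu> w ws \<eta> \<eta>s * f w * f ws * (\<phi> (post_trade \<gamma> w ws \<eta>) - \<phi> w))) =
    coll \<gamma> (density lborel (\<lambda>x. ennreal (\<mu> x))) (density_measure f) \<phi>"
proof -
  let ?\<nu> = "density lborel (\<lambda>x. ennreal (\<mu> x))"
  define a where "a w = indicator {0..} w * f w" for w
  interpret noise ?\<nu> by fact
  have [measurable]: "\<mu> \<in> borel_measurable borel" "a \<in> borel_measurable borel"
    using \<mu> f by (auto simp: prob_density_on_def set_borel_measurable_def a_def[abs_def])
  have pos: "0 \<le> \<mu> x" "0 \<le> a x" for x using \<mu> f by (auto simp: prob_density_on_def a_def indicator_def)
  have Fa: "density_measure f = density lborel (\<lambda>x. ennreal (a x))" by (simp add: density_measure_def a_def)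
  have Fp: "prob_space (density lborel (\<lambda>x. ennreal (a x)))" using wealthD(2)[OF F] by (simp add: Fa)
  have jm[measurable]: "(\<lambda>y. jump \<gamma> \<phi> z y) \<in> borel_measurable (borel \<Otimes>\<^sub>M borel)" for z
    unfolding jump_def admissible_def post_trade_def by measurable
  have in_eq: "set_lebesgue_integral lborel ({0..} \<times> {0..}) (\<lambda>(w, ws).
              trade_kernel \<gamma> \<mu> w ws \<eta> \<eta>s * f w * f ws * (\<phi> (post_trade \<gamma> w ws \<eta>) - \<phi> w)) =
      (\<mu> \<eta> * \<mu> \<eta>s) * (\<integral>y. jump \<gamma> \<phi> (\<eta>, \<eta>s) y \<partial>(density_measure f \<Otimes>\<^sub>M density_measure f))" for \<eta> \<eta>s
  proof -
    have "set_lebesgue_integral lborel ({0..} \<times> {0..}) (\<lambda>(w, ws).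
              trade_kernel \<gamma> \<mu> w ws \<eta> \<eta>s * f w * f ws * (\<phi> (post_trade \<gamma> w ws \<eta>) - \<phi> w)) =
      (\<integral>y. (\<mu> \<eta> * \<mu> \<eta>s) * ((a (fst y) * a (snd y)) * jump \<gamma> \<phi> (\<eta>, \<eta>s) y) \<partial>lborel)"
      unfolding set_lebesgue_integral_def
      by (intro Bochner_Integration.integral_cong)
         (auto simp: a_def jump_def admissible_def trade_kernel_def indicator_def)
    also have "\<dots> = (\<mu> \<eta> * \<mu> \<eta>s) * (\<integral>y. ((a (fst y) * a (snd y)) * jump \<gamma> \<phi> (\<eta>, \<eta>s) y) \<partial>lborel)" by simp
    also have "(\<integral>y. ((a (fst y) * a (snd y)) * jump \<gamma> \<phi> (\<eta>, \<eta>s) y) \<partial>lborel) =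
        (\<integral>y. jump \<gamma> \<phi> (\<eta>, \<eta>s) y \<partial>(density_measure f \<Otimes>\<^sub>M density_measure f))"
      unfolding Fa using pos Fp by (intro integral_density_pair[symmetric]) auto
    finally show ?thesis .
  qed
  interpret F: real_distribution "density_measure f" by (rule wealthD[OF F])
  interpret FF: pair_prob_space "density_measure f" "density_measure f" ..
  have [measurable_cong]: "sets (density_measure f \<Otimes>\<^sub>M density_measure f) = sets (borel \<Otimes>\<^sub>M borel)"
    by (intro sets_pair_measure_cong) auto
  have Hm: "(\<lambda>z. \<integral>y. jump \<gamma> \<phi> z y \<partial>(density_measure f \<Otimes>\<^sub>M density_measure f)) \<in> borel_measurable (borel \<Otimes>\<^sub>M borel)"
  proof -
    have "(\<lambda>x. jump \<gamma> \<phi> (fst x) (snd x)) \<in> borel_measurable ((borel \<Otimes>\<^sub>M borel) \<Otimes>\<^sub>M (density_measure f \<Otimes>\<^sub>M density_measure f))"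
      by measurable
    then show ?thesis by (intro FF.borel_measurable_lebesgue_integral) (simp add: case_prod_beta')
  qed
  show ?thesis
    unfolding coll_fubini(1)[OF F \<phi> g p i \<gamma>] in_eq
    by (subst integral_density_pair[OF _ Hm]) (use pos noise_prob in \<open>auto simp: case_prod_beta'\<close>)
qed

section \<open>Bounds for the collision operator\<close>

context noise begin

lemma coll_prod:
  assumes F: "wealth p F" and \<phi>: "\<phi> \<in> borel_measurable borel" and g: "growth p \<phi>" and p: "0 \<le> p"
    and i: "integrable \<nu> (\<lambda>x. \<bar>x\<bar> powr p)" and \<gamma>: "0 \<le> \<gamma>" "\<gamma> \<le> 1"
  shows "coll \<gamma> \<nu> F \<phi> = (\<integral>x. jump \<gamma> \<phi> (fst x) (snd x) \<partial>(\<nu>2 \<Otimes>\<^sub>M (F \<Otimes>\<^sub>M F)))"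
proof -
  interpret F: real_distribution F by (rule wealthD[OF F])
  interpret FF: pair_prob_space F F ..
  interpret P: pair_sigma_finite \<nu>2 "F \<Otimes>\<^sub>M F" ..
  show ?thesis using coll_fubini(1)[OF assms] P.integral_fst'[OF jump_integrable[OF assms]] by simp
qed

lemma coll_linear:
  assumes F: "wealth p F" and \<phi>: "\<phi> \<in> borel_measurable borel" "growth p \<phi>" and \<psi>: "\<psi> \<in> borel_measurable borel" "growth p \<psi>"
    and p: "0 \<le> p" and i: "integrable \<nu> (\<lambda>x. \<bar>x\<bar> powr p)" and \<gamma>: "0 \<le> \<gamma>" "\<gamma> \<le> 1"
  shows "coll \<gamma> \<nu> F (\<lambda>w. a * \<phi> w + b * \<psi> w) = a * coll \<gamma> \<nu> F \<phi> + b * coll \<gamma> \<nu> F \<psi>"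
proof -
  note A = jump_integrable[OF F \<phi> p i \<gamma>] and B = jump_integrable[OF F \<psi> p i \<gamma>]
  obtain C D where C: "\<And>w. w \<ge> 0 \<Longrightarrow> \<bar>\<phi> w\<bar> \<le> C * (1 + w powr p)" and D: "\<And>w. w \<ge> 0 \<Longrightarrow> \<bar>\<psi> w\<bar> \<le> D * (1 + w powr p)"
    using \<phi>(2) \<psi>(2) by (auto simp: growth_def)
  have g: "growth p (\<lambda>w. a * \<phi> w + b * \<psi> w)"
  proof (rule growthI)
    fix w :: real assume w: "w \<ge> 0"
    have "\<bar>a * \<phi> w + b * \<psi> w\<bar> \<le> \<bar>a\<bar> * \<bar>\<phi> w\<bar> + \<bar>b\<bar> * \<bar>\<psi> w\<bar>" by (metis abs_mult abs_triangle_ineq)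
    also have "\<dots> \<le> \<bar>a\<bar> * (C * (1 + w powr p)) + \<bar>b\<bar> * (D * (1 + w powr p))"
      using C[OF w] D[OF w] by (intro add_mono mult_left_mono) auto
    also have "\<dots> = (\<bar>a\<bar> * C + \<bar>b\<bar> * D) * (1 + w powr p)" by (simp add: algebra_simps)
    finally show "\<bar>a * \<phi> w + b * \<psi> w\<bar> \<le> (\<bar>a\<bar> * C + \<bar>b\<bar> * D) * (1 + w powr p)" .
  qed
  have m: "(\<lambda>w. a * \<phi> w + b * \<psi> w) \<in> borel_measurable borel" using \<phi> \<psi> by measurable
  have "coll \<gamma> \<nu> F (\<lambda>w. a * \<phi> w + b * \<psi> w) = (\<integral>x. a * jump \<gamma> \<phi> (fst x) (snd x) + b * jump \<gamma> \<psi> (fst x) (snd x) \<partial>(\<nu>2 \<Otimes>\<^sub>M (F \<Otimes>\<^sub>M F)))"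
    unfolding coll_prod[OF F m g p i \<gamma>] by (intro Bochner_Integration.integral_cong) (auto simp: jump_def algebra_simps)
  also have "\<dots> = a * coll \<gamma> \<nu> F \<phi> + b * coll \<gamma> \<nu> F \<psi>"
    unfolding coll_prod[OF F \<phi> p i \<gamma>] coll_prod[OF F \<psi> p i \<gamma>] using A B by simp
  finally show ?thesis .
qed

text \<open>Crude, with no gain as \<gamma> becomes small; enough for bounded corrections carrying a
  vanishing prefactor.\<close>

lemma coll_bounded:
  assumes F: "wealth p F" and \<phi>: "\<phi> \<in> borel_measurable borel" "\<And>w. \<bar>\<phi> w\<bar> \<le> B"
    and p: "0 \<le> p" and i: "integrable \<nu> (\<lambda>x. \<bar>x\<bar> powr p)" and \<gamma>: "0 \<le> \<gamma>" "\<gamma> \<le> 1"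
  shows "\<bar>coll \<gamma> \<nu> F \<phi>\<bar> \<le> 2 * B"
proof -
  interpret F: real_distribution F by (rule wealthD[OF F])
  interpret FF: pair_prob_space F F ..
  interpret P: pair_prob_space \<nu>2 "F \<Otimes>\<^sub>M F" ..
  have B: "B \<ge> 0" using \<phi>(2)[of 0] by linarith
  have g: "growth p \<phi>"
  proof (rule growthI)
    fix w :: real
    have "B * 1 \<le> B * (1 + w powr p)" using B by (intro mult_left_mono) auto
    then show "\<bar>\<phi> w\<bar> \<le> B * (1 + w powr p)" using \<phi>(2)[of w] by linarith
  qed
  have j: "\<bar>jump \<gamma> \<phi> z y\<bar> \<le> 2 * B" for z y
  proof -
    have "\<bar>jump \<gamma> \<phi> z y\<bar> \<le> 1 * \<bar>\<phi> (post_trade \<gamma> (fst y) (snd y) (fst z)) - \<phi> (fst y)\<bar>"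
      unfolding jump_def abs_mult by (intro mult_right_mono admissible_bounds) auto
    also have "\<dots> \<le> 2 * B" using \<phi>(2)[of "post_trade \<gamma> (fst y) (snd y) (fst z)"] \<phi>(2)[of "fst y"] by (simp add: abs_le_iff)
    finally show ?thesis .
  qed
  note ji = jump_integrable[OF F \<phi>(1) g p i \<gamma>]
  have "\<bar>coll \<gamma> \<nu> F \<phi>\<bar> \<le> (\<integral>x. \<bar>jump \<gamma> \<phi> (fst x) (snd x)\<bar> \<partial>(\<nu>2 \<Otimes>\<^sub>M (F \<Otimes>\<^sub>M F)))"
    unfolding coll_prod[OF F \<phi>(1) g p i \<gamma>] by (rule integral_abs_bound)
  also have "\<dots> \<le> (\<integral>x. 2 * B \<partial>(\<nu>2 \<Otimes>\<^sub>M (F \<Otimes>\<^sub>M F)))" using j ji by (intro integral_mono) auto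
  finally show ?thesis by (simp add: P.prob_space)
qed

lemma pair_moment:
  assumes "wealth p F"
  shows "integrable (F \<Otimes>\<^sub>M F) (\<lambda>y. 3 + \<bar>fst y\<bar> powr p + \<bar>snd y\<bar> powr p)"
    and "(\<integral>y. 3 + \<bar>fst y\<bar> powr p + \<bar>snd y\<bar> powr p \<partial>(F \<Otimes>\<^sub>M F)) = 3 + 2 * (\<integral>w. w powr p \<partial>F)"
proof -
  interpret F: real_distribution F by (rule wealthD[OF assms])
  interpret FF: pair_prob_space F F ..
  note m = wealthD(6)[OF assms]
  note f = integrable_pair_fst[OF F.prob_space_axioms F.prob_space_axioms m]
  note s = integrable_pair_snd[OF F.prob_space_axioms F.prob_space_axioms m]
  show "integrable (F \<Otimes>\<^sub>M F) (\<lambda>y. 3 + \<bar>fst y\<bar> powr p + \<bar>snd y\<bar> powr p)" using f s by simp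
  show "(\<integral>y. 3 + \<bar>fst y\<bar> powr p + \<bar>snd y\<bar> powr p \<partial>(F \<Otimes>\<^sub>M F)) = 3 + 2 * (\<integral>w. w powr p \<partial>F)"
    using f s by (simp add: FF.prob_space wealth_moment_eq[OF assms])
qed

lemma coll_powr_le:
  assumes F: "wealth p F" and p: "2 < p" "integrable \<nu> (\<lambda>x. \<bar>x\<bar> powr p)" and \<gamma>: "0 \<le> \<gamma>" "\<gamma> \<le> 1 / 2"
  shows "coll \<gamma> \<nu> F (\<lambda>w. w powr p)
    \<le> 8 * p\<^sup>2 * 6 powr p * (2 * \<gamma> + 9 * (2 + var) * var + abs_moment p) * (\<integral>w. w powr p \<partial>F)"
proof -
  interpret F: real_distribution F by (rule wealthD[OF F])
  interpret FF: pair_prob_space F F ..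
  define K where "K = 4 * p\<^sup>2 * 6 powr p * (2 * \<gamma> + 9 * (2 + var) * var + abs_moment p)"
  note m = wealthD(6)[OF F]
  note f = integrable_pair_fst[OF F.prob_space_axioms F.prob_space_axioms m]
  note s = integrable_pair_snd[OF F.prob_space_axioms F.prob_space_axioms m]
  have g: "growth p (\<lambda>w. w powr p)" using p by (intro growth_powr) auto
  have "coll \<gamma> \<nu> F (\<lambda>w. w powr p) \<le> (\<integral>y. K * (\<bar>fst y\<bar> powr p + \<bar>snd y\<bar> powr p) \<partial>(F \<Otimes>\<^sub>M F))"
    unfolding coll_def
  proof (rule integral_mono_AE)
    show "integrable (F \<Otimes>\<^sub>M F) (\<lambda>y. mean_jump \<gamma> \<nu> (\<lambda>w. w powr p) (fst y) (snd y))"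
      by (rule coll_fubini[OF F _ g]) (use p \<gamma> in auto)
    show "integrable (F \<Otimes>\<^sub>M F) (\<lambda>y. K * (\<bar>fst y\<bar> powr p + \<bar>snd y\<bar> powr p))" using f s by simp
    show "AE y in F \<Otimes>\<^sub>M F. mean_jump \<gamma> \<nu> (\<lambda>w. w powr p) (fst y) (snd y) \<le> K * (\<bar>fst y\<bar> powr p + \<bar>snd y\<bar> powr p)"
      using AE_pair_wealth[OF F F]
      by eventually_elim (use mean_jump_powr_le[OF p \<gamma>] in \<open>auto simp: K_def\<close>)
  qed
  also have "\<dots> = 2 * K * (\<integral>w. w powr p \<partial>F)"
    using f s by (simp add: wealth_moment_eq[OF F])
  finally show ?thesis by (simp add: K_def)
qed

text \<open>Averaging the two-agent expansion over \<open>F \<Otimes>\<^sub>M F\<close> turns the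
  partner's wealth into the mean of \<open>F\<close>, which is how the mean enters the drift. The
  first bound leads to the limit equation, the second to equicontinuity in time.\<close>

lemma coll_consistent:
  assumes F: "wealth p F" and p: "2 < p" "integrable \<nu> (\<lambda>x. \<bar>x\<bar> powr p)" and q: "2 \<le> q" "q \<le> 3" "q \<le> p"
    and \<gamma>: "0 \<le> \<gamma>" "\<gamma> \<le> 1 / 2" and \<phi>: "C2_smooth \<phi> \<phi>1 \<phi>2"
    and C: "\<And>x. \<bar>\<phi>1 x\<bar> \<le> C * (1 + \<bar>x\<bar>)" "\<And>x. \<bar>\<phi>2 x\<bar> \<le> C" "\<And>x y. \<bar>\<phi>2 x - \<phi>2 y\<bar> \<le> C * \<bar>x - y\<bar>"
  defines "M \<equiv> (\<integral>w. w powr p \<partial>F)" and "E \<equiv> 2560 * (2 + var) * (abs_moment q + \<gamma>\<^sup>2)"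
  shows "\<bar>coll \<gamma> \<nu> F \<phi> - (\<integral>w. \<gamma> * ((\<integral>v. v \<partial>F) - w) * \<phi>1 w + var / 2 * w\<^sup>2 * \<phi>2 w \<partial>F)\<bar> \<le> C * E * (3 + 2 * M)"
    and "\<bar>coll \<gamma> \<nu> F \<phi>\<bar> \<le> C * (3 * \<gamma> + var + E) * (3 + 2 * M)"
    and "integrable F (\<lambda>w. \<gamma> * ((\<integral>v. v \<partial>F) - w) * \<phi>1 w + var / 2 * w\<^sup>2 * \<phi>2 w)"
proof -
  interpret F: real_distribution F by (rule wealthD[OF F])
  interpret FF: pair_prob_space F F ..
  have C0: "C \<ge> 0" using C(2)[of 0] by linarith
  note cont = C2_smooth_continuous[OF \<phi>]
  have [measurable]: "\<phi> \<in> borel_measurable borel" "\<phi>1 \<in> borel_measurable borel" "\<phi>2 \<in> borel_measurable borel"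
    using cont by (auto intro: borel_measurable_continuous_onI)
  have qi: "integrable \<nu> (\<lambda>x. \<bar>x\<bar> powr q)"
  proof (rule Bochner_Integration.integrable_bound)
    show "integrable \<nu> (\<lambda>x. 1 + \<bar>x\<bar> powr p)" using p by simp
  qed (use powr_le_1_powr[of q p] q in auto)
  have g1: "growth p (\<lambda>w. w)" using growth_powr[of 1 p] p unfolding growth_def by simp
  have lin: "u * (1 + u) \<le> 2 * (1 + u powr p)" if "u \<ge> 0" for u :: real
  proof -
    have "u powr 1 \<le> 1 + u powr p" "u powr 2 \<le> 1 + u powr p"
      using powr_le_1_powr[of 1 p u] powr_le_1_powr[of 2 p u] that p by auto
    then have "u \<le> 1 + u powr p" "u\<^sup>2 \<le> 1 + u powr p" using that by (auto simp: powr_numeral)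
    then have "u + u\<^sup>2 \<le> 2 * (1 + u powr p)" by simp
    moreover have "u * (1 + u) = u + u\<^sup>2" by (simp add: power2_eq_square algebra_simps)
    ultimately show ?thesis by simp
  qed
  have i1: "integrable F \<phi>1"
  proof (rule wealth_integrable[OF F])
    show "growth p \<phi>1"
    proof (rule growthI)
      fix w :: real assume w: "w \<ge> 0"
      have "w powr 1 \<le> 1 + w powr p" using w p by (intro powr_le_1_powr) auto
      then have "w \<le> 1 + w powr p" using w by simp
      then have "1 + \<bar>w\<bar> \<le> 2 * (1 + w powr p)"
        using powr_ge_zero[of w p] unfolding abs_of_nonneg[OF w] distrib_left by linarith
      then have "C * (1 + \<bar>w\<bar>) \<le> C * (2 * (1 + w powr p))" using C0 by (rule mult_left_mono)
      with C(1)[of w] have "\<bar>\<phi>1 w\<bar> \<le> C * (2 * (1 + w powr p))" by (rule order_trans)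
      then show "\<bar>\<phi>1 w\<bar> \<le> (2 * C) * (1 + w powr p)" by (simp only: mult_ac)
    qed
  qed simp
  have i2: "integrable F (\<lambda>w. w * \<phi>1 w)"
  proof (rule wealth_integrable[OF F])
    show "growth p (\<lambda>w. w * \<phi>1 w)"
    proof (rule growthI)
      fix w :: real assume w: "w \<ge> 0"
      have "\<bar>w * \<phi>1 w\<bar> \<le> w * (C * (1 + w))" using C(1)[of w] w by (simp add: abs_mult mult_left_mono)
      also have "\<dots> = C * (w * (1 + w))" by simp
      also have "\<dots> \<le> C * (2 * (1 + w powr p))" using C0 lin[OF w] by (intro mult_left_mono)
      finally show "\<bar>w * \<phi>1 w\<bar> \<le> (2 * C) * (1 + w powr p)" by (simp only: mult_ac)
    qed
  qed simp
  have i3: "integrable F (\<lambda>w. w\<^sup>2 * \<phi>2 w)"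
  proof (rule wealth_integrable[OF F])
    show "growth p (\<lambda>w. w\<^sup>2 * \<phi>2 w)"
    proof (rule growthI)
      fix w :: real assume w: "w \<ge> 0"
      have "w powr 2 \<le> 1 + w powr p" using w p by (intro powr_le_1_powr) auto
      then have "w\<^sup>2 * \<bar>\<phi>2 w\<bar> \<le> (1 + w powr p) * C" using w C(2)[of w] by (intro mult_mono) (auto simp: powr_numeral)
      then show "\<bar>w\<^sup>2 * \<phi>2 w\<bar> \<le> C * (1 + w powr p)" by (simp add: abs_mult mult.commute)
    qed
  qed simp
  have iw: "integrable F (\<lambda>w. w)" by (rule wealth_integrable[OF F _ g1]) simp
  define T where "T y = \<gamma> * (snd y - fst y) * \<phi>1 (fst y) + var / 2 * (fst y)\<^sup>2 * \<phi>2 (fst y)" for y :: "real \<times> real"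
  have T: "T = (\<lambda>y. \<gamma> * (\<phi>1 (fst y) * snd y) - \<gamma> * (fst y * \<phi>1 (fst y)) + var / 2 * ((fst y)\<^sup>2 * \<phi>2 (fst y)))"
    by (auto simp: T_def algebra_simps)
  note pr = F.prob_space_axioms
  note p1 = integrable_pair_mult[OF pr pr i1 iw] and p2 = integrable_pair_fst[OF pr pr i2] and p3 = integrable_pair_fst[OF pr pr i3]
  have Ti: "integrable (F \<Otimes>\<^sub>M F) T" unfolding T using p1 p2 p3 by simp
  show Li: "integrable F (\<lambda>w. \<gamma> * ((\<integral>v. v \<partial>F) - w) * \<phi>1 w + var / 2 * w\<^sup>2 * \<phi>2 w)"
  proof -
    have "integrable F (\<lambda>w. \<gamma> * (\<integral>v. v \<partial>F) * \<phi>1 w - \<gamma> * (w * \<phi>1 w) + var / 2 * (w\<^sup>2 * \<phi>2 w))" using i1 i2 i3 by simp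
    then show ?thesis by (simp add: algebra_simps)
  qed
  have TE: "(\<integral>y. T y \<partial>(F \<Otimes>\<^sub>M F)) = (\<integral>w. \<gamma> * ((\<integral>v. v \<partial>F) - w) * \<phi>1 w + var / 2 * w\<^sup>2 * \<phi>2 w \<partial>F)"
  proof -
    have "(\<integral>w. \<gamma> * ((\<integral>v. v \<partial>F) - w) * \<phi>1 w + var / 2 * w\<^sup>2 * \<phi>2 w \<partial>F) =
       (\<integral>w. \<gamma> * (\<integral>v. v \<partial>F) * \<phi>1 w - \<gamma> * (w * \<phi>1 w) + var / 2 * (w\<^sup>2 * \<phi>2 w) \<partial>F)"
      by (intro Bochner_Integration.integral_cong) (auto simp: algebra_simps)
    also have "\<dots> = \<gamma> * (\<integral>v. v \<partial>F) * (\<integral>w. \<phi>1 w \<partial>F) - \<gamma> * (\<integral>w. w * \<phi>1 w \<partial>F) + var / 2 * (\<integral>w. w\<^sup>2 * \<phi>2 w \<partial>F)"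
      using i1 i2 i3 by simp
    also have "\<dots> = (\<integral>y. T y \<partial>(F \<Otimes>\<^sub>M F))" unfolding T using p1 p2 p3 by simp
    finally show ?thesis by simp
  qed
  define B where "B y = C * E * (3 + \<bar>fst y\<bar> powr p + \<bar>snd y\<bar> powr p)" for y :: "real \<times> real"
  note pm = pair_moment[OF F]
  have Bi: "integrable (F \<Otimes>\<^sub>M F) B" unfolding B_def using pm(1) by (intro integrable_mult_right)
  have BE: "(\<integral>y. B y \<partial>(F \<Otimes>\<^sub>M F)) = C * E * (3 + 2 * M)" unfolding B_def using pm by (simp add: M_def)
  have near: "AE y in F \<Otimes>\<^sub>M F. \<bar>mean_jump \<gamma> \<nu> \<phi> (fst y) (snd y) - T y\<bar> \<le> B y"
    using AE_pair_wealth[OF F F]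
  proof eventually_elim
    case (elim y)
    define w where "w = fst y" define v where "v = snd y"
    have w: "0 \<le> w" "0 \<le> v" using elim by (auto simp: w_def v_def)
    \<comment> \<open>Two splittings with \<open>2 powr q \<le> 8\<close> give the factor 64, and 40
      times 64 is 2560.\<close>
    have "(1 + w + v) powr q \<le> 64 * (3 + w powr p + v powr p)"
    proof -
      have q8: "2 powr q \<le> (8::real)" using powr_mono[of q 3 "2::real"] q powr_realpow[of 2 3] by simp
      have "(1 + (w + v)) powr q \<le> 2 powr q * (1 powr q + (w + v) powr q)" using w q by (intro powr_add_le) auto
      also have "\<dots> \<le> 8 * (1 powr q + (w + v) powr q)" using q8 by (intro mult_right_mono) auto
      also have "\<dots> \<le> 8 * (1 + 8 * (w powr q + v powr q))"
      proof -
        have "(w + v) powr q \<le> 2 powr q * (w powr q + v powr q)" using w q by (intro powr_add_le) auto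
        also have "\<dots> \<le> 8 * (w powr q + v powr q)" using q8 by (intro mult_right_mono) auto
        finally show ?thesis by simp
      qed
      also have "\<dots> \<le> 64 * (1 + (w powr q + v powr q))" by simp
      also have "\<dots> \<le> 64 * (3 + w powr p + v powr p)"
        using powr_le_1_powr[of q p w] powr_le_1_powr[of q p v] q w by simp
      finally show ?thesis by (simp add: add.assoc)
    qed
    then have "C * (40 * (2 + var) * (abs_moment q + \<gamma>\<^sup>2)) * (1 + w + v) powr q
        \<le> C * (40 * (2 + var) * (abs_moment q + \<gamma>\<^sup>2)) * (64 * (3 + w powr p + v powr p))"
      using C0 var_nonneg abs_moment_nonneg by (intro mult_left_mono) auto
    also have "\<dots> = C * (40 * 64 * (2 + var) * (abs_moment q + \<gamma>\<^sup>2)) * (3 + w powr p + v powr p)"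
      by (simp only: mult_ac)
    also have "\<dots> = B y" using w by (simp add: B_def E_def w_def v_def)
    finally show ?case
      using mean_jump_consistent[OF \<phi> C q(1,2) qi \<gamma> w] by (simp add: T_def w_def v_def)
  qed
  have n: "\<bar>coll \<gamma> \<nu> F \<phi> - (\<integral>y. T y \<partial>(F \<Otimes>\<^sub>M F))\<bar> \<le> C * E * (3 + 2 * M)"
    unfolding coll_def BE[symmetric] by (rule integral_near[OF Ti Bi mean_jump_measurable[OF F] near]) simp
  then show "\<bar>coll \<gamma> \<nu> F \<phi> - (\<integral>w. \<gamma> * ((\<integral>v. v \<partial>F) - w) * \<phi>1 w + var / 2 * w\<^sup>2 * \<phi>2 w \<partial>F)\<bar> \<le> C * E * (3 + 2 * M)"
    by (simp add: TE)
  have "\<bar>\<integral>y. T y \<partial>(F \<Otimes>\<^sub>M F)\<bar> \<le> (\<integral>y. \<bar>T y\<bar> \<partial>(F \<Otimes>\<^sub>M F))" by (rule integral_abs_bound)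
  also have "\<dots> \<le> (\<integral>y. C * (3 * \<gamma> + var) * (3 + \<bar>fst y\<bar> powr p + \<bar>snd y\<bar> powr p) \<partial>(F \<Otimes>\<^sub>M F))"
  proof (rule integral_mono_AE)
    show "AE y in F \<Otimes>\<^sub>M F. \<bar>T y\<bar> \<le> C * (3 * \<gamma> + var) * (3 + \<bar>fst y\<bar> powr p + \<bar>snd y\<bar> powr p)"
      using AE_pair_wealth[OF F F]
    proof eventually_elim
      case (elim y)
      define w where "w = fst y" define v where "v = snd y"
      have w: "0 \<le> w" "0 \<le> v" using elim by (auto simp: w_def v_def)
      define S where "S = 3 + w powr p + v powr p"
      have sq: "1 + w\<^sup>2 + v\<^sup>2 \<le> S"
        using powr_le_1_powr[of 2 p w] powr_le_1_powr[of 2 p v] p w by (simp add: S_def powr_numeral)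
      have S0: "0 \<le> S" by (simp add: S_def)
      have "(v + w) * (1 + w) \<le> 3 * (1 + w\<^sup>2 + v\<^sup>2)"
      proof -
        have "2 * v \<le> 1 + v\<^sup>2" "2 * w \<le> 1 + w\<^sup>2" "2 * (v * w) \<le> v\<^sup>2 + w\<^sup>2"
          using zero_le_power2[of "v - 1"] zero_le_power2[of "w - 1"] zero_le_power2[of "v - w"]
          by (simp_all add: power2_eq_square algebra_simps)
        moreover have "(v + w) * (1 + w) = v + w + v * w + w\<^sup>2" by (simp add: power2_eq_square algebra_simps)
        moreover have "3 * (1 + w\<^sup>2 + v\<^sup>2) = 3 + 3 * w\<^sup>2 + 3 * v\<^sup>2" by simp
        ultimately have "(v + w) * (1 + w) \<le> 3 + 3 * w\<^sup>2 + 3 * v\<^sup>2" using zero_le_power2[of v] zero_le_power2[of w] by (simp only:)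
        then show ?thesis by simp
      qed
      also have "\<dots> \<le> 3 * S" using sq by simp
      finally have a: "(v + w) * (1 + w) \<le> 3 * S" .
      have "\<bar>\<gamma> * (v - w) * \<phi>1 w\<bar> \<le> \<gamma> * (v + w) * (C * (1 + w))"
        unfolding abs_mult using \<gamma> w C(1)[of w] C0 by (intro mult_mono) auto
      also have "\<dots> = C * \<gamma> * ((v + w) * (1 + w))" by simp
      also have "\<dots> \<le> C * \<gamma> * (3 * S)" using a C0 \<gamma> by (intro mult_left_mono) auto
      finally have t1: "\<bar>\<gamma> * (v - w) * \<phi>1 w\<bar> \<le> C * (3 * \<gamma>) * S" by simp
      have "\<bar>var / 2 * w\<^sup>2 * \<phi>2 w\<bar> \<le> var * S * C"
      proof -
        have "w\<^sup>2 \<le> S" using sq zero_le_power2[of v] by linarith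
        then show ?thesis
          unfolding abs_mult using var_nonneg w C(2)[of w] C0 S0 by (intro mult_mono) auto
      qed
      then have "\<bar>T y\<bar> \<le> C * (3 * \<gamma>) * S + var * S * C" using t1 unfolding T_def w_def[symmetric] v_def[symmetric] by linarith
      also have "\<dots> = C * (3 * \<gamma> + var) * S" by (simp add: algebra_simps)
      finally show ?case using w by (simp add: S_def w_def v_def)
    qed
  qed (use Ti pm in auto)
  also have "\<dots> = C * (3 * \<gamma> + var) * (3 + 2 * M)" using pm by (simp add: M_def)
  finally have "\<bar>coll \<gamma> \<nu> F \<phi>\<bar> \<le> C * (3 * \<gamma> + var) * (3 + 2 * M) + C * E * (3 + 2 * M)" using n by linarith
  also have "\<dots> = C * (3 * \<gamma> + var + E) * (3 + 2 * M)" by (simp add: algebra_simps)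
  finally show "\<bar>coll \<gamma> \<nu> F \<phi>\<bar> \<le> C * (3 * \<gamma> + var + E) * (3 + 2 * M)" .
qed

text \<open>For small noise the post-trade wealth is affine in \<open>w\<close> with slope
  \<open>1 - \<gamma> + \<eta>\<close> at least 1/2, so \<open>conc\<close> applies and the Lebesgue
  integral is divided by the slope. Since the noise is centred, the inverse slope has a majorant of
  mean at most \<open>1 + (5 * \<gamma> + 4 * var)\<close>. Large noises of either agent are paid
  for by the moment of order \<open>q\<close>; the loss term is kept exactly.\<close>

lemma coll_le_concentration:
  assumes F: "wealth p F" and p: "2 < p" "integrable \<nu> (\<lambda>x. \<bar>x\<bar> powr p)" and q: "2 \<le> q" "q \<le> 3" "q \<le> p"
    and \<gamma>: "0 \<le> \<gamma>" "\<gamma> \<le> 1 / 4"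
    and \<phi>[measurable]: "\<phi> \<in> borel_measurable borel" and \<phi>01: "\<And>x. 0 \<le> \<phi> x" "\<And>x. \<phi> x \<le> 1"
    and \<phi>i: "integrable lborel \<phi>" and J: "0 \<le> J" and M: "0 \<le> M"
    and conc: "\<And>a b. 1 / 2 \<le> a \<Longrightarrow> (\<integral>w. \<phi> (a * w + b) \<partial>F) \<le> J + M * (\<integral>x. \<phi> (a * x + b) \<partial>lborel)"
  shows "coll \<gamma> \<nu> F \<phi> \<le> J + M * (1 + (5 * \<gamma> + 4 * var)) * (\<integral>x. \<phi> x \<partial>lborel) - (\<integral>w. \<phi> w \<partial>F) + 192 * abs_moment q"
proof -
  interpret F: real_distribution F by (rule wealthD[OF F])
  interpret FF: pair_prob_space F F ..
  interpret P: pair_prob_space \<nu>2 "F \<Otimes>\<^sub>M F" ..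
  have [measurable_cong]: "sets (F \<Otimes>\<^sub>M F) = sets (borel \<Otimes>\<^sub>M borel)" by (intro sets_pair_measure_cong) auto
  define \<Phi> where "\<Phi> = (\<integral>x. \<phi> x \<partial>lborel)"
  have \<Phi>0: "0 \<le> \<Phi>" unfolding \<Phi>_def using \<phi>01 by simp
  \<comment> \<open>With \<gamma> at most 1/4 the threshold 1/4 keeps the slope at least 1/2; it
    also makes \<open>big\<close> dominate \<open>large\<close>.\<close>
  define big where "big x = (if \<bar>x\<bar> > 1 / 4 then 1 else 0 :: real)" for x :: real
  have [measurable]: "big \<in> borel_measurable borel" unfolding big_def[abs_def] by measurable
  have qi: "integrable \<nu> (\<lambda>x. \<bar>x\<bar> powr q)"
  proof (rule Bochner_Integration.integrable_bound)
    show "integrable \<nu> (\<lambda>x. 1 + \<bar>x\<bar> powr p)" using p by simp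
  qed (use powr_le_1_powr[of q p] q in auto)
  have bigi: "integrable \<nu> big" by (rule integrable_const_bound[of _ 1]) (auto simp: big_def)
  \<comment> \<open>Chebyshev with \<open>4 powr q \<le> 64\<close>; three such terms give the
    constant 192.\<close>
  have bigE: "(\<integral>x. big x \<partial>\<nu>) \<le> 64 * abs_moment q"
  proof -
    have "big x \<le> 64 * \<bar>x\<bar> powr q" for x
    proof (cases "\<bar>x\<bar> > 1 / 4")
      case True
      have "1 \<le> (4 * \<bar>x\<bar>) powr q" using True q by (intro ge_one_powr_ge_zero) auto
      also have "\<dots> = 4 powr q * \<bar>x\<bar> powr q" by (simp add: powr_mult)
      also have "\<dots> \<le> 64 * \<bar>x\<bar> powr q"
        using powr_mono[of q 3 "4::real"] q powr_realpow[of 4 3] by (intro mult_right_mono) auto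
      finally show ?thesis using True by (simp add: big_def)
    qed (simp add: big_def)
    then have "(\<integral>x. big x \<partial>\<nu>) \<le> (\<integral>x. 64 * \<bar>x\<bar> powr q \<partial>\<nu>)" using bigi qi by (intro integral_mono) auto
    then show ?thesis by (simp add: abs_moment_def)
  qed
  have large_big: "large x \<le> big x" for x by (auto simp: large_def big_def indicator_def)
  define a where "a z = 1 - \<gamma> + fst z" for z :: "real \<times> real"
  define S where "S z y = (1 - big (fst z)) * \<phi> (a z * fst y + \<gamma> * snd y)" for z y :: "real \<times> real"
  have Sm[measurable]: "(\<lambda>x. S (fst x) (snd x)) \<in> borel_measurable ((borel \<Otimes>\<^sub>M borel) \<Otimes>\<^sub>M (borel \<Otimes>\<^sub>M borel))"
    unfolding S_def a_def by measurable
  have big01: "0 \<le> big x" "big x \<le> 1" for x by (auto simp: big_def)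
  have S01: "0 \<le> S z y" "S z y \<le> 1" for z y
    using \<phi>01 big01 by (auto simp: S_def intro!: mult_le_one)
  have Si: "integrable (\<nu>2 \<Otimes>\<^sub>M (F \<Otimes>\<^sub>M F)) (\<lambda>x. S (fst x) (snd x))"
    by (rule P.integrable_const_bound[of _ 1]) (use S01 in auto)
  have bf: "integrable (\<nu>2 \<Otimes>\<^sub>M (F \<Otimes>\<^sub>M F)) (\<lambda>x. big (fst (fst x)))" "integrable (\<nu>2 \<Otimes>\<^sub>M (F \<Otimes>\<^sub>M F)) (\<lambda>x. big (snd (fst x)))"
    "integrable (\<nu>2 \<Otimes>\<^sub>M (F \<Otimes>\<^sub>M F)) (\<lambda>x. \<phi> (fst (snd x)))"
    by (rule P.integrable_const_bound[of _ 1]; use big01 \<phi>01 in auto)+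
  have gr: "growth p \<phi>"
  proof (rule growthI)
    show "\<bar>\<phi> w\<bar> \<le> 1 * (1 + w powr p)" for w
      using \<phi>01(1)[of w] \<phi>01(2)[of w] powr_ge_zero[of w p] unfolding mult_1_left by linarith
  qed
  have "coll \<gamma> \<nu> F \<phi> = (\<integral>x. jump \<gamma> \<phi> (fst x) (snd x) \<partial>(\<nu>2 \<Otimes>\<^sub>M (F \<Otimes>\<^sub>M F)))"
    by (rule coll_prod[OF F \<phi> gr]) (use p \<gamma> in auto)
  \<comment> \<open>One copy of \<open>big\<close> in the agent's own noise covers the gain omitted
    from \<open>S\<close>; the other two, one per agent, cover the loss that inadmissible trades do
    not produce.\<close>
  also have "\<dots> \<le> (\<integral>x. S (fst x) (snd x) + 2 * big (fst (fst x)) + big (snd (fst x)) - \<phi> (fst (snd x)) \<partial>(\<nu>2 \<Otimes>\<^sub>M (F \<Otimes>\<^sub>M F)))"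
  proof (rule integral_mono_AE)
    show "integrable (\<nu>2 \<Otimes>\<^sub>M (F \<Otimes>\<^sub>M F)) (\<lambda>x. jump \<gamma> \<phi> (fst x) (snd x))"
      by (rule jump_integrable[OF F \<phi> gr]) (use p \<gamma> in auto)
    have nn: "AE x in \<nu>2 \<Otimes>\<^sub>M (F \<Otimes>\<^sub>M F). 0 \<le> fst (snd x) \<and> 0 \<le> snd (snd x)"
    proof (rule P.AE_pair_measure)
      show "{x \<in> space (\<nu>2 \<Otimes>\<^sub>M (F \<Otimes>\<^sub>M F)). 0 \<le> fst (snd x) \<and> 0 \<le> snd (snd x)} \<in> sets (\<nu>2 \<Otimes>\<^sub>M (F \<Otimes>\<^sub>M F))"
        by measurable
    qed (use AE_pair_wealth[OF F F] in auto)
    then show "AE x in \<nu>2 \<Otimes>\<^sub>M (F \<Otimes>\<^sub>M F). jump \<gamma> \<phi> (fst x) (snd x)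
        \<le> S (fst x) (snd x) + 2 * big (fst (fst x)) + big (snd (fst x)) - \<phi> (fst (snd x))"
    proof eventually_elim
      case (elim x)
      obtain z w ws where x: "x = (z, (w, ws))" by (metis surj_pair)
      with elim have w: "0 \<le> w" "0 \<le> ws" by auto
      define I where "I = admissible \<gamma> w ws z"
      have I: "0 \<le> I" "I \<le> 1" unfolding I_def by (rule admissible_bounds)+
      have I1: "1 - I \<le> big (fst z) + big (snd z)"
        using not_admissible_le[of \<gamma> w ws z] \<gamma> w large_big[of "fst z"] large_big[of "snd z"] by (simp add: I_def)
      have pt: "post_trade \<gamma> w ws (fst z) = a z * w + \<gamma> * ws" by (simp add: post_trade_def a_def algebra_simps)
      have "I * \<phi> (a z * w + \<gamma> * ws) \<le> S z (w, ws) + big (fst z)"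
      proof -
        have "I * \<phi> (a z * w + \<gamma> * ws) \<le> 1 * \<phi> (a z * w + \<gamma> * ws)" using I \<phi>01 by (intro mult_right_mono) auto
        also have "\<dots> \<le> S z (w, ws) + big (fst z)" using \<phi>01 by (auto simp: S_def big_def)
        finally show ?thesis .
      qed
      moreover have "(1 - I) * \<phi> w \<le> big (fst z) + big (snd z)"
      proof -
        have "(1 - I) * \<phi> w \<le> (1 - I) * 1" using I \<phi>01 by (intro mult_left_mono) auto
        then show ?thesis using I1 by simp
      qed
      moreover have "I * (\<phi> (a z * w + \<gamma> * ws) - \<phi> w) = I * \<phi> (a z * w + \<gamma> * ws) + (1 - I) * \<phi> w - \<phi> w"
        by (simp add: algebra_simps)
      ultimately show ?case by (simp add: x jump_def pt I_def[symmetric])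
    qed
  qed (use Si bf in auto)
  also have "\<dots> = (\<integral>x. S (fst x) (snd x) \<partial>(\<nu>2 \<Otimes>\<^sub>M (F \<Otimes>\<^sub>M F))) + 3 * (\<integral>x. big x \<partial>\<nu>) - (\<integral>w. \<phi> w \<partial>F)"
  proof -
    have Fi: "integrable F \<phi>" by (rule wealth_integrable[OF F \<phi> gr])
    note n2 = pair.prob_space_axioms and f2 = FF.prob_space_axioms
    note b1 = integrable_pair_fst[OF noise_prob noise_prob bigi] and b2 = integrable_pair_snd[OF noise_prob noise_prob bigi]
    note e1 = integrable_pair_fst(2)[OF n2 f2 b1(1)] and e2 = integrable_pair_fst(2)[OF n2 f2 b2(1)]
    note c1 = integrable_pair_fst[OF F.prob_space_axioms F.prob_space_axioms Fi]
    note e3 = integrable_pair_snd(2)[OF n2 f2 c1(1)]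
    show ?thesis using Si bf e1 e2 e3 b1(2) b2(2) c1(2) by simp
  qed
  also have "(\<integral>x. S (fst x) (snd x) \<partial>(\<nu>2 \<Otimes>\<^sub>M (F \<Otimes>\<^sub>M F))) = (\<integral>z. (\<integral>y. S z y \<partial>(F \<Otimes>\<^sub>M F)) \<partial>\<nu>2)"
    using P.integral_fst'[OF Si] by simp
  \<comment> \<open>The majorant is a polynomial in the noise and nonnegative everywhere, so it can
    be integrated without truncation and its linear term has mean zero.\<close>
  also have "\<dots> \<le> (\<integral>z. J + M * (1 - fst z + \<gamma> + 4 * (fst z)\<^sup>2 + 4 * \<gamma>\<^sup>2) * \<Phi> \<partial>\<nu>2)"
  proof (rule integral_mono)
    show "integrable \<nu>2 (\<lambda>z. \<integral>y. S z y \<partial>(F \<Otimes>\<^sub>M F))" using P.integrable_fst'[OF Si] by simp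
    have "integrable \<nu> (\<lambda>x. J + M * (1 - x + \<gamma> + 4 * x\<^sup>2 + 4 * \<gamma>\<^sup>2) * \<Phi>)" using abs_integrable square_integrable by simp
    then show "integrable \<nu>2 (\<lambda>z. J + M * (1 - fst z + \<gamma> + 4 * (fst z)\<^sup>2 + 4 * \<gamma>\<^sup>2) * \<Phi>)"
      by (rule integrable_pair_fst[OF noise_prob noise_prob])
    fix z :: "real \<times> real"
    define e where "e = fst z"
    have pol: "0 \<le> 1 - e + \<gamma> + 4 * e\<^sup>2 + 4 * \<gamma>\<^sup>2"
    proof -
      have "e \<le> e\<^sup>2 + 1 / 4" using zero_le_power2[of "e - 1 / 2"] by (simp add: power2_eq_square algebra_simps)
      then show ?thesis using zero_le_power2[of e] zero_le_power2[of \<gamma>] \<gamma> by linarith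
    qed
    show "(\<integral>y. S z y \<partial>(F \<Otimes>\<^sub>M F)) \<le> J + M * (1 - fst z + \<gamma> + 4 * (fst z)\<^sup>2 + 4 * \<gamma>\<^sup>2) * \<Phi>"
    proof (cases "\<bar>e\<bar> > 1 / 4")
      case True
      then have "S z y = 0" for y by (simp add: S_def big_def e_def)
      then show ?thesis using J M \<Phi>0 pol by (simp add: e_def)
    next
      case False
      then have az: "1 / 2 \<le> a z" using \<gamma> by (simp add: a_def e_def abs_le_iff)
      have Sz: "S z y = \<phi> (a z * fst y + \<gamma> * snd y)" for y using False by (simp add: S_def big_def e_def)
      have i: "integrable (F \<Otimes>\<^sub>M F) (\<lambda>y. \<phi> (a z * fst y + \<gamma> * snd y))"
        by (rule FF.integrable_const_bound[of _ 1]) (use \<phi>01 in auto)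
      have "(\<integral>y. S z y \<partial>(F \<Otimes>\<^sub>M F)) = (\<integral>v. (\<integral>w. \<phi> (a z * w + \<gamma> * v) \<partial>F) \<partial>F)"
        unfolding Sz using FF.integral_snd[of "\<lambda>w v. \<phi> (a z * w + \<gamma> * v)"] i by (simp add: case_prod_beta')
      also have "\<dots> \<le> (\<integral>v. J + M * (\<Phi> / a z) \<partial>F)"
      proof (rule integral_mono)
        show "integrable F (\<lambda>v. \<integral>w. \<phi> (a z * w + \<gamma> * v) \<partial>F)"
          using FF.integrable_snd[of "\<lambda>w v. \<phi> (a z * w + \<gamma> * v)"] i by (simp add: case_prod_beta')
        fix v
        have "(\<integral>x. \<phi> (\<gamma> * v + a z * x) \<partial>lborel) = \<Phi> / a z"
          using lborel_integral_real_affine[of "a z" \<phi> "\<gamma> * v"] az by (simp add: \<Phi>_def field_simps)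
        with conc[OF az, of "\<gamma> * v"] show "(\<integral>w. \<phi> (a z * w + \<gamma> * v) \<partial>F) \<le> J + M * (\<Phi> / a z)" by (simp add: add.commute)
      qed simp
      also have "\<dots> = J + M * \<Phi> * (1 / a z)" using F.prob_space by simp
      also have "\<dots> \<le> J + M * \<Phi> * (1 - e + \<gamma> + 4 * e\<^sup>2 + 4 * \<gamma>\<^sup>2)"
      proof -
        define t where "t = e - \<gamma>"
        have at: "a z = 1 + t" by (simp add: a_def e_def t_def)
        have t: "-1 / 2 \<le> t" using az at by simp
        \<comment> \<open>This is \<open>(1 - t + 2 * t\<^sup>2) * (1 + t) - 1\<close>.\<close>
        have "t\<^sup>2 * (1 + 2 * t) \<ge> 0" using t by (intro mult_nonneg_nonneg) auto
        then have "1 \<le> (1 - t + 2 * t\<^sup>2) * (1 + t)" by (simp add: power2_eq_square algebra_simps)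
        then have "1 / (1 + t) \<le> 1 - t + 2 * t\<^sup>2" using t by (simp add: divide_le_eq)
        also have "\<dots> \<le> 1 - e + \<gamma> + 4 * e\<^sup>2 + 4 * \<gamma>\<^sup>2"
          using zero_le_power2[of "e + \<gamma>"] by (simp add: t_def power2_eq_square algebra_simps)
        finally show ?thesis using M \<Phi>0 at by (intro add_left_mono mult_left_mono) auto
      qed
      finally show ?thesis by (simp add: e_def mult_ac)
    qed
  qed
  also have "\<dots> = J + M * (1 + \<gamma> + 4 * var + 4 * \<gamma>\<^sup>2) * \<Phi>"
  proof -
    have i: "integrable \<nu> (\<lambda>x. J + M * (1 - x + \<gamma> + 4 * x\<^sup>2 + 4 * \<gamma>\<^sup>2) * \<Phi>)" using abs_integrable square_integrable by simp
    have "(\<integral>x. J + M * (1 - x + \<gamma> + 4 * x\<^sup>2 + 4 * \<gamma>\<^sup>2) * \<Phi> \<partial>\<nu>) = J + M * (1 + \<gamma> + 4 * var + 4 * \<gamma>\<^sup>2) * \<Phi>"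
      using abs_integrable square_integrable by (simp add: mean_zero var_def)
    with integrable_pair_fst(2)[OF noise_prob noise_prob i] show ?thesis by simp
  qed
  also have "\<dots> \<le> J + M * (1 + (5 * \<gamma> + 4 * var)) * \<Phi>"
  proof -
    have "\<gamma>\<^sup>2 \<le> \<gamma>" using \<gamma> by (simp add: power2_eq_square mult_left_le)
    then show ?thesis using M \<Phi>0 by (intro add_left_mono mult_right_mono mult_left_mono) auto
  qed
  finally show ?thesis using bigE by (simp add: \<Phi>_def)
qed

end

section \<open>Kinetic flows\<close>

text \<open>Differentiability is asked in the open interval only, because the evolution equation
  holds for positive times; continuity covers the end points.\<close>

lemma abs_diff_le_of_interior_deriv_le:
  fixes h :: "real \<Rightarrow> real"
  assumes st: "s \<le> t" and c: "continuous_on {s..t} h"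
    and d: "\<And>x. s < x \<Longrightarrow> x < t \<Longrightarrow> \<exists>l. (h has_real_derivative l) (at x) \<and> \<bar>l\<bar> \<le> B"
  shows "\<bar>h t - h s\<bar> \<le> B * (t - s)"
proof (cases "s = t")
  case False
  then have "s < t" using st by simp
  have "\<exists>l z. s < z \<and> z < t \<and> (h has_real_derivative l) (at z) \<and> h t - h s = (t - s) * l"
  proof (rule MVT[OF \<open>s < t\<close> c])
    show "h differentiable (at x)" if "s < x" "x < t" for x
      using d[OF that] by (auto simp: real_differentiable_def)
  qed
  then obtain l z where z: "s < z" "z < t" "(h has_real_derivative l) (at z)" "h t - h s = (t - s) * l" by blast
  obtain l' where l': "(h has_real_derivative l') (at z)" "\<bar>l'\<bar> \<le> B" using d[OF z(1,2)] by blast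
  have "l = l'" using DERIV_unique[OF z(3) l'(1)] .
  then have "\<bar>h t - h s\<bar> = (t - s) * \<bar>l'\<bar>" using z \<open>s < t\<close> by (simp add: abs_mult)
  also have "\<dots> \<le> (t - s) * B" using l' \<open>s < t\<close> by (intro mult_left_mono) auto
  finally show ?thesis by (simp add: mult.commute)
qed simp

text \<open>Smooth integrable stand-ins for indicator functions, a class preserved by the affine
  maps that trades induce.\<close>

definition conc_test :: "(real \<Rightarrow> real) \<Rightarrow> bool" where
  "conc_test \<phi> \<longleftrightarrow> bdd_smooth \<phi> \<and> (\<forall>x. 0 \<le> \<phi> x \<and> \<phi> x \<le> 1) \<and> integrable lborel \<phi>"

lemma conc_test_affine: assumes "conc_test \<phi>" "a \<noteq> 0" shows "conc_test (\<lambda>x. \<phi> (a * x + b))"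
proof -
  have "integrable lborel (\<lambda>x. \<phi> (b + a * x))"
    using assms lborel_integrable_real_affine[of \<phi> a b] by (simp add: conc_test_def)
  then show ?thesis using assms bdd_smooth_affine[of \<phi> a b] by (simp add: conc_test_def add.commute)
qed

text \<open>Reduces statements on characteristic functions to integrals of \<open>cos\<close> and
  \<open>sin\<close>, which belong to the smooth class.\<close>

lemma char_eq:
  assumes "real_distribution G"
  shows "char G \<xi> = Complex (\<integral>w. cos (\<xi> * w) \<partial>G) (\<integral>w. sin (\<xi> * w) \<partial>G)"
proof -
  interpret real_distribution G by fact
  have i: "integrable G (\<lambda>w. iexp (\<xi> * w))" by (rule integrable_const_bound[of _ 1]) auto
  have "Re (char G \<xi>) = (\<integral>w. cos (\<xi> * w) \<partial>G)" "Im (char G \<xi>) = (\<integral>w. sin (\<xi> * w) \<partial>G)"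
    unfolding char_def using integral_Re[OF i] integral_Im[OF i] by (simp_all add: Re_exp Im_exp)
  then show ?thesis by (simp add: complex_eq_iff)
qed

text \<open>A weak solution seen as a curve of measures. Measurability is required separately
  because a test function may be arbitrary on the negative half-line; weak continuity is what links
  the value at time 0 to the initial datum.\<close>

locale kinetic_flow = noise \<nu> for \<nu> +
  fixes p \<gamma> :: real and F :: "real \<Rightarrow> real measure" and F0 :: "real measure"
  assumes p: "2 < p" and noise_moment: "integrable \<nu> (\<lambda>x. \<bar>x\<bar> powr p)"
    and \<gamma>: "0 < \<gamma>" "\<gamma> \<le> 1 / 4"
    and F: "\<And>t. 0 \<le> t \<Longrightarrow> wealth p (F t)" and F0: "wealth p F0"
    and flow: "\<And>\<phi> t. \<phi> \<in> test_functions p \<Longrightarrow> \<phi> \<in> borel_measurable borel \<Longrightarrow> growth p \<phi> \<Longrightarrow> 0 < t \<Longrightarrow>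
      ((\<lambda>t. \<integral>w. \<phi> w \<partial>F t) has_real_derivative coll \<gamma> \<nu> (F t) \<phi>) (at t)"
    and init: "\<And>\<phi>. \<phi> \<in> test_functions p \<Longrightarrow> \<phi> \<in> borel_measurable borel \<Longrightarrow> growth p \<phi> \<Longrightarrow>
      ((\<lambda>t. \<integral>w. \<phi> w \<partial>F t) \<longlongrightarrow> (\<integral>w. \<phi> w \<partial>F0)) (at_right 0)"
    and weakly_continuous: "\<And>\<phi> :: real \<Rightarrow> real. continuous_on UNIV \<phi> \<Longrightarrow> bounded (range \<phi>) \<Longrightarrow>
      continuous_on {0..} (\<lambda>t. \<integral>w. \<phi> w \<partial>F t)"
begin

lemma \<gamma>_bounds: "0 \<le> \<gamma>" "\<gamma> \<le> 1" "\<gamma> \<le> 1 / 2" using \<gamma> by auto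

lemma C2_smooth_measurable: "C2_smooth \<phi> \<phi>1 \<phi>2 \<Longrightarrow> \<phi> \<in> borel_measurable borel"
  by (intro borel_measurable_continuous_onI C2_smooth_continuous(1))

lemma C2_growth: "C2_smooth \<phi> \<phi>1 \<phi>2 \<Longrightarrow> growth p \<phi>"
  using C2_smooth_imp_growth p by auto

lemma C2_integrable: "C2_smooth \<phi> \<phi>1 \<phi>2 \<Longrightarrow> wealth p G \<Longrightarrow> integrable G \<phi>"
  by (rule wealth_integrable[OF _ C2_smooth_measurable C2_growth])

lemma coll_C2_linear:
  assumes "wealth p G" "C2_smooth \<phi> \<phi>1 \<phi>2" "C2_smooth \<psi> \<psi>1 \<psi>2"
  shows "coll \<gamma> \<nu> G (\<lambda>w. a * \<phi> w + b * \<psi> w) = a * coll \<gamma> \<nu> G \<phi> + b * coll \<gamma> \<nu> G \<psi>"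
  by (rule coll_linear[OF assms(1) C2_smooth_measurable[OF assms(2)] C2_growth[OF assms(2)]
      C2_smooth_measurable[OF assms(3)] C2_growth[OF assms(3)] _ noise_moment \<gamma>_bounds(1,2)])
     (use p in auto)

text \<open>The identity is not a test function, but it is the uniform limit as \<open>k \<rightarrow> \<infinity>\<close> of these functions, which are.\<close>

lemma approx_id:
  fixes k :: real assumes k: "k > 0"
  defines "\<phi> \<equiv> \<lambda>w. w + (-1 / k) * tanh (k * w)"
  shows "C2_smooth \<phi> (\<lambda>w. (tanh (k * w))\<^sup>2) (\<lambda>w. 2 * tanh (k * w) * ((1 - (tanh (k * w))\<^sup>2) * k))"
    and "\<phi> 0 = 0" and "C2_smooth (\<lambda>w. tanh (k * w)) (\<lambda>w. (1 - (tanh (k * w))\<^sup>2) * k) (\<lambda>w. - 2 * tanh (k * w) * ((1 - (tanh (k * w))\<^sup>2) * k) * k)"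
proof -
  have t: "((\<lambda>w. tanh (k * w)) has_real_derivative (1 - (tanh (k * w))\<^sup>2) * k) (at w)" for w
    by (rule DERIV_chain2[of tanh]) (auto intro!: derivative_eq_intros)
  have s: "bdd_smooth (\<lambda>w. tanh (k * w))" using bdd_smooth_affine[OF bdd_smooth_tanh, of k 0] by simp
  have p2: "((\<lambda>w. (tanh (k * w))\<^sup>2) has_real_derivative 2 * tanh (k * w) * ((1 - (tanh (k * w))\<^sup>2) * k)) (at w)" for w
    using DERIV_power[OF t, of 2 w] by (simp add: mult_ac)
  have b: "bdd_smooth (\<lambda>w. 2 * tanh (k * w) * ((1 - (tanh (k * w))\<^sup>2) * k))"
    by (intro bdd_smooth_intros s)
  have d: "(\<phi> has_real_derivative (tanh (k * w))\<^sup>2) (at w)" for w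
  proof -
    have "(\<phi> has_real_derivative 1 + (-1 / k) * ((1 - (tanh (k * w))\<^sup>2) * k)) (at w)"
      unfolding \<phi>_def by (intro DERIV_add DERIV_ident DERIV_cmult t)
    moreover have "1 + (-1 / k) * ((1 - (tanh (k * w))\<^sup>2) * k) = (tanh (k * w))\<^sup>2" using k by (simp add: field_simps)
    ultimately show ?thesis by simp
  qed
  show "C2_smooth \<phi> (\<lambda>w. (tanh (k * w))\<^sup>2) (\<lambda>w. 2 * tanh (k * w) * ((1 - (tanh (k * w))\<^sup>2) * k))"
    unfolding C2_smooth_def using d p2 b by blast
  show "\<phi> 0 = 0" by (simp add: \<phi>_def)
  have d3: "((\<lambda>w. (1 - (tanh (k * w))\<^sup>2) * k) has_real_derivative - 2 * tanh (k * w) * ((1 - (tanh (k * w))\<^sup>2) * k) * k) (at w)" for w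
  proof -
    have "((\<lambda>w. (1 - (tanh (k * w))\<^sup>2) * k) has_real_derivative (0 - 2 * tanh (k * w) * ((1 - (tanh (k * w))\<^sup>2) * k)) * k) (at w)"
      by (intro DERIV_cmult_right DERIV_diff DERIV_const p2)
    then show ?thesis by simp
  qed
  have b3: "bdd_smooth (\<lambda>w. - 2 * tanh (k * w) * ((1 - (tanh (k * w))\<^sup>2) * k) * k)"
    by (intro bdd_smooth_intros s)
  show "C2_smooth (\<lambda>w. tanh (k * w)) (\<lambda>w. (1 - (tanh (k * w))\<^sup>2) * k) (\<lambda>w. - 2 * tanh (k * w) * ((1 - (tanh (k * w))\<^sup>2) * k) * k)"
    unfolding C2_smooth_def using t d3 b3 by blast
qed

text \<open>The approximants differ from the identity by at most \<open>1 / k\<close> uniformly, and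
  their collision terms by at most \<open>2 / k\<close>, independently of time. Hence the
  derivatives converge uniformly on positive times and the differentiated equation survives the
  limit.\<close>

lemma flow_id:
  shows "0 < t \<Longrightarrow> ((\<lambda>t. \<integral>w. w \<partial>F t) has_real_derivative coll \<gamma> \<nu> (F t) (\<lambda>w. w)) (at t)"
    and "((\<lambda>t. \<integral>w. w \<partial>F t) \<longlongrightarrow> (\<integral>w. w \<partial>F0)) (at_right 0)"
proof -
  define k where "k n = real (Suc n)" for n
  have k: "k n > 0" for n by (simp add: k_def)
  have klim: "(\<lambda>n. 2 / k n) \<longlonglongrightarrow> 0"
    unfolding k_def using tendsto_mult_right_zero[OF LIMSEQ_inverse_real_of_nat, of 2] by (simp add: divide_inverse)
  define \<phi> where "\<phi> n w = w + (-1 / k n) * tanh (k n * w)" for n w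
  note a = approx_id[OF k, folded \<phi>_def]
  have C2: "C2_smooth (\<phi> n) (\<lambda>w. (tanh (k n * w))\<^sup>2) (\<lambda>w. 2 * tanh (k n * w) * ((1 - (tanh (k n * w))\<^sup>2) * k n))" for n
    using a(1)[of n] by (simp add: \<phi>_def[abs_def])
  have tf: "\<phi> n \<in> test_functions p" for n
    by (rule C2_smooth_test_function[OF C2 _ _ p]) (auto simp: \<phi>_def)
  have t1: "\<bar>tanh x\<bar> \<le> 1" for x :: real using tanh_real_lt_1[of x] tanh_real_gt_neg1[of x] by linarith
  have near: "\<bar>(\<integral>w. \<phi> n w \<partial>G) - (\<integral>w. w \<partial>G)\<bar> \<le> 1 / k n" if G: "wealth p G" for G n
  proof -
    interpret G: real_distribution G by (rule wealthD[OF G])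
    have "\<bar>(\<integral>w. \<phi> n w \<partial>G) - (\<integral>w. w \<partial>G)\<bar> \<le> (\<integral>w. 1 / k n \<partial>G)"
    proof (rule integral_near)
      show "integrable G (\<lambda>w. w)" by (rule C2_integrable[OF C2_smooth_id G])
      show "\<phi> n \<in> borel_measurable G" using C2_integrable[OF C2 G] by auto
      have "\<bar>\<phi> n w - w\<bar> \<le> 1 / k n" for w
      proof -
        have "\<bar>\<phi> n w - w\<bar> = (1 / k n) * \<bar>tanh (k n * w)\<bar>" using k[of n] by (simp add: \<phi>_def abs_mult)
        also have "\<dots> \<le> (1 / k n) * 1" using k[of n] t1 by (intro mult_left_mono) (auto simp: less_imp_le)
        finally show ?thesis by simp
      qed
      then show "AE w in G. \<bar>\<phi> n w - w\<bar> \<le> 1 / k n" by simp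
    qed simp
    then show ?thesis using G.prob_space by simp
  qed
  have collnear: "\<bar>coll \<gamma> \<nu> (F t) (\<phi> n) - coll \<gamma> \<nu> (F t) (\<lambda>w. w)\<bar> \<le> 2 / k n" if t: "0 < t" for t n
  proof -
    have Ft: "wealth p (F t)" using F t by simp
    have "coll \<gamma> \<nu> (F t) (\<phi> n) = coll \<gamma> \<nu> (F t) (\<lambda>w. w) - (1 / k n) * coll \<gamma> \<nu> (F t) (\<lambda>w. tanh (k n * w))"
      using coll_C2_linear[OF Ft C2_smooth_id a(3), of 1 "-1 / k n" n] by (simp add: \<phi>_def[abs_def])
    moreover have "\<bar>coll \<gamma> \<nu> (F t) (\<lambda>w. tanh (k n * w))\<bar> \<le> 2 * 1"
      by (rule coll_bounded[OF Ft C2_smooth_measurable[OF a(3)] t1 _ noise_moment]) (use p \<gamma>_bounds in auto)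
    then have "(1 / k n) * \<bar>coll \<gamma> \<nu> (F t) (\<lambda>w. tanh (k n * w))\<bar> \<le> (1 / k n) * 2"
      using k[of n] by (intro mult_left_mono) (auto simp: less_imp_le)
    ultimately show ?thesis using k[of n] by (simp add: abs_mult)
  qed
  have lim: "(\<lambda>n. \<integral>w. \<phi> n w \<partial>G) \<longlonglongrightarrow> (\<integral>w. w \<partial>G)" if "wealth p G" for G
  proof (rule LIMSEQ_I)
    fix e :: real assume "e > 0"
    with LIMSEQ_D[OF klim] obtain N where N: "\<And>n. n \<ge> N \<Longrightarrow> \<bar>2 / k n\<bar> < e" by auto
    have "norm ((\<integral>w. \<phi> n w \<partial>G) - (\<integral>w. w \<partial>G)) < e" if "n \<ge> N" for n
    proof -
      have "1 / k n \<le> 2 / k n" using k[of n] by (intro divide_right_mono) auto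
      then show ?thesis using near[OF \<open>wealth p G\<close>, of n] N[OF that] unfolding real_norm_def by linarith
    qed
    then show "\<exists>N. \<forall>n\<ge>N. norm ((\<integral>w. \<phi> n w \<partial>G) - (\<integral>w. w \<partial>G)) < e" by blast
  qed
  have "\<exists>g. \<forall>t\<in>{0<..}. (\<lambda>n. \<integral>w. \<phi> n w \<partial>F t) \<longlonglongrightarrow> g t \<and>
      (g has_derivative (\<lambda>h. coll \<gamma> \<nu> (F t) (\<lambda>w. w) * h)) (at t within {0<..})"
  proof (rule has_derivative_sequence)
    show "((\<lambda>t. \<integral>w. \<phi> n w \<partial>F t) has_derivative (\<lambda>h. coll \<gamma> \<nu> (F t) (\<phi> n) * h)) (at t within {0<..})"
      if "t \<in> {0<..}" for n t
      using flow[OF tf C2_smooth_measurable[OF C2] C2_growth[OF C2], of t n] that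
      by (auto simp: has_field_derivative_def intro: has_derivative_at_withinI)
    show "\<forall>\<^sub>F n in sequentially. \<forall>t\<in>{0<..}. \<forall>h. norm (coll \<gamma> \<nu> (F t) (\<phi> n) * h - coll \<gamma> \<nu> (F t) (\<lambda>w. w) * h) \<le> e * norm h"
      if "e > 0" for e
    proof -
      from LIMSEQ_D[OF klim that] obtain N where N: "\<And>n. n \<ge> N \<Longrightarrow> \<bar>2 / k n\<bar> < e" by auto
      have "norm (coll \<gamma> \<nu> (F t) (\<phi> n) * h - coll \<gamma> \<nu> (F t) (\<lambda>w. w) * h) \<le> e * norm h"
        if "n \<ge> N" "t \<in> {0<..}" for n t h
      proof -
        have "\<bar>coll \<gamma> \<nu> (F t) (\<phi> n) - coll \<gamma> \<nu> (F t) (\<lambda>w. w)\<bar> \<le> e"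
          using collnear[of t n] N[OF that(1)] that(2) by (simp del: abs_divide)
        then have "\<bar>coll \<gamma> \<nu> (F t) (\<phi> n) - coll \<gamma> \<nu> (F t) (\<lambda>w. w)\<bar> * \<bar>h\<bar> \<le> e * \<bar>h\<bar>" by (rule mult_right_mono) simp
        then show ?thesis by (simp add: left_diff_distrib[symmetric] abs_mult)
      qed
      then show ?thesis unfolding eventually_sequentially by blast
    qed
    show "(\<lambda>n. \<integral>w. \<phi> n w \<partial>F 1) \<longlonglongrightarrow> (\<integral>w. w \<partial>F 1)" using F by (intro lim) auto
  qed (auto simp: convex_real_interval)
  then obtain g where g: "\<And>t. t > 0 \<Longrightarrow> (\<lambda>n. \<integral>w. \<phi> n w \<partial>F t) \<longlonglongrightarrow> g t"
    "\<And>t. t > 0 \<Longrightarrow> (g has_derivative (\<lambda>h. coll \<gamma> \<nu> (F t) (\<lambda>w. w) * h)) (at t within {0<..})" by auto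
  have gF: "g t = (\<integral>w. w \<partial>F t)" if "t > 0" for t
    using LIMSEQ_unique[OF g(1)[OF that] lim] F that by auto
  show "((\<lambda>t. \<integral>w. w \<partial>F t) has_real_derivative coll \<gamma> \<nu> (F t) (\<lambda>w. w)) (at t)" if t: "0 < t"
  proof -
    have w: "at t within {0<..} = at t" by (rule at_within_open) (use t in auto)
    have "(g has_real_derivative coll \<gamma> \<nu> (F t) (\<lambda>w. w)) (at t)"
      using g(2)[OF t] unfolding w has_field_derivative_def .
    moreover have "open ({0<..} :: real set)" "t \<in> {0<..}" using t by simp_all
    moreover have "\<And>x. x \<in> {0<..} \<Longrightarrow> g x = (\<integral>w. w \<partial>F x)" using gF by simp
    ultimately show ?thesis by (rule has_field_derivative_transform_within_open)
  qed
  show "((\<lambda>t. \<integral>w. w \<partial>F t) \<longlongrightarrow> (\<integral>w. w \<partial>F0)) (at_right 0)"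
  proof (rule tendstoI)
    fix e :: real assume e: "e > 0"
    then obtain n where n: "\<bar>2 / k n\<bar> < e / 2" using LIMSEQ_D[OF klim, of "e / 2"] by auto
    have "\<forall>\<^sub>F t in at_right 0. dist (\<integral>w. \<phi> n w \<partial>F t) (\<integral>w. \<phi> n w \<partial>F0) < e / 2"
      using init[OF tf C2_smooth_measurable[OF C2] C2_growth[OF C2]] e by (intro tendstoD) auto
    moreover have "\<forall>\<^sub>F t in at_right (0::real). 0 < t" by (auto simp: eventually_at_filter)
    ultimately show "\<forall>\<^sub>F t in at_right 0. dist (\<integral>w. w \<partial>F t) (\<integral>w. w \<partial>F0) < e"
    proof eventually_elim
      case (elim t)
      have "2 / k n = 1 / k n + 1 / k n" by simp
      then show ?case using near[OF F0, of n] near[OF F[of t], of n] n elim unfolding dist_real_def by linarith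
    qed
  qed
qed

text \<open>Subtracting the affine part at 0 leaves a test function; constants have no collision
  term, and the identity is covered by \<open>flow_id\<close>.\<close>

lemma flow_C2:
  assumes "C2_smooth \<phi> \<phi>1 \<phi>2"
  shows "0 < t \<Longrightarrow> ((\<lambda>t. \<integral>w. \<phi> w \<partial>F t) has_real_derivative coll \<gamma> \<nu> (F t) \<phi>) (at t)"
    and "((\<lambda>t. \<integral>w. \<phi> w \<partial>F t) \<longlongrightarrow> (\<integral>w. \<phi> w \<partial>F0)) (at_right 0)"
proof -
  define a b where "a = \<phi> 0" and "b = \<phi>1 0"
  define \<psi> where "\<psi> w = \<phi> w + (- b * w + - a)" for w
  have l: "C2_smooth (\<lambda>w. b * w + a) (\<lambda>w. b * 1 + 0) (\<lambda>w. b * 0 + 0)"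
    by (intro C2_smooth_add C2_smooth_cmult C2_smooth_id C2_smooth_const)
  have l': "C2_smooth (\<lambda>w. - b * w + - a) (\<lambda>w. - b * 1 + 0) (\<lambda>w. - b * 0 + 0)"
    by (intro C2_smooth_add C2_smooth_cmult C2_smooth_id C2_smooth_const)
  have \<psi>: "C2_smooth \<psi> (\<lambda>w. \<phi>1 w + (- b * 1 + 0)) (\<lambda>w. \<phi>2 w + (- b * 0 + 0))"
    unfolding \<psi>_def by (rule C2_smooth_add[OF assms l'])
  have tf: "\<psi> \<in> test_functions p"
    by (rule C2_smooth_test_function[OF \<psi> _ _ p]) (auto simp: \<psi>_def a_def b_def)
  have dec: "(\<integral>w. \<phi> w \<partial>G) = (\<integral>w. \<psi> w \<partial>G) + b * (\<integral>w. w \<partial>G) + a" if G: "wealth p G" for G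
  proof -
    interpret G: real_distribution G by (rule wealthD[OF G])
    have "(\<integral>w. \<phi> w \<partial>G) = (\<integral>w. \<psi> w + (b * w + a) \<partial>G)" by (simp add: \<psi>_def)
    also have "\<dots> = (\<integral>w. \<psi> w \<partial>G) + b * (\<integral>w. w \<partial>G) + a"
      using C2_integrable[OF \<psi> G] C2_integrable[OF C2_smooth_id G] G.prob_space by simp
    finally show ?thesis .
  qed
  have cdec: "coll \<gamma> \<nu> (F t) \<phi> = coll \<gamma> \<nu> (F t) \<psi> + b * coll \<gamma> \<nu> (F t) (\<lambda>w. w)" if t: "0 < t" for t
  proof -
    have Ft: "wealth p (F t)" using F t by simp
    have c1: "coll \<gamma> \<nu> (F t) (\<lambda>w. 1) = 0" by (simp add: coll_def mean_jump_def)
    have c2: "coll \<gamma> \<nu> (F t) (\<lambda>w. b * w + a * 1) = b * coll \<gamma> \<nu> (F t) (\<lambda>w. w) + a * coll \<gamma> \<nu> (F t) (\<lambda>w. 1)"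
      by (rule coll_C2_linear[OF Ft C2_smooth_id C2_smooth_const])
    have "coll \<gamma> \<nu> (F t) (\<lambda>w. 1 * \<psi> w + 1 * (b * w + a)) = 1 * coll \<gamma> \<nu> (F t) \<psi> + 1 * coll \<gamma> \<nu> (F t) (\<lambda>w. b * w + a)"
      by (rule coll_C2_linear[OF Ft \<psi> l])
    then show ?thesis using c1 c2 by (simp add: \<psi>_def)
  qed
  show "((\<lambda>t. \<integral>w. \<phi> w \<partial>F t) has_real_derivative coll \<gamma> \<nu> (F t) \<phi>) (at t)" if t: "0 < t"
  proof -
    have "((\<lambda>t. (\<integral>w. \<psi> w \<partial>F t) + b * (\<integral>w. w \<partial>F t) + a) has_real_derivative
        coll \<gamma> \<nu> (F t) \<psi> + b * coll \<gamma> \<nu> (F t) (\<lambda>w. w) + 0) (at t)"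
      by (intro DERIV_add DERIV_cmult flow_id flow DERIV_const tf t C2_smooth_measurable[OF \<psi>] C2_growth[OF \<psi>])
    then have "((\<lambda>t. (\<integral>w. \<psi> w \<partial>F t) + b * (\<integral>w. w \<partial>F t) + a) has_real_derivative coll \<gamma> \<nu> (F t) \<phi>) (at t)"
      by (simp add: cdec[OF t])
    moreover have "open ({0<..} :: real set)" "t \<in> {0<..}" using t by simp_all
    moreover have "\<And>x. x \<in> {0<..} \<Longrightarrow> (\<integral>w. \<psi> w \<partial>F x) + b * (\<integral>w. w \<partial>F x) + a = (\<integral>w. \<phi> w \<partial>F x)"
      using dec[OF F] by simp
    ultimately show ?thesis by (rule has_field_derivative_transform_within_open)
  qed
  have "((\<lambda>t. (\<integral>w. \<psi> w \<partial>F t) + b * (\<integral>w. w \<partial>F t) + a) \<longlongrightarrow> (\<integral>w. \<psi> w \<partial>F0) + b * (\<integral>w. w \<partial>F0) + a) (at_right 0)"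
    by (intro tendsto_add tendsto_mult tendsto_const flow_id init tf C2_smooth_measurable[OF \<psi>] C2_growth[OF \<psi>])
  then show "((\<lambda>t. \<integral>w. \<phi> w \<partial>F t) \<longlongrightarrow> (\<integral>w. \<phi> w \<partial>F0)) (at_right 0)"
    unfolding dec[OF F0]
    by (rule Lim_transform_eventually) (use dec F in \<open>auto simp: eventually_at_filter\<close>)
qed

text \<open>The weak formulation only fixes the limit as time decreases to 0, while weak continuity
  identifies this limit with the value at 0; trigonometric functions are enough to compare the two
  measures.\<close>

lemma F_0: "F 0 = F0"
proof (rule Levy_uniqueness)
  show r: "real_distribution (F 0)" "real_distribution F0" using F[of 0] F0 wealthD by auto
  have e: "(\<integral>w. \<phi> w \<partial>F 0) = (\<integral>w. \<phi> w \<partial>F0)" if s: "bdd_smooth \<phi>" for \<phi>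
  proof -
    obtain \<phi>1 \<phi>2 where "C2_smooth \<phi> \<phi>1 \<phi>2" using bdd_smooth_imp_C2[OF s] .
    note l1 = flow_C2(2)[OF this]
    have "bounded (range \<phi>)" using s by (auto simp: bdd_smooth_def intro: bdd_deriv_imp_bounded)
    then have "continuous_on {0..} (\<lambda>t. \<integral>w. \<phi> w \<partial>F t)"
      by (rule weakly_continuous[OF bdd_smooth_continuous[OF s]])
    then have "((\<lambda>t. \<integral>w. \<phi> w \<partial>F t) \<longlongrightarrow> (\<integral>w. \<phi> w \<partial>F 0)) (at 0 within {0..})"
      by (auto simp: continuous_on_def)
    then have "((\<lambda>t. \<integral>w. \<phi> w \<partial>F t) \<longlongrightarrow> (\<integral>w. \<phi> w \<partial>F 0)) (at_right 0)" by (simp add: at_within_Ici_at_right)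
    from tendsto_unique[OF _ this l1] show ?thesis by simp
  qed
  have "bdd_smooth (\<lambda>w. cos (\<xi> * w))" "bdd_smooth (\<lambda>w. sin (\<xi> * w))" for \<xi>
    using bdd_smooth_affine[OF bdd_smooth_cos, of \<xi> 0] bdd_smooth_affine[OF bdd_smooth_sin, of \<xi> 0] by auto
  then show "char (F 0) = char F0" by (intro ext) (simp add: char_eq r e)
qed

text \<open>Monotonicity up to the initial limit, without continuity or a derivative at 0.\<close>

lemma nonincreasing_right_limit:
  fixes h :: "real \<Rightarrow> real"
  assumes "\<And>t. 0 < t \<Longrightarrow> \<exists>d. (h has_real_derivative d) (at t) \<and> d \<le> 0" "(h \<longlongrightarrow> l) (at_right 0)" "0 < t"
  shows "h t \<le> l"
proof (rule tendsto_lowerbound[OF assms(2)])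
  have "\<forall>\<^sub>F s in at_right 0. s < t" using assms(3) by (intro eventually_at_right_real[THEN eventually_mono]) auto
  moreover have "\<forall>\<^sub>F s in at_right (0::real). 0 < s" by (auto simp: eventually_at_filter)
  ultimately show "\<forall>\<^sub>F s in at_right 0. h t \<le> h s"
  proof eventually_elim
    case (elim s)
    show ?case by (rule DERIV_nonpos_imp_nonincreasing) (use elim assms(1) in auto)
  qed
qed simp

text \<open>Of order \<gamma> when the variance is a multiple of \<gamma> and the noise moment of
  order \<open>p\<close> a multiple of \<open>\<gamma> powr (p / 2)\<close>, hence still bounded
  after division by \<gamma>.\<close>

definition moment_rate :: real where
  "moment_rate = 8 * p\<^sup>2 * 6 powr p * (2 * \<gamma> + 9 * (2 + var) * var + abs_moment p)"

lemma moment_bound: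
  assumes "0 \<le> t"
  shows "(\<integral>w. w powr p \<partial>F t) \<le> exp (moment_rate * t) * (\<integral>w. w powr p \<partial>F0)"
proof (cases "t = 0")
  case True then show ?thesis by (simp add: F_0)
next
  case False
  then have t: "0 < t" using assms by simp
  define y where "y t = (\<integral>w. w powr p \<partial>F t)" for t
  have g: "growth p (\<lambda>w. w powr p)" using p by (intro growth_powr) auto
  have m: "(\<lambda>w::real. w powr p) \<in> borel_measurable borel" by simp
  have d: "(y has_real_derivative coll \<gamma> \<nu> (F t) (\<lambda>w. w powr p)) (at t)" if "0 < t" for t
    unfolding y_def by (rule flow[OF powr_test_function[OF p] m g that])
  have le: "coll \<gamma> \<nu> (F t) (\<lambda>w. w powr p) \<le> moment_rate * y t" if "0 < t" for t
    unfolding moment_rate_def y_def using that by (intro coll_powr_le F p noise_moment \<gamma>_bounds) auto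
  have "exp (- moment_rate * t) * y t \<le> exp (- moment_rate * 0) * (\<integral>w. w powr p \<partial>F0)"
  proof (rule nonincreasing_right_limit[where h = "\<lambda>t. exp (- moment_rate * t) * y t"])
    fix t :: real assume t: "0 < t"
    have "((\<lambda>t. exp (- moment_rate * t) * y t) has_real_derivative
        (exp (- moment_rate * t) * - moment_rate) * y t + exp (- moment_rate * t) * coll \<gamma> \<nu> (F t) (\<lambda>w. w powr p)) (at t)"
      by (auto intro!: derivative_eq_intros d[OF t])
    moreover have "(exp (- moment_rate * t) * - moment_rate) * y t + exp (- moment_rate * t) * coll \<gamma> \<nu> (F t) (\<lambda>w. w powr p)
       = exp (- moment_rate * t) * (coll \<gamma> \<nu> (F t) (\<lambda>w. w powr p) - moment_rate * y t)" by (simp add: algebra_simps)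
    moreover have "\<dots> \<le> 0" using le[OF t] by (intro mult_nonneg_nonpos) auto
    ultimately show "\<exists>d. ((\<lambda>t. exp (- moment_rate * t) * y t) has_real_derivative d) (at t) \<and> d \<le> 0" by auto
  next
    show "((\<lambda>t. exp (- moment_rate * t) * y t) \<longlongrightarrow> exp (- moment_rate * 0) * (\<integral>w. w powr p \<partial>F0)) (at_right 0)"
      unfolding y_def by (intro tendsto_intros init[OF powr_test_function[OF p] m g])
  qed (rule t)
  then show ?thesis by (simp add: y_def exp_minus field_simps)
qed

lemma flow_diff_le:
  assumes \<phi>: "C2_smooth \<phi> \<phi>1 \<phi>2" and st: "0 \<le> s" "s \<le> t"
    and B: "\<And>r. 0 < r \<Longrightarrow> r < t \<Longrightarrow> \<bar>coll \<gamma> \<nu> (F r) \<phi>\<bar> \<le> B"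
  shows "\<bar>(\<integral>w. \<phi> w \<partial>F t) - (\<integral>w. \<phi> w \<partial>F s)\<bar> \<le> B * (t - s)"
proof -
  define y where "y t = (\<integral>w. \<phi> w \<partial>F t)" for t
  have d: "(y has_real_derivative coll \<gamma> \<nu> (F t) \<phi>) (at t)" if "0 < t" for t
    unfolding y_def by (rule flow_C2(1)[OF \<phi> that])
  have c: "continuous_on {0..} y"
    unfolding continuous_on_def
  proof
    fix r :: real assume "r \<in> {0..}"
    then consider "r = 0" | "0 < r" by fastforce
    then show "(y \<longlongrightarrow> y r) (at r within {0..})"
    proof cases
      case 1
      show ?thesis using flow_C2(2)[OF \<phi>] unfolding 1 at_within_Ici_at_right y_def F_0 .
    next
      case 2
      show ?thesis using DERIV_isCont[OF d[OF 2]] by (auto simp: isCont_def intro: tendsto_within_subset)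
    qed
  qed
  have "\<bar>y t - y s\<bar> \<le> B * (t - s)"
  proof (rule abs_diff_le_of_interior_deriv_le[OF st(2)])
    show "continuous_on {s..t} y" using c by (rule continuous_on_subset) (use st in auto)
    show "\<exists>l. (y has_real_derivative l) (at r) \<and> \<bar>l\<bar> \<le> B" if "s < r" "r < t" for r
      using d[of r] B[of r] that st by auto
  qed
  then show ?thesis by (simp add: y_def)
qed

text \<open>A Gronwall argument for \<open>sup (\<integral> \<phi> dF\<^sub>t - M e\<^sup>c\<^sup>t \<integral> \<phi> dx)\<close> over all test functions \<open>0 \<le> \<phi> \<le> 1\<close>:
  a trade is an affine change of variables up to an error, and affine maps act on the class of test functions.\<close>

lemma concentration_bound:
  assumes q: "2 \<le> q" "q \<le> 3" "q \<le> p" and M: "0 \<le> M" and J0: "0 \<le> J0"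
    and init_conc: "\<And>\<phi>. conc_test \<phi> \<Longrightarrow> (\<integral>w. \<phi> w \<partial>F0) \<le> J0 + M * (\<integral>x. \<phi> x \<partial>lborel)"
    and \<phi>: "conc_test \<phi>" and t: "0 \<le> t"
  shows "(\<integral>w. \<phi> w \<partial>F t) \<le> J0 + 192 * abs_moment q * t + M * exp ((5 * \<gamma> + 4 * var) * t) * (\<integral>x. \<phi> x \<partial>lborel)"
proof (cases "t = 0")
  case True then show ?thesis using init_conc[OF \<phi>] by (simp add: F_0)
next
  case False
  define T where "T = t"
  have T: "0 < T" using False t by (simp add: T_def)
  define c where "c = 5 * \<gamma> + 4 * var"
  define e where "e = 192 * abs_moment q"
  have e0: "0 \<le> e" using abs_moment_nonneg by (simp add: e_def)
  \<comment> \<open>Excess over the claimed bound, before \<open>J0\<close> is subtracted;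
    \<open>e * t\<close> absorbs the error made by large noises.\<close>
  define D where "D \<phi> t = (\<integral>w. \<phi> w \<partial>F t) - M * exp (c * t) * (\<integral>x. \<phi> x \<partial>lborel) - e * t" for \<phi> t
  define A where "A = {D \<phi> t | \<phi> t. conc_test \<phi> \<and> 0 < t \<and> t \<le> T}"
  \<comment> \<open>The maximum with 0 keeps \<open>J\<close> nonnegative, as the bound on the
    collision operator requires.\<close>
  define J where "J = max 0 (Sup A)"
  have I1: "(\<integral>w. \<phi> w \<partial>F t) \<le> 1" if \<phi>: "conc_test \<phi>" and t: "0 < t" for \<phi> t
  proof -
    have Ft: "wealth p (F t)" using F t by simp
    interpret Ft: real_distribution "F t" by (rule wealthD[OF Ft])
    have "(\<integral>w. \<phi> w \<partial>F t) \<le> (\<integral>w. 1 \<partial>F t)"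
    proof (rule integral_mono)
      obtain \<phi>1 \<phi>2 where "C2_smooth \<phi> \<phi>1 \<phi>2" using bdd_smooth_imp_C2 \<phi> by (metis conc_test_def)
      then show "integrable (F t) \<phi>" using Ft by (rule C2_integrable)
    qed (use \<phi> in \<open>auto simp: conc_test_def\<close>)
    then show ?thesis using Ft.prob_space by simp
  qed
  have \<Phi>0: "0 \<le> (\<integral>x. \<phi> x \<partial>lborel)" if "conc_test \<phi>" for \<phi>
    using that by (auto simp: conc_test_def intro: integral_nonneg_AE)
  have "D \<phi> t \<le> 1" if "conc_test \<phi>" "0 < t" for \<phi> t
  proof -
    have "0 \<le> M * exp (c * t) * (\<integral>x. \<phi> x \<partial>lborel)" using M \<Phi>0[OF that(1)] by simp
    moreover have "0 \<le> e * t" using e0 that by simp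
    ultimately show ?thesis using I1[OF that] unfolding D_def by linarith
  qed
  then have bdd: "bdd_above A" by (intro bdd_aboveI[of _ 1]) (auto simp: A_def)
  have A_ne: "A \<noteq> {}" using \<phi> T by (auto simp: A_def intro: exI[of _ T])
  have J: "0 \<le> J" "\<And>\<phi> t. conc_test \<phi> \<Longrightarrow> 0 < t \<Longrightarrow> t \<le> T \<Longrightarrow> D \<phi> t \<le> J"
  proof -
    show "0 \<le> J" by (simp add: J_def)
    fix \<phi> t assume "conc_test \<phi>" "0 < t" "t \<le> T"
    then have "D \<phi> t \<in> A" by (auto simp: A_def)
    then show "D \<phi> t \<le> J" using cSup_upper[OF _ bdd] by (fastforce simp: J_def)
  qed
  \<comment> \<open>The loss term in the collision bound makes \<open>D\<close> relax towards
    \<open>J\<close> at rate 1, which explains the factor \<open>exp t\<close>. Starting from at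
    most \<open>J0\<close>, it stays below \<open>J\<close> by the margin
    \<open>exp (- T) * (J - J0)\<close>, the same for all tests and times, which contradicts the
    choice of \<open>J\<close> as a supremum.\<close>
  have key: "D \<phi> t \<le> J + exp (- T) * (J0 - J)" if \<phi>: "conc_test \<phi>" and t: "0 < t" "t \<le> T" and lt: "J0 < J" for \<phi> t
  proof -
    obtain \<phi>1 \<phi>2 where C2: "C2_smooth \<phi> \<phi>1 \<phi>2" using bdd_smooth_imp_C2 \<phi> by (metis conc_test_def)
    define \<Phi> where "\<Phi> = (\<integral>x. \<phi> x \<partial>lborel)"

    have der: "((\<lambda>t. exp t * (D \<phi> t - J)) has_real_derivative
        exp r * (D \<phi> r - J) + exp r * (coll \<gamma> \<nu> (F r) \<phi> - M * (exp (c * r) * c) * \<Phi> - e)) (at r)" if r: "0 < r" for r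
      unfolding D_def \<Phi>_def by (auto intro!: derivative_eq_intros flow_C2(1)[OF C2 r])
    have neg: "exp r * (D \<phi> r - J) + exp r * (coll \<gamma> \<nu> (F r) \<phi> - M * (exp (c * r) * c) * \<Phi> - e) \<le> 0" if r: "0 < r" "r \<le> T" for r
    proof -
      have "coll \<gamma> \<nu> (F r) \<phi> \<le> (J + e * r) + (M * exp (c * r)) * (1 + (5 * \<gamma> + 4 * var)) * (\<integral>x. \<phi> x \<partial>lborel) - (\<integral>w. \<phi> w \<partial>F r) + 192 * abs_moment q"
      proof (rule coll_le_concentration[OF _ p noise_moment q \<gamma>_bounds(1) \<gamma>(2)])
        show "wealth p (F r)" using F r by simp
        show "\<phi> \<in> borel_measurable borel" using C2_smooth_measurable[OF C2] .
        fix a b :: real assume a: "1 / 2 \<le> a"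
        then have "D (\<lambda>x. \<phi> (a * x + b)) r \<le> J" using r by (intro J conc_test_affine \<phi>) auto
        then show "(\<integral>w. \<phi> (a * w + b) \<partial>F r) \<le> (J + e * r) + (M * exp (c * r)) * (\<integral>x. \<phi> (a * x + b) \<partial>lborel)"
          by (simp add: D_def)
      qed (use \<phi> J e0 r M in \<open>auto simp: conc_test_def\<close>)
      then have "D \<phi> r - J + (coll \<gamma> \<nu> (F r) \<phi> - M * (exp (c * r) * c) * \<Phi> - e) \<le> 0"
        by (simp add: D_def \<Phi>_def c_def e_def algebra_simps)
      then have "exp r * (D \<phi> r - J + (coll \<gamma> \<nu> (F r) \<phi> - M * (exp (c * r) * c) * \<Phi> - e)) \<le> 0"
        by (intro mult_nonneg_nonpos) auto
      then show ?thesis by (simp add: distrib_left)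
    qed
    have "exp t * (D \<phi> t - J) \<le> exp 0 * (((\<integral>w. \<phi> w \<partial>F0) - M * exp (c * 0) * \<Phi> - e * 0) - J)"
    proof (rule tendsto_lowerbound)
      show "((\<lambda>t. exp t * (D \<phi> t - J)) \<longlongrightarrow> exp 0 * (((\<integral>w. \<phi> w \<partial>F0) - M * exp (c * 0) * \<Phi> - e * 0) - J)) (at_right 0)"
        unfolding D_def \<Phi>_def by (intro tendsto_intros flow_C2(2)[OF C2])
      have "\<forall>\<^sub>F s in at_right 0. s < t" using t by (intro eventually_at_right_real[THEN eventually_mono]) auto
      moreover have "\<forall>\<^sub>F s in at_right (0::real). 0 < s" by (auto simp: eventually_at_filter)
      ultimately show "\<forall>\<^sub>F s in at_right 0. exp t * (D \<phi> t - J) \<le> exp s * (D \<phi> s - J)"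
      proof eventually_elim
        case (elim s)
        show ?case
          by (rule DERIV_nonpos_imp_nonincreasing[where f = "\<lambda>t. exp t * (D \<phi> t - J)"])
             (use elim t der neg in \<open>force+\<close>)
      qed
    qed simp
    also have "\<dots> \<le> J0 - J" using init_conc[OF \<phi>] by (simp add: \<Phi>_def)
    finally have "exp t * (D \<phi> t - J) \<le> J0 - J" .
    then have "D \<phi> t - J \<le> exp (- t) * (J0 - J)" by (simp add: exp_minus field_simps)
    also have "\<dots> \<le> exp (- T) * (J0 - J)" using t lt by (intro mult_right_mono_neg) auto
    finally show ?thesis by simp
  qed
  have "J \<le> J0"
  proof (rule ccontr)
    assume "\<not> J \<le> J0"
    then have lt: "J0 < J" by simp
    then have "J = Sup A" using J0 by (auto simp: J_def max_def split: if_splits)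
    also have "\<dots> \<le> J + exp (- T) * (J0 - J)" by (rule cSup_least[OF A_ne]) (use key lt in \<open>auto simp: A_def\<close>)
    finally have "0 \<le> exp (- T) * (J0 - J)" by simp
    then show False using lt by (simp add: zero_le_mult_iff)
  qed
  moreover have "D \<phi> t \<le> J" using J(2)[OF \<phi>, of t] False t by (simp add: T_def)
  ultimately show ?thesis by (simp add: D_def c_def e_def)
qed

end

section \<open>Weak convergence and moments\<close>

lemma wealth_mono:
  assumes "wealth p F" "0 \<le> r" "r \<le> p" shows "wealth r F"
proof -
  note F = wealthD[OF assms(1)]
  interpret real_distribution F by (rule F)
  have "integrable F (\<lambda>w. \<bar>w\<bar> powr r)"
  proof (rule Bochner_Integration.integrable_bound)
    show "integrable F (\<lambda>w. 1 + \<bar>w\<bar> powr p)" using F by simp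
    show "AE w in F. norm (\<bar>w\<bar> powr r) \<le> norm (1 + \<bar>w\<bar> powr p)"
      using powr_le_1_powr[OF assms(2,3)] by (intro AE_I2) simp
  qed simp
  with assms(1) show ?thesis by (auto simp: wealth_def moment_measures_def)
qed

lemma wealthI:
  assumes "real_distribution F" "AE w in F. 0 \<le> w" "integrable F (\<lambda>w. \<bar>w\<bar> powr p)"
  shows "wealth p F"
proof -
  interpret real_distribution F by fact
  have "emeasure F {w \<in> space F. \<not> 0 \<le> w} = 0" using assms(2) by (subst (asm) AE_iff_measurable[OF _ refl]) auto
  moreover have "{w \<in> space F. \<not> 0 \<le> w} = {..<0}" by auto
  ultimately show ?thesis using assms by (auto simp: wealth_def moment_measures_def)
qed

text \<open>Fatou's lemma along weak convergence: truncations at level \<open>N\<close> are bounded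
  and continuous, so they pass to the limit, and monotone convergence removes the
  truncation.\<close>

lemma weak_limit_fatou:
  fixes g :: "real \<Rightarrow> real"
  assumes \<mu>: "\<And>n. real_distribution (\<mu> n)" and G: "real_distribution G" and w: "weak_conv_m \<mu> G"
    and g: "continuous_on UNIV g" "\<And>x. 0 \<le> g x" and i: "\<And>n. integrable (\<mu> n) g" and K: "\<And>n. (\<integral>x. g x \<partial>\<mu> n) \<le> K"
  shows "integrable G g" "(\<integral>x. g x \<partial>G) \<le> K"
proof -
  interpret G: real_distribution G by fact
  have [measurable]: "g \<in> borel_measurable borel" using g(1) by (rule borel_measurable_continuous_onI)

  define h where "h N x = min (g x) (real N)" for N x
  have h01: "0 \<le> h N x" "h N x \<le> real N" "h N x \<le> g x" for N x using g(2) by (auto simp: h_def)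
  have [measurable]: "h N \<in> borel_measurable borel" for N unfolding h_def[abs_def] by measurable
  have hG: "(\<integral>x. h N x \<partial>G) \<le> K" for N
  proof (rule LIMSEQ_le_const2)
    show "(\<lambda>n. \<integral>x. h N x \<partial>\<mu> n) \<longlonglongrightarrow> (\<integral>x. h N x \<partial>G)"
    proof (rule weak_conv_imp_integral_bdd_continuous_conv[OF \<mu> G w])
      show "isCont (h N) x" for x unfolding h_def
        using g(1) by (intro continuous_intros) (simp add: continuous_on_eq_continuous_at)
      show "norm (h N x) \<le> real N" for x using h01[of N x] by simp
    qed
    have "(\<integral>x. h N x \<partial>\<mu> n) \<le> K" for n
    proof -
      interpret \<mu>: real_distribution "\<mu> n" by (rule \<mu>)
      have "integrable (\<mu> n) (h N)" by (rule \<mu>.integrable_const_bound[of _ "real N"]) (use h01 in auto)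
      then have "(\<integral>x. h N x \<partial>\<mu> n) \<le> (\<integral>x. g x \<partial>\<mu> n)" using i h01 by (intro integral_mono) auto
      with K[of n] show ?thesis by simp
    qed
    then show "\<exists>n0. \<forall>n\<ge>n0. (\<integral>x. h N x \<partial>\<mu> n) \<le> K" by blast
  qed
  have hi: "integrable G (h N)" for N by (rule G.integrable_const_bound[of _ "real N"]) (use h01 in auto)
  have lim: "(\<lambda>N. h N x) \<longlonglongrightarrow> g x" for x
  proof (rule tendsto_eventually)
    obtain N0 where "g x \<le> real N0" using real_arch_simple by blast
    then show "\<forall>\<^sub>F N in sequentially. h N x = g x"
      by (intro eventually_sequentiallyI[of N0]) (simp add: h_def min_def)
  qed
  have mono: "mono (\<lambda>N. \<integral>x. h N x \<partial>G)" by (intro monoI integral_mono hi) (auto simp: h_def min_def)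
  have bdd: "bdd_above (range (\<lambda>N. \<integral>x. h N x \<partial>G))" using hG by (intro bdd_aboveI[of _ K]) auto
  have conv: "(\<lambda>N. \<integral>x. h N x \<partial>G) \<longlonglongrightarrow> (SUP N. \<integral>x. h N x \<partial>G)" by (rule LIMSEQ_incseq_SUP[OF bdd mono])
  have mc: "AE x in G. mono (\<lambda>N. h N x)" by (intro AE_I2 monoI) (auto simp: h_def min_def)
  note m = integrable_monotone_convergence[OF hi mc _ conv] integral_monotone_convergence[OF hi mc _ conv]
  show "integrable G g" by (rule m(1)) (use lim in auto)
  have "(\<integral>x. g x \<partial>G) = (SUP N. \<integral>x. h N x \<partial>G)" by (rule m(2)) (use lim in auto)
  also have "\<dots> \<le> K" using hG by (intro cSUP_least) auto
  finally show "(\<integral>x. g x \<partial>G) \<le> K" .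
qed

text \<open>The limit puts no mass on negative numbers because the bounded continuous function
  \<open>min 1 (max 0 (- x))\<close> is positive exactly there and integrates to 0 along the
  sequence.\<close>

lemma wealth_weak_limit:
  assumes \<mu>: "\<And>n. wealth p (\<mu> n)" and G: "real_distribution G" and w: "weak_conv_m \<mu> G"
    and p: "0 < p" and K: "\<And>n. (\<integral>x. x powr p \<partial>\<mu> n) \<le> K"
  shows "wealth p G" "(\<integral>x. x powr p \<partial>G) \<le> K"
proof -
  interpret G: real_distribution G by fact
  note rd = wealthD(1)[OF \<mu>]
  have c: "continuous_on UNIV (\<lambda>x. \<bar>x\<bar> powr p)"
    using p by (intro continuous_on_powr' continuous_intros) auto
  have K': "(\<integral>x. \<bar>x\<bar> powr p \<partial>\<mu> n) \<le> K" for n using K[of n] wealth_moment_eq[OF \<mu>] by simp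
  note f = weak_limit_fatou[OF rd G w c _ wealthD(6)[OF \<mu>] K']
  have "(\<lambda>n. \<integral>x. min 1 (max 0 (- x)) \<partial>\<mu> n) \<longlonglongrightarrow> (\<integral>x. min 1 (max 0 (- x)) \<partial>G)"
    by (rule weak_conv_imp_integral_bdd_continuous_conv[OF rd G w, of _ 1]) (auto intro!: continuous_intros)
  moreover have "(\<integral>x. min 1 (max 0 (- x)) \<partial>\<mu> n) = 0" for n
  proof -
    interpret \<mu>: real_distribution "\<mu> n" by (rule rd)
    have "(\<integral>x. min 1 (max 0 (- x)) \<partial>\<mu> n) = (\<integral>x. 0 \<partial>\<mu> n)"
      using wealthD(5)[OF \<mu>[of n]] by (intro integral_cong_AE) auto
    then show ?thesis by simp
  qed
  ultimately have z: "(\<integral>x. min 1 (max 0 (- x)) \<partial>G) = 0" by (simp add: LIMSEQ_const_iff)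
  have "integrable G (\<lambda>x. min 1 (max 0 (- x)))" by (rule G.integrable_const_bound[of _ 1]) auto
  with z have "AE x in G. min 1 (max 0 (- x)) = 0" by (subst (asm) integral_nonneg_eq_0_iff_AE) auto
  then have nn: "AE x in G. 0 \<le> x" by eventually_elim (auto simp: min_def max_def split: if_splits)
  show wG: "wealth p G" by (rule wealthI[OF G nn]) (use f in simp)
  show "(\<integral>x. x powr p \<partial>G) \<le> K" using f(2) wealth_moment_eq[OF wG] by simp
qed

text \<open>If it failed infinitely often, the Fatou bound along the corresponding subsequence would
  be violated.\<close>

lemma weak_liminf:
  fixes g :: "real \<Rightarrow> real"
  assumes \<mu>: "\<And>n. real_distribution (\<mu> n)" and G: "real_distribution G" and w: "weak_conv_m \<mu> G"
    and g: "continuous_on UNIV g" "\<And>x. 0 \<le> g x" and i: "\<And>n. integrable (\<mu> n) g" "integrable G g" and e: "0 < e"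
  shows "\<forall>\<^sub>F n in sequentially. (\<integral>x. g x \<partial>G) - e < (\<integral>x. g x \<partial>\<mu> n)"
proof (rule ccontr)
  assume "\<not> ?thesis"
  then have "\<exists>\<^sub>F n in sequentially. (\<integral>x. g x \<partial>\<mu> n) \<le> (\<integral>x. g x \<partial>G) - e"
    unfolding not_eventually not_less .
  then have "infinite {n. (\<integral>x. g x \<partial>\<mu> n) \<le> (\<integral>x. g x \<partial>G) - e}"
    by (simp add: frequently_cofinite[symmetric] cofinite_eq_sequentially)
  from infinite_enumerate[OF this] obtain s :: "nat \<Rightarrow> nat" where s: "strict_mono s"
    "\<And>n. (\<integral>x. g x \<partial>\<mu> (s n)) \<le> (\<integral>x. g x \<partial>G) - e" by auto
  have ws: "weak_conv_m (\<lambda>n. \<mu> (s n)) G"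
    using w s(1) unfolding weak_conv_m_def weak_conv_def by (auto intro: LIMSEQ_subseq_LIMSEQ[unfolded o_def])
  have "(\<integral>x. g x \<partial>G) \<le> (\<integral>x. g x \<partial>G) - e"
    by (rule weak_limit_fatou(2)[OF \<mu> G ws g i(1) s(2)])
  then show False using e by simp
qed

text \<open>Lower semicontinuity is applied to \<open>h + \<psi>'\<close> and
  \<open>h - \<psi>'\<close>, where \<open>h\<close> dominates and its integrals converge by the
  hypothesis on moments of order \<open>p\<close>. The reflection \<open>\<psi>'\<close> extends the
  growth bound, known only on \<open>{0..}\<close>, to the line.\<close>

lemma weak_conv_growth:
  assumes \<mu>: "\<And>n. wealth p (\<mu> n)" and G: "wealth p G" and w: "weak_conv_m \<mu> G" and p: "0 < p"
    and m: "(\<lambda>n. \<integral>x. x powr p \<partial>\<mu> n) \<longlonglongrightarrow> (\<integral>x. x powr p \<partial>G)"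
    and \<psi>: "continuous_on UNIV \<psi>" "growth p \<psi>"
  shows "(\<lambda>n. \<integral>x. \<psi> x \<partial>\<mu> n) \<longlonglongrightarrow> (\<integral>x. \<psi> x \<partial>G)"
proof -
  note rd = wealthD(1)[OF \<mu>] and rG = wealthD(1)[OF G]
  obtain C where C: "C \<ge> 0" "\<And>x. x \<ge> 0 \<Longrightarrow> \<bar>\<psi> x\<bar> \<le> C * (1 + x powr p)" using growthE[OF \<psi>(2)] by blast
  define \<psi>' where "\<psi>' x = \<psi> \<bar>x\<bar>" for x
  have \<psi>'c: "continuous_on UNIV \<psi>'" unfolding \<psi>'_def
    by (rule continuous_on_compose2[OF \<psi>(1)]) (auto intro!: continuous_intros)
  have \<psi>'g: "growth p \<psi>'" by (rule growthI[of _ C]) (use C in \<open>auto simp: \<psi>'_def\<close>)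
  have \<psi>m: "\<psi> \<in> borel_measurable borel" "\<psi>' \<in> borel_measurable borel"
    using \<psi>(1) \<psi>'c by (auto intro: borel_measurable_continuous_onI)
  define h where "h x = C * (1 + \<bar>x\<bar> powr p)" for x
  have hc: "continuous_on UNIV h" unfolding h_def using p by (intro continuous_intros continuous_on_powr') auto
  have hi: "integrable H h" "(\<integral>x. h x \<partial>H) = C * (1 + (\<integral>x. x powr p \<partial>H))" if H: "wealth p H" for H
  proof -
    interpret H: real_distribution H by (rule wealthD[OF H])
    show "integrable H h" unfolding h_def using wealthD(6)[OF H] by simp
    show "(\<integral>x. h x \<partial>H) = C * (1 + (\<integral>x. x powr p \<partial>H))"
      unfolding h_def using wealthD(6)[OF H] H.prob_space wealth_moment_eq[OF H] by simp
  qed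
  have \<psi>i: "integrable H \<psi>'" "(\<integral>x. \<psi>' x \<partial>H) = (\<integral>x. \<psi> x \<partial>H)" if H: "wealth p H" for H
  proof -
    interpret H: real_distribution H by (rule wealthD[OF H])
    show "integrable H \<psi>'" by (rule wealth_integrable[OF H \<psi>m(2) \<psi>'g])
    show "(\<integral>x. \<psi>' x \<partial>H) = (\<integral>x. \<psi> x \<partial>H)"
      using wealthD(5)[OF H] \<psi>m by (intro integral_cong_AE) (auto simp: \<psi>'_def)
  qed
  have hl: "(\<lambda>n. \<integral>x. h x \<partial>\<mu> n) \<longlonglongrightarrow> (\<integral>x. h x \<partial>G)" unfolding hi(2)[OF \<mu>] hi(2)[OF G] by (intro tendsto_intros m)
  have nn: "0 \<le> h x + \<psi>' x" "0 \<le> h x - \<psi>' x" for x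
    using C(2)[of "\<bar>x\<bar>"] by (auto simp: h_def \<psi>'_def abs_le_iff)
  have "(\<lambda>n. \<integral>x. \<psi>' x \<partial>\<mu> n) \<longlonglongrightarrow> (\<integral>x. \<psi>' x \<partial>G)"
  proof (rule tendstoI)
    fix e :: real assume e: "0 < e"
    have 1: "\<forall>\<^sub>F n in sequentially. (\<integral>x. h x + \<psi>' x \<partial>G) - e / 2 < (\<integral>x. h x + \<psi>' x \<partial>\<mu> n)"
      by (rule weak_liminf[OF rd rG w]) (use nn hi \<psi>i \<mu> G e in \<open>auto intro!: continuous_intros hc \<psi>'c\<close>)
    have 2: "\<forall>\<^sub>F n in sequentially. (\<integral>x. h x - \<psi>' x \<partial>G) - e / 2 < (\<integral>x. h x - \<psi>' x \<partial>\<mu> n)"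
      by (rule weak_liminf[OF rd rG w]) (use nn hi \<psi>i \<mu> G e in \<open>auto intro!: continuous_intros hc \<psi>'c\<close>)
    have 3: "\<forall>\<^sub>F n in sequentially. dist (\<integral>x. h x \<partial>\<mu> n) (\<integral>x. h x \<partial>G) < e / 2"
      by (rule tendstoD[OF hl]) (use e in simp)
    from 1 2 3 show "\<forall>\<^sub>F n in sequentially. dist (\<integral>x. \<psi>' x \<partial>\<mu> n) (\<integral>x. \<psi>' x \<partial>G) < e"
    proof eventually_elim
      case (elim n)
      have a: "(\<integral>x. h x + \<psi>' x \<partial>H) = (\<integral>x. h x \<partial>H) + (\<integral>x. \<psi>' x \<partial>H)" "(\<integral>x. h x - \<psi>' x \<partial>H) = (\<integral>x. h x \<partial>H) - (\<integral>x. \<psi>' x \<partial>H)"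
        if "wealth p H" for H using hi(1)[OF that] \<psi>i(1)[OF that] by auto
      show ?case using elim unfolding a[OF \<mu>] a[OF G] dist_real_def by linarith
    qed
  qed
  then show ?thesis by (simp add: \<psi>i(2)[OF \<mu>] \<psi>i(2)[OF G])
qed

text \<open>Below order \<open>p\<close> a bound on the moments of order \<open>p\<close> replaces
  their convergence, because truncating at \<open>N\<close> costs at most
  \<open>N powr (r - p) * K\<close> uniformly.\<close>

lemma weak_conv_lower_moment:
  assumes \<mu>: "\<And>n. wealth p (\<mu> n)" and G: "real_distribution G" and w: "weak_conv_m \<mu> G"
    and r: "0 < r" "r < p" and K: "\<And>n. (\<integral>x. x powr p \<partial>\<mu> n) \<le> K"
  shows "(\<lambda>n. \<integral>x. x powr r \<partial>\<mu> n) \<longlonglongrightarrow> (\<integral>x. x powr r \<partial>G)"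
proof -
  have p: "0 < p" using r by simp
  note wG = wealth_weak_limit[OF \<mu> G w p K]
  define h where "h N x = min (\<bar>x\<bar> powr r) (N powr r)" for N x :: real
  have near: "\<bar>(\<integral>x. h N x \<partial>H) - (\<integral>x. x powr r \<partial>H)\<bar> \<le> N powr (r - p) * K"
    if H: "wealth p H" "(\<integral>x. x powr p \<partial>H) \<le> K" and N: "0 < N" for H N
  proof -
    interpret H: real_distribution H by (rule wealthD[OF H(1)])
    have i: "integrable H (\<lambda>x. \<bar>x\<bar> powr r)" using wealthD(6)[OF wealth_mono[OF H(1), of r]] r by simp
    have "\<bar>(\<integral>x. h N x \<partial>H) - (\<integral>x. \<bar>x\<bar> powr r \<partial>H)\<bar> \<le> (\<integral>x. N powr (r - p) * \<bar>x\<bar> powr p \<partial>H)"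
    proof (rule integral_near[OF i])
      show "integrable H (\<lambda>x. N powr (r - p) * \<bar>x\<bar> powr p)" using wealthD(6)[OF H(1)] by simp
      show "h N \<in> borel_measurable H" unfolding h_def[abs_def] by measurable
      have "\<bar>h N x - \<bar>x\<bar> powr r\<bar> \<le> N powr (r - p) * \<bar>x\<bar> powr p" for x
      proof (cases "\<bar>x\<bar> \<le> N")
        case True
        then have "\<bar>x\<bar> powr r \<le> N powr r" using r by (intro powr_mono2) auto
        then show ?thesis by (simp add: h_def)
      next
        case False
        then have "N powr r \<le> \<bar>x\<bar> powr r" using r N by (intro powr_mono2) auto
        then have "\<bar>h N x - \<bar>x\<bar> powr r\<bar> \<le> \<bar>x\<bar> powr r" by (simp add: h_def min_def)
        also have "\<dots> = \<bar>x\<bar> powr (r - p) * \<bar>x\<bar> powr p" using False N by (simp flip: powr_add)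
        also have "\<dots> \<le> N powr (r - p) * \<bar>x\<bar> powr p"
          using False N r by (intro mult_right_mono powr_mono2') auto
        finally show ?thesis .
      qed
      then show "AE x in H. \<bar>h N x - \<bar>x\<bar> powr r\<bar> \<le> N powr (r - p) * \<bar>x\<bar> powr p" by simp
    qed
    also have "\<dots> = N powr (r - p) * (\<integral>x. x powr p \<partial>H)" using wealth_moment_eq[OF H(1)] by simp
    also have "\<dots> \<le> N powr (r - p) * K" using H by (intro mult_left_mono) auto
    finally show ?thesis using wealth_moment_eq[OF wealth_mono[OF H(1), of r], of r] r by simp
  qed
  have "((\<lambda>N::real. N powr (r - p) * K) \<longlongrightarrow> 0 * K) at_top"
    using r by (intro tendsto_intros tendsto_neg_powr filterlim_ident) auto
  then have small: "\<forall>\<^sub>F N in at_top. \<bar>N powr (r - p) * K\<bar> < e" if "0 < e" for e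
    using tendstoD[OF _ that] by fastforce
  show ?thesis
  proof (rule tendstoI)
    fix e :: real assume e: "0 < e"
    have "\<forall>\<^sub>F N in at_top. \<bar>N powr (r - p) * K\<bar> < e / 3 \<and> (0::real) < N"
      using small[of "e / 3"] e eventually_gt_at_top[of "0::real"] by (auto elim: eventually_conj)
    then obtain N where N: "\<bar>N powr (r - p) * K\<bar> < e / 3" "0 < N"
      using eventually_happens' by (metis (no_types, lifting) trivial_limit_at_top_linorder)
    have "(\<lambda>n. \<integral>x. h N x \<partial>\<mu> n) \<longlonglongrightarrow> (\<integral>x. h N x \<partial>G)"
    proof (rule weak_conv_imp_integral_bdd_continuous_conv[OF wealthD(1)[OF \<mu>] G w])
      have "continuous_on UNIV (h N)" unfolding h_def using r by (intro continuous_intros continuous_on_powr') auto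
      then show "isCont (h N) x" for x by (simp add: continuous_on_eq_continuous_at)
      show "norm (h N x) \<le> N powr r" for x by (auto simp: h_def)
    qed
    then have "\<forall>\<^sub>F n in sequentially. dist (\<integral>x. h N x \<partial>\<mu> n) (\<integral>x. h N x \<partial>G) < e / 3"
      by (rule tendstoD) (use e in simp)
    then show "\<forall>\<^sub>F n in sequentially. dist (\<integral>x. x powr r \<partial>\<mu> n) (\<integral>x. x powr r \<partial>G) < e"
    proof eventually_elim
      case (elim n)
      show ?case using elim near[OF \<mu> K N(2), of n] near[OF wG N(2)] N(1) unfolding dist_real_def by linarith
    qed
  qed
qed

lemma weak_conv_lower_growth:
  assumes \<mu>: "\<And>n. wealth p (\<mu> n)" and G: "real_distribution G" and w: "weak_conv_m \<mu> G"
    and r: "0 < r" "r < p" and K: "\<And>n. (\<integral>x. x powr p \<partial>\<mu> n) \<le> K"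
    and \<psi>: "continuous_on UNIV \<psi>" "growth r \<psi>"
  shows "(\<lambda>n. \<integral>x. \<psi> x \<partial>\<mu> n) \<longlonglongrightarrow> (\<integral>x. \<psi> x \<partial>G)"
proof -
  have "wealth p G" using wealth_weak_limit(1)[OF \<mu> G w _ K] r by simp
  then show ?thesis
    using weak_conv_growth[OF wealth_mono[OF \<mu>] wealth_mono w _ weak_conv_lower_moment[OF \<mu> G w r K] \<psi>] r by simp
qed

section \<open>Tightness and compactness of curves of measures\<close>

lemma tight_of_moment_bound:
  assumes \<mu>: "\<And>n. wealth p (\<mu> n)" and p: "0 < p" and K: "\<And>n. (\<integral>x. x powr p \<partial>\<mu> n) \<le> K"
  shows "tight \<mu>"
  unfolding tight_def
proof (intro conjI allI impI)
  show "real_distribution (\<mu> n)" for n by (rule wealthD[OF \<mu>])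
  fix e :: real assume e: "0 < e"
  have "((\<lambda>N::real. N powr (- p) * K) \<longlongrightarrow> 0 * K) at_top"
    using p by (intro tendsto_intros tendsto_neg_powr filterlim_ident) auto
  then have "\<forall>\<^sub>F N in at_top. \<bar>N powr (- p) * K\<bar> < e" using tendstoD[OF _ e] by fastforce
  then have "\<forall>\<^sub>F N in at_top. \<bar>N powr (- p) * K\<bar> < e \<and> (0::real) < N"
    using eventually_gt_at_top[of "0::real"] by (rule eventually_conj)
  then obtain N where N: "\<bar>N powr (- p) * K\<bar> < e" "0 < N"
    using eventually_happens' by (metis (no_types, lifting) trivial_limit_at_top_linorder)
  show "\<exists>a b. a < b \<and> (\<forall>n. 1 - e < measure (\<mu> n) {a<..b})"
  proof (intro exI conjI allI)
    \<comment> \<open>Any negative left end would do, the measures being carried by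
      \<open>{0..}\<close>.\<close>
    show "-1 < N" using N by simp
    fix n
    interpret M: real_distribution "\<mu> n" by (rule wealthD[OF \<mu>])
    have "M.prob {N<..} \<le> (\<integral>x. N powr (- p) * \<bar>x\<bar> powr p \<partial>\<mu> n)"
    proof -
      have "M.prob {N<..} = (\<integral>x. indicator {N<..} x \<partial>\<mu> n)" by simp
      also have "\<dots> \<le> (\<integral>x. N powr (- p) * \<bar>x\<bar> powr p \<partial>\<mu> n)"
      proof (rule integral_mono)
        show "integrable (\<mu> n) (indicator {N<..} :: real \<Rightarrow> real)" by (rule M.integrable_const_bound[of _ 1]) auto
        show "integrable (\<mu> n) (\<lambda>x. N powr (- p) * \<bar>x\<bar> powr p)" using wealthD(6)[OF \<mu>] by simp
        fix x
        show "indicator {N<..} x \<le> N powr (- p) * \<bar>x\<bar> powr p"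
        proof (cases "N < x")
          case True
          have "N powr p \<le> \<bar>x\<bar> powr p" using True N p by (intro powr_mono2) auto
          then have "N powr (- p) * N powr p \<le> N powr (- p) * \<bar>x\<bar> powr p" by (intro mult_left_mono) auto
          then show ?thesis using N True by (simp flip: powr_add)
        qed simp
      qed
      finally show ?thesis .
    qed
    also have "\<dots> = N powr (- p) * (\<integral>x. x powr p \<partial>\<mu> n)" using wealth_moment_eq[OF \<mu>] by simp
    also have "\<dots> \<le> N powr (- p) * K" using K by (intro mult_left_mono) auto
    finally have 1: "M.prob {N<..} < e" using N by simp
    have "AE x in \<mu> n. x \<notin> {..-1}" using wealthD(5)[OF \<mu>[of n]] by eventually_elim auto
    then have 2: "M.prob {..-1} = 0" by (simp add: M.prob_eq_0)
    have "UNIV = {..-1} \<union> ({-1<..N} \<union> {N<..})" using N by auto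
    then have "1 = M.prob ({..-1} \<union> ({-1<..N} \<union> {N<..}))" using M.prob_space by simp
    also have "\<dots> = M.prob {..-1} + (M.prob {-1<..N} + M.prob {N<..})"
      using N by (subst M.finite_measure_Union; (subst M.finite_measure_Union)?) auto
    finally show "1 - e < M.prob {-1<..N}" using 1 2 by simp
  qed
qed

text \<open>Diagonal extraction gives convergence at all nonnegative rational times; the uniform
  Lipschitz bound makes the integrals of smooth functions Cauchy at every other time along the same
  subsequence, and tightness turns these limits of integrals into measures.\<close>

lemma weak_compactness:
  fixes F :: "nat \<Rightarrow> real \<Rightarrow> real measure"
  assumes F: "\<And>n t. 0 \<le> t \<Longrightarrow> wealth p (F n t)" and p: "0 < p"
    and K: "\<And>n t. 0 \<le> t \<Longrightarrow> (\<integral>x. x powr p \<partial>F n t) \<le> K t"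
    and lip: "\<And>\<phi> T. bdd_smooth \<phi> \<Longrightarrow> 0 \<le> T \<Longrightarrow> \<exists>L. \<forall>n s t. 0 \<le> s \<longrightarrow> s \<le> T \<longrightarrow> 0 \<le> t \<longrightarrow> t \<le> T \<longrightarrow>
      \<bar>(\<integral>x. \<phi> x \<partial>F n t) - (\<integral>x. \<phi> x \<partial>F n s)\<bar> \<le> L * \<bar>t - s\<bar>"
  obtains r G where "strict_mono r" "\<And>t. 0 \<le> t \<Longrightarrow> real_distribution (G t)"
    "\<And>t. 0 \<le> t \<Longrightarrow> weak_conv_m (\<lambda>n. F (r n) t) (G t)"
proof -
  \<comment> \<open>An enumeration, with repetitions, of the nonnegative rationals.\<close>
  define q where "q k = \<bar>real_of_rat (nat_to_rat_surj k)\<bar>" for k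
  have q0: "0 \<le> q k" for k by (simp add: q_def)
  define P where "P k s \<longleftrightarrow> (\<exists>M. real_distribution M \<and> weak_conv_m (\<lambda>i. F (s i) (q k)) M)" for k and s :: "nat \<Rightarrow> nat"
  have tgt: "tight (\<lambda>n. F n t)" if "0 \<le> t" for t
    by (rule tight_of_moment_bound[OF F p K]) (use that in auto)
  interpret subseqs P
  proof
    fix k and s :: "nat \<Rightarrow> nat" assume s: "strict_mono s"
    from tight_imp_convergent_subsubsequence[OF tgt[OF q0] s]
    obtain r M where "strict_mono r" "real_distribution M" "weak_conv_m ((\<lambda>n. F n (q k)) \<circ> s \<circ> r) M" by blast
    then show "\<exists>r'. strict_mono r' \<and> P k (s \<circ> r')" by (auto simp: P_def o_def)
  qed
  define d where "d = diagseq"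
  have d: "strict_mono d" unfolding d_def by (rule subseq_diagseq)
  have qconv: "convergent (\<lambda>i. \<integral>x. \<phi> x \<partial>F (d i) (q k))" if s: "bdd_smooth \<phi>" for k \<phi>
  proof -
    \<comment> \<open>The property of index \<open>k\<close> is obtained for the tail of the
      diagonal sequence from \<open>Suc k\<close> on; a shift does not affect the limit.\<close>
    have "P k (diagseq \<circ> (+) (Suc k))"
    proof (rule diagseq_holds)
      fix n s and r :: "nat \<Rightarrow> nat" assume r: "strict_mono r" "P n s"
      then obtain M where M: "real_distribution M" "weak_conv_m (\<lambda>i. F (s i) (q n)) M" by (auto simp: P_def)
      have "weak_conv_m (\<lambda>i. F (s (r i)) (q n)) M"
        using M(2) r(1) unfolding weak_conv_m_def weak_conv_def by (auto intro: LIMSEQ_subseq_LIMSEQ[unfolded o_def])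
      with M show "P n (s \<circ> r)" by (auto simp: P_def)
    qed
    then obtain M where M: "real_distribution M" "weak_conv_m (\<lambda>i. F (d (Suc k + i)) (q k)) M" by (auto simp: P_def d_def)
    obtain B where "\<And>x. \<bar>\<phi> x\<bar> \<le> B" using bdd_smooth_bounded[OF s] by blast
    then have "(\<lambda>i. \<integral>x. \<phi> x \<partial>F (d (Suc k + i)) (q k)) \<longlonglongrightarrow> (\<integral>x. \<phi> x \<partial>M)"
      using bdd_smooth_continuous[OF s]
      by (intro weak_conv_imp_integral_bdd_continuous_conv[OF wealthD(1)[OF F[OF q0]] M])
         (auto simp: continuous_on_eq_continuous_at)
    then have "(\<lambda>i. \<integral>x. \<phi> x \<partial>F (d (i + Suc k)) (q k)) \<longlonglongrightarrow> (\<integral>x. \<phi> x \<partial>M)" by (simp add: add.commute)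
    then show ?thesis by (intro convergentI) (rule LIMSEQ_offset)
  qed
  have conv: "convergent (\<lambda>i. \<integral>x. \<phi> x \<partial>F (d i) t)" if s: "bdd_smooth \<phi>" and t: "0 \<le> t" for t \<phi>
  proof -
    obtain L where L: "\<And>n s u. 0 \<le> s \<Longrightarrow> s \<le> t + 1 \<Longrightarrow> 0 \<le> u \<Longrightarrow> u \<le> t + 1 \<Longrightarrow>
      \<bar>(\<integral>x. \<phi> x \<partial>F n u) - (\<integral>x. \<phi> x \<partial>F n s)\<bar> \<le> L * \<bar>u - s\<bar>" using lip[OF s, of "t + 1"] t by auto
    have "Cauchy (\<lambda>i. \<integral>x. \<phi> x \<partial>F (d i) t)"
    proof (rule metric_CauchyI)
      fix e :: real assume e: "0 < e"
      define \<epsilon> where "\<epsilon> = min 1 (e / (3 * (\<bar>L\<bar> + 1)))"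
      have \<epsilon>: "0 < \<epsilon>" using e by (simp add: \<epsilon>_def)
      obtain x where x: "x \<in> \<rat>" "t < x" "x < t + \<epsilon>" using Rats_dense_in_real[of t "t + \<epsilon>"] \<epsilon> by auto
      then obtain k where k: "q k = x"
      proof -
        from x(1) obtain y where y: "x = real_of_rat y" by (auto simp: Rats_def)
        then have "0 < real_of_rat y" using x t by linarith
        then have "\<bar>real_of_rat y\<bar> = real_of_rat y" by simp
        note y this
        moreover obtain k where "nat_to_rat_surj k = y" using surj_nat_to_rat_surj by (metis surjD)
        ultimately show ?thesis using that[of k] unfolding q_def by simp
      qed
      have close: "\<bar>(\<integral>x. \<phi> x \<partial>F n t) - (\<integral>x. \<phi> x \<partial>F n (q k))\<bar> < e / 3" for n
      proof -
        have "\<bar>(\<integral>x. \<phi> x \<partial>F n t) - (\<integral>x. \<phi> x \<partial>F n (q k))\<bar> \<le> L * \<bar>t - q k\<bar>"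
          using x k t by (intro L) (auto simp: \<epsilon>_def)
        also have "\<dots> \<le> (\<bar>L\<bar> + 1) * \<bar>t - q k\<bar>" by (intro mult_right_mono) auto
        also have "\<dots> < (\<bar>L\<bar> + 1) * \<epsilon>" using x k by (intro mult_strict_left_mono) auto
        also have "\<dots> \<le> (\<bar>L\<bar> + 1) * (e / (3 * (\<bar>L\<bar> + 1)))" by (intro mult_left_mono) (auto simp: \<epsilon>_def)
        also have "\<dots> = e / 3" by (simp add: field_simps)
        finally show ?thesis .
      qed
      obtain M where M: "\<And>m n. m \<ge> M \<Longrightarrow> n \<ge> M \<Longrightarrow> dist (\<integral>x. \<phi> x \<partial>F (d m) (q k)) (\<integral>x. \<phi> x \<partial>F (d n) (q k)) < e / 3"
        using metric_CauchyD[OF convergent_Cauchy[OF qconv[OF s]], of "e / 3" k] e by auto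
      have "dist (\<integral>x. \<phi> x \<partial>F (d m) t) (\<integral>x. \<phi> x \<partial>F (d n) t) < e" if "m \<ge> M" "n \<ge> M" for m n
        using M[OF that] close[of "d m"] close[of "d n"] unfolding dist_real_def by linarith
      then show "\<exists>M. \<forall>m\<ge>M. \<forall>n\<ge>M. dist (\<integral>x. \<phi> x \<partial>F (d m) t) (\<integral>x. \<phi> x \<partial>F (d n) t) < e" by blast
    qed
    then show ?thesis by (simp add: Cauchy_convergent_iff)
  qed
  have ex: "\<exists>M. real_distribution M \<and> weak_conv_m (\<lambda>n. F (d n) t) M" if t: "0 \<le> t" for t
  proof -
    from tight_imp_convergent_subsubsequence[OF tgt[OF t] d]
    obtain r M where r: "strict_mono r" "real_distribution M" "weak_conv_m ((\<lambda>n. F n t) \<circ> d \<circ> r) M" by blast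
    \<comment> \<open>\<open>M\<close> comes from a further subsequence that depends on
      \<open>t\<close>, but characteristic functions already converge along \<open>d\<close>, so
      \<open>M\<close> is the limit of the whole sequence.\<close>
    have "weak_conv_m (\<lambda>n. F (d n) t) M"
    proof (rule levy_continuity)
      show "real_distribution (F (d n) t)" for n by (rule wealthD[OF F[OF t]])
      show "real_distribution M" by fact
      fix \<xi>
      have s: "bdd_smooth (\<lambda>w. cos (\<xi> * w))" "bdd_smooth (\<lambda>w. sin (\<xi> * w))"
        using bdd_smooth_affine[OF bdd_smooth_cos, of \<xi> 0] bdd_smooth_affine[OF bdd_smooth_sin, of \<xi> 0] by auto
      from conv[OF s(1) t] conv[OF s(2) t] obtain a b where ab: "(\<lambda>i. \<integral>x. cos (\<xi> * x) \<partial>F (d i) t) \<longlonglongrightarrow> a"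
        "(\<lambda>i. \<integral>x. sin (\<xi> * x) \<partial>F (d i) t) \<longlonglongrightarrow> b" by (auto simp: convergent_def)
      have l: "(\<lambda>i. char (F (d i) t) \<xi>) \<longlonglongrightarrow> Complex a b"
        unfolding char_eq[OF wealthD(1)[OF F[OF t]]] by (intro tendsto_Complex ab)
      have "(\<lambda>i. char (F (d (r i)) t) \<xi>) \<longlonglongrightarrow> Complex a b" using LIMSEQ_subseq_LIMSEQ[OF l r(1)] by (simp add: o_def)
      moreover have "(\<lambda>i. char (F (d (r i)) t) \<xi>) \<longlonglongrightarrow> char M \<xi>"
        using levy_continuity1[OF _ r(2), of "\<lambda>i. F (d (r i)) t"] r(3) wealthD(1)[OF F[OF t]] by (auto simp: o_def)
      ultimately have "char M \<xi> = Complex a b" by (rule LIMSEQ_unique[rotated])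
      with l show "(\<lambda>i. char (F (d i) t) \<xi>) \<longlonglongrightarrow> char M \<xi>" by simp
    qed
    with r(2) show ?thesis by blast
  qed
  define G where "G t = (SOME M. real_distribution M \<and> weak_conv_m (\<lambda>n. F (d n) t) M)" for t
  have "real_distribution (G t) \<and> weak_conv_m (\<lambda>n. F (d n) t) (G t)" if "0 \<le> t" for t
    unfolding G_def by (rule someI_ex[OF ex[OF that]])
  then show ?thesis using that[OF d, of G] by blast
qed

section \<open>Absolute continuity\<close>

lemma sech2_integral: "integrable lborel (\<lambda>x::real. 1 - (tanh x)\<^sup>2)" "(\<integral>x. 1 - (tanh x)\<^sup>2 \<partial>lborel) = (2::real)"
proof -
  have le: "(tanh x)\<^sup>2 \<le> 1" for x :: real
    using tanh_real_lt_1[of x] tanh_real_gt_neg1[of x] by (simp add: abs_square_le_1 abs_le_iff)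
  have d: "DERIV tanh x :> 1 - (tanh x)\<^sup>2" for x :: real by (auto intro!: derivative_eq_intros)
  have c: "isCont (\<lambda>x. 1 - (tanh x)\<^sup>2) x" for x :: real by (intro continuous_intros isCont_tanh) auto
  note F = interval_integral_FTC_nonneg[of "-\<infinity>" "\<infinity>" tanh "\<lambda>x. 1 - (tanh x)\<^sup>2" "-1" 1]
  have A: "((tanh \<circ> real_of_ereal) \<longlongrightarrow> - 1) (at_right (- \<infinity>))" "((tanh \<circ> real_of_ereal) \<longlongrightarrow> (1::real)) (at_left \<infinity>)"
    using tanh_real_at_bot tanh_real_at_top by (simp_all add: ereal_tendsto_simps)
  have "set_integrable lborel (einterval (-\<infinity>) \<infinity>) (\<lambda>x::real. 1 - (tanh x)\<^sup>2)"
    by (rule F(1)) (use d c le A in auto)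
  then show "integrable lborel (\<lambda>x::real. 1 - (tanh x)\<^sup>2)" by (simp add: set_integrable_def)
  have "(LBINT x=-\<infinity>..\<infinity>. 1 - (tanh x)\<^sup>2) = 1 - (-1::real)"
    by (rule F(2)) (use d c le A in auto)
  then show "(\<integral>x. 1 - (tanh x)\<^sup>2 \<partial>lborel) = (2::real)"
    by (simp add: interval_lebesgue_integral_def set_lebesgue_integral_def)
qed

text \<open>The squared hyperbolic secant, centred at \<open>c\<close> with width \<open>l\<close>:
  a member of the smooth class whose integral is the length of \<open>{c - l..c + l}\<close> and
  which is at least \<open>1 - (tanh 1)\<^sup>2\<close> on that interval.\<close>

definition bump :: "real \<Rightarrow> real \<Rightarrow> real \<Rightarrow> real" where
  "bump c l x = 1 - (tanh (1 / l * x + - (c / l)))\<^sup>2"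

lemma bump_props:
  assumes l: "0 < l"
  shows "bdd_smooth (bump c l)" "0 \<le> bump c l x" "bump c l x \<le> 1"
    "integrable lborel (bump c l)" "(\<integral>x. bump c l x \<partial>lborel) = 2 * l"
    "\<bar>x - c\<bar> \<le> l \<Longrightarrow> 1 - (tanh 1)\<^sup>2 \<le> bump c l x"
proof -
  show "bdd_smooth (bump c l)" unfolding bump_def
    by (intro bdd_smooth_intros bdd_smooth_affine[OF bdd_smooth_tanh])
  show "0 \<le> bump c l x"
    using tanh_real_lt_1[of "1 / l * x + - (c / l)"] tanh_real_gt_neg1[of "1 / l * x + - (c / l)"]
    by (simp add: bump_def abs_square_le_1 abs_le_iff)
  show "bump c l x \<le> 1" by (simp add: bump_def)
  have e: "bump c l = (\<lambda>x. (\<lambda>x. 1 - (tanh x)\<^sup>2) (- (c / l) + 1 / l * x))" by (auto simp: bump_def add.commute)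
  show "integrable lborel (bump c l)" unfolding e
    by (rule lborel_integrable_real_affine[OF sech2_integral(1)]) (use l in simp)
  have "(2::real) = \<bar>1 / l\<bar> *\<^sub>R (\<integral>x. bump c l x \<partial>lborel)"
    using lborel_integral_real_affine[of "1 / l" "\<lambda>x. 1 - (tanh x)\<^sup>2" "- (c / l)"] l
    unfolding sech2_integral(2) e by simp
  then show "(\<integral>x. bump c l x \<partial>lborel) = 2 * l" using l by (simp add: field_simps)
  assume "\<bar>x - c\<bar> \<le> l"
  then have "\<bar>(x - c) / l\<bar> \<le> 1" using l by simp
  then have t: "-1 \<le> 1 / l * x + - (c / l)" "1 / l * x + - (c / l) \<le> 1"
    by (auto simp: abs_le_iff diff_divide_distrib)
  have "tanh (1 / l * x + - (c / l)) \<le> tanh 1" "tanh (- 1) \<le> tanh (1 / l * x + - (c / l))"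
    using t by (simp_all only: tanh_real_le_iff)
  then have "\<bar>tanh (1 / l * x + - (c / l))\<bar> \<le> tanh 1" by (auto simp: abs_le_iff)
  then have "(tanh (1 / l * x + - (c / l)))\<^sup>2 \<le> (tanh 1)\<^sup>2" using abs_le_square_iff[of "tanh (1 / l * x + - (c / l))" "tanh 1"] by simp
  then show "1 - (tanh 1)\<^sup>2 \<le> bump c l x" by (simp add: bump_def)
qed

lemma one_minus_prod_le_sum:
  fixes b :: "'a \<Rightarrow> real"
  assumes "finite A" "\<And>i. i \<in> A \<Longrightarrow> 0 \<le> b i" "\<And>i. i \<in> A \<Longrightarrow> b i \<le> 1"
  shows "1 - (\<Prod>i\<in>A. 1 - b i) \<le> (\<Sum>i\<in>A. b i)"
  using assms
proof (induction A rule: finite_induct)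
  case (insert i A)
  have P: "0 \<le> (\<Prod>i\<in>A. 1 - b i)" "(\<Prod>i\<in>A. 1 - b i) \<le> 1"
    using insert.prems by (auto intro!: prod_nonneg prod_le_1)
  have "b i * (\<Prod>i\<in>A. 1 - b i) \<le> b i * 1" using P insert.prems by (intro mult_left_mono) auto
  moreover have "1 - (\<Prod>i\<in>A. 1 - b i) \<le> (\<Sum>i\<in>A. b i)" using insert by simp
  ultimately show ?case using insert.hyps by (simp add: algebra_simps)
qed simp

text \<open>One minus the product of the factors \<open>1 - b i x\<close> replaces the indicator of
  the union: it stays between 0 and 1, is at least each bump and at most their sum.\<close>

lemma concentration_imp_interval_union:
  assumes G: "real_distribution G" and J: "0 \<le> K" and D: "finite D" "\<And>c l. (c, l) \<in> D \<Longrightarrow> 0 < l"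
    and conc: "\<And>\<phi>. conc_test \<phi> \<Longrightarrow> (\<integral>x. \<phi> x \<partial>G) \<le> J + K * (\<integral>x. \<phi> x \<partial>lborel)"
  shows "(1 - (tanh 1)\<^sup>2) * measure G (\<Union>(c, l)\<in>D. {c - l..c + l}) \<le> J + K * (\<Sum>(c, l)\<in>D. 2 * l)"
proof -
  interpret G: real_distribution G by fact
  define b where "b i = (case i of (c, l) \<Rightarrow> bump c l)" for i
  have b: "bdd_smooth (b i)" "0 \<le> b i x" "b i x \<le> 1" "integrable lborel (b i)" "(\<integral>x. b i x \<partial>lborel) = 2 * snd i"
    if "i \<in> D" for i x
    using bump_props[OF D(2)[of "fst i" "snd i"]] that by (auto simp: b_def case_prod_beta')
  define \<phi> where "\<phi> x = 1 - (\<Prod>i\<in>D. 1 - b i x)" for x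
  have \<phi>s: "bdd_smooth \<phi>" unfolding \<phi>_def using b by (intro bdd_smooth_intros) auto
  have P: "0 \<le> (\<Prod>i\<in>D. 1 - b i x)" "(\<Prod>i\<in>D. 1 - b i x) \<le> 1" for x using b by (auto intro!: prod_nonneg prod_le_1)
  have le: "\<phi> x \<le> (\<Sum>i\<in>D. b i x)" for x unfolding \<phi>_def using D b by (intro one_minus_prod_le_sum) auto
  have si: "integrable lborel (\<lambda>x. \<Sum>i\<in>D. b i x)" using b by simp
  have \<phi>i: "integrable lborel \<phi>"
    by (rule Bochner_Integration.integrable_bound[OF si])
       (use P le bdd_smooth_measurable[OF \<phi>s] in \<open>auto simp: \<phi>_def abs_le_iff intro!: AE_I2 order_trans[OF _ abs_ge_self]\<close>)
  have ct: "conc_test \<phi>" using \<phi>s \<phi>i P by (auto simp: conc_test_def \<phi>_def)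
  have lower: "(1 - (tanh 1)\<^sup>2) * indicator (\<Union>(c, l)\<in>D. {c - l..c + l}) x \<le> \<phi> x" for x
  proof (cases "x \<in> (\<Union>(c, l)\<in>D. {c - l..c + l})")
    case True
    then obtain c l where cl: "(c, l) \<in> D" "\<bar>x - c\<bar> \<le> l" by (auto simp: abs_le_iff)
    have "(\<Prod>i\<in>D. 1 - b i x) = (1 - b (c, l) x) * (\<Prod>i\<in>D - {(c, l)}. 1 - b i x)"
      using D cl by (intro prod.remove) auto
    also have "\<dots> \<le> (1 - b (c, l) x) * 1"
      using b cl by (intro mult_left_mono prod_le_1) auto
    finally have "b (c, l) x \<le> \<phi> x" by (simp add: \<phi>_def)
    moreover have "1 - (tanh 1)\<^sup>2 \<le> b (c, l) x" using bump_props(6)[OF D(2)[OF cl(1)] cl(2)] by (simp add: b_def)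
    ultimately show ?thesis using True by simp
  next
    case False then show ?thesis using P by (simp add: \<phi>_def)
  qed
  have fin: "(\<Union>(c, l)\<in>D. {c - l..c + l}) \<in> sets borel" using D by (intro sets.finite_UN) auto
  have "(1 - (tanh 1)\<^sup>2) * measure G (\<Union>(c, l)\<in>D. {c - l..c + l}) =
      (\<integral>x. (1 - (tanh 1)\<^sup>2) * indicator (\<Union>(c, l)\<in>D. {c - l..c + l}) x \<partial>G)" using fin by simp
  also have "\<dots> \<le> (\<integral>x. \<phi> x \<partial>G)"
  proof (rule integral_mono)
    show "integrable G \<phi>"
      by (rule G.integrable_const_bound[of _ 1]) (use P bdd_smooth_measurable[OF \<phi>s] in \<open>auto simp: \<phi>_def\<close>)
    show "integrable G (\<lambda>x. (1 - (tanh (1::real))\<^sup>2) * indicator (\<Union>(c, l)\<in>D. {c - l..c + l}) x)"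
    proof -
      have "integrable G (indicator A :: real \<Rightarrow> real)" if "A \<in> sets borel" for A
        by (rule G.integrable_const_bound[of _ 1]) (use that in auto)
      from this[OF fin] show ?thesis by (intro integrable_mult_right)
    qed
  qed (use lower in auto)
  also have "\<dots> \<le> J + K * (\<integral>x. \<phi> x \<partial>lborel)" by (rule conc[OF ct])
  also have "\<dots> \<le> J + K * (\<integral>x. (\<Sum>i\<in>D. b i x) \<partial>lborel)"
    using J \<phi>i si le by (intro add_left_mono mult_left_mono integral_mono) auto
  also have "(\<integral>x. (\<Sum>i\<in>D. b i x) \<partial>lborel) = (\<Sum>i\<in>D. 2 * snd i)" using b by (simp add: Bochner_Integration.integral_sum)
  finally show ?thesis by (simp add: case_prod_beta')
qed

text \<open>A bounded null set is covered by non-overlapping intervals of total length at most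
  \<open>e\<close>, so the hypothesis bounds its mass by \<open>J M + M * K * e\<close>, up to the
  factor \<kappa>. Letting \<open>e\<close> tend to 0 at fixed \<open>M\<close>, and then
  \<open>M\<close> to infinity, leaves 0.\<close>

lemma absolutely_continuous_of_concentration:
  assumes G: "real_distribution G" and K: "0 \<le> K" and J: "(J \<longlongrightarrow> 0) at_top"
    and conc: "\<And>M \<phi>. 0 < M \<Longrightarrow> conc_test \<phi> \<Longrightarrow> (\<integral>x. \<phi> x \<partial>G) \<le> J M + M * K * (\<integral>x. \<phi> x \<partial>lborel)"
  shows "absolutely_continuous lborel G"
proof -
  interpret G: real_distribution G by fact
  define \<kappa> :: real where "\<kappa> = 1 - (tanh 1)\<^sup>2"
  have "(tanh (1::real))\<^sup>2 < 1" using tanh_real_lt_1[of 1] tanh_real_gt_neg1[of 1] by (simp add: abs_square_less_1 abs_less_iff)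
  then have \<kappa>: "0 < \<kappa>" by (simp add: \<kappa>_def)
  have box: "measure G (N \<inter> {-R..R}) = 0" if N: "N \<in> null_sets lborel" and R: "0 < R" for N R
  proof -
    have Nb: "N \<in> sets borel" using N by auto
    define S where "S = N \<inter> cbox (-R) R"
    have Sn: "S \<in> null_sets lborel" unfolding S_def by (rule null_set_Int2[OF N]) simp
    then have "negligible S" by (simp add: negligible_iff_null_sets null_sets_completionI)
    then have Sm: "S \<in> lmeasurable" "measure lebesgue S = 0" by (simp_all add: negligible_iff_measure)
    have est: "\<kappa> * measure G S \<le> J M + M * K * e" if M: "0 < M" and e: "0 < e" for M e
    proof -
      obtain D where D: "countable D" "\<And>K. K \<in> D \<Longrightarrow> K \<subseteq> cbox (-R) R \<and> K \<noteq> {} \<and> (\<exists>c d. K = cbox c d)"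
        "pairwise (\<lambda>A B. interior A \<inter> interior B = {}) D"
        "\<And>K. \<lbrakk>K \<in> D; box (-R) R \<noteq> {}\<rbrakk> \<Longrightarrow> interior K \<noteq> {}"
        "S \<subseteq> \<Union>D" "\<Union>D \<in> lmeasurable" "measure lebesgue (\<Union>D) \<le> measure lebesgue S + e"
        using measurable_outer_intervals_bounded[OF Sm(1) _ e, of "-R" R] unfolding S_def by (metis inf_le2)
      \<comment> \<open>Inside a nondegenerate box the covering intervals have nonempty interior,
        hence positive half-length.\<close>
      have ne: "box (-R) R \<noteq> {}" using R by simp
      define mid where "mid I = ((Inf I + Sup I) / 2, (Sup I - Inf I) / 2)" for I :: "real set"
      have I: "I = {fst (mid I) - snd (mid I)..fst (mid I) + snd (mid I)} \<and> 0 < snd (mid I) \<and> measure lebesgue I = 2 * snd (mid I)"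
        if ID: "I \<in> D" for I
      proof -
        obtain c d where cd: "I = {c..d}" using D(2)[OF ID] by auto
        have "c < d" using D(4)[OF ID ne] by (auto simp: cd)
        then show ?thesis by (simp add: cd mid_def field_simps)
      qed
      \<comment> \<open>Finite subfamilies only, since the smooth substitute for a union is a finite
        product. Disjoint interiors make the sum of the lengths equal to the measure of the
        union.\<close>
      have finite_le: "\<kappa> * measure G (\<Union>E) \<le> J M + M * K * e" if E: "finite E" "E \<subseteq> D" for E
      proof -
        have inj: "inj_on mid E" using I E(2) by (intro inj_onI) (metis subsetD)
        have U: "\<Union>E = (\<Union>(c, l)\<in>mid ` E. {c - l..c + l})"
        proof -
          have "(\<Union>(c, l)\<in>mid ` E. {c - l..c + l}) = (\<Union>I\<in>E. {fst (mid I) - snd (mid I)..fst (mid I) + snd (mid I)})"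
            by (simp add: case_prod_beta')
          also have "\<dots> = (\<Union>I\<in>E. I)" using I E(2) by (intro SUP_cong) auto
          finally show ?thesis by simp
        qed
        have "\<kappa> * measure G (\<Union>(c, l)\<in>mid ` E. {c - l..c + l}) \<le> J M + M * K * (\<Sum>(c, l)\<in>mid ` E. 2 * l)"
          unfolding \<kappa>_def
        proof (rule concentration_imp_interval_union[OF G])
          show "0 < l" if "(c, l) \<in> mid ` E" for c l
          proof -
            from that obtain I' where I': "I' \<in> E" "(c, l) = mid I'" by auto
            then show ?thesis using I[of I'] E(2) by (metis snd_conv subsetD)
          qed
        qed (use K M E conc in auto)
        moreover have "(\<Sum>(c, l)\<in>mid ` E. 2 * l) = (\<Sum>I\<in>E. measure lebesgue I)"
        proof -
          have "(\<Sum>(c, l)\<in>mid ` E. 2 * l) = (\<Sum>I\<in>E. 2 * snd (mid I))"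
            by (subst sum.reindex[OF inj]) (simp add: case_prod_beta')
          also have "\<dots> = (\<Sum>I\<in>E. measure lebesgue I)" using I E(2) by (intro sum.cong) auto
          finally show ?thesis .
        qed
        moreover have "(\<Sum>I\<in>E. measure lebesgue I) = measure lebesgue (\<Union>E)"
        proof (rule measure_negligible_finite_Union[symmetric, OF E(1)])
          show "I \<in> lmeasurable" if "I \<in> E" for I using D(2)[of I] that E(2) by auto
          show "pairwise (\<lambda>S T. negligible (S \<inter> T)) E"
          proof (rule pairwiseI)
            fix A B assume AB: "A \<in> E" "B \<in> E" "A \<noteq> B"
            then have "interior (A \<inter> B) = {}" using D(3) E(2) by (auto simp: pairwise_def)
            moreover have "convex (A \<inter> B)" using D(2)[of A] D(2)[of B] AB E(2) by (auto intro!: convex_Int convex_box)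
            ultimately show "negligible (A \<inter> B)" by (simp add: negligible_convex_interior)
          qed
        qed
        moreover have "measure lebesgue (\<Union>E) \<le> measure lebesgue (\<Union>D)"
        proof (rule measure_mono_fmeasurable[OF _ _ D(6)])
          show "\<Union>E \<in> sets lebesgue"          proof (intro sets.finite_Union E subsetI)
            fix I assume "I \<in> E"
            then obtain c d where "I = cbox c d" using D(2) E(2) by (metis subsetD)
            then show "I \<in> sets lebesgue" using lmeasurable_cbox by (metis fmeasurableD)
          qed
        qed (use E in auto)
        ultimately have "\<kappa> * measure G (\<Union>E) \<le> J M + M * K * measure lebesgue (\<Union>E)" "measure lebesgue (\<Union>E) \<le> e"
          using D(7) Sm(2) U by auto
        moreover have "M * K * measure lebesgue (\<Union>E) \<le> M * K * e" using calculation(2) M K by (intro mult_left_mono) auto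
        ultimately show ?thesis by linarith
      qed
      have Ib: "I \<in> sets borel" if "I \<in> D" for I using D(2)[OF that] by auto
      have UDb: "\<Union>D \<in> sets borel" using D(1) Ib by (intro sets.countable_Union) auto
      show ?thesis
      proof (cases "D = {}")
        case True
        then have "S = {}" using D(5) by auto
        then show ?thesis using finite_le[of "{}"] by simp
      next
        case False
        \<comment> \<open>Countably many intervals are reached through increasing finite
          unions.\<close>
        define U where "U n = (\<Union>i\<le>n. from_nat_into D i)" for n
        have rng: "range (from_nat_into D) = D" using range_from_nat_into[OF False D(1)] .
        have Un: "(\<lambda>n. measure G (U n)) \<longlonglongrightarrow> measure G (\<Union>n. U n)"
        proof (rule G.finite_Lim_measure_incseq)
          show "range U \<subseteq> sets G" using rng Ib unfolding U_def by (auto intro!: sets.finite_UN)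
          show "incseq U" unfolding U_def by (intro monoI UN_mono) auto
        qed
        have UU: "(\<Union>n. U n) = \<Union>D"
        proof -
          have "(\<Union>n. U n) = \<Union>(range (from_nat_into D))" unfolding U_def by auto
          then show ?thesis by (simp only: rng)
        qed
        have "\<kappa> * measure G (U n) \<le> J M + M * K * e" for n
        proof -
          have "U n = \<Union>(from_nat_into D ` {..n})" by (simp add: U_def)
          moreover have "from_nat_into D ` {..n} \<subseteq> D" using rng by blast
          ultimately show ?thesis using finite_le[of "from_nat_into D ` {..n}"] by simp
        qed
        then have "\<kappa> * measure G (\<Union>D) \<le> J M + M * K * e"
          using tendsto_mult_left[OF Un, of \<kappa>] unfolding UU by (intro LIMSEQ_le_const2) auto
        moreover have "measure G S \<le> measure G (\<Union>D)" using D(5) UDb by (intro G.finite_measure_mono) auto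
        then have "\<kappa> * measure G S \<le> \<kappa> * measure G (\<Union>D)" using \<kappa> by (intro mult_left_mono) auto
        ultimately show ?thesis by linarith
      qed
    qed
    have est2: "\<kappa> * measure G S \<le> J M" if M: "0 < M" for M
    proof (rule tendsto_lowerbound)
      show "((\<lambda>e. J M + M * K * e) \<longlongrightarrow> J M) (at_right 0)" by (auto intro!: tendsto_eq_intros)
      show "\<forall>\<^sub>F e in at_right 0. \<kappa> * measure G S \<le> J M + M * K * e"
        using est[OF M] by (auto simp: eventually_at_filter)
    qed simp
    have "\<kappa> * measure G S \<le> 0"
    proof (rule tendsto_lowerbound[OF J])
      show "\<forall>\<^sub>F M in at_top. \<kappa> * measure G S \<le> J M" using eventually_gt_at_top[of 0] by eventually_elim (rule est2)
    qed simp
    then have "measure G S = 0" using \<kappa> by (simp add: mult_le_0_iff measure_le_0_iff)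
    then show ?thesis by (simp add: S_def)
  qed
  show ?thesis
    unfolding absolutely_continuous_def
  proof
    fix N :: "real set" assume N: "N \<in> null_sets lborel"
    then have Nb: "N \<in> sets borel" by auto
    have "(\<Union>n. N \<inter> {- real (Suc n)..real (Suc n)}) \<in> null_sets G"
    proof (rule null_sets_UN)
      fix n
      have "measure G (N \<inter> {- real (Suc n)..real (Suc n)}) = 0" by (rule box[OF N]) simp
      then show "N \<inter> {- real (Suc n)..real (Suc n)} \<in> null_sets G" using Nb by (auto simp: null_sets_def G.emeasure_eq_measure)
    qed
    moreover have "(\<Union>n. N \<inter> {- real (Suc n)..real (Suc n)}) = N"
    proof -
      have "\<exists>n. - real (Suc n) \<le> x \<and> x \<le> real (Suc n)" for x :: real
      proof -
        obtain n where "\<bar>x\<bar> \<le> real n" using real_arch_simple by blast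
        then show ?thesis by (intro exI[of _ n]) auto
      qed
      then show ?thesis by auto
    qed
    ultimately show "N \<in> null_sets G" by simp
  qed
qed

text \<open>\<phi> is arbitrary on the negative half-line and may fail to be measurable; \<psi> is a
  measurable function agreeing with it where the density lives.\<close>

lemma density_measure_integral:
  assumes f: "prob_density_on {0..} f" and \<psi>: "\<psi> \<in> borel_measurable borel" and e: "\<And>w. 0 \<le> w \<Longrightarrow> \<phi> w = \<psi> w"
  shows "(LINT w:{0..}|lborel. \<phi> w * f w) = (\<integral>w. \<psi> w \<partial>density_measure f)"
    and "integrable (density_measure f) \<psi> \<Longrightarrow> set_integrable lborel {0..} (\<lambda>w. \<phi> w * f w)"
proof -
  define a where "a w = indicator {0..} w * f w" for w
  have m: "a \<in> borel_measurable lborel" "\<psi> \<in> borel_measurable lborel"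
    using f \<psi> by (auto simp: prob_density_on_def set_borel_measurable_def a_def[abs_def])
  have nn: "AE x in lborel. 0 \<le> a x" using f by (auto simp: prob_density_on_def a_def indicator_def)
  have D: "density_measure f = density lborel (\<lambda>x. ennreal (a x))" by (simp add: density_measure_def a_def)
  have s: "indicator {0..} w *\<^sub>R (\<phi> w * f w) = a w *\<^sub>R \<psi> w" for w using e by (auto simp: a_def indicator_def)
  show "(LINT w:{0..}|lborel. \<phi> w * f w) = (\<integral>w. \<psi> w \<partial>density_measure f)"
    unfolding set_lebesgue_integral_def s D by (rule integral_density[symmetric, OF m(2,1) nn])
  show "integrable (density_measure f) \<psi> \<Longrightarrow> set_integrable lborel {0..} (\<lambda>w. \<phi> w * f w)"
    unfolding set_integrable_def s D using integrable_density[OF m(2,1) nn] by simp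
qed

text \<open>Radon-Nikodym; the derivative vanishes almost everywhere on the negative half-line
  because \<open>G\<close> puts no mass there.\<close>

lemma wealth_density:
  assumes G: "wealth p G" and ac: "absolutely_continuous lborel G"
  obtains g where "prob_density_on {0..} g" "density_measure g = G"
proof -
  note G' = wealthD[OF G]
  interpret G: real_distribution G by (rule G')
  obtain d where d: "d \<in> borel_measurable lborel" "AE x in lborel. RN_deriv lborel G x = ennreal (d x)" "\<And>x. 0 \<le> d x"
    using sigma_finite_measure.real_RN_deriv[OF lborel.sigma_finite_measure_axioms G.finite_measure_axioms ac] by (auto simp: G')
  have "density lborel (\<lambda>x. ennreal (d x)) = density lborel (RN_deriv lborel G)"
    using d by (intro density_cong) auto
  also have "\<dots> = G" using ac by (intro sigma_finite_measure.density_RN_deriv[OF lborel.sigma_finite_measure_axioms]) (simp_all add: G')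
  finally have dG: "density lborel (\<lambda>x. ennreal (d x)) = G" .
  have neg: "AE x in lborel. x < 0 \<longrightarrow> d x = 0"
  proof -
    have "AE x in lborel. 0 < ennreal (d x) \<longrightarrow> 0 \<le> x"
      using G'(5) d(1) unfolding dG[symmetric] by (subst (asm) AE_density) auto
    then show ?thesis by eventually_elim (use d(3) in \<open>force simp: less_le\<close>)
  qed
  have dm: "density_measure d = G"
    unfolding density_measure_def dG[symmetric]
  proof (rule density_cong)
    show "AE x in lborel. ennreal (indicator {0..} x * d x) = ennreal (d x)"
      using neg by eventually_elim (auto simp: indicator_def)
  qed (use d in auto)
  have m: "(\<lambda>x. indicator {0..} x * d x) \<in> borel_measurable lborel" using d by measurable
  have "(\<integral>x. (1::real) \<partial>G) = (\<integral>x. (indicator {0..} x * d x) *\<^sub>R (1::real) \<partial>lborel)"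
    unfolding dm[symmetric] density_measure_def using d(3) by (intro integral_density[OF _ m]) auto
  then have "prob_density_on {0..} d"
    using d m G.prob_space by (auto simp: prob_density_on_def set_borel_measurable_def set_lebesgue_integral_def)
  with dm that show ?thesis by blast
qed

section \<open>The Fokker-Planck equation for general test functions\<close>

lemma deriv_Rplus_has_derivative:
  assumes "\<phi> differentiable (at w within {0..})"
  shows "(\<phi> has_real_derivative deriv_Rplus \<phi> w) (at w within {0..})"
  using vector_derivative_works[THEN iffD1, OF assms]
  by (simp add: deriv_Rplus_def has_real_derivative_iff_has_vector_derivative)

lemma abs_diff_le_on_Icc:
  assumes "\<And>x. 0 \<le> x \<Longrightarrow> (D has_real_derivative D' x) (at x within {0..})"
    and "\<And>x. 0 \<le> x \<Longrightarrow> x \<le> w \<Longrightarrow> \<bar>D' x\<bar> \<le> B" and w: "0 \<le> w"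
  shows "\<bar>D w - D 0\<bar> \<le> B * w"
proof -
  have "norm (D w - D 0) \<le> B * norm (w - 0)"
  proof (rule field_differentiable_bound[of "{0..w}" D D'])
    show "(D has_real_derivative D' z) (at z within {0..w})" if "z \<in> {0..w}" for z
      by (rule DERIV_subset[OF assms(1)]) (use that in auto)
    show "norm (D' z) \<le> B" if "z \<in> {0..w}" for z using assms(2)[of z] that by simp
  qed (use w in auto)
  then show ?thesis using w by simp
qed

text \<open>Integration raises the exponent of growth by one; the factor 2 absorbs \<open>w\<close>
  into \<open>1 + w powr (r + 1)\<close>.\<close>

lemma growth_antideriv:
  assumes "\<And>x. 0 \<le> x \<Longrightarrow> (D has_real_derivative D' x) (at x within {0..})"
    and C: "0 \<le> C" "\<And>x. 0 \<le> x \<Longrightarrow> \<bar>D' x\<bar> \<le> C * (1 + x powr r)" and r: "0 \<le> r" and w: "0 \<le> w"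
  shows "\<bar>D w\<bar> \<le> (\<bar>D 0\<bar> + 2 * C) * (1 + w powr (r + 1))"
proof -
  have "\<bar>D w - D 0\<bar> \<le> (C * (1 + w powr r)) * w"
  proof (rule abs_diff_le_on_Icc[OF assms(1) _ w])
    fix x assume x: "0 \<le> x" "x \<le> w"
    then have "1 + x powr r \<le> 1 + w powr r" using r by (simp add: powr_mono2)
    then have "C * (1 + x powr r) \<le> C * (1 + w powr r)" using C(1) by (rule mult_left_mono)
    with C(2)[OF x(1)] show "\<bar>D' x\<bar> \<le> C * (1 + w powr r)" by (rule order_trans)
  qed
  also have "\<dots> = C * (w + w powr (r + 1))" using w by (cases "w = 0") (auto simp: powr_add algebra_simps)
  also have "\<dots> \<le> C * (2 * (1 + w powr (r + 1)))"
  proof (rule mult_left_mono[OF _ C(1)])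
    have "w powr 1 \<le> 1 + w powr (r + 1)" using r w by (intro powr_le_1_powr) auto
    then have "w \<le> 1 + w powr (r + 1)" using w by simp
    then show "w + w powr (r + 1) \<le> 2 * (1 + w powr (r + 1))" by simp
  qed
  finally have "\<bar>D w\<bar> \<le> \<bar>D 0\<bar> * 1 + C * (2 * (1 + w powr (r + 1)))" by simp
  also have "\<dots> \<le> \<bar>D 0\<bar> * (1 + w powr (r + 1)) + C * (2 * (1 + w powr (r + 1)))"
    by (intro add_right_mono mult_left_mono) auto
  also have "\<dots> = (\<bar>D 0\<bar> + 2 * C) * (1 + w powr (r + 1))" by (simp add: algebra_simps)
  finally show ?thesis .
qed

text \<open>Hoelder continuity of the derivative of order \<open>k\<close> gives it growth \<kappa>;
  each of the \<open>k - 2\<close> integrations back to the second derivative adds 1, and \<kappa> +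
  k - 2 = p - 2. For \<open>p > 2\<close> the decomposition has \<open>k\<close> at least 2; when
  \<open>k\<close> is exactly 2, continuity of the second derivative comes from the Hoelder
  condition.\<close>

lemma test_functions_C2:
  assumes "\<phi> \<in> test_functions p" "2 < p"
  defines "\<phi>1 \<equiv> deriv_Rplus \<phi>" and "\<phi>2 \<equiv> (deriv_Rplus ^^ 2) \<phi>"
  shows "\<phi> 0 = 0" "\<phi>1 0 = 0"
    "\<And>w. 0 \<le> w \<Longrightarrow> (\<phi> has_real_derivative \<phi>1 w) (at w within {0..})"
    "\<And>w. 0 \<le> w \<Longrightarrow> (\<phi>1 has_real_derivative \<phi>2 w) (at w within {0..})"
    "continuous_on {0..} \<phi>2" "growth (p - 2) \<phi>2"
proof -
  from assms(1) obtain k :: nat and \<kappa> where z: "\<phi> 0 = 0" and d0: "(\<phi> has_real_derivative 0) (at 0 within {0..})"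
    and k: "p = real k + \<kappa>" "0 < \<kappa>" "\<kappa> \<le> 1"
    and diff: "\<And>i w. i < k \<Longrightarrow> 0 \<le> w \<Longrightarrow> (deriv_Rplus ^^ i) \<phi> differentiable (at w within {0..})"
    and hol: "holder_Rplus \<kappa> ((deriv_Rplus ^^ k) \<phi>)" unfolding test_functions_def by blast
  have k2: "2 \<le> k"
  proof -
    have "1 < real k" using k assms(2) by simp
    then show ?thesis by simp
  qed
  define D where "D i = (deriv_Rplus ^^ i) \<phi>" for i
  have D: "(D i has_real_derivative D (Suc i) w) (at w within {0..})" if "i < k" "0 \<le> w" for i w
    using deriv_Rplus_has_derivative[OF diff[OF that]] by (simp add: D_def)
  have D12: "D 0 = \<phi>" "D (Suc 0) = \<phi>1" "D (Suc (Suc 0)) = \<phi>2" "D 2 = \<phi>2"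
    by (simp_all add: D_def \<phi>1_def \<phi>2_def numeral_2_eq_2)
  show "\<phi> 0 = 0" by fact
  show "\<phi>1 0 = 0" unfolding \<phi>1_def using d0 by (intro deriv_Rplus_eq) auto
  show "(\<phi> has_real_derivative \<phi>1 w) (at w within {0..})" if "0 \<le> w" for w
    using D[of 0 w] k2 that by (simp add: D12)
  show "(\<phi>1 has_real_derivative \<phi>2 w) (at w within {0..})" if "0 \<le> w" for w
    using D[of "Suc 0" w] k2 that by (simp add: D12)
  from hol obtain H where H: "\<And>v w. 0 \<le> v \<Longrightarrow> 0 \<le> w \<Longrightarrow> v \<noteq> w \<Longrightarrow> \<bar>D k v - D k w\<bar> / \<bar>v - w\<bar> powr \<kappa> \<le> H"
    unfolding holder_Rplus_def bdd_above_def D_def by blast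
  have H': "\<bar>D k v - D k w\<bar> \<le> \<bar>H\<bar> * \<bar>v - w\<bar> powr \<kappa>" if "0 \<le> v" "0 \<le> w" for v w
  proof (cases "v = w")
    case False
    then have "\<bar>D k v - D k w\<bar> \<le> H * \<bar>v - w\<bar> powr \<kappa>" using H[OF that False] by (simp add: divide_le_eq)
    also have "\<dots> \<le> \<bar>H\<bar> * \<bar>v - w\<bar> powr \<kappa>" by (intro mult_right_mono) auto
    finally show ?thesis .
  qed simp
  have gk: "growth \<kappa> (D k)"
  proof (rule growthI)
    fix w :: real assume w: "0 \<le> w"
    have "\<bar>D k w\<bar> \<le> \<bar>D k 0\<bar> * 1 + \<bar>H\<bar> * w powr \<kappa>" using H'[OF w, of 0] w by simp
    also have "\<dots> \<le> (\<bar>D k 0\<bar> + \<bar>H\<bar>) * 1 + (\<bar>D k 0\<bar> + \<bar>H\<bar>) * w powr \<kappa>"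
      by (intro add_mono mult_right_mono) auto
    also have "\<dots> = (\<bar>D k 0\<bar> + \<bar>H\<bar>) * (1 + w powr \<kappa>)" by (simp add: algebra_simps)
    finally show "\<bar>D k w\<bar> \<le> (\<bar>D k 0\<bar> + \<bar>H\<bar>) * (1 + w powr \<kappa>)" .
  qed
  have ck: "continuous_on {0..} (D k)"
    unfolding continuous_on_def
  proof
    fix v :: real assume v: "v \<in> {0..}"
    have "((\<lambda>w. \<bar>H\<bar> * \<bar>w - v\<bar> powr \<kappa>) \<longlongrightarrow> \<bar>H\<bar> * \<bar>v - v\<bar> powr \<kappa>) (at v within {0..})"
      using k by (intro tendsto_mult tendsto_const tendsto_powr' tendsto_intros) auto
    then have l: "((\<lambda>w. \<bar>H\<bar> * \<bar>w - v\<bar> powr \<kappa>) \<longlongrightarrow> 0) (at v within {0..})" using k by simp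
    have "((\<lambda>w. D k w - D k v) \<longlongrightarrow> 0) (at v within {0..})"
      by (rule Lim_null_comparison[OF _ l]) (use H' v in \<open>auto simp: eventually_at_filter\<close>)
    then show "(D k \<longlongrightarrow> D k v) (at v within {0..})" by (simp add: LIM_zero_iff)
  qed
  have "growth (\<kappa> + real j) (D (k - j))" if "j \<le> k" for j
    using that
  proof (induction j)
    case 0 then show ?case using gk by simp
  next
    case (Suc j)
    then have g: "growth (\<kappa> + real j) (D (Suc (k - Suc j)))" by (simp add: Suc_diff_Suc)
    have r0: "0 \<le> \<kappa> + real j" using k(2) by simp
    obtain C where C: "0 \<le> C" "\<And>x. 0 \<le> x \<Longrightarrow> \<bar>D (Suc (k - Suc j)) x\<bar> \<le> C * (1 + x powr (\<kappa> + real j))"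
      using growthE[OF g] by blast
    show ?case
    proof (rule growthI)
      fix w :: real assume w: "0 \<le> w"
      show "\<bar>D (k - Suc j) w\<bar> \<le> (\<bar>D (k - Suc j) 0\<bar> + 2 * C) * (1 + w powr (\<kappa> + real (Suc j)))"
      proof -
        have "\<bar>D (k - Suc j) w\<bar> \<le> (\<bar>D (k - Suc j) 0\<bar> + 2 * C) * (1 + w powr (\<kappa> + real j + 1))"
        proof (rule growth_antideriv[OF _ C r0 w])
          show "(D (k - Suc j) has_real_derivative D (Suc (k - Suc j)) x) (at x within {0..})" if "0 \<le> x" for x
            using D[of "k - Suc j" x] Suc.prems that by simp
        qed
        moreover have "\<kappa> + real j + 1 = \<kappa> + real (Suc j)" by simp
        ultimately show ?thesis by simp
      qed
    qed
  qed
  from this[of "k - 2"] k2 k show "growth (p - 2) \<phi>2" by (simp add: D12 of_nat_diff algebra_simps)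
  show "continuous_on {0..} \<phi>2"
  proof (cases "k = 2")
    case True then show ?thesis using ck by (simp add: D12)
  next
    case False
    then have "2 < k" using k2 by simp
    then have "continuous_on {0..} (D 2)" using D[of 2] by (intro DERIV_continuous_on) auto
    then show ?thesis by (simp add: D12)
  qed
qed

text \<open>The substitution \<open>y = tanh w\<close> maps the half-line into
  \<open>[0, 1)\<close>. After freezing \<psi> beyond \<open>n\<close> it becomes a continuous
  function of \<open>y\<close> on \<open>{0..1}\<close>, and a Bernstein polynomial in
  \<open>tanh w\<close> approximates it uniformly on the unbounded half-line.\<close>

lemma bdd_smooth_approx:
  assumes c: "continuous_on {0..} \<psi>" and n: "0 < (n::real)" and e: "0 < e"
  obtains \<theta> where "bdd_smooth \<theta>" "\<And>w. 0 \<le> w \<Longrightarrow> \<bar>\<theta> w - \<psi> (min w n)\<bar> \<le> e"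
proof -
  define y0 where "y0 = tanh n"
  have y0: "0 \<le> y0" "y0 < 1" using n by (simp_all add: y0_def tanh_real_lt_1)
  define h where "h y = \<psi> (artanh (min y y0))" for y
  have "continuous_on {0..1} h" unfolding h_def
  proof (rule continuous_on_compose2[OF c])
    show "continuous_on {0..1} (\<lambda>y. artanh (min y y0))"
      by (rule continuous_on_artanh') (use y0 in \<open>auto intro!: continuous_intros\<close>)
    have "0 \<le> artanh y" if y: "0 \<le> y" "y \<le> y0" for y
    proof -
      have "y < 1" using y y0 by simp
      have "1 \<le> (1 + y) / (1 - y)" using \<open>y < 1\<close> y by (simp add: le_divide_eq)
      then show ?thesis by (simp add: artanh_def)
    qed
    then show "(\<lambda>y. artanh (min y y0)) ` {0..1} \<subseteq> {0..}" using y0 by (auto simp: min_def)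
  qed
  from Bernstein_Weierstrass[OF this e] obtain N where
    N: "\<And>x. x \<in> {0..1} \<Longrightarrow> \<bar>h x - (\<Sum>k\<le>N. h (k / N) * Bernstein N k x)\<bar> < e" by blast
  show ?thesis
  proof (rule that)
    show "bdd_smooth (\<lambda>w. \<Sum>k\<le>N. h (k / N) * Bernstein N k (tanh w))"
      unfolding Bernstein_def by (intro bdd_smooth_intros bdd_smooth_tanh)
    fix w :: real assume w: "0 \<le> w"
    then have t: "tanh w \<in> {0..1}" using tanh_real_lt_1[of w] by (simp add: less_imp_le)
    have "min (tanh w) y0 = tanh (min w n)"
      unfolding y0_def by (simp add: min_def)
    then have "h (tanh w) = \<psi> (min w n)" by (simp add: h_def artanh_tanh_real)
    with N[OF t] show "\<bar>(\<Sum>k\<le>N. h (k / N) * Bernstein N k (tanh w)) - \<psi> (min w n)\<bar> \<le> e" by simp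
  qed
qed

text \<open>Both primitives vanish at 0, as the integrated equation for smooth functions
  demands.\<close>

lemma C2_smooth_antideriv:
  assumes "bdd_smooth \<theta>"
  obtains \<phi> \<phi>1 where "C2_smooth \<phi> \<phi>1 \<theta>" "\<phi> 0 = 0" "\<phi>1 0 = 0"
proof -
  have anti: "\<exists>F. (\<forall>x. (F has_real_derivative f x) (at x)) \<and> F 0 = 0" if f: "continuous_on UNIV f" for f :: "real \<Rightarrow> real"
  proof -
    have "\<exists>F. \<forall>x :: real. - \<infinity> < ereal x \<longrightarrow> ereal x < \<infinity> \<longrightarrow> (F has_vector_derivative f x) (at x)"
      by (rule einterval_antiderivative) (use f in \<open>auto simp: continuous_on_eq_continuous_at\<close>)
    then obtain F where F: "\<And>x. (F has_real_derivative f x) (at x)"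
      by (auto simp: has_real_derivative_iff_has_vector_derivative)
    have "((\<lambda>x. F x - F 0) has_real_derivative f x) (at x)" for x
      using DERIV_diff[OF F DERIV_const[of "F 0"]] by simp
    then show ?thesis by (intro exI[of _ "\<lambda>x. F x - F 0"]) simp
  qed
  obtain \<phi>1 where 1: "\<And>x. (\<phi>1 has_real_derivative \<theta> x) (at x)" "\<phi>1 0 = 0"
    using anti[OF bdd_smooth_continuous[OF assms]] by blast
  obtain \<phi> where 2: "\<And>x. (\<phi> has_real_derivative \<phi>1 x) (at x)" "\<phi> 0 = 0"
    using anti[OF DERIV_imp_continuous_on_UNIV[OF 1(1)]] by blast
  show ?thesis by (rule that[of \<phi> \<phi>1]) (use 1 2 assms in \<open>auto simp: C2_smooth_def\<close>)
qed

section \<open>The Fokker-Planck operator and its flows\<close>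

definition fp_op :: "real \<Rightarrow> real \<Rightarrow> (real \<Rightarrow> real) \<Rightarrow> (real \<Rightarrow> real) \<Rightarrow> real \<Rightarrow> real" where
  "fp_op m lam \<phi>1 \<phi>2 w = (m - w) * \<phi>1 w + lam / 2 * w\<^sup>2 * \<phi>2 w"

lemma fp_op_growth:
  assumes p: "2 \<le> p" and C: "0 \<le> C" "\<And>x. 0 \<le> x \<Longrightarrow> \<bar>\<phi>1 x\<bar> \<le> C * (1 + x powr (p - 1))"
    "\<And>x. 0 \<le> x \<Longrightarrow> \<bar>\<phi>2 x\<bar> \<le> C * (1 + x powr (p - 2))" and w: "0 \<le> w"
  shows "\<bar>fp_op m lam \<phi>1 \<phi>2 w\<bar> \<le> C * (2 * \<bar>m\<bar> + 2 + \<bar>lam\<bar>) * (1 + w powr p)"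
proof -
  have pw: "w powr r * w powr s = w powr (r + s)" for r s by (simp add: powr_add)
  have a: "1 + w powr (p - 1) \<le> 2 * (1 + w powr p)"
    using powr_le_1_powr[of "p - 1" p w] p w powr_ge_zero[of w p] unfolding distrib_left by linarith
  have b: "w * (1 + w powr (p - 1)) \<le> 2 * (1 + w powr p)"
  proof -
    have "w * (1 + w powr (p - 1)) = w powr 1 + w powr 1 * w powr (p - 1)" using w by (simp add: algebra_simps)
    also have "\<dots> = w powr 1 + w powr p" unfolding pw by simp
    also have "\<dots> \<le> 2 * (1 + w powr p)"
      using powr_le_1_powr[of 1 p w] p w unfolding distrib_left by linarith
    finally show ?thesis .
  qed
  have c: "w\<^sup>2 * (1 + w powr (p - 2)) \<le> 2 * (1 + w powr p)"
  proof -
    have "w\<^sup>2 * (1 + w powr (p - 2)) = w powr 2 + w powr 2 * w powr (p - 2)" using w by (simp add: algebra_simps powr_numeral)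
    also have "\<dots> = w powr 2 + w powr p" unfolding pw by simp
    also have "\<dots> \<le> 2 * (1 + w powr p)"
      using powr_le_1_powr[of 2 p w] p w unfolding distrib_left by linarith
    finally show ?thesis .
  qed
  have "\<bar>fp_op m lam \<phi>1 \<phi>2 w\<bar> \<le> \<bar>m - w\<bar> * \<bar>\<phi>1 w\<bar> + \<bar>lam\<bar> / 2 * w\<^sup>2 * \<bar>\<phi>2 w\<bar>"
    unfolding fp_op_def by (rule order_trans[OF abs_triangle_ineq]) (simp add: abs_mult)
  also have "\<dots> \<le> (\<bar>m\<bar> + w) * (C * (1 + w powr (p - 1))) + \<bar>lam\<bar> / 2 * w\<^sup>2 * (C * (1 + w powr (p - 2)))"
    using w C by (intro add_mono mult_mono mult_left_mono) auto
  also have "\<dots> = C * (\<bar>m\<bar> * (1 + w powr (p - 1)) + w * (1 + w powr (p - 1)) + \<bar>lam\<bar> / 2 * (w\<^sup>2 * (1 + w powr (p - 2))))"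
    by (simp add: algebra_simps)
  also have "\<dots> \<le> C * (\<bar>m\<bar> * (2 * (1 + w powr p)) + 2 * (1 + w powr p) + \<bar>lam\<bar> / 2 * (2 * (1 + w powr p)))"
    using a b c C(1) by (intro mult_left_mono add_mono) auto
  also have "\<dots> = C * (2 * \<bar>m\<bar> + 2 + \<bar>lam\<bar>) * (1 + w powr p)" by (simp add: algebra_simps)
  finally show ?thesis .
qed

lemma fp_op_C2_bound:
  assumes \<phi>: "C2_smooth \<phi> \<phi>1 \<phi>2"
  obtains A where "0 \<le> A" "\<And>w. 0 \<le> w \<Longrightarrow> \<bar>fp_op m lam \<phi>1 \<phi>2 w\<bar> \<le> A * (1 + w powr 2)"
proof -
  obtain C where C: "C \<ge> 0" "\<And>x. \<bar>\<phi>1 x\<bar> \<le> C * (1 + \<bar>x\<bar>)" "\<And>x. \<bar>\<phi>2 x\<bar> \<le> C"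
    using C2_smooth_deriv_growth[OF \<phi>] by metis
  have "\<bar>fp_op m lam \<phi>1 \<phi>2 w\<bar> \<le> C * (2 * \<bar>m\<bar> + 2 + \<bar>lam\<bar>) * (1 + w powr 2)" if w: "0 \<le> w" for w
  proof (rule fp_op_growth[OF order_refl C(1) _ _ w])
    fix x :: real assume x: "0 \<le> x"
    show "\<bar>\<phi>1 x\<bar> \<le> C * (1 + x powr (2 - 1))" using C(2)[of x] x by simp
    have "C * 1 \<le> C * (1 + x powr (2 - 2))" using C(1) by (intro mult_left_mono) auto
    with C(3)[of x] show "\<bar>\<phi>2 x\<bar> \<le> C * (1 + x powr (2 - 2))" by linarith
  qed
  then show ?thesis using that[of "C * (2 * \<bar>m\<bar> + 2 + \<bar>lam\<bar>)"] C(1) by simp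
qed

lemma fp_op_C2_continuous: "C2_smooth \<phi> \<phi>1 \<phi>2 \<Longrightarrow> continuous_on UNIV (fp_op m lam \<phi>1 \<phi>2)"
  unfolding fp_op_def using C2_smooth_continuous[of \<phi> \<phi>1 \<phi>2] by (intro continuous_intros) auto

lemma fp_op_C2_growth: "C2_smooth \<phi> \<phi>1 \<phi>2 \<Longrightarrow> growth 2 (fp_op m lam \<phi>1 \<phi>2)"
  by (metis fp_op_C2_bound growthI)

text \<open>What survives the limit directly: moment bounds, weak continuity in time, and the
  integrated equation for smooth functions vanishing to first order at 0. \<open>K t\<close> bounds
  the moments of order \<open>p\<close> at all times up to \<open>t\<close>.\<close>

locale fp_flow =
  fixes p m lam :: real and G :: "real \<Rightarrow> real measure" and K :: "real \<Rightarrow> real"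
  assumes p: "2 < p" and G: "\<And>t. 0 \<le> t \<Longrightarrow> wealth p (G t)"
    and K: "\<And>s t. 0 \<le> s \<Longrightarrow> s \<le> t \<Longrightarrow> (\<integral>w. w powr p \<partial>G s) \<le> K t"
    and weak: "\<And>s t. (\<And>n. 0 \<le> s n) \<Longrightarrow> s \<longlonglongrightarrow> t \<Longrightarrow> 0 \<le> t \<Longrightarrow> weak_conv_m (\<lambda>n. G (s n)) (G t)"
    and fp_smooth: "\<And>\<phi> \<phi>1 \<phi>2 t. C2_smooth \<phi> \<phi>1 \<phi>2 \<Longrightarrow> \<phi> 0 = 0 \<Longrightarrow> \<phi>1 0 = 0 \<Longrightarrow> 0 \<le> t \<Longrightarrow>
      (\<integral>w. \<phi> w \<partial>G t) - (\<integral>w. \<phi> w \<partial>G 0) = integral {0..t} (\<lambda>s. \<integral>w. fp_op m lam \<phi>1 \<phi>2 w \<partial>G s)"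
begin

lemma continuous_lower_growth:
  assumes \<psi>: "continuous_on UNIV \<psi>" "growth r \<psi>" and r: "0 < r" "r < p"
  shows "continuous_on {0..} (\<lambda>t. \<integral>w. \<psi> w \<partial>G t)"
  unfolding continuous_on_sequentially
proof (intro allI ballI impI)
  fix s and t :: real assume t: "t \<in> {0..}" and s: "(\<forall>n. s n \<in> {0..}) \<and> s \<longlonglongrightarrow> t"
  then have s0: "\<And>n. 0 \<le> s n" and st: "s \<longlonglongrightarrow> t" and t0: "0 \<le> t" by auto
  from st obtain B where B: "\<And>n. \<bar>s n\<bar> \<le> B" using convergent_imp_Bseq[of s] by (auto simp: convergent_def Bseq_def)
  have "(\<lambda>n. \<integral>w. \<psi> w \<partial>G (s n)) \<longlonglongrightarrow> (\<integral>w. \<psi> w \<partial>G t)"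
    by (rule weak_conv_lower_growth[OF G[OF s0] wealthD(1)[OF G[OF t0]] weak[OF s0 st t0] r _ \<psi>])
       (use B K[OF s0] in \<open>auto simp: abs_le_iff\<close>)
  then show "((\<lambda>t. \<integral>w. \<psi> w \<partial>G t) \<circ> s) \<longlonglongrightarrow> (\<integral>w. \<psi> w \<partial>G t)" by (simp add: o_def)
qed

text \<open>The second derivative is approximated and integrated twice, so that growth bounds are
  uniform in the approximation. Dominated convergence is used against a multiple of
  \<open>1 + \<bar>w\<bar> powr p\<close> in wealth and against a constant in time. The limit
  \<open>v\<close> is obtained as integrable only: its integrand grows like the highest controlled
  moment, so its continuity in time is not yet known. Composition with \<open>max 0 w\<close>
  extends functions known on the half-line.\<close>

lemma fp_integral_equation:
  assumes d1': "\<forall>w\<ge>0. (\<phi> has_real_derivative \<phi>1 w) (at w within {0..})"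
    and d2': "\<forall>w\<ge>0. (\<phi>1 has_real_derivative \<phi>2 w) (at w within {0..})"
    and c2: "continuous_on {0..} \<phi>2" and g2: "growth (p - 2) \<phi>2" and z: "\<phi> 0 = 0" "\<phi>1 0 = 0" and t: "0 \<le> t"
  defines "u \<equiv> \<lambda>s. \<integral>w. \<phi> (max 0 w) \<partial>G s" and "v \<equiv> \<lambda>s. \<integral>w. fp_op m lam \<phi>1 \<phi>2 (max 0 w) \<partial>G s"
  shows "u t - u 0 = integral {0..t} v" "v integrable_on {0..t}"
    and "continuous_on UNIV (\<lambda>w. \<phi> (max 0 w))" "growth p (\<lambda>w. \<phi> (max 0 w))"
    and "continuous_on UNIV (\<lambda>w. fp_op m lam \<phi>1 \<phi>2 (max 0 w))" "growth p (\<lambda>w. fp_op m lam \<phi>1 \<phi>2 (max 0 w))"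
proof -
  have d1: "\<And>w. 0 \<le> w \<Longrightarrow> (\<phi> has_real_derivative \<phi>1 w) (at w within {0..})"
    and d2: "\<And>w. 0 \<le> w \<Longrightarrow> (\<phi>1 has_real_derivative \<phi>2 w) (at w within {0..})"
    using d1' d2' by auto
  have c0: "continuous_on {0..} \<phi>" "continuous_on {0..} \<phi>1"
    using d1 d2 by (auto intro!: DERIV_continuous_on)
  have ext: "continuous_on UNIV (\<lambda>w. f (max 0 w))" if "continuous_on {0..} f" for f :: "real \<Rightarrow> real"
    by (rule continuous_on_compose2[OF that]) (auto intro!: continuous_intros)
  have cL: "continuous_on {0..} (fp_op m lam \<phi>1 \<phi>2)" unfolding fp_op_def using c0 c2 by (intro continuous_intros)
  show cu: "continuous_on UNIV (\<lambda>w. \<phi> (max 0 w))" and cv: "continuous_on UNIV (\<lambda>w. fp_op m lam \<phi>1 \<phi>2 (max 0 w))"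
    using ext c0 cL by auto
  obtain C where C: "0 \<le> C" "\<And>x. 0 \<le> x \<Longrightarrow> \<bar>\<phi>2 x\<bar> \<le> C * (1 + x powr (p - 2))" using growthE[OF g2] by blast
  have gr: "\<bar>f1 w\<bar> \<le> 4 * B * (1 + w powr (p - 1))" "\<bar>f w\<bar> \<le> 4 * B * (1 + w powr p)"
    if f: "\<And>w. 0 \<le> w \<Longrightarrow> (f has_real_derivative f1 w) (at w within {0..})"
      "\<And>w. 0 \<le> w \<Longrightarrow> (f1 has_real_derivative f2 w) (at w within {0..})" "f 0 = 0" "f1 0 = 0"
      and B: "0 \<le> B" "\<And>x. 0 \<le> x \<Longrightarrow> \<bar>f2 x\<bar> \<le> B * (1 + x powr (p - 2))" and w: "0 \<le> w" for f f1 f2 B w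
  proof -
    have 1: "\<bar>f1 x\<bar> \<le> 2 * B * (1 + x powr (p - 1))" if "0 \<le> x" for x
      using growth_antideriv[OF f(2) B _ that] f(4) p by simp
    have 2: "\<bar>f w\<bar> \<le> 2 * (2 * B) * (1 + w powr p)"
      using growth_antideriv[OF f(1) _ 1 _ w] f(3) p B(1) by simp
    show "\<bar>f w\<bar> \<le> 4 * B * (1 + w powr p)" using 2 by simp
    have "2 * B * (1 + w powr (p - 1)) \<le> 4 * B * (1 + w powr (p - 1))" using B(1) by (intro mult_right_mono) auto
    with 1[OF w] show "\<bar>f1 w\<bar> \<le> 4 * B * (1 + w powr (p - 1))" by (rule order_trans)
  qed
  have grL: "\<bar>fp_op m lam f1 f2 w\<bar> \<le> 4 * B * (2 * \<bar>m\<bar> + 2 + \<bar>lam\<bar>) * (1 + w powr p)"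
    if f: "\<And>w. 0 \<le> w \<Longrightarrow> (f has_real_derivative f1 w) (at w within {0..})"
      "\<And>w. 0 \<le> w \<Longrightarrow> (f1 has_real_derivative f2 w) (at w within {0..})" "f 0 = 0" "f1 0 = 0"
      and B: "0 \<le> B" "\<And>x. 0 \<le> x \<Longrightarrow> \<bar>f2 x\<bar> \<le> B * (1 + x powr (p - 2))" and w: "0 \<le> w" for f f1 f2 B w
  proof (rule fp_op_growth[OF _ _ gr(1)[OF f B] _ w])
    fix x :: real assume x: "0 \<le> x"
    have "B * (1 + x powr (p - 2)) \<le> 4 * B * (1 + x powr (p - 2))" using B(1) by (intro mult_right_mono) auto
    with B(2)[OF x] show "\<bar>f2 x\<bar> \<le> 4 * B * (1 + x powr (p - 2))" by (rule order_trans)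
  qed (use p B in auto)
  show "growth p (\<lambda>w. \<phi> (max 0 w))" by (rule growthI) (use gr(2)[OF d1 d2 z C] in auto)
  show gv: "growth p (\<lambda>w. fp_op m lam \<phi>1 \<phi>2 (max 0 w))" by (rule growthI) (use grL[OF d1 d2 z C] in auto)
  \<comment> \<open>The extra 1 absorbs the approximation error
    \<open>1 / real (Suc n)\<close>.\<close>
  define B where "B = C + 1"
  have B0: "0 \<le> B" using C by (simp add: B_def)
  have "\<exists>\<theta>. bdd_smooth \<theta> \<and> (\<forall>w\<ge>0. \<bar>\<theta> w - \<phi>2 (min w (real (Suc n)))\<bar> \<le> 1 / real (Suc n))" for n
    using bdd_smooth_approx[OF c2, of "real (Suc n)" "1 / real (Suc n)"] by (metis of_nat_0_less_iff zero_less_Suc zero_less_divide_1_iff)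
  then obtain \<theta> where \<theta>: "\<And>n. bdd_smooth (\<theta> n)" "\<And>n w. 0 \<le> w \<Longrightarrow> \<bar>\<theta> n w - \<phi>2 (min w (real (Suc n)))\<bar> \<le> 1 / real (Suc n)"
    by metis
  have "\<exists>f f1. C2_smooth f f1 (\<theta> n) \<and> f 0 = 0 \<and> f1 0 = 0" for n
    using C2_smooth_antideriv[OF \<theta>(1)[of n]] by metis
  then obtain f f1 where ff: "\<And>n. C2_smooth (f n) (f1 n) (\<theta> n)" "\<And>n. f n 0 = 0" "\<And>n. f1 n 0 = 0" by metis
  have fd: "(f n has_real_derivative f1 n w) (at w within S)" "(f1 n has_real_derivative \<theta> n w) (at w within S)" for n w S
    using ff(1)[of n] by (auto simp: C2_smooth_def intro: DERIV_subset)
  have \<theta>B: "\<bar>\<theta> n x\<bar> \<le> B * (1 + x powr (p - 2))" if x: "0 \<le> x" for n x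
  proof -
    have "\<bar>\<theta> n x\<bar> \<le> \<bar>\<phi>2 (min x (real (Suc n)))\<bar> + 1 / real (Suc n)" using \<theta>(2)[OF x, of n] by linarith
    also have "\<dots> \<le> C * (1 + (min x (real (Suc n))) powr (p - 2)) + 1" using C(2) x by (intro add_mono) auto
    also have "\<dots> \<le> C * (1 + x powr (p - 2)) + 1 * (1 + x powr (p - 2))"
    proof (intro add_mono mult_left_mono C(1))
      show "min x (real (Suc n)) powr (p - 2) \<le> x powr (p - 2)" using x p by (intro powr_mono2) auto
    qed auto
    also have "\<dots> = B * (1 + x powr (p - 2))" by (simp add: B_def algebra_simps)
    finally show ?thesis .
  qed
  \<comment> \<open>On \<open>{0..real (Suc n)}\<close> the truncation of the argument is inactive,
    and every fixed point eventually lies there.\<close>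
  have near2: "\<bar>\<theta> n x - \<phi>2 x\<bar> \<le> 1 / real (Suc n)" if "0 \<le> x" "x \<le> real (Suc n)" for n x
    using \<theta>(2)[OF that(1), of n] that(2) by (simp add: min_def)
  have near1: "\<bar>f1 n x - \<phi>1 x\<bar> \<le> 1 / real (Suc n) * x" if x: "0 \<le> x" "x \<le> real (Suc n)" for n x
    using abs_diff_le_on_Icc[of "\<lambda>x. f1 n x - \<phi>1 x" "\<lambda>x. \<theta> n x - \<phi>2 x" x "1 / real (Suc n)"]
      DERIV_diff[OF fd(2) d2] near2 x z ff(3) by simp
  have near0: "\<bar>f n x - \<phi> x\<bar> \<le> 1 / real (Suc n) * x * x" if x: "0 \<le> x" "x \<le> real (Suc n)" for n x
  proof -
    have "\<bar>f1 n y - \<phi>1 y\<bar> \<le> 1 / real (Suc n) * x" if "0 \<le> y" "y \<le> x" for y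
    proof -
      have "\<bar>f1 n y - \<phi>1 y\<bar> \<le> 1 / real (Suc n) * y" using that x by (intro near1) auto
      also have "\<dots> \<le> 1 / real (Suc n) * x" using that by (intro mult_left_mono) auto
      finally show ?thesis .
    qed
    then show ?thesis
      using abs_diff_le_on_Icc[of "\<lambda>x. f n x - \<phi> x" "\<lambda>x. f1 n x - \<phi>1 x" x "1 / real (Suc n) * x"]
        DERIV_diff[OF fd(1) d1] x z ff(2) by simp
  qed
  have inv: "(\<lambda>n. 1 / real (Suc n) * y) \<longlonglongrightarrow> 0" for y
    using tendsto_mult_left_zero[OF LIMSEQ_inverse_real_of_nat, of y] by (simp add: divide_inverse)
  have ev: "\<forall>\<^sub>F n in sequentially. x \<le> real (Suc n)" for x
  proof -
    obtain N where "x \<le> real N" using real_arch_simple by blast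
    then show ?thesis by (intro eventually_sequentiallyI[of N]) auto
  qed
  have lim2: "(\<lambda>n. \<theta> n x) \<longlonglongrightarrow> \<phi>2 x" if x: "0 \<le> x" for x
  proof (rule LIM_zero_cancel, rule Lim_null_comparison[OF _ inv[of 1]])
    show "\<forall>\<^sub>F n in sequentially. norm (\<theta> n x - \<phi>2 x) \<le> 1 / real (Suc n) * 1"
      using ev[of x] by eventually_elim (use near2[OF x] in simp)
  qed
  have lim1: "(\<lambda>n. f1 n x) \<longlonglongrightarrow> \<phi>1 x" if x: "0 \<le> x" for x
  proof (rule LIM_zero_cancel, rule Lim_null_comparison[OF _ inv[of x]])
    show "\<forall>\<^sub>F n in sequentially. norm (f1 n x - \<phi>1 x) \<le> 1 / real (Suc n) * x"
      using ev[of x] by eventually_elim (use near1[OF x] in simp)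
  qed
  have lim0: "(\<lambda>n. f n x) \<longlonglongrightarrow> \<phi> x" if x: "0 \<le> x" for x
  proof (rule LIM_zero_cancel, rule Lim_null_comparison[OF _ inv[of "x * x"]])
    show "\<forall>\<^sub>F n in sequentially. norm (f n x - \<phi> x) \<le> 1 / real (Suc n) * (x * x)"
      using ev[of x] by eventually_elim (use near0[OF x] in simp)
  qed
  have limL: "(\<lambda>n. fp_op m lam (f1 n) (\<theta> n) x) \<longlonglongrightarrow> fp_op m lam \<phi>1 \<phi>2 x" if x: "0 \<le> x" for x
    unfolding fp_op_def by (intro tendsto_intros lim1 lim2 x)
  have fgr: "\<bar>f n w\<bar> \<le> 4 * B * (1 + w powr p)" "\<bar>fp_op m lam (f1 n) (\<theta> n) w\<bar> \<le> 4 * B * (2 * \<bar>m\<bar> + 2 + \<bar>lam\<bar>) * (1 + w powr p)"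
    if "0 \<le> w" for n w
    using gr(2)[OF fd ff(2,3) B0 \<theta>B that] grL[OF fd ff(2,3) B0 \<theta>B that] by auto
  have dct: "(\<lambda>n. \<integral>w. g n w \<partial>G s) \<longlonglongrightarrow> (\<integral>w. h (max 0 w) \<partial>G s)"
    if s: "0 \<le> s" and gc: "\<And>n. continuous_on UNIV (g n)" and hc: "continuous_on UNIV (\<lambda>w. h (max 0 w))"
      and lim: "\<And>x. 0 \<le> x \<Longrightarrow> (\<lambda>n. g n x) \<longlonglongrightarrow> h x" and A: "\<And>n w. 0 \<le> w \<Longrightarrow> \<bar>g n w\<bar> \<le> A * (1 + w powr p)"
    for s A and g :: "nat \<Rightarrow> real \<Rightarrow> real" and h :: "real \<Rightarrow> real"
  proof -
    note Gs = wealthD[OF G[OF s]]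
    interpret Gs: real_distribution "G s" by (rule Gs)
    show ?thesis
    proof (rule integral_dominated_convergence)
      show "integrable (G s) (\<lambda>w. A * (1 + \<bar>w\<bar> powr p))" using Gs(6) by simp
      show "AE w in G s. (\<lambda>n. g n w) \<longlonglongrightarrow> h (max 0 w)" using Gs(5) by eventually_elim (use lim in simp)
      show "AE w in G s. norm (g n w) \<le> A * (1 + \<bar>w\<bar> powr p)" for n using Gs(5) by eventually_elim (use A in simp)
      have "g n \<in> borel_measurable borel" "(\<lambda>w. h (max 0 w)) \<in> borel_measurable borel" for n
        using gc hc by (auto intro: borel_measurable_continuous_onI)
      then show "g n \<in> borel_measurable (G s)" "(\<lambda>w. h (max 0 w)) \<in> borel_measurable (G s)" for n by simp_all
    qed
  qed
  define vn where "vn n s = (\<integral>w. fp_op m lam (f1 n) (\<theta> n) w \<partial>G s)" for n s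
  have vn_lim: "(\<lambda>n. vn n s) \<longlonglongrightarrow> v s" if "0 \<le> s" for s
    unfolding vn_def v_def by (rule dct[OF that fp_op_C2_continuous[OF ff(1)] cv limL fgr(2)])
  have un_lim: "(\<lambda>n. \<integral>w. f n w \<partial>G s) \<longlonglongrightarrow> u s" if "0 \<le> s" for s
    unfolding u_def by (rule dct[OF that C2_smooth_continuous(1)[OF ff(1)] cu lim0 fgr(1)])
  have vn_cont: "continuous_on {0..} (vn n)" for n
    unfolding vn_def by (rule continuous_lower_growth[OF fp_op_C2_continuous[OF ff(1)] fp_op_C2_growth[OF ff(1)]]) (use p in auto)
  have vn_int: "vn n integrable_on {0..t}" for n
    by (rule integrable_continuous_real, rule continuous_on_subset[OF vn_cont]) auto
  define A where "A = 4 * B * (2 * \<bar>m\<bar> + 2 + \<bar>lam\<bar>)"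
  have A0: "0 \<le> A" using B0 by (simp add: A_def)
  have vn_bd: "norm (vn n s) \<le> A * (1 + K t)" if s: "s \<in> {0..t}" for n s
  proof -
    have s0: "0 \<le> s" using s by simp
    note Gs = wealthD[OF G[OF s0]]
    interpret Gs: real_distribution "G s" by (rule Gs)
    have i: "integrable (G s) (\<lambda>w. A * (1 + \<bar>w\<bar> powr p))" using Gs(6) by simp
    have gL: "growth p (fp_op m lam (f1 n) (\<theta> n))" using fgr(2) by (rule growthI)
    have iL: "integrable (G s) (fp_op m lam (f1 n) (\<theta> n))"
      by (rule wealth_integrable[OF G[OF s0] _ gL]) (intro borel_measurable_continuous_onI fp_op_C2_continuous[OF ff(1)])
    have "\<bar>vn n s\<bar> \<le> (\<integral>w. \<bar>fp_op m lam (f1 n) (\<theta> n) w\<bar> \<partial>G s)" unfolding vn_def by (rule integral_abs_bound)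
    also have "\<dots> \<le> (\<integral>w. A * (1 + \<bar>w\<bar> powr p) \<partial>G s)"
    proof (rule integral_mono_AE)
      show "AE w in G s. \<bar>fp_op m lam (f1 n) (\<theta> n) w\<bar> \<le> A * (1 + \<bar>w\<bar> powr p)"
        using Gs(5) by eventually_elim (use fgr(2) in \<open>simp add: A_def\<close>)
    qed (use i iL in auto)
    also have "\<dots> = A * (1 + (\<integral>w. w powr p \<partial>G s))" using Gs(6) Gs.prob_space wealth_moment_eq[OF G[OF s0]] by simp
    also have "\<dots> \<le> A * (1 + K t)" using K[of s t] s A0 by (intro mult_left_mono add_left_mono) auto
    finally show ?thesis by simp
  qed
  have vl: "(\<lambda>n. vn n s) \<longlonglongrightarrow> v s" if "s \<in> {0..t}" for s using vn_lim that by simp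
  have ci: "(\<lambda>s. A * (1 + K t)) integrable_on {0..t}" by (rule integrable_const_ivl)
  note hk = dominated_convergence[OF vn_int ci vn_bd vl]
  show "v integrable_on {0..t}" by (rule hk)
  have "(\<lambda>n. (\<integral>w. f n w \<partial>G t) - (\<integral>w. f n w \<partial>G 0)) \<longlonglongrightarrow> u t - u 0" using un_lim t by (intro tendsto_diff) auto
  moreover have "(\<integral>w. f n w \<partial>G t) - (\<integral>w. f n w \<partial>G 0) = integral {0..t} (vn n)" for n
    unfolding vn_def by (rule fp_smooth[OF ff t])
  ultimately show "u t - u 0 = integral {0..t} v" using LIMSEQ_unique hk(2) by simp
qed

text \<open>The integral equation for \<open>w powr p\<close> exhibits this moment as a constant
  plus an indefinite integral, which is continuous even when the integrand is merely
  integrable.\<close>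

lemma continuous_moment: "continuous_on {0..} (\<lambda>t. \<integral>w. w powr p \<partial>G t)"
proof -
  define y where "y t = (\<integral>w. w powr p \<partial>G t)" for t
  define \<phi>2 where "\<phi>2 w = p * ((p - 1) * w powr (p - 2))" for w :: real
  have d1: "\<forall>w\<ge>0. ((\<lambda>w. w powr p) has_real_derivative p * w powr (p - 1)) (at w within {0..})"
    using powr_has_deriv_Rplus p by auto
  have d2: "\<forall>w\<ge>0. ((\<lambda>w. p * w powr (p - 1)) has_real_derivative \<phi>2 w) (at w within {0..})"
    using DERIV_cmult[OF powr_has_deriv_Rplus[of "p - 1"], of _ p] p by (simp add: \<phi>2_def)
  have c2: "continuous_on {0..} \<phi>2" unfolding \<phi>2_def using p by (intro continuous_intros continuous_on_powr') auto
  have g2: "growth (p - 2) \<phi>2"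
  proof (rule growthI)
    fix w :: real
    have "p * (p - 1) * w powr (p - 2) \<le> p * (p - 1) * (1 + w powr (p - 2))" using p by (intro mult_left_mono) auto
    then show "\<bar>\<phi>2 w\<bar> \<le> p * (p - 1) * (1 + w powr (p - 2))" using p by (simp add: \<phi>2_def abs_mult)
  qed
  have z: "(0::real) powr p = 0" "p * 0 powr (p - 1) = 0" using p by auto
  define v where "v s = (\<integral>w. fp_op m lam (\<lambda>w. p * w powr (p - 1)) \<phi>2 (max 0 w) \<partial>G s)" for s
  have ym: "(\<integral>w. (max 0 w) powr p \<partial>G t) = y t" if t: "0 \<le> t" for t
  proof -
    interpret Gt: real_distribution "G t" by (rule wealthD[OF G[OF t]])
    show ?thesis unfolding y_def using wealthD(5)[OF G[OF t]] by (intro integral_cong_AE) auto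
  qed
  note fe = fp_integral_equation[OF d1 d2 c2 g2 z, folded v_def]
  have "continuous_on {0..T} y" if T: "0 \<le> T" for T
  proof -
    have "continuous_on {0..T} (\<lambda>t. y 0 + integral {0..t} v)"
      using fe(2)[OF T] by (intro continuous_intros indefinite_integral_continuous_1) (simp add: v_def[abs_def])
    moreover have "y t = y 0 + integral {0..t} v" if "t \<in> {0..T}" for t
      using fe(1)[of t] that ym by (simp add: v_def[abs_def])
    ultimately show ?thesis by (metis (no_types, lifting) continuous_on_cong)
  qed
  then have T: "continuous_on {0..T} y" if "0 \<le> T" for T using that by blast
  show ?thesis
    unfolding y_def[symmetric] continuous_on_sequentially
  proof (intro allI ballI impI)
    fix s and t :: real assume t: "t \<in> {0..}" and s: "(\<forall>n. s n \<in> {0..}) \<and> s \<longlonglongrightarrow> t"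
    then obtain B where B: "\<And>n. \<bar>s n\<bar> \<le> B" using convergent_imp_Bseq[of s] by (auto simp: convergent_def Bseq_def)
    have sB: "s n \<in> {0..max B t}" for n using B[of n] s by (auto simp: abs_le_iff)
    have tB: "t \<in> {0..max B t}" using t by auto
    show "(y \<circ> s) \<longlonglongrightarrow> y t"
      using T[of "max B t"] t sB tB s unfolding continuous_on_sequentially by auto
  qed
qed

text \<open>Weak continuity together with continuity of the moment of order \<open>p\<close>
  prevents any part of that moment from escaping to infinity, so the critical growth is covered as
  well.\<close>

lemma continuous_growth:
  assumes \<psi>: "continuous_on UNIV \<psi>" "growth p \<psi>"
  shows "continuous_on {0..} (\<lambda>t. \<integral>w. \<psi> w \<partial>G t)"
  unfolding continuous_on_sequentially
proof (intro allI ballI impI)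
  fix s and t :: real assume t: "t \<in> {0..}" and s: "(\<forall>n. s n \<in> {0..}) \<and> s \<longlonglongrightarrow> t"
  then have s0: "\<And>n. 0 \<le> s n" and st: "s \<longlonglongrightarrow> t" and t0: "0 \<le> t" by auto
  have "((\<lambda>t. \<integral>w. w powr p \<partial>G t) \<circ> s) \<longlonglongrightarrow> (\<integral>w. w powr p \<partial>G t)"
    using continuous_moment t s unfolding continuous_on_sequentially by blast
  then have m: "(\<lambda>n. \<integral>w. w powr p \<partial>G (s n)) \<longlonglongrightarrow> (\<integral>w. w powr p \<partial>G t)" by (simp add: o_def)
  have "(\<lambda>n. \<integral>w. \<psi> w \<partial>G (s n)) \<longlonglongrightarrow> (\<integral>w. \<psi> w \<partial>G t)"
    by (rule weak_conv_growth[OF G[OF s0] G[OF t0] weak[OF s0 st t0] _ m \<psi>]) (use p in simp)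
  then show "((\<lambda>t. \<integral>w. \<psi> w \<partial>G t) \<circ> s) \<longlonglongrightarrow> (\<integral>w. \<psi> w \<partial>G t)" by (simp add: o_def)
qed

text \<open>The integrand of the time integral is continuous now that growth of order
  \<open>p\<close> is under control, and the fundamental theorem of calculus applies.\<close>

lemma fp_derivative:
  assumes \<phi>: "\<phi> \<in> test_functions p"
  defines "L \<equiv> fp_op m lam (deriv_Rplus \<phi>) ((deriv_Rplus ^^ 2) \<phi>)"
  defines "u \<equiv> \<lambda>t. \<integral>w. \<phi> (max 0 w) \<partial>G t"
  shows "0 < t \<Longrightarrow> (u has_real_derivative (\<integral>w. L (max 0 w) \<partial>G t)) (at t)"
    and "(u \<longlongrightarrow> u 0) (at_right 0)"
    and "(\<lambda>w. \<phi> (max 0 w)) \<in> borel_measurable borel" "(\<lambda>w. L (max 0 w)) \<in> borel_measurable borel"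
    and "0 \<le> t \<Longrightarrow> integrable (G t) (\<lambda>w. \<phi> (max 0 w))" "0 \<le> t \<Longrightarrow> integrable (G t) (\<lambda>w. L (max 0 w))"
proof -
  note T = test_functions_C2[OF \<phi> p]
  have d: "\<forall>w\<ge>0. (\<phi> has_real_derivative deriv_Rplus \<phi> w) (at w within {0..})"
    "\<forall>w\<ge>0. (deriv_Rplus \<phi> has_real_derivative (deriv_Rplus ^^ 2) \<phi> w) (at w within {0..})"
    using T(3,4) by auto
  note fe = fp_integral_equation[OF d T(5,6,1,2), folded L_def]
  define v where "v s = (\<integral>w. L (max 0 w) \<partial>G s)" for s
  have e: "u t - u 0 = integral {0..t} v" if "0 \<le> t" for t
    using fe(1)[OF that] by (simp add: u_def v_def[abs_def])
  note c = fe(3,5)[OF order_refl] and g = fe(4,6)[OF order_refl]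
  have cv: "continuous_on {0..} v" unfolding v_def by (rule continuous_growth[OF c(2) g(2)])
  show m: "(\<lambda>w. \<phi> (max 0 w)) \<in> borel_measurable borel" "(\<lambda>w. L (max 0 w)) \<in> borel_measurable borel"
    using c by (auto intro: borel_measurable_continuous_onI)
  show "integrable (G t) (\<lambda>w. \<phi> (max 0 w))" "integrable (G t) (\<lambda>w. L (max 0 w))" if "0 \<le> t"
    using wealth_integrable[OF G[OF that] m(1) g(1)] wealth_integrable[OF G[OF that] m(2) g(2)] by auto
  have cu: "continuous_on {0..} u" unfolding u_def by (rule continuous_growth[OF c(1) g(1)])
  then have "(u \<longlongrightarrow> u 0) (at 0 within {0..})" by (simp add: continuous_on_def)
  then show "(u \<longlongrightarrow> u 0) (at_right 0)" unfolding at_within_Ici_at_right .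
  assume t: "0 < t"
  have "((\<lambda>t. integral {0..t} v) has_real_derivative v t) (at t within {0..t + 1})"
    by (rule integral_has_real_derivative) (use t cv in \<open>auto intro: continuous_on_subset\<close>)
  then have i: "((\<lambda>t. u 0 + integral {0..t} v) has_real_derivative v t) (at t)"
    using t by (auto simp: at_within_Icc_at intro!: derivative_eq_intros)
  have "(u has_real_derivative v t) (at t)"
  proof (rule has_field_derivative_transform_within_open[OF i])
    show "open ({0<..} :: real set)" "t \<in> {0<..}" using t by auto
    show "u 0 + integral {0..x} v = u x" if "x \<in> {0<..}" for x using e[of x] that by simp
  qed
  then show "(u has_real_derivative (\<integral>w. L (max 0 w) \<partial>G t)) (at t)" by (simp add: v_def)
qed

end

section \<open>The quasi-invariant limit\<close>

text \<open>By Levy's continuity theorem it is enough to test with \<open>cos\<close> and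
  \<open>sin\<close>.\<close>

lemma weak_conv_of_bdd_smooth:
  assumes \<mu>: "\<And>n. real_distribution (\<mu> n)" and G: "real_distribution G"
    and lim: "\<And>\<phi>. bdd_smooth \<phi> \<Longrightarrow> (\<lambda>n. \<integral>w. \<phi> w \<partial>\<mu> n) \<longlonglongrightarrow> (\<integral>w. \<phi> w \<partial>G)"
  shows "weak_conv_m \<mu> G"
proof (rule levy_continuity[OF \<mu> G])
  fix \<xi>
  have s: "bdd_smooth (\<lambda>w. cos (\<xi> * w))" "bdd_smooth (\<lambda>w. sin (\<xi> * w))"
    using bdd_smooth_affine[OF bdd_smooth_cos, of \<xi> 0] bdd_smooth_affine[OF bdd_smooth_sin, of \<xi> 0] by auto
  show "(\<lambda>n. char (\<mu> n) \<xi>) \<longlonglongrightarrow> char G \<xi>"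
    unfolding char_eq[OF \<mu>] char_eq[OF G] by (intro tendsto_Complex lim s)
qed

text \<open>Models noises of the form \<open>sqrt (lam * \<gamma> n)\<close> times one fixed
  variable, whose absolute moments are \<open>k r\<close>; this accounts for the powers
  \<open>r / 2\<close>.\<close>

locale kinetic_family =
  fixes p lam :: real and k :: "real \<Rightarrow> real" and \<gamma> :: "nat \<Rightarrow> real" and \<nu> :: "nat \<Rightarrow> real measure"
    and F :: "nat \<Rightarrow> real \<Rightarrow> real measure" and F0 :: "real measure"
  assumes flows: "\<And>n. kinetic_flow (\<nu> n) p (\<gamma> n) (F n) F0"
    and var_eq: "\<And>n. noise.var (\<nu> n) = lam * \<gamma> n"
    and moment_eq: "\<And>n r. 2 \<le> r \<Longrightarrow> r \<le> p \<Longrightarrow> noise.abs_moment (\<nu> n) r = (lam * \<gamma> n) powr (r / 2) * k r"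
    and \<gamma>_lim: "\<gamma> \<longlonglongrightarrow> 0" and lam: "0 < lam"
begin

lemma p: "2 < p" and F0: "wealth p F0"
  using kinetic_flow.p[OF flows] kinetic_flow.F0[OF flows] by auto

lemma \<gamma>: "0 < \<gamma> n" "\<gamma> n \<le> 1 / 4" "\<gamma> n \<le> 1 / 2" "\<gamma> n \<le> 1"
  using kinetic_flow.\<gamma>[OF flows, of n] by auto

lemma k_nonneg: "2 \<le> r \<Longrightarrow> r \<le> p \<Longrightarrow> 0 \<le> k r"
proof -
  assume r: "2 \<le> r" "r \<le> p"
  have "0 \<le> noise.abs_moment (\<nu> 0) r"
    by (rule noise.abs_moment_nonneg) (rule kinetic_flow.axioms(1)[OF flows])
  moreover have "0 < (lam * \<gamma> 0) powr (r / 2)" using lam \<gamma>[of 0] by simp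
  ultimately show "0 \<le> k r" using moment_eq[OF r, of 0] by (simp add: zero_le_mult_iff)
qed

text \<open>At most 3 for the Taylor remainder, at most \<open>p\<close> for the available moments,
  and above 2 so that the noise moment of order \<open>q\<close> is of smaller order than
  \<gamma>.\<close>

definition q :: real where "q = min p 3"

lemma q: "2 \<le> q" "q \<le> 3" "q \<le> p" "2 < q" using p by (auto simp: q_def)

section \<open>Rescaled flows and estimates uniform in the parameter\<close>

definition scaled :: "nat \<Rightarrow> real \<Rightarrow> real measure" where "scaled n t = F n (t / \<gamma> n)"

lemma scaled_wealth: "0 \<le> t \<Longrightarrow> wealth p (scaled n t)"
  unfolding scaled_def using kinetic_flow.F[OF flows] \<gamma>[of n] by simp

lemma scaled_0: "scaled n 0 = F0"
  unfolding scaled_def using kinetic_flow.F_0[OF flows] by simp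

text \<open>The exponent bounds the moment rate divided by \<open>\<gamma> n\<close>; it is
  independent of \<open>n\<close> because \<open>\<gamma> n\<close> is at most 1.\<close>

definition moment_cap :: "real \<Rightarrow> real" where
  "moment_cap t = exp (8 * p\<^sup>2 * 6 powr p * (2 + 9 * (2 + lam) * lam + lam powr (p / 2) * k p) * t) * (\<integral>w. w powr p \<partial>F0)"

lemma moment_cap_mono: "0 \<le> s \<Longrightarrow> s \<le> t \<Longrightarrow> moment_cap s \<le> moment_cap t"
  unfolding moment_cap_def using lam p k_nonneg[of p] by (intro mult_right_mono) (auto intro!: mult_left_mono mult_nonneg_nonneg add_nonneg_nonneg)

lemma moment_cap_nonneg: "0 \<le> moment_cap t" by (simp add: moment_cap_def)

lemma scaled_moment: assumes "0 \<le> t" shows "(\<integral>w. w powr p \<partial>scaled n t) \<le> moment_cap t"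
proof -
  interpret kf: kinetic_flow "\<nu> n" p "\<gamma> n" "F n" F0 by (rule flows)
  define R where "R = 8 * p\<^sup>2 * 6 powr p * (2 + 9 * (2 + lam) * lam + lam powr (p / 2) * k p)"
  have kp: "0 \<le> k p" using k_nonneg p by simp
  have g: "0 < \<gamma> n" "\<gamma> n \<le> 1" using \<gamma>[of n] by auto
  have "kf.moment_rate \<le> R * \<gamma> n"
  proof -
    have a: "9 * (2 + lam * \<gamma> n) * (lam * \<gamma> n) \<le> 9 * (2 + lam) * lam * \<gamma> n"
    proof -
      have "lam * \<gamma> n \<le> lam * 1" using g lam by (intro mult_left_mono) auto
      then have "(2 + lam * \<gamma> n) * (lam * \<gamma> n) \<le> (2 + lam) * (lam * \<gamma> n)" using g lam by (intro mult_right_mono) auto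
      then have "9 * ((2 + lam * \<gamma> n) * (lam * \<gamma> n)) \<le> 9 * ((2 + lam) * (lam * \<gamma> n))" by (intro mult_left_mono) auto
      then show ?thesis by (simp only: mult.assoc)
    qed
    have b: "(lam * \<gamma> n) powr (p / 2) * k p \<le> lam powr (p / 2) * k p * \<gamma> n"
    proof -
      have "\<gamma> n powr (p / 2) \<le> \<gamma> n powr 1" using g p by (intro powr_mono') auto
      then have "lam powr (p / 2) * \<gamma> n powr (p / 2) * k p \<le> lam powr (p / 2) * \<gamma> n * k p"
        using g kp by (intro mult_right_mono mult_left_mono) auto
      then show ?thesis using g lam by (simp add: powr_mult mult_ac)
    qed
    have "2 * \<gamma> n + 9 * (2 + lam * \<gamma> n) * (lam * \<gamma> n) + (lam * \<gamma> n) powr (p / 2) * k p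
        \<le> (2 + 9 * (2 + lam) * lam + lam powr (p / 2) * k p) * \<gamma> n"
      using a b unfolding distrib_right by linarith
    then have "8 * p\<^sup>2 * 6 powr p * (2 * \<gamma> n + 9 * (2 + lam * \<gamma> n) * (lam * \<gamma> n) + (lam * \<gamma> n) powr (p / 2) * k p)
        \<le> 8 * p\<^sup>2 * 6 powr p * ((2 + 9 * (2 + lam) * lam + lam powr (p / 2) * k p) * \<gamma> n)" by (intro mult_left_mono) auto
    then show ?thesis unfolding kf.moment_rate_def var_eq R_def using moment_eq[of p n] p by (simp add: mult.assoc)
  qed
  then have "kf.moment_rate * (t / \<gamma> n) \<le> R * \<gamma> n * (t / \<gamma> n)" using assms g by (intro mult_right_mono) auto
  also have "\<dots> = R * t" using g by simp
  finally have "exp (kf.moment_rate * (t / \<gamma> n)) * (\<integral>w. w powr p \<partial>F0) \<le> moment_cap t"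
    unfolding moment_cap_def R_def[symmetric] by (intro mult_right_mono) auto
  with kf.moment_bound[of "t / \<gamma> n"] assms g show ?thesis unfolding scaled_def by simp
qed

text \<open>The consistency error per unit of rescaled time. The noise moment of order
  \<open>q\<close> is of order \<open>\<gamma> n powr (q / 2)\<close>, so a positive power remains
  after division by \<open>\<gamma> n\<close>.\<close>

definition err :: "nat \<Rightarrow> real" where
  "err n = 2560 * (2 + lam * \<gamma> n) * (lam powr (q / 2) * k q * \<gamma> n powr (q / 2 - 1) + \<gamma> n)"

lemma moment_q: "noise.abs_moment (\<nu> n) q = \<gamma> n * (lam powr (q / 2) * k q * \<gamma> n powr (q / 2 - 1))"
proof -
  have "\<gamma> n powr (q / 2) = \<gamma> n powr (1 + (q / 2 - 1))" by simp
  also have "\<dots> = \<gamma> n powr 1 * \<gamma> n powr (q / 2 - 1)" by (rule powr_add)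
  finally have "\<gamma> n powr (q / 2) = \<gamma> n * \<gamma> n powr (q / 2 - 1)" using \<gamma>[of n] by simp
  then show ?thesis using moment_eq[OF q(1,3), of n] lam \<gamma>[of n] by (simp add: powr_mult mult_ac)
qed

lemma powr_\<gamma>_lim: "(\<lambda>n. \<gamma> n powr (q / 2 - 1)) \<longlonglongrightarrow> 0"
proof -
  have "(\<lambda>n. \<gamma> n powr (q / 2 - 1)) \<longlonglongrightarrow> 0 powr (q / 2 - 1)"
    using q \<gamma>(1) by (intro tendsto_powr' \<gamma>_lim tendsto_const) (auto intro!: always_eventually less_imp_le)
  then show ?thesis using q by simp
qed

lemma err_lim: "err \<longlonglongrightarrow> 0"
proof -
  have "err \<longlonglongrightarrow> 2560 * (2 + lam * 0) * (lam powr (q / 2) * k q * 0 + 0)"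
    unfolding err_def by (intro tendsto_intros \<gamma>_lim powr_\<gamma>_lim)
  then show ?thesis by simp
qed

lemma err_nonneg: "0 \<le> err n"
  unfolding err_def using lam \<gamma>[of n] k_nonneg[OF q(1,3)] by (intro mult_nonneg_nonneg add_nonneg_nonneg) auto

lemma err_eq: "2560 * (2 + noise.var (\<nu> n)) * (noise.abs_moment (\<nu> n) q + (\<gamma> n)\<^sup>2) = \<gamma> n * err n"
  unfolding err_def var_eq moment_q by (simp add: power2_eq_square algebra_simps)

lemma coll_estimates:
  assumes \<phi>: "C2_smooth \<phi> \<phi>1 \<phi>2"
    and C: "\<And>x. \<bar>\<phi>1 x\<bar> \<le> C * (1 + \<bar>x\<bar>)" "\<And>x. \<bar>\<phi>2 x\<bar> \<le> C" "\<And>x y. \<bar>\<phi>2 x - \<phi>2 y\<bar> \<le> C * \<bar>x - y\<bar>"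
    and s: "0 \<le> s" "s \<le> T"
  shows "\<bar>coll (\<gamma> n) (\<nu> n) (scaled n s) \<phi> - \<gamma> n * (\<integral>w. fp_op (\<integral>v. v \<partial>scaled n s) lam \<phi>1 \<phi>2 w \<partial>scaled n s)\<bar>
      \<le> \<gamma> n * (C * err n * (3 + 2 * moment_cap T))"
    and "\<bar>coll (\<gamma> n) (\<nu> n) (scaled n s) \<phi>\<bar> \<le> \<gamma> n * (C * (3 + lam + err n) * (3 + 2 * moment_cap T))"
proof -
  interpret kf: kinetic_flow "\<nu> n" p "\<gamma> n" "F n" F0 by (rule flows)
  have C0: "0 \<le> C" using C(2)[of 0] by linarith
  note cc = kf.coll_consistent[OF scaled_wealth[OF s(1)] p kf.noise_moment q(1-3) kf.\<gamma>_bounds(1,3) \<phi> C, of n, unfolded err_eq]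
  have mom: "(\<integral>w. w powr p \<partial>scaled n s) \<le> moment_cap T" using scaled_moment[OF s(1), of n] moment_cap_mono[OF s] by linarith
  have "(\<integral>w. \<gamma> n * ((\<integral>v. v \<partial>scaled n s) - w) * \<phi>1 w + kf.var / 2 * w\<^sup>2 * \<phi>2 w \<partial>scaled n s)
      = (\<integral>w. \<gamma> n * fp_op (\<integral>v. v \<partial>scaled n s) lam \<phi>1 \<phi>2 w \<partial>scaled n s)"
    by (intro Bochner_Integration.integral_cong) (auto simp: fp_op_def var_eq algebra_simps)
  then have e: "(\<integral>w. \<gamma> n * ((\<integral>v. v \<partial>scaled n s) - w) * \<phi>1 w + kf.var / 2 * w\<^sup>2 * \<phi>2 w \<partial>scaled n s)
      = \<gamma> n * (\<integral>w. fp_op (\<integral>v. v \<partial>scaled n s) lam \<phi>1 \<phi>2 w \<partial>scaled n s)" by simp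
  have "C * (\<gamma> n * err n) * (3 + 2 * (\<integral>w. w powr p \<partial>scaled n s)) \<le> C * (\<gamma> n * err n) * (3 + 2 * moment_cap T)"
    using mom C0 err_nonneg[of n] \<gamma>(1)[of n] by (intro mult_left_mono) auto
  with cc(1) show "\<bar>coll (\<gamma> n) (\<nu> n) (scaled n s) \<phi> - \<gamma> n * (\<integral>w. fp_op (\<integral>v. v \<partial>scaled n s) lam \<phi>1 \<phi>2 w \<partial>scaled n s)\<bar>
      \<le> \<gamma> n * (C * err n * (3 + 2 * moment_cap T))" unfolding e by (simp add: mult_ac)
  have "C * (3 * \<gamma> n + kf.var + \<gamma> n * err n) * (3 + 2 * (\<integral>w. w powr p \<partial>scaled n s)) \<le> C * (3 * \<gamma> n + kf.var + \<gamma> n * err n) * (3 + 2 * moment_cap T)"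
    using mom C0 err_nonneg[of n] \<gamma>(1)[of n] kf.var_nonneg by (intro mult_left_mono) auto
  moreover have "C * (3 * \<gamma> n + kf.var + \<gamma> n * err n) * (3 + 2 * moment_cap T) = \<gamma> n * (C * (3 + lam + err n) * (3 + 2 * moment_cap T))"
    unfolding var_eq by (simp add: algebra_simps)
  ultimately show "\<bar>coll (\<gamma> n) (\<nu> n) (scaled n s) \<phi>\<bar> \<le> \<gamma> n * (C * (3 + lam + err n) * (3 + 2 * moment_cap T))"
    using cc(2) by linarith
qed

lemma scaled_diff_le:
  assumes \<phi>: "C2_smooth \<phi> \<phi>1 \<phi>2" and st: "0 \<le> s" "s \<le> t"
    and B: "\<And>r. 0 \<le> r \<Longrightarrow> r \<le> t \<Longrightarrow> \<bar>coll (\<gamma> n) (\<nu> n) (scaled n r) \<phi>\<bar> \<le> \<gamma> n * B"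
  shows "\<bar>(\<integral>w. \<phi> w \<partial>scaled n t) - (\<integral>w. \<phi> w \<partial>scaled n s)\<bar> \<le> B * (t - s)"
proof -
  interpret kf: kinetic_flow "\<nu> n" p "\<gamma> n" "F n" F0 by (rule flows)
  have g: "0 < \<gamma> n" by (rule \<gamma>)
  have "\<bar>(\<integral>w. \<phi> w \<partial>F n (t / \<gamma> n)) - (\<integral>w. \<phi> w \<partial>F n (s / \<gamma> n))\<bar> \<le> (\<gamma> n * B) * (t / \<gamma> n - s / \<gamma> n)"
  proof (rule kf.flow_diff_le[OF \<phi>])
    fix r assume r: "0 < r" "r < t / \<gamma> n"
    then have "r * \<gamma> n \<le> t" using g by (simp add: pos_less_divide_eq)
    then show "\<bar>coll (\<gamma> n) (\<nu> n) (F n r) \<phi>\<bar> \<le> \<gamma> n * B"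
      using B[of "r * \<gamma> n"] r g by (simp add: scaled_def)
  qed (use st g in \<open>auto intro: divide_right_mono\<close>)
  also have "(\<gamma> n * B) * (t / \<gamma> n - s / \<gamma> n) = B * (t - s)" using g by (simp add: field_simps)
  finally show ?thesis by (simp add: scaled_def)
qed

lemma err_bounded: obtains E where "0 \<le> E" "\<And>n. err n \<le> E"
proof -
  from convergent_imp_Bseq[of err] err_lim obtain E where "0 < E" "\<And>n. \<bar>err n\<bar> \<le> E"
    by (auto simp: convergent_def Bseq_def)
  then show ?thesis using that[of E] by (meson abs_le_D1 less_imp_le)
qed

text \<open>The collision term is of order \<open>\<gamma> n\<close>, and rescaled time runs faster
  by the inverse factor, so the Lipschitz constant does not depend on \<open>n\<close>.\<close>

lemma scaled_lipschitz:
  assumes s: "bdd_smooth \<phi>" and T: "0 \<le> T"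
  shows "\<exists>L. \<forall>n s t. 0 \<le> s \<longrightarrow> s \<le> T \<longrightarrow> 0 \<le> t \<longrightarrow> t \<le> T \<longrightarrow>
      \<bar>(\<integral>x. \<phi> x \<partial>scaled n t) - (\<integral>x. \<phi> x \<partial>scaled n s)\<bar> \<le> L * \<bar>t - s\<bar>"
proof -
  obtain \<phi>1 \<phi>2 where \<phi>: "C2_smooth \<phi> \<phi>1 \<phi>2" using bdd_smooth_imp_C2[OF s] .
  obtain C where C: "C \<ge> 0" "\<And>x. \<bar>\<phi>1 x\<bar> \<le> C * (1 + \<bar>x\<bar>)" "\<And>x. \<bar>\<phi>2 x\<bar> \<le> C" "\<And>x y. \<bar>\<phi>2 x - \<phi>2 y\<bar> \<le> C * \<bar>x - y\<bar>"
    using C2_smooth_deriv_growth[OF \<phi>] by blast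
  obtain E where E: "0 \<le> E" "\<And>n. err n \<le> E" using err_bounded by blast
  define L where "L = C * (3 + lam + E) * (3 + 2 * moment_cap T)"
  have one: "\<bar>(\<integral>x. \<phi> x \<partial>scaled n t) - (\<integral>x. \<phi> x \<partial>scaled n s)\<bar> \<le> L * (t - s)" if "0 \<le> s" "s \<le> t" "t \<le> T" for n s t
  proof (rule scaled_diff_le[OF \<phi> that(1,2)])
    fix r assume r: "0 \<le> r" "r \<le> t"
    have "\<bar>coll (\<gamma> n) (\<nu> n) (scaled n r) \<phi>\<bar> \<le> \<gamma> n * (C * (3 + lam + err n) * (3 + 2 * moment_cap T))"
      using r that by (intro coll_estimates(2)[OF \<phi> C(2-4)]) auto
    also have "\<dots> \<le> \<gamma> n * L"
      unfolding L_def using \<gamma>(1)[of n] C(1) E(2)[of n] moment_cap_nonneg[of T] by (intro mult_left_mono mult_right_mono) auto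
    finally show "\<bar>coll (\<gamma> n) (\<nu> n) (scaled n r) \<phi>\<bar> \<le> \<gamma> n * L" .
  qed
  have "\<bar>(\<integral>x. \<phi> x \<partial>scaled n t) - (\<integral>x. \<phi> x \<partial>scaled n s)\<bar> \<le> L * \<bar>t - s\<bar>"
    if "0 \<le> s" "s \<le> T" "0 \<le> t" "t \<le> T" for n s t
  proof (cases "s \<le> t")
    case True then show ?thesis using one[of s t n] that by simp
  next
    case False then show ?thesis using one[of t s n] that by (simp add: abs_minus_commute)
  qed
  then show ?thesis by blast
qed

text \<open>The mean may drift because cut-off trades are not balanced. The Fokker-Planck drift
  contributes nothing, being centred at the mean of the same measure, and only the consistency error
  remains.\<close>

lemma scaled_mean:
  assumes t: "0 \<le> t" "t \<le> T"
  shows "\<bar>(\<integral>w. w \<partial>scaled n t) - (\<integral>w. w \<partial>F0)\<bar> \<le> err n * (3 + 2 * moment_cap T) * T"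
proof -
  have C: "\<bar>1\<bar> \<le> 1 * (1 + \<bar>x\<bar>)" "\<bar>0\<bar> \<le> (1::real)" "\<bar>0 - 0\<bar> \<le> 1 * \<bar>x - y\<bar>" for x y :: real by auto
  have "\<bar>(\<integral>w. w \<partial>scaled n t) - (\<integral>w. w \<partial>scaled n 0)\<bar> \<le> err n * (3 + 2 * moment_cap T) * (t - 0)"
  proof (rule scaled_diff_le[OF C2_smooth_id])
    fix r assume r: "0 \<le> r" "r \<le> t"
    interpret S: real_distribution "scaled n r" by (rule wealthD[OF scaled_wealth[OF r(1)]])
    have i: "integrable (scaled n r) (\<lambda>w. w)"
      by (rule wealth_integrable[OF scaled_wealth[OF r(1)] _ C2_smooth_imp_growth[OF C2_smooth_id]]) (use p in auto)
    have z: "(\<integral>w. fp_op (\<integral>v. v \<partial>scaled n r) lam (\<lambda>w. 1) (\<lambda>w. 0) w \<partial>scaled n r) = 0"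
      unfolding fp_op_def using i S.prob_space by simp
    have "r \<le> T" using r t by simp
    from coll_estimates(1)[OF C2_smooth_id C r(1) this, of n]
    show "\<bar>coll (\<gamma> n) (\<nu> n) (scaled n r) (\<lambda>w. w)\<bar> \<le> \<gamma> n * (err n * (3 + 2 * moment_cap T))" unfolding z by simp
  qed (use t in auto)
  also have "\<dots> \<le> err n * (3 + 2 * moment_cap T) * T"
    using t err_nonneg[of n] moment_cap_nonneg[of T] by (intro mult_left_mono) auto
  finally show ?thesis by (simp add: scaled_0)
qed

lemma scaled_weak_continuous:
  assumes s: "\<And>i. 0 \<le> s i" "s \<longlonglongrightarrow> t" "0 \<le> t"
  shows "weak_conv_m (\<lambda>i. scaled n (s i)) (scaled n t)"
proof (rule weak_conv_of_bdd_smooth)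
  fix \<phi> assume \<phi>: "bdd_smooth \<phi>"
  obtain B where B: "\<And>i. \<bar>s i\<bar> \<le> B" using convergent_imp_Bseq[of s] s(2) by (auto simp: convergent_def Bseq_def)
  have sB: "s i \<le> max B t" for i using B[of i] by (simp add: abs_le_iff le_max_iff_disj)
  obtain L where L: "\<And>u v. 0 \<le> u \<Longrightarrow> u \<le> max B t \<Longrightarrow> 0 \<le> v \<Longrightarrow> v \<le> max B t \<Longrightarrow>
      \<bar>(\<integral>x. \<phi> x \<partial>scaled n v) - (\<integral>x. \<phi> x \<partial>scaled n u)\<bar> \<le> L * \<bar>v - u\<bar>"
    using scaled_lipschitz[OF \<phi>, of "max B t"] s(3) by (auto simp: le_max_iff_disj)
  have "(\<lambda>i. L * \<bar>s i - t\<bar>) \<longlonglongrightarrow> L * \<bar>t - t\<bar>" by (intro tendsto_intros s)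
  then have l: "(\<lambda>i. L * \<bar>s i - t\<bar>) \<longlonglongrightarrow> 0" by simp
  show "(\<lambda>i. \<integral>w. \<phi> w \<partial>scaled n (s i)) \<longlonglongrightarrow> (\<integral>w. \<phi> w \<partial>scaled n t)"
  proof (rule LIM_zero_cancel, rule Lim_null_comparison[OF _ l])
    show "\<forall>\<^sub>F i in sequentially. norm ((\<integral>w. \<phi> w \<partial>scaled n (s i)) - (\<integral>w. \<phi> w \<partial>scaled n t)) \<le> L * \<bar>s i - t\<bar>"
      using L s sB by (intro always_eventually) auto
  qed
qed (use wealthD(1)[OF scaled_wealth] s in auto)

lemma scaled_continuous:
  assumes \<psi>: "continuous_on UNIV \<psi>" "growth 2 \<psi>"
  shows "continuous_on {0..} (\<lambda>t. \<integral>w. \<psi> w \<partial>scaled n t)"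
  unfolding continuous_on_sequentially
proof (intro allI ballI impI)
  fix s and t :: real assume t: "t \<in> {0..}" and s: "(\<forall>i. s i \<in> {0..}) \<and> s \<longlonglongrightarrow> t"
  then have s0: "\<And>i. 0 \<le> s i" and st: "s \<longlonglongrightarrow> t" and t0: "0 \<le> t" by auto
  from st obtain B where B: "\<And>i. \<bar>s i\<bar> \<le> B" using convergent_imp_Bseq[of s] by (auto simp: convergent_def Bseq_def)
  have "(\<lambda>i. \<integral>w. \<psi> w \<partial>scaled n (s i)) \<longlonglongrightarrow> (\<integral>w. \<psi> w \<partial>scaled n t)"
  proof (rule weak_conv_lower_growth[OF scaled_wealth[OF s0] wealthD(1)[OF scaled_wealth[OF t0]] scaled_weak_continuous[OF s0 st t0] _ p _ \<psi>])
    show "(\<integral>w. w powr p \<partial>scaled n (s i)) \<le> moment_cap B" for i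
      using scaled_moment[OF s0, of n i] moment_cap_mono[OF s0, of i B] B[of i] by (simp add: abs_le_iff)
  qed simp
  then show "((\<lambda>t. \<integral>w. \<psi> w \<partial>scaled n t) \<circ> s) \<longlonglongrightarrow> (\<integral>w. \<psi> w \<partial>scaled n t)" by (simp add: o_def)
qed

text \<open>The difference between the integral of \<phi> and the accumulated Fokker-Planck term is
  differentiated. Its derivative consists of the consistency error and of the change from the
  current mean to the initial mean \<open>m\<close>, both of order \<open>err n\<close>.\<close>

lemma scaled_integral_equation:
  assumes \<phi>: "C2_smooth \<phi> \<phi>1 \<phi>2" and t: "0 \<le> t"
  defines "m \<equiv> \<integral>w. w \<partial>F0"
  shows "\<exists>A. \<forall>n. \<bar>(\<integral>w. \<phi> w \<partial>scaled n t) - (\<integral>w. \<phi> w \<partial>scaled n 0)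
      - integral {0..t} (\<lambda>s. \<integral>w. fp_op m lam \<phi>1 \<phi>2 w \<partial>scaled n s)\<bar> \<le> err n * A"
proof -
  obtain C where C: "C \<ge> 0" "\<And>x. \<bar>\<phi>1 x\<bar> \<le> C * (1 + \<bar>x\<bar>)" "\<And>x. \<bar>\<phi>2 x\<bar> \<le> C" "\<And>x y. \<bar>\<phi>2 x - \<phi>2 y\<bar> \<le> C * \<bar>x - y\<bar>"
    using C2_smooth_deriv_growth[OF \<phi>] by blast
  \<comment> \<open>First summand: consistency. Second summand: replacement of the mean, weighted by
    a bound on the integral of \<open>\<bar>\<phi>1 w\<bar>\<close>.\<close>
  define B where "B = C * (3 + 2 * moment_cap t) + ((3 + 2 * moment_cap t) * t) * (C * (2 + moment_cap t))"
  have "\<bar>(\<integral>w. \<phi> w \<partial>scaled n t) - (\<integral>w. \<phi> w \<partial>scaled n 0)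
      - integral {0..t} (\<lambda>s. \<integral>w. fp_op m lam \<phi>1 \<phi>2 w \<partial>scaled n s)\<bar> \<le> err n * (B * t)" for n
  proof -
    interpret kf: kinetic_flow "\<nu> n" p "\<gamma> n" "F n" F0 by (rule flows)
    have g: "0 < \<gamma> n" by (rule \<gamma>)
    define u where "u s = (\<integral>w. \<phi> w \<partial>scaled n s)" for s
    define v where "v s = (\<integral>w. fp_op m lam \<phi>1 \<phi>2 w \<partial>scaled n s)" for s
    define h where "h s = u s - integral {0..s} v" for s
    note gL = fp_op_C2_growth[OF \<phi>]
    have g\<phi>: "growth 2 \<phi>" using C2_smooth_imp_growth[OF \<phi> order_refl] .
    have cv: "continuous_on {0..} v" unfolding v_def by (rule scaled_continuous[OF fp_op_C2_continuous[OF \<phi>] gL])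
    have cu: "continuous_on {0..} u" unfolding u_def by (rule scaled_continuous[OF C2_smooth_continuous(1)[OF \<phi>] g\<phi>])
    have vint: "v integrable_on {0..t}"
      by (rule integrable_continuous_real, rule continuous_on_subset[OF cv]) auto
    have ch: "continuous_on {0..t} h"
      unfolding h_def by (intro continuous_intros continuous_on_subset[OF cu] indefinite_integral_continuous_1 vint) auto
    have "\<bar>h t - h 0\<bar> \<le> (err n * B) * (t - 0)"
    proof (rule abs_diff_le_of_interior_deriv_le[OF t ch])
      fix s assume s: "0 < s" "s < t"
      then have s0: "0 \<le> s" and sg: "0 < s / \<gamma> n" using g by auto
      interpret S: real_distribution "scaled n s" by (rule wealthD[OF scaled_wealth[OF s0]])
      have du: "(u has_real_derivative coll (\<gamma> n) (\<nu> n) (scaled n s) \<phi> * (1 / \<gamma> n)) (at s)"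
        unfolding u_def scaled_def
        by (rule DERIV_chain2[where f = "\<lambda>t. \<integral>w. \<phi> w \<partial>F n t" and g = "\<lambda>s. s / \<gamma> n", OF kf.flow_C2(1)[OF \<phi> sg] DERIV_cdivide[OF DERIV_ident]])
      have "((\<lambda>s. integral {0..s} v) has_real_derivative v s) (at s within {0..t})"
        by (rule integral_has_real_derivative) (use s cv in \<open>auto intro: continuous_on_subset\<close>)
      then have "((\<lambda>s. integral {0..s} v) has_real_derivative v s) (at s)" using s by (simp add: at_within_Icc_at)
      then have dh: "(h has_real_derivative coll (\<gamma> n) (\<nu> n) (scaled n s) \<phi> * (1 / \<gamma> n) - v s) (at s)"
        unfolding h_def by (intro DERIV_diff du)
      define ms where "ms = (\<integral>v. v \<partial>scaled n s)"
      define vs where "vs = (\<integral>w. fp_op ms lam \<phi>1 \<phi>2 w \<partial>scaled n s)"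
      have a: "\<bar>coll (\<gamma> n) (\<nu> n) (scaled n s) \<phi> * (1 / \<gamma> n) - vs\<bar> \<le> C * err n * (3 + 2 * moment_cap t)"
      proof -
        have "\<bar>coll (\<gamma> n) (\<nu> n) (scaled n s) \<phi> - \<gamma> n * vs\<bar> \<le> \<gamma> n * (C * err n * (3 + 2 * moment_cap t))"
          unfolding vs_def ms_def using s by (intro coll_estimates(1)[OF \<phi> C(2-4)]) auto
        moreover have "coll (\<gamma> n) (\<nu> n) (scaled n s) \<phi> - \<gamma> n * vs = \<gamma> n * (coll (\<gamma> n) (\<nu> n) (scaled n s) \<phi> * (1 / \<gamma> n) - vs)"
          using g by (simp add: field_simps)
        ultimately show ?thesis using g by (simp add: abs_mult)
      qed
      have i1: "integrable (scaled n s) \<phi>1" and i1E: "(\<integral>w. \<bar>\<phi>1 w\<bar> \<partial>scaled n s) \<le> C * (2 + moment_cap t)"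
      proof -
        have ip: "integrable (scaled n s) (\<lambda>w. C * (2 + \<bar>w\<bar> powr p))" using wealthD(6)[OF scaled_wealth[OF s0]] by simp
        have ae: "AE w in scaled n s. \<bar>\<phi>1 w\<bar> \<le> C * (2 + \<bar>w\<bar> powr p)"
          using wealthD(5)[OF scaled_wealth[OF s0]]
        proof eventually_elim
          case (elim w)
          have "w \<le> 1 + w powr p" using powr_le_1_powr[of 1 p w] elim p by simp
          then have "C * (1 + \<bar>w\<bar>) \<le> C * (2 + \<bar>w\<bar> powr p)" using C(1) elim by (intro mult_left_mono) auto
          with C(2)[of w] show ?case by (rule order_trans)
        qed
        have m1: "\<phi>1 \<in> borel_measurable borel" by (rule borel_measurable_continuous_onI[OF C2_smooth_continuous(2)[OF \<phi>]])
        show i1: "integrable (scaled n s) \<phi>1"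
        proof (rule Bochner_Integration.integrable_bound[OF ip])
          show "AE w in scaled n s. norm (\<phi>1 w) \<le> norm (C * (2 + \<bar>w\<bar> powr p))"
            using ae by eventually_elim (use C(1) in \<open>simp add: abs_mult\<close>)
        qed (use m1 in simp)
        have "(\<integral>w. \<bar>\<phi>1 w\<bar> \<partial>scaled n s) \<le> (\<integral>w. C * (2 + \<bar>w\<bar> powr p) \<partial>scaled n s)"
          using i1 ip ae by (intro integral_mono_AE) auto
        also have "\<dots> = C * (2 + (\<integral>w. w powr p \<partial>scaled n s))"
          using wealthD(6)[OF scaled_wealth[OF s0]] S.prob_space wealth_moment_eq[OF scaled_wealth[OF s0]] by simp
        also have "\<dots> \<le> C * (2 + moment_cap t)"
          using scaled_moment[OF s0, of n] moment_cap_mono[OF s0, of t] s C(1) by (intro mult_left_mono add_left_mono) auto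
        finally show "(\<integral>w. \<bar>\<phi>1 w\<bar> \<partial>scaled n s) \<le> C * (2 + moment_cap t)" .
      qed
      have iL: "integrable (scaled n s) (fp_op a lam \<phi>1 \<phi>2)" for a
        by (rule wealth_integrable[OF wealth_mono[OF scaled_wealth[OF s0], of 2] _ gL])
           (use p in \<open>auto intro: borel_measurable_continuous_onI fp_op_C2_continuous[OF \<phi>]\<close>)
      have b: "\<bar>vs - v s\<bar> \<le> err n * ((3 + 2 * moment_cap t) * t) * (C * (2 + moment_cap t))"
      proof -
        have "vs - v s = (\<integral>w. fp_op ms lam \<phi>1 \<phi>2 w - fp_op m lam \<phi>1 \<phi>2 w \<partial>scaled n s)"
          unfolding vs_def v_def using iL by simp
        also have "\<dots> = (\<integral>w. (ms - m) * \<phi>1 w \<partial>scaled n s)"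
          by (intro Bochner_Integration.integral_cong) (auto simp: fp_op_def algebra_simps)
        also have "\<dots> = (ms - m) * (\<integral>w. \<phi>1 w \<partial>scaled n s)" by simp
        finally have "\<bar>vs - v s\<bar> = \<bar>ms - m\<bar> * \<bar>\<integral>w. \<phi>1 w \<partial>scaled n s\<bar>" by (simp add: abs_mult)
        also have "\<dots> \<le> (err n * (3 + 2 * moment_cap t) * t) * (C * (2 + moment_cap t))"
        proof (intro mult_mono)
          show "\<bar>ms - m\<bar> \<le> err n * (3 + 2 * moment_cap t) * t" unfolding ms_def m_def using s by (intro scaled_mean) auto
          show "\<bar>\<integral>w. \<phi>1 w \<partial>scaled n s\<bar> \<le> C * (2 + moment_cap t)" using integral_abs_bound[of "scaled n s" \<phi>1] i1E by linarith
        qed (use err_nonneg[of n] moment_cap_nonneg[of t] t in auto)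
        finally show ?thesis by (simp add: mult.assoc)
      qed
      have "\<bar>coll (\<gamma> n) (\<nu> n) (scaled n s) \<phi> * (1 / \<gamma> n) - v s\<bar> \<le> C * err n * (3 + 2 * moment_cap t) + err n * ((3 + 2 * moment_cap t) * t) * (C * (2 + moment_cap t))"
        using a b by linarith
      also have "\<dots> = err n * B" by (simp add: B_def algebra_simps)
      finally show "\<exists>l. (h has_real_derivative l) (at s) \<and> \<bar>l\<bar> \<le> err n * B" using dh by blast
    qed
    moreover have "h t - h 0 = u t - u 0 - integral {0..t} v" by (simp add: h_def)
    ultimately show ?thesis by (simp add: u_def v_def[abs_def] mult.assoc)
  qed
  then show ?thesis by blast
qed

text \<open>For smooth \<phi> both \<phi> and the operator applied to it have quadratic growth,
  below the controlled order \<open>p\<close>, so all integrals converge at each time; the moment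
  cap dominates them in time.\<close>

lemma fokker_planck_limit:
  defines "m \<equiv> \<integral>w. w \<partial>F0"
  obtains r G where "strict_mono r" "\<And>t. 0 \<le> t \<Longrightarrow> wealth p (G t)"
    "\<And>t. 0 \<le> t \<Longrightarrow> weak_conv_m (\<lambda>n. scaled (r n) t) (G t)" "fp_flow p m lam G moment_cap" "G 0 = F0"
    "\<And>t. 0 \<le> t \<Longrightarrow> (\<integral>w. w \<partial>G t) = m"
proof -
  obtain r G where r: "strict_mono r" and G: "\<And>t. 0 \<le> t \<Longrightarrow> real_distribution (G t)"
    and w: "\<And>t. 0 \<le> t \<Longrightarrow> weak_conv_m (\<lambda>n. scaled (r n) t) (G t)"
    using weak_compactness[OF scaled_wealth _ scaled_moment scaled_lipschitz] p by (metis less_trans zero_less_numeral)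
  have p0: "0 < p" using p by simp
  note wl = wealth_weak_limit[OF scaled_wealth G w p0 scaled_moment]
  have wG: "wealth p (G t)" if "0 \<le> t" for t using wl(1)[OF that that that that] .
  have mG: "(\<integral>w. w powr p \<partial>G t) \<le> moment_cap t" if "0 \<le> t" for t using wl(2)[OF that that that that] .
  have lim: "(\<lambda>n. \<integral>w. \<psi> w \<partial>scaled (r n) t) \<longlonglongrightarrow> (\<integral>w. \<psi> w \<partial>G t)"
    if t: "0 \<le> t" and \<psi>: "continuous_on UNIV \<psi>" "growth 2 \<psi>" for t \<psi>
    by (rule weak_conv_lower_growth[OF scaled_wealth[OF t] G[OF t] w[OF t] _ p scaled_moment[OF t] \<psi>]) simp
  have errr: "(\<lambda>n. err (r n) * A) \<longlonglongrightarrow> 0" for A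
    using tendsto_mult_left_zero[OF LIMSEQ_subseq_LIMSEQ[OF err_lim r], of A] by (simp add: o_def)
  have mean: "(\<integral>w. w \<partial>G t) = m" if t: "0 \<le> t" for t
  proof -
    have 1: "(\<lambda>n. \<integral>w. w \<partial>scaled (r n) t) \<longlonglongrightarrow> (\<integral>w. w \<partial>G t)"
      by (rule lim[OF t _ C2_smooth_imp_growth[OF C2_smooth_id order_refl]]) (intro continuous_intros)
    have "(\<lambda>n. \<integral>w. w \<partial>scaled (r n) t) \<longlonglongrightarrow> m"
    proof (rule LIM_zero_cancel, rule Lim_null_comparison[OF _ errr])
      show "\<forall>\<^sub>F n in sequentially. norm ((\<integral>w. w \<partial>scaled (r n) t) - m) \<le> err (r n) * ((3 + 2 * moment_cap t) * t)"
        using scaled_mean[OF t order_refl] by (intro always_eventually allI) (simp add: m_def mult.assoc)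
    qed
    with 1 show ?thesis by (rule LIMSEQ_unique)
  qed
  have fp: "fp_flow p m lam G moment_cap"
  proof
    show "2 < p" by (rule p)
    show "wealth p (G t)" if "0 \<le> t" for t by (rule wG[OF that])
    show "(\<integral>w. w powr p \<partial>G s) \<le> moment_cap t" if "0 \<le> s" "s \<le> t" for s t
      using mG[OF that(1)] moment_cap_mono[OF that] by linarith
    show "weak_conv_m (\<lambda>n. G (s n)) (G t)" if s: "\<And>n. 0 \<le> s n" "s \<longlonglongrightarrow> t" "0 \<le> t" for s t
    proof (rule weak_conv_of_bdd_smooth)
      fix \<phi> assume \<phi>: "bdd_smooth \<phi>"
      obtain B where B: "\<And>i. \<bar>s i\<bar> \<le> B" using convergent_imp_Bseq[of s] s(2) by (auto simp: convergent_def Bseq_def)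
      have sB: "s i \<le> max B t" for i using B[of i] by (simp add: abs_le_iff le_max_iff_disj)
      obtain L where L: "\<And>n u v. 0 \<le> u \<Longrightarrow> u \<le> max B t \<Longrightarrow> 0 \<le> v \<Longrightarrow> v \<le> max B t \<Longrightarrow>
          \<bar>(\<integral>x. \<phi> x \<partial>scaled n v) - (\<integral>x. \<phi> x \<partial>scaled n u)\<bar> \<le> L * \<bar>v - u\<bar>"
        using scaled_lipschitz[OF \<phi>, of "max B t"] s(3) by (auto simp: le_max_iff_disj)
      obtain b where b: "\<And>x. \<bar>\<phi> x\<bar> \<le> b" using bdd_smooth_bounded[OF \<phi>] by blast
      have wc: "(\<lambda>n. \<integral>x. \<phi> x \<partial>scaled (r n) u) \<longlonglongrightarrow> (\<integral>x. \<phi> x \<partial>G u)" if "0 \<le> u" for u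
        using b bdd_smooth_continuous[OF \<phi>]
        by (intro weak_conv_imp_integral_bdd_continuous_conv[OF wealthD(1)[OF scaled_wealth[OF that]] G[OF that] w[OF that]])
           (auto simp: continuous_on_eq_continuous_at)
      \<comment> \<open>The Lipschitz constant is uniform in \<open>n\<close>, so it passes to the
        limit curve and yields its weak continuity.\<close>
      have LG: "\<bar>(\<integral>x. \<phi> x \<partial>G (s i)) - (\<integral>x. \<phi> x \<partial>G t)\<bar> \<le> L * \<bar>s i - t\<bar>" for i
      proof (rule LIMSEQ_le_const2)
        show "(\<lambda>n. \<bar>(\<integral>x. \<phi> x \<partial>scaled (r n) (s i)) - (\<integral>x. \<phi> x \<partial>scaled (r n) t)\<bar>) \<longlonglongrightarrow> \<bar>(\<integral>x. \<phi> x \<partial>G (s i)) - (\<integral>x. \<phi> x \<partial>G t)\<bar>"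
          using s by (intro tendsto_intros wc) auto
        show "\<exists>N. \<forall>n\<ge>N. \<bar>(\<integral>x. \<phi> x \<partial>scaled (r n) (s i)) - (\<integral>x. \<phi> x \<partial>scaled (r n) t)\<bar> \<le> L * \<bar>s i - t\<bar>"
          using L s sB by auto
      qed
      have "(\<lambda>i. L * \<bar>s i - t\<bar>) \<longlonglongrightarrow> L * \<bar>t - t\<bar>" by (intro tendsto_intros s)
      then have l: "(\<lambda>i. L * \<bar>s i - t\<bar>) \<longlonglongrightarrow> 0" by simp
      show "(\<lambda>i. \<integral>w. \<phi> w \<partial>G (s i)) \<longlonglongrightarrow> (\<integral>w. \<phi> w \<partial>G t)"
        by (rule LIM_zero_cancel, rule Lim_null_comparison[OF _ l]) (use LG in simp)
    qed (use G s in auto)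
    show "(\<integral>w. \<phi> w \<partial>G t) - (\<integral>w. \<phi> w \<partial>G 0) = integral {0..t} (\<lambda>s. \<integral>w. fp_op m lam \<phi>1 \<phi>2 w \<partial>G s)"
      if \<phi>: "C2_smooth \<phi> \<phi>1 \<phi>2" and t: "0 \<le> t" for \<phi> \<phi>1 \<phi>2 t
    proof -
      obtain A where A: "0 \<le> A" "\<And>w. 0 \<le> w \<Longrightarrow> \<bar>fp_op m lam \<phi>1 \<phi>2 w\<bar> \<le> A * (1 + w powr 2)"
        using fp_op_C2_bound[OF \<phi>, where m = m and lam = lam] by blast
      have gL: "growth 2 (fp_op m lam \<phi>1 \<phi>2)" using A(2) by (rule growthI)
      define vn where "vn n s = (\<integral>w. fp_op m lam \<phi>1 \<phi>2 w \<partial>scaled (r n) s)" for n s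
      define v where "v s = (\<integral>w. fp_op m lam \<phi>1 \<phi>2 w \<partial>G s)" for s
      have vnl: "(\<lambda>n. vn n s) \<longlonglongrightarrow> v s" if "s \<in> {0..t}" for s
        unfolding vn_def v_def using that by (intro lim fp_op_C2_continuous[OF \<phi>] gL) auto
      have vni: "vn n integrable_on {0..t}" for n
      proof (rule integrable_continuous_real)
        have "continuous_on {0..} (vn n)"
          unfolding vn_def by (rule scaled_continuous[OF fp_op_C2_continuous[OF \<phi>] gL])
        then show "continuous_on {0..t} (vn n)" by (rule continuous_on_subset) auto
      qed
      have vnb: "norm (vn n s) \<le> A * (2 + moment_cap t)" if s: "s \<in> {0..t}" for n s
      proof -
        have s0: "0 \<le> s" using s by simp
        note S' = wealthD[OF scaled_wealth[OF s0, of "r n"]]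
        interpret S: real_distribution "scaled (r n) s" by (rule S')
        have ip: "integrable (scaled (r n) s) (\<lambda>w. A * (2 + \<bar>w\<bar> powr p))" using S'(6) by simp
        have iL: "integrable (scaled (r n) s) (fp_op m lam \<phi>1 \<phi>2)"
          by (rule wealth_integrable[OF wealth_mono[OF scaled_wealth[OF s0], of 2] _ gL])
             (use p in \<open>auto intro: borel_measurable_continuous_onI fp_op_C2_continuous[OF \<phi>]\<close>)
        have "\<bar>vn n s\<bar> \<le> (\<integral>w. \<bar>fp_op m lam \<phi>1 \<phi>2 w\<bar> \<partial>scaled (r n) s)" unfolding vn_def by (rule integral_abs_bound)
        also have "\<dots> \<le> (\<integral>w. A * (2 + \<bar>w\<bar> powr p) \<partial>scaled (r n) s)"
        proof (rule integral_mono_AE)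
          show "AE w in scaled (r n) s. \<bar>fp_op m lam \<phi>1 \<phi>2 w\<bar> \<le> A * (2 + \<bar>w\<bar> powr p)"
            using S'(5)
          proof eventually_elim
            case (elim w)
            have "w powr 2 \<le> 1 + w powr p" using elim p by (intro powr_le_1_powr) auto
            then have "A * (1 + w powr 2) \<le> A * (2 + \<bar>w\<bar> powr p)" using A(1) elim by (intro mult_left_mono) auto
            with A(2)[OF elim] show ?case by (rule order_trans)
          qed
        qed (use ip iL in auto)
        also have "\<dots> = A * (2 + (\<integral>w. w powr p \<partial>scaled (r n) s))"
          using S'(6) S.prob_space wealth_moment_eq[OF scaled_wealth[OF s0]] by simp
        also have "\<dots> \<le> A * (2 + moment_cap t)"
          using scaled_moment[OF s0, of "r n"] moment_cap_mono[OF s0, of t] s A(1) by (intro mult_left_mono add_left_mono) auto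
        finally show ?thesis by simp
      qed
      have ci: "(\<lambda>s. A * (2 + moment_cap t)) integrable_on {0..t}" by (rule integrable_const_ivl)
      note hk = dominated_convergence[OF vni ci vnb vnl]
      have g\<phi>: "growth 2 \<phi>" using C2_smooth_imp_growth[OF \<phi> order_refl] .
      note l\<phi> = lim[OF _ C2_smooth_continuous(1)[OF \<phi>] g\<phi>]
      have l1: "(\<lambda>n. (\<integral>w. \<phi> w \<partial>scaled (r n) t) - (\<integral>w. \<phi> w \<partial>scaled (r n) 0) - integral {0..t} (vn n))
          \<longlonglongrightarrow> (\<integral>w. \<phi> w \<partial>G t) - (\<integral>w. \<phi> w \<partial>G 0) - integral {0..t} v"
        by (intro tendsto_diff hk l\<phi>) (use t in auto)
      obtain A' where A': "\<And>n. \<bar>(\<integral>w. \<phi> w \<partial>scaled n t) - (\<integral>w. \<phi> w \<partial>scaled n 0)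
          - integral {0..t} (\<lambda>s. \<integral>w. fp_op m lam \<phi>1 \<phi>2 w \<partial>scaled n s)\<bar> \<le> err n * A'"
        using scaled_integral_equation[OF \<phi> t] unfolding m_def by blast
      have l2: "(\<lambda>n. (\<integral>w. \<phi> w \<partial>scaled (r n) t) - (\<integral>w. \<phi> w \<partial>scaled (r n) 0) - integral {0..t} (vn n)) \<longlonglongrightarrow> 0"
        by (rule Lim_null_comparison[OF _ errr[of A']]) (use A' in \<open>auto simp: vn_def[abs_def]\<close>)
      show ?thesis using LIMSEQ_unique[OF l1 l2] by (simp add: v_def[abs_def])
    qed
  qed
  have G0: "G 0 = F0"
  proof (rule Levy_uniqueness[OF G wealthD(1)[OF F0]])
    have "(\<lambda>n. char (scaled (r n) 0) \<xi>) \<longlonglongrightarrow> char (G 0) \<xi>" for \<xi>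
      by (rule levy_continuity1[OF _ G w]) (use wealthD(1)[OF scaled_wealth] in auto)
    then show "char (G 0) = char F0" by (auto simp: scaled_0 LIMSEQ_const_iff)
  qed simp
  show ?thesis by (rule that[OF r wG w fp G0 mean])
qed

text \<open>Rescaling by \<gamma> turns the exponential rate into \<open>5 + 4 * lam\<close> and the
  error term into a multiple of \<open>\<gamma> n powr (q / 2 - 1)\<close>, which vanishes.\<close>

lemma limit_concentration:
  assumes t: "0 \<le> t" and G: "real_distribution G" and r: "strict_mono r" and w: "weak_conv_m (\<lambda>n. scaled (r n) t) G"
    and N: "0 \<le> N" "0 \<le> J" and init: "\<And>\<phi>. conc_test \<phi> \<Longrightarrow> (\<integral>w. \<phi> w \<partial>F0) \<le> J + N * (\<integral>x. \<phi> x \<partial>lborel)"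
    and \<phi>: "conc_test \<phi>"
  shows "(\<integral>w. \<phi> w \<partial>G) \<le> J + N * exp ((5 + 4 * lam) * t) * (\<integral>x. \<phi> x \<partial>lborel)"
proof (rule LIMSEQ_le)
  have s: "bdd_smooth \<phi>" using \<phi> by (simp add: conc_test_def)
  obtain b where b: "\<And>x. \<bar>\<phi> x\<bar> \<le> b" using bdd_smooth_bounded[OF s] by blast
  show "(\<lambda>n. \<integral>w. \<phi> w \<partial>scaled (r n) t) \<longlonglongrightarrow> (\<integral>w. \<phi> w \<partial>G)"
    using b bdd_smooth_continuous[OF s]
    by (intro weak_conv_imp_integral_bdd_continuous_conv[OF wealthD(1)[OF scaled_wealth[OF t]] G w])
       (auto simp: continuous_on_eq_continuous_at)
  define E where "E n = 192 * (lam powr (q / 2) * k q * \<gamma> n powr (q / 2 - 1)) * t" for n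
  have "E \<longlonglongrightarrow> 192 * (lam powr (q / 2) * k q * 0) * t" unfolding E_def by (intro tendsto_intros powr_\<gamma>_lim)
  then have "(\<lambda>n. E (r n)) \<longlonglongrightarrow> 0" using LIMSEQ_subseq_LIMSEQ[OF _ r] by (force simp: o_def)
  then have "(\<lambda>n. J + E (r n) + N * exp ((5 + 4 * lam) * t) * (\<integral>x. \<phi> x \<partial>lborel))
      \<longlonglongrightarrow> J + 0 + N * exp ((5 + 4 * lam) * t) * (\<integral>x. \<phi> x \<partial>lborel)" by (intro tendsto_intros)
  then show "(\<lambda>n. J + E (r n) + N * exp ((5 + 4 * lam) * t) * (\<integral>x. \<phi> x \<partial>lborel))
      \<longlonglongrightarrow> J + N * exp ((5 + 4 * lam) * t) * (\<integral>x. \<phi> x \<partial>lborel)" by simp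
  have "(\<integral>w. \<phi> w \<partial>scaled n t) \<le> J + E n + N * exp ((5 + 4 * lam) * t) * (\<integral>x. \<phi> x \<partial>lborel)" for n
  proof -
    interpret kf: kinetic_flow "\<nu> n" p "\<gamma> n" "F n" F0 by (rule flows)
    have g: "0 < \<gamma> n" by (rule \<gamma>)
    have "(\<integral>w. \<phi> w \<partial>F n (t / \<gamma> n)) \<le> J + 192 * kf.abs_moment q * (t / \<gamma> n) + N * exp ((5 * \<gamma> n + 4 * kf.var) * (t / \<gamma> n)) * (\<integral>x. \<phi> x \<partial>lborel)"
      by (rule kf.concentration_bound[OF q(1-3) N init \<phi>]) (use t g in auto)
    moreover have "192 * kf.abs_moment q * (t / \<gamma> n) = E n" using g by (simp add: moment_q E_def)
    moreover have "(5 * \<gamma> n + 4 * kf.var) * (t / \<gamma> n) = (5 + 4 * lam) * t" using g by (simp add: var_eq field_simps)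
    ultimately show ?thesis by (simp add: scaled_def)
  qed
  then show "\<exists>N'. \<forall>n\<ge>N'. (\<integral>w. \<phi> w \<partial>scaled (r n) t) \<le> J + E (r n) + N * exp ((5 + 4 * lam) * t) * (\<integral>x. \<phi> x \<partial>lborel)"
    by blast
qed

end

section \<open>Weak solutions of the kinetic equation\<close>

text \<open>All integrals are transported to the variable \<open>Y\<close>, so the moments of the
  noise scale as powers of \<sigma>.\<close>

lemma noise_of_scaled_variable:
  fixes Y :: "'a \<Rightarrow> real"
  assumes M: "prob_space M" and Y: "Y \<in> borel_measurable M" and \<sigma>: "0 < \<sigma>"
    and D: "distributed M lborel (\<lambda>\<omega>. \<sigma> * Y \<omega>) (\<lambda>y. ennreal (\<mu> y))"
    and s: "2 \<le> s" "integrable M (\<lambda>\<omega>. \<bar>Y \<omega>\<bar> powr s)"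
    and mean: "(\<integral>\<omega>. Y \<omega> \<partial>M) = 0" and var: "(\<integral>\<omega>. (Y \<omega>)\<^sup>2 \<partial>M) = 1"
  defines "\<nu> \<equiv> density lborel (\<lambda>y. ennreal (\<mu> y))"
  shows "noise \<nu>" "noise.var \<nu> = \<sigma>\<^sup>2"
    and "\<And>r. 0 \<le> r \<Longrightarrow> r \<le> s \<Longrightarrow> integrable \<nu> (\<lambda>x. \<bar>x\<bar> powr r)"
    and "\<And>r. noise.abs_moment \<nu> r = \<sigma> powr r * (\<integral>\<omega>. \<bar>Y \<omega>\<bar> powr r \<partial>M)"
proof -
  interpret M: prob_space M by fact
  have \<nu>: "\<nu> = distr M lborel (\<lambda>\<omega>. \<sigma> * Y \<omega>)" unfolding \<nu>_def using D by (simp add: distributed_distr_eq_density)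
  have m[measurable]: "(\<lambda>\<omega>. \<sigma> * Y \<omega>) \<in> measurable M lborel" using Y by simp
  have I: "(\<integral>x. g x \<partial>\<nu>) = (\<integral>\<omega>. g (\<sigma> * Y \<omega>) \<partial>M)" "integrable \<nu> g \<longleftrightarrow> integrable M (\<lambda>\<omega>. g (\<sigma> * Y \<omega>))"
    if "g \<in> borel_measurable borel" for g :: "real \<Rightarrow> real"
    unfolding \<nu> using that by (auto intro!: integral_distr[OF m] integrable_distr_eq[OF m])
  have iY: "integrable M (\<lambda>\<omega>. \<bar>Y \<omega>\<bar> powr r)" if "0 \<le> r" "r \<le> s" for r
  proof (rule Bochner_Integration.integrable_bound)
    show "integrable M (\<lambda>\<omega>. 1 + \<bar>Y \<omega>\<bar> powr s)" using s by simp
    show "AE \<omega> in M. norm (\<bar>Y \<omega>\<bar> powr r) \<le> norm (1 + \<bar>Y \<omega>\<bar> powr s)"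
      using powr_le_1_powr[OF that] by (intro AE_I2) simp
  qed (use Y in measurable)
  show ir: "integrable \<nu> (\<lambda>x. \<bar>x\<bar> powr r)" if "0 \<le> r" "r \<le> s" for r
    using iY[OF that] \<sigma> by (subst I(2)) (auto simp: abs_mult powr_mult)
  have sq: "integrable \<nu> (\<lambda>x. x\<^sup>2)" using ir[of 2] s by (simp add: powr_numeral)
  interpret \<nu>: prob_space \<nu> unfolding \<nu> by (rule M.prob_space_distr[OF m])
  show n: "noise \<nu>"
  proof
    show "sets \<nu> = sets borel" by (simp add: \<nu>_def)
    show "integrable \<nu> (\<lambda>x. x\<^sup>2)" by (rule sq)
    show "(\<integral>x. x \<partial>\<nu>) = 0" using mean by (subst I(1)) auto
  qed
  show "noise.var \<nu> = \<sigma>\<^sup>2" unfolding noise.var_def[OF n] using var by (subst I(1)) (auto simp: power_mult_distrib)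
  show "noise.abs_moment \<nu> r = \<sigma> powr r * (\<integral>\<omega>. \<bar>Y \<omega>\<bar> powr r \<partial>M)" for r
    unfolding noise.abs_moment_def[OF n] using \<sigma> by (subst I(1)) (auto simp: abs_mult powr_mult)
qed

text \<open>Passage from densities to curves of measures. Weak differentiability on
  \<open>{0..}\<close>, one-sided at 0, supplies the weak continuity.\<close>

lemma kinetic_flow_of_weak_solution:
  assumes sol: "kinetic_weak_solution p \<gamma> \<mu> f0 f" and \<mu>: "prob_density_on UNIV \<mu>"
    and n: "noise (density lborel (\<lambda>y. ennreal (\<mu> y)))"
    and i: "integrable (density lborel (\<lambda>y. ennreal (\<mu> y))) (\<lambda>x. \<bar>x\<bar> powr p)"
    and p: "2 < p" and \<gamma>: "0 < \<gamma>" "\<gamma> \<le> 1 / 4"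
    and f0: "prob_density_on {0..} f0" "density_measure f0 \<in> moment_measures p"
  shows "kinetic_flow (density lborel (\<lambda>y. ennreal (\<mu> y))) p \<gamma> (\<lambda>t. density_measure (f t)) (density_measure f0)"
proof -
  let ?\<nu> = "density lborel (\<lambda>y. ennreal (\<mu> y))"
  interpret noise ?\<nu> by fact
  have f: "prob_density_on {0..} (f t)" and wf: "wealth p (density_measure (f t))" if "0 \<le> t" for t
    using sol that by (auto simp: kinetic_weak_solution_def wealth_def)
  have eq: "(LINT w:{0..}|lborel. \<phi> w * g w) = (\<integral>w. \<phi> w \<partial>density_measure g)"
    if "prob_density_on {0..} g" "\<phi> \<in> borel_measurable borel" for \<phi> g :: "real \<Rightarrow> real"
    by (rule density_measure_integral(1)[OF that refl])
  show ?thesis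
  proof
    show "wealth p (density_measure f0)" using f0 by (simp add: wealth_def)
    fix \<phi> assume tf: "\<phi> \<in> test_functions p" and m: "\<phi> \<in> borel_measurable borel" and g: "growth p \<phi>"
    show "((\<lambda>t. \<integral>w. \<phi> w \<partial>density_measure (f t)) has_real_derivative coll \<gamma> ?\<nu> (density_measure (f t)) \<phi>) (at t)" if t: "0 < t" for t
    proof -
      have "((\<lambda>t. LINT w:{0..}|lborel. \<phi> w * f t w) has_real_derivative
           (LINT (\<eta>, \<eta>s)|lborel. set_lebesgue_integral lborel ({0..} \<times> {0..}) (\<lambda>(w, ws).
              trade_kernel \<gamma> \<mu> w ws \<eta> \<eta>s * f t w * f t ws *
              (\<phi> (post_trade \<gamma> w ws \<eta>) - \<phi> w)))) (at t)"
        using sol tf t by (simp add: kinetic_weak_solution_def)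
      moreover have "(LINT (\<eta>, \<eta>s)|lborel. set_lebesgue_integral lborel ({0..} \<times> {0..}) (\<lambda>(w, ws).
              trade_kernel \<gamma> \<mu> w ws \<eta> \<eta>s * f t w * f t ws * (\<phi> (post_trade \<gamma> w ws \<eta>) - \<phi> w)))
          = coll \<gamma> ?\<nu> (density_measure (f t)) \<phi>"
        by (rule kinetic_integral_eq_coll[OF \<mu> f wf n i m g]) (use t p \<gamma> in auto)
      ultimately have "((\<lambda>t. LINT w:{0..}|lborel. \<phi> w * f t w) has_real_derivative coll \<gamma> ?\<nu> (density_measure (f t)) \<phi>) (at t)"
        by simp
      moreover have "open ({0<..} :: real set)" "t \<in> {0<..}" using t by simp_all
      moreover have "\<And>x. x \<in> {0<..} \<Longrightarrow> (LINT w:{0..}|lborel. \<phi> w * f x w) = (\<integral>w. \<phi> w \<partial>density_measure (f x))"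
        using eq[OF f m] by simp
      ultimately show ?thesis by (rule has_field_derivative_transform_within_open)
    qed
    have "((\<lambda>t. LINT w:{0..}|lborel. \<phi> w * f t w) \<longlongrightarrow> (LINT w:{0..}|lborel. \<phi> w * f0 w)) (at_right 0)"
      using sol tf by (simp add: kinetic_weak_solution_def)
    then show "((\<lambda>t. \<integral>w. \<phi> w \<partial>density_measure (f t)) \<longlongrightarrow> (\<integral>w. \<phi> w \<partial>density_measure f0)) (at_right 0)"
      unfolding eq[OF f0(1) m]
      by (rule Lim_transform_eventually) (use eq[OF f m] in \<open>auto simp: eventually_at_filter\<close>)
  next
    fix \<phi> :: "real \<Rightarrow> real" assume c: "continuous_on UNIV \<phi>" and b: "bounded (range \<phi>)"
    have "continuous_on {0..} \<phi> \<and> bounded (\<phi> ` {0..})"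
      using c b by (auto intro: continuous_on_subset bounded_subset)
    then obtain D where D: "\<And>t. 0 \<le> t \<Longrightarrow> ((\<lambda>t. LINT w:{0..}|density_measure (f t). \<phi> w) has_real_derivative D t) (at t within {0..})"
      using sol unfolding kinetic_weak_solution_def weakly_C1_def by blast
    have "continuous_on {0..} (\<lambda>t. LINT w:{0..}|density_measure (f t). \<phi> w)"
      by (rule DERIV_continuous_on[of _ _ D]) (use D in auto)
    moreover have "(LINT w:{0..}|density_measure (f t). \<phi> w) = (\<integral>w. \<phi> w \<partial>density_measure (f t))" if "0 \<le> t" for t
    proof -
      note W = wealthD[OF wf[OF that]]
      interpret W: real_distribution "density_measure (f t)" by (rule W)
      have [measurable]: "\<phi> \<in> borel_measurable borel" using c by (rule borel_measurable_continuous_onI)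
      show ?thesis unfolding set_lebesgue_integral_def
        using W(5) by (intro integral_cong_AE) (auto simp: indicator_def)
    qed
    ultimately show "continuous_on {0..} (\<lambda>t. \<integral>w. \<phi> w \<partial>density_measure (f t))"
      by (metis (no_types, lifting) atLeast_iff continuous_on_cong)
  qed (use i p \<gamma> wf in auto)
qed

text \<open>The mass of \<open>f\<close> above the level \<open>N\<close>. It is the additive
  constant in the concentration inequality for \<open>f\<close>, and it decays in \<open>N\<close>
  because the density is integrable.\<close>

definition excess :: "(real \<Rightarrow> real) \<Rightarrow> real \<Rightarrow> real" where
  "excess f N = (\<integral>w. max 0 (indicator {0..} w * f w - N) \<partial>lborel)"

lemma excess:
  assumes f: "prob_density_on {0..} f"
  shows "(excess f \<longlongrightarrow> 0) at_top" "0 \<le> excess f N"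
    and "0 \<le> N \<Longrightarrow> conc_test \<phi> \<Longrightarrow> (\<integral>w. \<phi> w \<partial>density_measure f) \<le> excess f N + N * (\<integral>x. \<phi> x \<partial>lborel)"
proof -
  define a where "a w = indicator {0..} w * f w" for w
  have am: "a \<in> borel_measurable lborel" and a0: "0 \<le> a w" for w
    using f by (auto simp: prob_density_on_def set_borel_measurable_def a_def[abs_def] indicator_def)
  have "(\<integral>w. a w \<partial>lborel) = 1" using f by (simp add: prob_density_on_def set_lebesgue_integral_def a_def)
  then have ai: "integrable lborel a" using not_integrable_integral_eq by fastforce
  have ex: "excess f N = (\<integral>w. max 0 (a w - N) \<partial>lborel)" for N by (simp add: excess_def a_def)
  show "0 \<le> excess f N" by (simp add: excess_def)
  have "((\<lambda>N. \<integral>w. max 0 (a w - N) \<partial>lborel) \<longlongrightarrow> (\<integral>w. 0 \<partial>(lborel :: real measure))) at_top"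
  proof (rule integral_dominated_convergence_at_top[where s = "\<lambda>N w. max 0 (a w - N)" and f = "\<lambda>w. 0" and w = a])
    show "\<forall>\<^sub>F N in at_top. AE w in lborel. norm (max 0 (a w - N)) \<le> a w"
      using eventually_ge_at_top[of 0] by eventually_elim (use a0 in auto)
    show "AE w in lborel. ((\<lambda>N. max 0 (a w - N)) \<longlongrightarrow> 0) at_top"
    proof (intro AE_I2 tendsto_eventually)
      fix w show "\<forall>\<^sub>F N in at_top. max 0 (a w - N) = 0"
        using eventually_ge_at_top[of "a w"] by eventually_elim simp
    qed
  qed (use am ai in auto)
  then show "(excess f \<longlongrightarrow> 0) at_top" unfolding ex by simp
  assume N: "0 \<le> N" and \<phi>: "conc_test \<phi>"
  have \<phi>m: "\<phi> \<in> borel_measurable borel" and \<phi>01: "\<And>x. 0 \<le> \<phi> x" "\<And>x. \<phi> x \<le> 1" and \<phi>i: "integrable lborel \<phi>"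
    using \<phi> by (auto simp: conc_test_def bdd_smooth_measurable)
  have ei: "integrable lborel (\<lambda>w. max 0 (a w - N))"
    by (rule Bochner_Integration.integrable_bound[OF ai]) (use am a0 N in auto)
  have api: "integrable lborel (\<lambda>w. a w * \<phi> w)"
  proof (rule Bochner_Integration.integrable_bound[OF ai])
    show "AE w in lborel. norm (a w * \<phi> w) \<le> norm (a w)"
      using \<phi>01 a0 by (intro AE_I2) (simp add: abs_mult mult_left_le)
  qed (use am \<phi>m in auto)
  have "(\<integral>w. \<phi> w \<partial>density_measure f) = (\<integral>w. a w * \<phi> w \<partial>lborel)"
    unfolding density_measure_def a_def[symmetric]
    using integral_density[of \<phi> lborel a] \<phi>m am a0 by simp
  also have "\<dots> \<le> (\<integral>w. max 0 (a w - N) + N * \<phi> w \<partial>lborel)"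
  proof (rule integral_mono)
    fix w
    have "(a w - N) * \<phi> w \<le> max 0 (a w - N)"
    proof (cases "a w \<le> N")
      case True
      then have "(a w - N) * \<phi> w \<le> 0" using \<phi>01 by (intro mult_nonpos_nonneg) auto
      then show ?thesis by simp
    next
      case False
      then have "(a w - N) * \<phi> w \<le> (a w - N) * 1" using \<phi>01 by (intro mult_left_mono) auto
      then show ?thesis by simp
    qed
    then show "a w * \<phi> w \<le> max 0 (a w - N) + N * \<phi> w" by (simp add: algebra_simps)
  qed (use api ei \<phi>i in auto)
  also have "\<dots> = excess f N + N * (\<integral>x. \<phi> x \<partial>lborel)" using ei \<phi>i by (simp add: ex)
  finally show "(\<integral>w. \<phi> w \<partial>density_measure f) \<le> excess f N + N * (\<integral>x. \<phi> x \<partial>lborel)" .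
qed

text \<open>The initial condition comes from continuity of the test integrals at time 0 and from
  \<open>G 0\<close> being the initial measure. Values of \<phi> on negative numbers are irrelevant
  to the densities and are replaced by \<open>\<phi> (max 0 w)\<close>, which is measurable.\<close>

lemma fokker_planck_weak_solution_of_flow:
  assumes flow: "fp_flow p m lam G K" and g: "\<And>t. 0 \<le> t \<Longrightarrow> prob_density_on {0..} (g t) \<and> density_measure (g t) = G t"
    and f0: "prob_density_on {0..} f0" "G 0 = density_measure f0"
  shows "fokker_planck_weak_solution p lam m f0 g"
  unfolding fokker_planck_weak_solution_def
proof (intro conjI ballI allI impI)
  interpret fp_flow p m lam G K by (rule flow)
  show "prob_density_on {0..} (g t)" if "0 \<le> t" for t using g[OF that] by simp
  fix \<phi> assume \<phi>: "\<phi> \<in> test_functions p"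
  define L where "L = fp_op m lam (deriv_Rplus \<phi>) ((deriv_Rplus ^^ 2) \<phi>)"
  note fd = fp_derivative[OF \<phi>, folded L_def]
  have e: "\<phi> w = \<phi> (max 0 w)" "L w = L (max 0 w)" if "0 \<le> w" for w using that by (simp_all add: max_absorb2)
  note gt = conjunct1[OF g] and gG = conjunct2[OF g]
  have u: "(LINT w:{0..}|lborel. \<phi> w * g t w) = (\<integral>w. \<phi> (max 0 w) \<partial>G t)" if t: "0 \<le> t" for t
    using density_measure_integral(1)[OF gt[OF t] fd(3) e(1)] unfolding gG[OF t] by blast
  have v: "(LINT w:{0..}|lborel. L w * g t w) = (\<integral>w. L (max 0 w) \<partial>G t)" if t: "0 \<le> t" for t
    using density_measure_integral(1)[OF gt[OF t] fd(4) e(2)] unfolding gG[OF t] by blast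
  have L: "(\<lambda>w. ((m - w) * deriv_Rplus \<phi> w + lam / 2 * w\<^sup>2 * (deriv_Rplus ^^ 2) \<phi> w) * g t w) = (\<lambda>w. L w * g t w)" for t
    by (simp add: L_def fp_op_def)
  show "set_integrable lborel {0..} (\<lambda>w. \<phi> w * g t w)" if "0 < t" for t
  proof -
    have t: "0 \<le> t" using that by simp
    show ?thesis using density_measure_integral(2)[OF gt[OF t] fd(3) e(1)] fd(5)[OF t] unfolding gG[OF t] by blast
  qed
  show "set_integrable lborel {0..} (\<lambda>w. ((m - w) * deriv_Rplus \<phi> w + lam / 2 * w\<^sup>2 * (deriv_Rplus ^^ 2) \<phi> w) * g t w)" if "0 < t" for t
  proof -
    have t: "0 \<le> t" using that by simp
    show ?thesis unfolding L using density_measure_integral(2)[OF gt[OF t] fd(4) e(2)] fd(6)[OF t] unfolding gG[OF t] by blast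
  qed
  show "((\<lambda>t. LINT w:{0..}|lborel. \<phi> w * g t w) has_real_derivative
      (LINT w:{0..}|lborel. ((m - w) * deriv_Rplus \<phi> w + lam / 2 * w\<^sup>2 * (deriv_Rplus ^^ 2) \<phi> w) * g t w)) (at t)" if t: "0 < t" for t
  proof -
    have "((\<lambda>t. \<integral>w. \<phi> (max 0 w) \<partial>G t) has_real_derivative (LINT w:{0..}|lborel. L w * g t w)) (at t)"
      using fd(1)[OF t] v[of t] t by simp
    moreover have "open ({0<..} :: real set)" "t \<in> {0<..}" using t by simp_all
    moreover have "\<And>x. x \<in> {0<..} \<Longrightarrow> (\<integral>w. \<phi> (max 0 w) \<partial>G x) = (LINT w:{0..}|lborel. \<phi> w * g x w)" using u by simp
    ultimately show ?thesis unfolding L by (rule has_field_derivative_transform_within_open)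
  qed
  have "(LINT w:{0..}|lborel. \<phi> w * f0 w) = (\<integral>w. \<phi> (max 0 w) \<partial>G 0)"
    using density_measure_integral(1)[OF f0(1) fd(3) e(1)] unfolding f0(2) by blast
  with fd(2) have "((\<lambda>t. \<integral>w. \<phi> (max 0 w) \<partial>G t) \<longlongrightarrow> (LINT w:{0..}|lborel. \<phi> w * f0 w)) (at_right 0)" by simp
  then show "((\<lambda>t. LINT w:{0..}|lborel. \<phi> w * g t w) \<longlongrightarrow> (LINT w:{0..}|lborel. \<phi> w * f0 w)) (at_right 0)"
    by (rule Lim_transform_eventually) (use u in \<open>auto simp: eventually_at_filter\<close>)
qed

text \<open>Extraction is expressed through arbitrary parameter sequences tending to 0, and one
  subsequence serves all times.\<close>

theorem theorem4p1:
  fixes \<delta> \<alpha> lam p m :: real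
    and f0 :: "real \<Rightarrow> real"
    and M :: "'a measure" and Y :: "'a \<Rightarrow> real" and h :: "real \<Rightarrow> real"
    and \<sigma> :: "real \<Rightarrow> real" and \<mu> :: "real \<Rightarrow> real \<Rightarrow> real"
    and f :: "real \<Rightarrow> real \<Rightarrow> real \<Rightarrow> real"
  assumes "\<delta> > 0" and "p = 2 + \<delta>"
    and "prob_density_on {0..} f0" and "density_measure f0 \<in> moment_measures p"
    and "m = (LINT w:{0..}|lborel. w * f0 w)"
    and "prob_space M"
    and "prob_density_on UNIV h" and "distributed M lborel Y (\<lambda>y. ennreal (h y))"
    and "distr M borel (\<lambda>\<omega>. - Y \<omega>) = distr M borel Y"
    and "\<alpha> > \<delta>" and "integrable M (\<lambda>\<omega>. \<bar>Y \<omega>\<bar> powr (2 + \<alpha>))"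
    and "prob_space.expectation M Y = 0" and "prob_space.variance M Y = 1"
    and "lam > 0"
    and "\<And>\<gamma>. \<gamma> \<in> {0<..<1} \<Longrightarrow> \<sigma> \<gamma> > 0 \<and> (\<sigma> \<gamma>)\<^sup>2 = lam * \<gamma>"
    and "\<And>\<gamma>. \<gamma> \<in> {0<..<1} \<Longrightarrow>
           prob_density_on UNIV (\<mu> \<gamma>) \<and>
           distributed M lborel (\<lambda>\<omega>. \<sigma> \<gamma> * Y \<omega>) (\<lambda>y. ennreal (\<mu> \<gamma> y))"
    and "\<And>\<gamma>. \<gamma> \<in> {0<..<1} \<Longrightarrow> kinetic_weak_solution p \<gamma> (\<mu> \<gamma>) f0 (f \<gamma>)"
  shows "\<forall>\<Gamma> :: nat \<Rightarrow> real. (\<forall>n. \<Gamma> n \<in> {0<..<1}) \<and> \<Gamma> \<longlonglongrightarrow> 0 \<longrightarrow>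
    (\<exists>(r :: nat \<Rightarrow> nat) (g :: real \<Rightarrow> real \<Rightarrow> real). strict_mono r \<and>
       (\<forall>\<tau>\<ge>0. prob_density_on {0..} (g \<tau>) \<and>
          weak_conv_m
            (\<lambda>n. density_measure (scaled_density (\<Gamma> (r n)) (f (\<Gamma> (r n))) \<tau>))
            (density_measure (g \<tau>))) \<and>
       fokker_planck_weak_solution p lam m f0 g \<and>
       (\<forall>\<tau>\<ge>0. set_integrable lborel {0..} (\<lambda>w. w * g \<tau> w) \<and>
          (LINT w:{0..}|lborel. w * g \<tau> w) = m))"
proof (intro allI impI)
  fix \<Gamma> :: "nat \<Rightarrow> real" assume \<Gamma>: "(\<forall>n. \<Gamma> n \<in> {0<..<1}) \<and> \<Gamma> \<longlonglongrightarrow> 0"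
  have p: "2 < p" "p \<le> 2 + \<alpha>" using assms(1,2,10) by auto
  have Ym: "Y \<in> borel_measurable M" using distributed_measurable[OF assms(8)] by simp
  have var1: "(\<integral>\<omega>. (Y \<omega>)\<^sup>2 \<partial>M) = 1" using assms(12,13) by simp
  \<comment> \<open>Finitely many terms are dropped so that all parameters are at most 1/4; the
    index shift by \<open>N\<close> is restored in the final subsequence.\<close>
  obtain N where N: "\<And>n. n \<ge> N \<Longrightarrow> norm (\<Gamma> n - 0) < 1 / 4" using LIMSEQ_D[of \<Gamma> 0 "1 / 4"] \<Gamma> by auto
  define \<gamma> where "\<gamma> n = \<Gamma> (n + N)" for n
  have \<gamma>01: "\<gamma> n \<in> {0<..<1}" and \<gamma>4: "\<gamma> n \<le> 1 / 4" for n
    using \<Gamma> N[of "n + N"] by (auto simp: \<gamma>_def)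
  have \<gamma>lim: "\<gamma> \<longlonglongrightarrow> 0" unfolding \<gamma>_def using \<Gamma> by (intro LIMSEQ_ignore_initial_segment) auto
  define \<nu> where "\<nu> n = density lborel (\<lambda>y. ennreal (\<mu> (\<gamma> n) y))" for n
  define F where "F n t = density_measure (f (\<gamma> n) t)" for n t
  define F0 where "F0 = density_measure f0"
  have s2: "2 \<le> 2 + \<alpha>" using p by simp
  note no = noise_of_scaled_variable[OF assms(6) Ym conjunct1[OF assms(15)[OF \<gamma>01]] conjunct2[OF assms(16)[OF \<gamma>01]]
      s2 assms(11,12) var1, folded \<nu>_def]
  interpret kf: kinetic_family p lam "\<lambda>r. \<integral>\<omega>. \<bar>Y \<omega>\<bar> powr r \<partial>M" \<gamma> \<nu> F F0
  proof (rule kinetic_family.intro)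
    fix n
    have "integrable (\<nu> n) (\<lambda>x. \<bar>x\<bar> powr p)" using no(3)[of p n] p by simp
    then show "kinetic_flow (\<nu> n) p (\<gamma> n) (F n) F0"
      unfolding \<nu>_def F_def F0_def using \<gamma>01[of n] \<gamma>4[of n] no(1)[of n] p(1) assms(3,4) assms(16)[OF \<gamma>01] assms(17)[OF \<gamma>01]
      by (intro kinetic_flow_of_weak_solution) (auto simp: \<nu>_def)
    show "noise.var (\<nu> n) = lam * \<gamma> n" using no(2)[of n] assms(15)[OF \<gamma>01] by simp
    have "\<sigma> (\<gamma> n) powr r = (lam * \<gamma> n) powr (r / 2)" for r
    proof -
      have "\<sigma> (\<gamma> n) powr r = (\<sigma> (\<gamma> n) powr 2) powr (r / 2)" by (simp add: powr_powr)
      also have "\<sigma> (\<gamma> n) powr 2 = lam * \<gamma> n" using assms(15)[OF \<gamma>01, of n] by (simp add: powr_numeral)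
      finally show ?thesis .
    qed
    then show "noise.abs_moment (\<nu> n) r = (lam * \<gamma> n) powr (r / 2) * (\<integral>\<omega>. \<bar>Y \<omega>\<bar> powr r \<partial>M)" for r
      using no(4)[of n r] by simp
  qed (use \<gamma>lim assms(14) in auto)
  have m: "m = (\<integral>w. w \<partial>F0)"
    unfolding assms(5) F0_def by (rule density_measure_integral(1)[OF assms(3)]) auto
  obtain r G where r: "strict_mono r" and wG: "\<And>t. 0 \<le> t \<Longrightarrow> wealth p (G t)"
    and wc: "\<And>t. 0 \<le> t \<Longrightarrow> weak_conv_m (\<lambda>n. kf.scaled (r n) t) (G t)"
    and fp: "\<exists>K. fp_flow p m lam G K" and G0: "G 0 = F0"
    and mean: "\<And>t. 0 \<le> t \<Longrightarrow> (\<integral>w. w \<partial>G t) = m"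
    unfolding m by (rule kf.fokker_planck_limit) blast
  have "\<exists>g. prob_density_on {0..} g \<and> density_measure g = G t" if t: "0 \<le> t" for t
  proof -
    \<comment> \<open>The initial density satisfies the concentration inequality at every level
      \<open>N\<close> with additive constant \<open>excess f0 N\<close>. In the limit the level is
      only multiplied by an exponential, and the additive constants still vanish as \<open>N\<close>
      grows.\<close>
    have "absolutely_continuous lborel (G t)"
    proof (rule absolutely_continuous_of_concentration[OF wealthD(1)[OF wG[OF t]] _ excess(1)[OF assms(3)]])
      show "(\<integral>x. \<phi> x \<partial>G t) \<le> excess f0 N + N * exp ((5 + 4 * lam) * t) * (\<integral>x. \<phi> x \<partial>lborel)"
        if "0 < N" "conc_test \<phi>" for N \<phi>
        using excess(2,3)[OF assms(3), of N] that
        by (intro kf.limit_concentration[OF t wealthD(1)[OF wG[OF t]] r wc[OF t]]) (auto simp: F0_def)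
    qed simp
    then show ?thesis using wealth_density[OF wG[OF t]] by metis
  qed
  then obtain g where g: "\<And>t. 0 \<le> t \<Longrightarrow> prob_density_on {0..} (g t) \<and> density_measure (g t) = G t" by metis
  have "strict_mono (\<lambda>n. r n + N)" using r by (simp add: strict_mono_def)
  moreover have "weak_conv_m (\<lambda>n. density_measure (scaled_density (\<Gamma> (r n + N)) (f (\<Gamma> (r n + N))) t)) (density_measure (g t))"
    if "0 \<le> t" for t
    using wc[OF that] g[OF that] by (simp add: kf.scaled_def F_def \<gamma>_def scaled_density_def[abs_def])
  moreover have "fokker_planck_weak_solution p lam m f0 g"
    using fp fokker_planck_weak_solution_of_flow[OF _ g assms(3)] G0 by (auto simp: F0_def)
  moreover have "set_integrable lborel {0..} (\<lambda>w. w * g t w) \<and> (LINT w:{0..}|lborel. w * g t w) = m" if t: "0 \<le> t" for t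
  proof -
    have gt: "prob_density_on {0..} (g t)" "density_measure (g t) = G t" using g[OF t] by auto
    have "integrable (G t) (\<lambda>w. w)"
      by (rule wealth_integrable[OF wG[OF t] _ C2_smooth_imp_growth[OF C2_smooth_id]]) (use p in auto)
    then have "integrable (density_measure (g t)) (\<lambda>w. w)" by (simp only: gt(2))
    moreover have "(\<lambda>w. w) \<in> borel_measurable (borel :: real measure)" by simp
    note density_measure_integral[OF gt(1) this refl]
    ultimately have "set_integrable lborel {0..} (\<lambda>w. w * g t w)"
      "(LINT w:{0..}|lborel. w * g t w) = (\<integral>w. w \<partial>density_measure (g t))" by simp_all
    then show ?thesis unfolding gt(2) mean[OF t] by blast
  qed
  ultimately show "\<exists>(r :: nat \<Rightarrow> nat) (g :: real \<Rightarrow> real \<Rightarrow> real). strict_mono r \<and>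
       (\<forall>\<tau>\<ge>0. prob_density_on {0..} (g \<tau>) \<and>
          weak_conv_m
            (\<lambda>n. density_measure (scaled_density (\<Gamma> (r n)) (f (\<Gamma> (r n))) \<tau>))
            (density_measure (g \<tau>))) \<and>
       fokker_planck_weak_solution p lam m f0 g \<and>
       (\<forall>\<tau>\<ge>0. set_integrable lborel {0..} (\<lambda>w. w * g \<tau> w) \<and>
          (LINT w:{0..}|lborel. w * g \<tau> w) = m)"
    using g by (intro exI[of _ "\<lambda>n. r n + N"] exI[of _ g] conjI allI impI) simp_all
qed

end
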